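(* Let $(X,\omega)$ be a complex Hermitian manifold with $\dim_{\mathbb C}X=n\ge2$. For any $C^\infty$ function $\eta$ on $X$ such that $\eta>0$ or $\eta<0$, the following rough $\eta$-Bochner-Kodaira-Nakano identity holds on the $C^\infty$ forms of any degree $k\in\{0,\dots,2n\}$ on $X$: $$\Delta''_\eta=\Delta'_\eta+i\,\Big[[D^{0,1}_\eta,\overline{D^{0,1}_\eta}],\Lambda\Big]+\big[\overline{D^{0,1}_\eta},\ \overline{\tau^{0,1}_\eta}^{\,\star}\big]-\big[D^{0,1}_\eta,\ (\tau^{0,1}_\eta)^\star\big]+n\,\Big[D^{0,1}_\eta,\ \tfrac i\eta\,[\partial\eta\wedge\cdot\,,\Lambda]\Big]+n\,\Big[\overline{D^{0,1}_\eta},\ \tfrac i\eta\,[\bar\partial\eta\wedge\cdot\,,\Lambda]\Big].$$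
   Context: $\eta$ is real-valued and $\eta>0$ (resp. $\eta<0$) means at every point. The Hermitian metric is identified with its positive definite $(1,1)$-form $\omega$, normalized so that $\omega=i\sum_j\zeta_j\wedge\bar\zeta_j$ for a local orthonormal coframe of $(1,0)$-forms. $\star$ denotes the formal adjoint for the $L^2$-inner product induced by $\omega$ (pointwise adjoint for zero-order operators); $\Lambda$ is the adjoint of $\omega\wedge\cdot$; $[A,B]=AB-(-1)^{ab}BA$ is the graded commutator of operators of degrees $a,b$. The conjugate of an operator $P$ is $\overline P u=\overline{P\bar u}$. On $(p,q)$-forms, $D^{0,1}_\eta=\bar\partial-\frac p\eta\,\bar\partial\eta\wedge\cdot$, hence $\overline{D^{0,1}_\eta}=\partial-\frac q\eta\,\partial\eta\wedge\cdot$. Further, $\tau^{0,1}_\eta:=[\Lambda,\,D^{0,1}_\eta\omega\wedge\cdot\,]$, $\overline{\tau^{0,1}_\eta}$ is its conjugate, $\Delta''_\eta:=[D^{0,1}_\eta,(D^{0,1}_\eta)^\star]$ and $\Delta'_\eta:=[\overline{D^{0,1}_\eta},\overline{D^{0,1}_\eta}^{\,\star}]$. *)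

theory Defs
  imports "HOL-Analysis.Analysis"
begin

section \<open>Exterior algebra\<close>

text \<open>
  The complex exterior algebra generated by \<open>dz\<^sub>j\<close>, \<open>d\<bar>z\<^sub>j\<close> (\<open>j\<close> in the finite linearly ordered
  type \<open>'n\<close>). The coefficient at \<open>(I, J)\<close> is that of \<open>dz\<^sub>I \<and> d\<bar>z\<^sub>J\<close>, both products taken in
  increasing order of the indices. All degrees are kept in one space.
\<close>

type_synonym 'n ext = "complex ^ ('n set \<times> 'n set)"

definition inversions :: "'n::linorder set \<Rightarrow> 'n set \<Rightarrow> nat" where
  "inversions I I' = card {(i, i'). i \<in> I \<and> i' \<in> I' \<and> i' < i}"

text \<open>
  \<open>dz\<^sub>I \<and> d\<bar>z\<^sub>J \<and> dz\<^sub>I\<^sub>' \<and> d\<bar>z\<^sub>J\<^sub>' = wedge_sign I J I' J' \<cdot> dz\<^bsub>I \<union> I'\<^esub> \<and> d\<bar>z\<^bsub>J \<union> J'\<^esub>\<close>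
  for \<open>I \<inter> I' = J \<inter> J' = {}\<close>; the product is \<open>0\<close> otherwise.
\<close>

definition wedge_sign :: "'n::linorder set \<Rightarrow> 'n set \<Rightarrow> 'n set \<Rightarrow> 'n set \<Rightarrow> complex" where
  "wedge_sign I J I' J' = (-1) ^ (card J * card I' + inversions I I' + inversions J J')"

definition wedge :: "'n::{finite,linorder} ext \<Rightarrow> 'n ext \<Rightarrow> 'n ext" where
  "wedge a b = (\<chi> P. \<Sum>I\<in>Pow (fst P). \<Sum>J\<in>Pow (snd P).
     wedge_sign I J (fst P - I) (snd P - J) * a $ (I, J) * b $ (fst P - I, snd P - J))"

definition scalar_ext :: "complex \<Rightarrow> 'n::finite ext" where
  "scalar_ext c = axis ({}, {}) c"

definition dz :: "'n::finite \<Rightarrow> 'n ext" where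
  "dz j = axis ({j}, {}) 1"

definition dzbar :: "'n::finite \<Rightarrow> 'n ext" where
  "dzbar j = axis ({}, {j}) 1"

text \<open>The sign comes from \<open>d\<bar>z\<^sub>J \<and> dz\<^sub>I = (-1)\<^bsup>card I * card J\<^esup> dz\<^sub>I \<and> d\<bar>z\<^sub>J\<close>.\<close>

definition conj_ext :: "'n::finite ext \<Rightarrow> 'n ext" where
  "conj_ext a = (\<chi> P. (-1) ^ (card (fst P) * card (snd P)) * cnj (a $ (snd P, fst P)))"

definition row_form :: "complex ^ 'n ^ 'n \<Rightarrow> 'n::finite \<Rightarrow> 'n ext" where
  "row_form A i = (\<Sum>k\<in>UNIV. A $ i $ k *s dz k)"

definition wedge_list :: "'n::{finite,linorder} ext list \<Rightarrow> 'n ext" where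
  "wedge_list as = foldr wedge as (scalar_ext 1)"

text \<open>
  The algebra homomorphism with \<open>dz\<^sub>i \<mapsto> \<Sum>\<^sub>k A\<^sub>i\<^sub>k dz\<^sub>k\<close> and \<open>d\<bar>z\<^sub>i \<mapsto> \<Sum>\<^sub>k cnj A\<^sub>i\<^sub>k d\<bar>z\<^sub>k\<close>. With \<open>A\<close> the
  Jacobian matrix of a holomorphic change of coordinates this is the pullback of forms at a point.
\<close>

definition subst_ext :: "complex ^ 'n::{finite,linorder} ^ 'n::{finite,linorder} \<Rightarrow> 'n::{finite,linorder} ext \<Rightarrow> 'n ext" where
  "subst_ext A a = (\<Sum>P\<in>UNIV. a $ P *s
     wedge (wedge_list (map (row_form A) (sorted_list_of_set (fst P))))
           (wedge_list (map (\<lambda>j. conj_ext (row_form A j)) (sorted_list_of_set (snd P)))))"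

text \<open>The matrix \<open>h\<close> with \<open>w = \<i> \<Sum>\<^sub>j\<^sub>k h\<^sub>j\<^sub>k dz\<^sub>j \<and> d\<bar>z\<^sub>k\<close>.\<close>

definition herm_matrix :: "'n::finite ext \<Rightarrow> complex ^ 'n ^ 'n" where
  "herm_matrix w = (\<chi> j k. - \<i> * w $ ({j}, {k}))"

definition positive_11 :: "'n::finite ext \<Rightarrow> bool" where
  "positive_11 w \<longleftrightarrow>
     (\<forall>I J. w $ (I, J) \<noteq> 0 \<longrightarrow> card I = 1 \<and> card J = 1) \<and>
     conj_ext w = w \<and>
     (\<forall>v. v \<noteq> 0 \<longrightarrow>
        0 < Re (\<Sum>j\<in>UNIV. \<Sum>k\<in>UNIV. herm_matrix w $ j $ k * v $ j * cnj (v $ k)))"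

text \<open>The rows of \<open>C\<close> are an orthonormal coframe \<open>\<zeta>\<^sub>j\<close> of \<open>(1,0)\<close>-covectors: \<open>w = \<i> \<Sum>\<^sub>j \<zeta>\<^sub>j \<and> \<bar>\<zeta>\<^sub>j\<close>.\<close>

definition orthonormal_coframe :: "'n::{finite,linorder} ext \<Rightarrow> complex ^ 'n::{finite,linorder} ^ 'n::{finite,linorder} \<Rightarrow> bool" where
  "orthonormal_coframe w C \<longleftrightarrow> invertible C \<and>
     w = (\<Sum>j\<in>UNIV. \<i> *s wedge (row_form C j) (conj_ext (row_form C j)))"

text \<open>
  The Hermitian product for which the \<open>\<zeta>\<^sub>I \<and> \<bar>\<zeta>\<^sub>J\<close> are orthonormal. As \<open>dz\<^sub>i = \<Sum>\<^sub>k (C\<^sup>-\<^sup>1)\<^sub>i\<^sub>k \<zeta>\<^sub>k\<close>,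
  the coefficients of \<open>a\<close> in the basis \<open>\<zeta>\<^sub>I \<and> \<bar>\<zeta>\<^sub>J\<close> are those of \<open>subst_ext (C\<^sup>-\<^sup>1) a\<close>. The choice of
  the coframe is immaterial, two of them being related by a unitary matrix.
\<close>

definition ext_inner :: "'n::{finite,linorder} ext \<Rightarrow> 'n ext \<Rightarrow> 'n ext \<Rightarrow> complex" where
  "ext_inner w a b =
     (let B = matrix_inv (SOME C. orthonormal_coframe w C)
      in \<Sum>P\<in>UNIV. subst_ext B a $ P * cnj (subst_ext B b $ P))"


section \<open>Complex manifolds and smooth forms\<close>

primrec Ck_on :: "nat \<Rightarrow> 'a::real_normed_vector set \<Rightarrow> ('a \<Rightarrow> 'b::real_normed_vector) \<Rightarrow> bool" where
  "Ck_on 0 S f \<longleftrightarrow> continuous_on S f"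
| "Ck_on (Suc k) S f \<longleftrightarrow> (\<forall>x\<in>S. f differentiable (at x)) \<and>
     (\<forall>v. Ck_on k S (\<lambda>x. frechet_derivative f (at x) v))"

definition smooth_on :: "'a::real_normed_vector set \<Rightarrow> ('a \<Rightarrow> 'b::real_normed_vector) \<Rightarrow> bool" where
  "smooth_on S f \<longleftrightarrow> (\<forall>k. Ck_on k S f)"

definition holomorphic_map_on ::
  "(complex ^ 'n::finite) set \<Rightarrow> (complex ^ 'n \<Rightarrow> complex ^ 'n) \<Rightarrow> bool" where
  "holomorphic_map_on S f \<longleftrightarrow> smooth_on S f \<and>
     (\<forall>z\<in>S. \<forall>c v. frechet_derivative f (at z) (c *s v) = c *s frechet_derivative f (at z) v)"

text \<open>A chart is a pair of its domain and its coordinate map (irrelevant outside the domain).\<close>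

type_synonym ('x, 'n) chart = "'x set \<times> ('x \<Rightarrow> complex ^ 'n)"

definition chart_image :: "('x, 'n::finite) chart \<Rightarrow> (complex ^ 'n) set" where
  "chart_image c = snd c ` fst c"

definition chart_inv :: "('x, 'n::finite) chart \<Rightarrow> complex ^ 'n \<Rightarrow> 'x" where
  "chart_inv c = inv_into (fst c) (snd c)"

definition complex_atlas :: "('x::topological_space, 'n::finite) chart set \<Rightarrow> bool" where
  "complex_atlas A \<longleftrightarrow>
     (\<Union>c\<in>A. fst c) = UNIV \<and>
     (\<forall>c\<in>A. open (fst c) \<and> open (chart_image c) \<and>
        homeomorphism (fst c) (chart_image c) (snd c) (chart_inv c)) \<and>
     (\<forall>c\<in>A. \<forall>d\<in>A. holomorphic_map_on (snd c ` (fst c \<inter> fst d)) (snd d \<circ> chart_inv c))"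

definition chart_at :: "('x, 'n::finite) chart set \<Rightarrow> 'x \<Rightarrow> ('x, 'n) chart" where
  "chart_at A x = (SOME c. c \<in> A \<and> x \<in> fst c)"

text \<open>
  The cotangent space at \<open>x\<close> is trivialised by the coordinates of the chosen chart \<open>chart_at A x\<close>.
  Hence a form of arbitrary (mixed) degree is an arbitrary function into \<open>'n ext\<close>, whose value at
  \<open>x\<close> lists the coefficients with respect to \<open>chart_at A x\<close>. Since the chosen chart may jump from
  point to point, every differential notion refers to the expression of the form in one fixed
  chart, \<open>local_expr\<close>.
\<close>

type_synonym ('x, 'n) form = "'x \<Rightarrow> 'n ext"

text \<open>The holomorphic Jacobian \<open>(\<partial>w\<^sub>i / \<partial>z\<^sub>k)\<^sub>i\<^sub>k\<close> of the coordinates \<open>w\<close> of \<open>d\<close> in the coordinates \<open>z\<close> of \<open>c\<close>.\<close>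

definition transition_jac ::
  "('x, 'n::finite) chart \<Rightarrow> ('x, 'n) chart \<Rightarrow> complex ^ 'n \<Rightarrow> complex ^ 'n ^ 'n" where
  "transition_jac d c z =
     (\<chi> i k. frechet_derivative (snd d \<circ> chart_inv c) (at z) (axis k 1) $ i)"

definition local_expr ::
  "('x, 'n::{finite,linorder}) chart set \<Rightarrow> ('x, 'n) chart \<Rightarrow> ('x, 'n) form \<Rightarrow> complex ^ 'n::{finite,linorder} \<Rightarrow> 'n ext" where
  "local_expr A c u z =
     (let y = chart_inv c z in subst_ext (transition_jac (chart_at A y) c z) (u y))"

definition smooth_form :: "('x, 'n::{finite,linorder}) chart set \<Rightarrow> ('x, 'n) form \<Rightarrow> bool" where
  "smooth_form A u \<longleftrightarrow> (\<forall>c\<in>A. smooth_on (chart_image c) (local_expr A c u))"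

definition smooth_function :: "('x, 'n::finite) chart set \<Rightarrow> ('x \<Rightarrow> real) \<Rightarrow> bool" where
  "smooth_function A f \<longleftrightarrow> (\<forall>c\<in>A. smooth_on (chart_image c) (f \<circ> chart_inv c))"

definition has_degree :: "nat \<Rightarrow> ('x, 'n::finite) form \<Rightarrow> bool" where
  "has_degree k u \<longleftrightarrow> (\<forall>x I J. u x $ (I, J) \<noteq> 0 \<longrightarrow> card I + card J = k)"

definition function_form :: "('x \<Rightarrow> real) \<Rightarrow> ('x, 'n::finite) form" where
  "function_form f = (\<lambda>x. scalar_ext (of_real (f x)))"

definition hermitian_metric :: "('x, 'n::{finite,linorder}) chart set \<Rightarrow> ('x, 'n) form \<Rightarrow> bool" where
  "hermitian_metric A \<omega> \<longleftrightarrow> smooth_form A \<omega> \<and> (\<forall>x. positive_11 (\<omega> x))"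


section \<open>Operators on forms\<close>

definition wirt :: "'n::finite \<Rightarrow> (complex ^ 'n \<Rightarrow> complex ^ 'm) \<Rightarrow> complex ^ 'n \<Rightarrow> complex ^ 'm::finite" where
  "wirt j f z = (1/2) *s (frechet_derivative f (at z) (axis j 1)
                          - \<i> *s frechet_derivative f (at z) (axis j \<i>))"

definition wirtbar :: "'n::finite \<Rightarrow> (complex ^ 'n \<Rightarrow> complex ^ 'm) \<Rightarrow> complex ^ 'n \<Rightarrow> complex ^ 'm::finite" where
  "wirtbar j f z = (1/2) *s (frechet_derivative f (at z) (axis j 1)
                             + \<i> *s frechet_derivative f (at z) (axis j \<i>))"

definition del :: "('x, 'n::{finite,linorder}) chart set \<Rightarrow> ('x, 'n) form \<Rightarrow> ('x, 'n) form" where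
  "del A u = (\<lambda>x. let c = chart_at A x in
     \<Sum>j\<in>UNIV. wedge (dz j) (wirt j (local_expr A c u) (snd c x)))"

definition delbar :: "('x, 'n::{finite,linorder}) chart set \<Rightarrow> ('x, 'n) form \<Rightarrow> ('x, 'n) form" where
  "delbar A u = (\<lambda>x. let c = chart_at A x in
     \<Sum>j\<in>UNIV. wedge (dzbar j) (wirtbar j (local_expr A c u) (snd c x)))"

definition ext_mult :: "('x, 'n::{finite,linorder}) form \<Rightarrow> ('x, 'n) form \<Rightarrow> ('x, 'n) form" where
  "ext_mult \<alpha> u = (\<lambda>x. wedge (\<alpha> x) (u x))"

definition conj_op :: "(('x, 'n::finite) form \<Rightarrow> ('x, 'n) form) \<Rightarrow> ('x, 'n) form \<Rightarrow> ('x, 'n) form" where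
  "conj_op P u = (\<lambda>x. conj_ext (P (\<lambda>y. conj_ext (u y)) x))"

text \<open>The graded commutator of \<open>P\<close> of degree \<open>a\<close> and \<open>Q\<close> of degree \<open>b\<close>.\<close>

definition gcomm ::
  "int \<Rightarrow> (('x, 'n::finite) form \<Rightarrow> ('x, 'n) form) \<Rightarrow> int \<Rightarrow> (('x, 'n) form \<Rightarrow> ('x, 'n) form) \<Rightarrow>
   ('x, 'n) form \<Rightarrow> ('x, 'n) form" where
  "gcomm a P b Q u = (\<lambda>x. P (Q u) x - ((-1) powi (a * b)) *s Q (P u) x)"

text \<open>
  The volume measure \<open>\<omega>\<^sup>n / n!\<close>, where
  \<open>\<omega>\<^sup>n / n! = det h \<cdot> \<Prod>\<^sub>j (\<i> dz\<^sub>j \<and> d\<bar>z\<^sub>j) = 2\<^sup>n det h \<cdot> \<Prod>\<^sub>j (dx\<^sub>j \<and> dy\<^sub>j)\<close> in a chart.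
\<close>

definition volume ::
  "('x::topological_space, 'n::{finite,linorder}) chart set \<Rightarrow> ('x, 'n) form \<Rightarrow> 'x measure" where
  "volume A \<omega> = (THE \<mu>. sets \<mu> = sets borel \<and>
     (\<forall>c\<in>A. \<forall>S\<in>sets borel. S \<subseteq> fst c \<longrightarrow>
        emeasure \<mu> S = (\<integral>\<^sup>+ z\<in>snd c ` S.
          ennreal (2 ^ CARD('n) * Re (det (herm_matrix (local_expr A c \<omega> z)))) \<partial>lborel)))"

definition L2_inner ::
  "('x::topological_space, 'n::{finite,linorder}) chart set \<Rightarrow> ('x, 'n) form \<Rightarrow>
   ('x, 'n) form \<Rightarrow> ('x, 'n) form \<Rightarrow> complex" where
  "L2_inner A \<omega> u v = (\<integral>x. ext_inner (\<omega> x) (u x) (v x) \<partial>volume A \<omega>)"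

definition formal_adj ::
  "('x::topological_space, 'n::{finite,linorder}) chart set \<Rightarrow> ('x, 'n) form \<Rightarrow>
   (('x, 'n) form \<Rightarrow> ('x, 'n) form) \<Rightarrow> ('x, 'n) form \<Rightarrow> ('x, 'n) form" where
  "formal_adj A \<omega> P v = (THE w. smooth_form A w \<and>
     (\<forall>u. smooth_form A u \<and> compact (closure {x. u x \<noteq> 0}) \<longrightarrow>
        L2_inner A \<omega> (P u) v = L2_inner A \<omega> u w))"

definition pointwise_adj ::
  "('x, 'n::{finite,linorder}) form \<Rightarrow> (('x, 'n) form \<Rightarrow> ('x, 'n) form) \<Rightarrow>
   ('x, 'n) form \<Rightarrow> ('x, 'n) form" where
  "pointwise_adj \<omega> T v = (\<lambda>x. THE b.
     \<forall>u. ext_inner (\<omega> x) (T u x) (v x) = ext_inner (\<omega> x) (u x) b)"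

definition Lam :: "('x, 'n::{finite,linorder}) form \<Rightarrow> ('x, 'n) form \<Rightarrow> ('x, 'n) form" where
  "Lam \<omega> = pointwise_adj \<omega> (ext_mult \<omega>)"

text \<open>Multiplication of the \<open>(p,q)\<close>-component by \<open>p\<close>, for every \<open>(p,q)\<close>.\<close>

definition p_weight :: "('x, 'n::finite) form \<Rightarrow> ('x, 'n) form" where
  "p_weight u = (\<lambda>x. \<chi> P. of_nat (card (fst P)) * u x $ P)"

definition D01 ::
  "('x, 'n::{finite,linorder}) chart set \<Rightarrow> ('x \<Rightarrow> real) \<Rightarrow> ('x, 'n) form \<Rightarrow> ('x, 'n) form" where
  "D01 A \<eta> u = (\<lambda>x. delbar A u x -
     (1 / of_real (\<eta> x)) *s ext_mult (delbar A (function_form \<eta>)) (p_weight u) x)"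

definition D01bar ::
  "('x, 'n::{finite,linorder}) chart set \<Rightarrow> ('x \<Rightarrow> real) \<Rightarrow> ('x, 'n) form \<Rightarrow> ('x, 'n) form" where
  "D01bar A \<eta> = conj_op (D01 A \<eta>)"

definition tau01 ::
  "('x, 'n::{finite,linorder}) chart set \<Rightarrow> ('x, 'n) form \<Rightarrow> ('x \<Rightarrow> real) \<Rightarrow>
   ('x, 'n) form \<Rightarrow> ('x, 'n) form" where
  "tau01 A \<omega> \<eta> = gcomm (-2) (Lam \<omega>) 3 (ext_mult (D01 A \<eta> \<omega>))"

definition Laplace'' ::
  "('x::topological_space, 'n::{finite,linorder}) chart set \<Rightarrow> ('x, 'n) form \<Rightarrow> ('x \<Rightarrow> real) \<Rightarrow>
   ('x, 'n) form \<Rightarrow> ('x, 'n) form" where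
  "Laplace'' A \<omega> \<eta> = gcomm 1 (D01 A \<eta>) (-1) (formal_adj A \<omega> (D01 A \<eta>))"

definition Laplace' ::
  "('x::topological_space, 'n::{finite,linorder}) chart set \<Rightarrow> ('x, 'n) form \<Rightarrow> ('x \<Rightarrow> real) \<Rightarrow>
   ('x, 'n) form \<Rightarrow> ('x, 'n) form" where
  "Laplace' A \<omega> \<eta> = gcomm 1 (D01bar A \<eta>) (-1) (formal_adj A \<omega> (D01bar A \<eta>))"

text \<open>The operator \<open>(\<i> / \<eta>) [\<alpha> \<and> \<cdot>, \<Lambda>]\<close> for a 1-form \<open>\<alpha>\<close>; it has degree \<open>-1\<close>.\<close>

definition eta_comm ::
  "('x, 'n::{finite,linorder}) form \<Rightarrow> ('x \<Rightarrow> real) \<Rightarrow> ('x, 'n) form \<Rightarrow>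
   ('x, 'n) form \<Rightarrow> ('x, 'n) form" where
  "eta_comm \<omega> \<eta> \<alpha> u = (\<lambda>x. (\<i> / of_real (\<eta> x)) *s gcomm 1 (ext_mult \<alpha>) (-2) (Lam \<omega>) u x)"

end

theory Submission
  imports Defs
begin

text \<open>
  Write \<open>D = D\<^bsup>0,1\<^esup>\<^sub>\<eta>\<close> and \<open>\<tau> = \<tau>\<^bsup>0,1\<^esup>\<^sub>\<eta>\<close>. The identity follows from the twisted commutation relation
  \<open>D\<^sup>* = - \<i>[\<Lambda>, \<bar>D] - \<tau>\<^sup>* + n(\<i>/\<eta>)[\<partial>\<eta> \<and> \<cdot>, \<Lambda>]\<close>, its conjugate and the Jacobi identity for graded commutators.
  The relation for \<open>\<eta> = 1\<close> is the divergence identity that expresses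
  \<open>\<Sum>\<^sub>j \<partial>/\<partial>\<bar>z\<^sub>j (\<langle>d\<bar>z\<^sub>j \<and> u, v\<rangle> det h)\<close> in a chart, where all derivatives of the metric are collected in \<open>\<tau>\<^sup>*\<close>
  by pointwise exterior algebra; the zero-order terms for general \<open>\<eta>\<close> are compared with the help of
  \<open>[\<Lambda>, \<omega> \<and> \<cdot>] = n - p - q\<close>. A test form is a finite sum of forms supported in charts, which reduces the global
  integration by parts to one chart.
\<close>

section \<open>Exterior algebra\<close>

text \<open>The volume and the formal adjoints are given by definite descriptions, so they can be
  used only after existence and uniqueness are proved. For the volume this calls for the change of
  variables formula of holomorphic maps. For the adjoints an explicit smooth candidate is integrated
  by parts, and it is the only one because compactly supported smooth forms separate smooth forms.
  No coordinates adapted to the metric at a point are chosen: the derivatives of the metric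
  coefficients stay in the formulas, and each of them cancels by itself against the torsion. The
  constant n is what remains of the weights: in n - p - q the part q cancels against the twist of
  the conjugate operator, the part p is the adjoint of the twist itself, and n is left for the last
  two terms of the identity to compensate. A form is stored in a chart that may jump from point to
  point, so each operator must first be shown to have the expected expression in a fixed chart. All
  of this is done for type (0,1) only and conjugated afterwards.\<close>

lemma wedge_nth:
  "wedge a b $ (I, J) = (\<Sum>K\<in>Pow I. \<Sum>L\<in>Pow J. wedge_sign K L (I - K) (J - L) * a $ (K, L) * b $ (I - K, J - L))"
  by (simp add: wedge_def)

lemma wedge_add_left: "wedge (a + b) c = wedge a c + wedge b c"
  by (simp add: vec_eq_iff wedge_def ring_distribs sum.distrib)

lemma wedge_add_right: "wedge a (b + c) = wedge a b + wedge a c"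
  by (simp add: vec_eq_iff wedge_def ring_distribs sum.distrib)

lemma wedge_scale_left: "wedge (x *s a) c = x *s wedge a c"
  by (simp add: vec_eq_iff wedge_def sum_distrib_left algebra_simps)

lemma wedge_scale_right: "wedge a (x *s c) = x *s wedge a c"
  by (simp add: vec_eq_iff wedge_def sum_distrib_left algebra_simps)

lemma wedge_zero_left [simp]: "wedge 0 c = 0"
  using wedge_scale_left[of 0 0 c] by simp

lemma wedge_zero_right [simp]: "wedge c 0 = 0"
  using wedge_scale_right[of c 0 0] by simp

lemma wedge_sum_left: "wedge (\<Sum>i\<in>X. f i) c = (\<Sum>i\<in>X. wedge (f i) c)"
  by (induction X rule: infinite_finite_induct) (auto simp: wedge_add_left)

lemma wedge_sum_right: "wedge c (\<Sum>i\<in>X. f i) = (\<Sum>i\<in>X. wedge c (f i))"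
  by (induction X rule: infinite_finite_induct) (auto simp: wedge_add_right)

lemma wedge_minus_left: "wedge (- a) c = - wedge a c"
  using wedge_scale_left[of "-1" a c] by (simp add: vec_eq_iff)

lemma wedge_minus_right: "wedge a (- c) = - wedge a c"
  using wedge_scale_right[of a "-1" c] by (simp add: vec_eq_iff)

lemma wedge_diff_left: "wedge (a - b) c = wedge a c - wedge b c"
  using wedge_add_left[of a "-b" c] by (simp add: wedge_minus_left)

lemma wedge_diff_right: "wedge a (b - c) = wedge a b - wedge a c"
  using wedge_add_right[of a b "-c"] by (simp add: wedge_minus_right)

text \<open>The exponent of the sign that \<open>dz j\<close> picks up on its way past the smaller
  generators of a monomial to its sorted place.\<close>

definition below :: "'n::linorder \<Rightarrow> 'n set \<Rightarrow> nat" where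
  "below j I = card {i \<in> I. i < j}"

lemma inversions_single_left: "inversions {j} I = below j I"
proof -
  have "{(i, i'). i \<in> {j} \<and> i' \<in> I \<and> i' < i} = Pair j ` {i \<in> I. i < j}" by auto
  then show ?thesis by (simp add: inversions_def below_def card_image inj_on_def)
qed

lemma inversions_empty [simp]: "inversions {} I = 0" "inversions I {} = 0"
  by (simp_all add: inversions_def)

lemma inversions_insert:
  fixes I :: "'n::{finite,linorder} set"
  assumes "j \<notin> I" shows "inversions (insert j I) I' = inversions I I' + below j I'"
proof -
  have "{(i, i'). i \<in> insert j I \<and> i' \<in> I' \<and> i' < i} =
    {(i, i'). i \<in> I \<and> i' \<in> I' \<and> i' < i} \<union> {(i, i'). i \<in> {j} \<and> i' \<in> I' \<and> i' < i}" by auto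
  moreover have "card \<dots> = inversions I I' + inversions {j} I'"
    unfolding inversions_def using assms by (intro card_Un_disjoint) auto
  ultimately show ?thesis by (simp add: inversions_def[symmetric] inversions_single_left) (simp add: inversions_def)
qed

lemma below_insert:
  fixes I :: "'n::{finite,linorder} set"
  assumes "k \<notin> I" shows "below j (insert k I) = below j I + (if k < j then 1 else 0)"
proof -
  have "{i \<in> insert k I. i < j} = (if k < j then insert k {i \<in> I. i < j} else {i \<in> I. i < j})" by auto
  then show ?thesis using assms by (simp add: below_def)
qed

lemma below_remove:
  fixes I :: "'n::{finite,linorder} set"
  shows "k \<in> I \<Longrightarrow> below j I = below j (I - {k}) + (if k < j then 1 else 0)"
  using below_insert[of k "I - {k}" j] by (simp add: insert_absorb)

lemma below_self [simp]: 
  fixes I :: "'n::{finite,linorder} set"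
  shows "below j (insert j I) = below j I" "below j (I - {j}) = below j I"
  by (simp_all add: below_def) (metis (lifting) insert_iff less_irrefl, metis (lifting) Diff_iff less_irrefl singletonD)

lemma below_disjoint_Un:
  fixes I :: "'n::{finite,linorder} set"
  shows "I \<inter> K = {} \<Longrightarrow> below j (I \<union> K) = below j I + below j K"
proof -
  assume "I \<inter> K = {}"
  moreover have "{i \<in> I \<union> K. i < j} = {i \<in> I. i < j} \<union> {i \<in> K. i < j}" by auto
  ultimately show ?thesis unfolding below_def by (simp add: card_Un_disjoint Int_def) (subst card_Un_disjoint, auto)
qed

lemma wedge_dz_nth:
  "wedge (dz j) a $ (I, J) = (if j \<in> I then (-1) ^ below j I * a $ (I - {j}, J) else 0)"
proof -
  have "wedge (dz j) a $ (I, J) = (\<Sum>K\<in>Pow I. \<Sum>L\<in>Pow J.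
     if L = {} then if K = {j} then wedge_sign K L (I - K) (J - L) * a $ (I - K, J - L) else 0 else 0)"
    unfolding wedge_nth dz_def by (intro sum.cong refl) (auto simp: axis_def)
  also have "\<dots> = (if j \<in> I then wedge_sign {j} {} (I - {j}) J * a $ (I - {j}, J) else 0)"
    by (simp add: sum.delta)
  finally show ?thesis by (simp add: wedge_sign_def inversions_single_left)
qed

text \<open>The extra exponent \<open>card I\<close> appears because the factors \<open>dz\<close>
  stand first in a basis monomial, and \<open>dzbar j\<close> has to pass all of them.\<close>

lemma wedge_dzbar_nth:
  "wedge (dzbar j) a $ (I, J) = (if j \<in> J then (-1) ^ (card I + below j J) * a $ (I, J - {j}) else 0)"
proof -
  have "wedge (dzbar j) a $ (I, J) = (\<Sum>K\<in>Pow I. 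
     if K = {} then (\<Sum>L\<in>Pow J. if L = {j} then wedge_sign K L (I - K) (J - L) * a $ (I - K, J - L) else 0) else 0)"
    unfolding wedge_nth dzbar_def
  proof (intro sum.cong refl, goal_cases)
    case (1 K)
    then show ?case by (cases "K = {}") (auto simp: axis_def intro!: sum.cong[OF refl] sum.neutral simp del: sum.delta)
  qed
  also have "\<dots> = (if j \<in> J then wedge_sign {} {j} I (J - {j}) * a $ (I, J - {j}) else 0)"
    by (simp add: sum.delta)
  finally show ?thesis by (simp add: wedge_sign_def inversions_single_left)
qed

lemma wedge_scalar_left [simp]: "wedge (scalar_ext c) a = c *s a"
proof -
  have "wedge (scalar_ext c) a $ (I, J) = c * a $ (I, J)" for I J
  proof -
    have "wedge (scalar_ext c) a $ (I, J) = (\<Sum>K\<in>Pow I. 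
     if K = {} then (\<Sum>L\<in>Pow J. if L = {} then c * wedge_sign K L (I - K) (J - L) * a $ (I - K, J - L) else 0) else 0)"
      unfolding wedge_nth scalar_ext_def
    proof (intro sum.cong refl, goal_cases)
      case (1 K)
      then show ?case by (cases "K = {}") (auto simp: axis_def intro!: sum.cong[OF refl] sum.neutral simp del: sum.delta)
    qed
    then show ?thesis by (simp add: wedge_sign_def)
  qed
  then show ?thesis by (simp add: vec_eq_iff split_paired_all)
qed

lemma wedge_scalar_right [simp]: "wedge a (scalar_ext c) = c *s a"
proof -
  have "wedge a (scalar_ext c) $ (I, J) = c * a $ (I, J)" for I J
  proof -
    have "wedge a (scalar_ext c) $ (I, J) = (\<Sum>K\<in>Pow I. 
     if K = I then (\<Sum>L\<in>Pow J. if L = J then c * wedge_sign K L (I - K) (J - L) * a $ (K, L) else 0) else 0)"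
      unfolding wedge_nth scalar_ext_def 
    proof (intro sum.cong refl, goal_cases)
      case (1 K)
      then show ?case by (cases "K = I") (auto simp: axis_def intro!: sum.cong[OF refl] sum.neutral simp del: sum.delta sum.delta')
    qed
    then show ?thesis by (simp add: wedge_sign_def)
  qed
  then show ?thesis by (simp add: vec_eq_iff split_paired_all)
qed

section \<open>Associativity and the relations between the generators\<close>

lemma sum_Pow_containing:
  fixes f :: "'a set \<Rightarrow> 'b::comm_monoid_add"
  assumes "j \<in> I" "finite I"
  shows "(\<Sum>K\<in>Pow I. if j \<in> K then f K else 0) = (\<Sum>K\<in>Pow (I - {j}). f (insert j K))"
proof -
  have "(\<Sum>K\<in>Pow I. if j \<in> K then f K else 0) = (\<Sum>K\<in>{K\<in>Pow I. j \<in> K}. f K)"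
    using assms by (simp add: sum.inter_filter[symmetric] del: Pow_iff)
  also have "\<dots> = (\<Sum>K\<in>Pow (I - {j}). f (insert j K))"
    using assms by (intro sum.reindex_bij_witness[of _ "insert j" "\<lambda>K. K - {j}"]) (auto simp: insert_absorb)
  finally show ?thesis .
qed

text \<open>Associativity with a generator on the left needs a single sign count: the indices of I
  below j are those in K together with those in the complementary part. The general law follows from
  this and its companion for \<open>dzbar j\<close> by induction over products of
  generators.\<close>

lemma wedge_dz_assoc: "wedge (wedge (dz j) b) c = wedge (dz j) (wedge b c)"
proof -
  have "wedge (wedge (dz j) b) c $ (I, J) = wedge (dz j) (wedge b c) $ (I, J)" for I J
  proof (cases "j \<in> I")
    case True
    have "wedge (wedge (dz j) b) c $ (I, J) = (\<Sum>K\<in>Pow I. if j \<in> K then (\<Sum>L\<in>Pow J. 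
      wedge_sign K L (I - K) (J - L) * (-1) ^ below j K * b $ (K - {j}, L) * c $ (I - K, J - L)) else 0)"
      unfolding wedge_nth[of "wedge _ _"] wedge_dz_nth 
      by (intro sum.cong refl) (auto intro!: sum.cong)
    also have "\<dots> = (\<Sum>K\<in>Pow (I - {j}). (\<Sum>L\<in>Pow J. 
      wedge_sign (insert j K) L (I - insert j K) (J - L) * (-1) ^ below j (insert j K) * b $ (insert j K - {j}, L) * c $ (I - insert j K, J - L)))"
      by (rule sum_Pow_containing[OF True finite])
    also have "\<dots> = (\<Sum>K\<in>Pow (I - {j}). (\<Sum>L\<in>Pow J. 
      (-1) ^ below j I * (wedge_sign K L (I - {j} - K) (J - L) * b $ (K, L) * c $ (I - {j} - K, J - L))))"
    proof (intro sum.cong refl)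
      fix K L assume K: "K \<in> Pow (I - {j})"
      then have j: "j \<notin> K" by auto
      have 1: "I - insert j K = I - {j} - K" by auto
      have "I = insert j (K \<union> (I - {j} - K))" using K True by auto
      then have "below j I = below j (K \<union> (I - {j} - K))" by (metis below_self(1))
      also have "\<dots> = below j K + below j (I - {j} - K)" by (rule below_disjoint_Un) auto
      finally have 2: "below j I = below j K + below j (I - {j} - K)" .
      show "wedge_sign (insert j K) L (I - insert j K) (J - L) * (-1) ^ below j (insert j K) * b $ (insert j K - {j}, L) * c $ (I - insert j K, J - L) = (-1) ^ below j I * (wedge_sign K L (I - {j} - K) (J - L) * b $ (K, L) * c $ (I - {j} - K, J - L))"
        unfolding 1 using j 2 by (simp add: wedge_sign_def inversions_insert power_add)
    qed
    also have "\<dots> = wedge (dz j) (wedge b c) $ (I, J)"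
      using True by (simp add: wedge_dz_nth wedge_nth[of b c] sum_distrib_left)
    finally show ?thesis .
  next
    case False
    then show ?thesis unfolding wedge_nth[of "wedge _ _"] wedge_dz_nth
      by (auto intro!: sum.neutral)
  qed
  then show ?thesis by (simp add: vec_eq_iff split_paired_all)
qed

lemma wedge_dzbar_assoc: "wedge (wedge (dzbar j) b) c = wedge (dzbar j) (wedge b c)"
proof -
  have "wedge (wedge (dzbar j) b) c $ (I, J) = wedge (dzbar j) (wedge b c) $ (I, J)" for I J
  proof (cases "j \<in> J")
    case True
    have "wedge (wedge (dzbar j) b) c $ (I, J) = (\<Sum>K\<in>Pow I. \<Sum>L\<in>Pow J. if j \<in> L then 
      wedge_sign K L (I - K) (J - L) * (-1) ^ (card K + below j L) * b $ (K, L - {j}) * c $ (I - K, J - L) else 0)"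
      unfolding wedge_nth[of "wedge _ _"] wedge_dzbar_nth 
      by (intro sum.cong refl) (auto intro!: sum.cong)
    also have "\<dots> = (\<Sum>K\<in>Pow I. \<Sum>L\<in>Pow (J - {j}). 
      wedge_sign K (insert j L) (I - K) (J - insert j L) * (-1) ^ (card K + below j (insert j L)) * b $ (K, insert j L - {j}) * c $ (I - K, J - insert j L))"
      by (intro sum.cong refl sum_Pow_containing[OF True finite])
    also have "\<dots> = (\<Sum>K\<in>Pow I. (\<Sum>L\<in>Pow (J - {j}). 
      (-1) ^ (card I + below j J) * (wedge_sign K L (I - K) (J - {j} - L) * b $ (K, L) * c $ (I - K, J - {j} - L))))"
    proof (intro sum.cong refl)
      fix K L assume L: "L \<in> Pow (J - {j})" and K: "K \<in> Pow I"
      then have j: "j \<notin> L" by auto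
      have 1: "J - insert j L = J - {j} - L" by auto
      have "J = insert j (L \<union> (J - {j} - L))" using L True by auto
      then have "below j J = below j (L \<union> (J - {j} - L))" by (metis below_self(1))
      also have "\<dots> = below j L + below j (J - {j} - L)" by (rule below_disjoint_Un) auto
      finally have 2: "below j J = below j L + below j (J - {j} - L)" .
      \<comment> \<open>Inserting j into L raises the exponent \<open>card L * card (I - K)\<close>
        of \<open>wedge_sign\<close> by \<open>card (I - K)\<close>, which completes the
        \<open>card K\<close> of the inner product to the \<open>card I\<close> of the outer
        one.\<close>
      have "card I = card (K \<union> (I - K))" using K by (simp add: Un_absorb1)
      also have "\<dots> = card K + card (I - K)" by (rule card_Un_disjoint) auto
      finally have 3: "card I = card K + card (I - K)" .
      show "wedge_sign K (insert j L) (I - K) (J - insert j L) * (-1) ^ (card K + below j (insert j L)) * b $ (K, insert j L - {j}) * c $ (I - K, J - insert j L) = (-1) ^ (card I + below j J) * (wedge_sign K L (I - K) (J - {j} - L) * b $ (K, L) * c $ (I - K, J - {j} - L))"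
        unfolding 1 using j 2 3 by (simp add: wedge_sign_def inversions_insert power_add)
    qed
    also have "\<dots> = wedge (dzbar j) (wedge b c) $ (I, J)"
      using True by (simp add: wedge_dzbar_nth wedge_nth[of b c] sum_distrib_left)
    finally show ?thesis .
  next
    case False
    then show ?thesis unfolding wedge_nth[of "wedge _ _"] wedge_dzbar_nth
      by (auto intro!: sum.neutral)
  qed
  then show ?thesis by (simp add: vec_eq_iff split_paired_all)
qed

lemma ext_eq_sum: "(a :: 'n::finite ext) = (\<Sum>P\<in>UNIV. a $ P *s axis P 1)"
proof -
  have "a $ Q = (\<Sum>P\<in>UNIV. if P = Q then a $ P else 0)" for Q
    by simp
  also have "\<dots> Q = (\<Sum>P\<in>UNIV. a $ P * axis P 1 $ Q)" for Q
    by (intro sum.cong) (auto simp: axis_def)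
  finally show ?thesis unfolding vec_eq_iff sum_component vector_smult_component by blast
qed

lemma dz_wedge_axis:
  assumes "j \<notin> I"
  shows "wedge (dz j) (axis (I, J) c) = axis (insert j I, J) ((-1) ^ below j I * c)"
  using assms by (auto simp: vec_eq_iff wedge_dz_nth axis_def split_paired_all insert_absorb)

lemma dzbar_wedge_axis:
  assumes "j \<notin> J"
  shows "wedge (dzbar j) (axis (I, J) c) = axis (I, insert j J) ((-1) ^ (card I + below j J) * c)"
  using assms by (auto simp: vec_eq_iff wedge_dzbar_nth axis_def split_paired_all insert_absorb)

lemma scale_axis: "x *s axis P c = axis P (x * c :: complex)"
  by (simp add: vec_eq_iff axis_def)

text \<open>The principal induction rule: forms are spanned by products of generators applied to 1.
  A linear identity therefore only has to be propagated through left multiplication by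
  \<open>dz j\<close> and \<open>dzbar j\<close>, and coefficients with their signs disappear from
  the later proofs.\<close>

lemma ext_induct [case_names add scale one dz dzbar]:
  fixes a :: "'n::{finite,linorder} ext"
  assumes add: "\<And>a b. P a \<Longrightarrow> P b \<Longrightarrow> P (a + b)" and scale: "\<And>x a. P a \<Longrightarrow> P (x *s a)"
    and one: "P (scalar_ext 1)" and dz: "\<And>j a. P a \<Longrightarrow> P (wedge (dz j) a)"
    and dzbar: "\<And>j a. P a \<Longrightarrow> P (wedge (dzbar j) a)"
  shows "P a"
proof -
  have 0: "P 0" using scale[OF one, of 0] by simp
  have J: "P (axis ({}, J) c)" for J c
  proof (induction J arbitrary: c rule: finite_induct[OF finite])
    case 1 then show ?case using scale[OF one, of c] by (simp add: scalar_ext_def scale_axis)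
  next
    case (2 j J)
    \<comment> \<open>The hypothesis is taken at the coefficient already multiplied by the sign of
      \<open>dzbar_wedge_axis\<close>, so that the two signs cancel.\<close>
    from dzbar[OF this(3)[of "(-1) ^ (below j J) * c"], of j] show ?case
      using 2(2) by (simp add: dzbar_wedge_axis mult.assoc[symmetric] power_mult_distrib[symmetric])
  qed
  have "P (axis (I, J) c)" for I J c
  proof (induction I arbitrary: c rule: finite_induct[OF finite])
    case 1 show ?case by (rule J)
  next
    case (2 j I)
    from dz[OF this(3)[of "(-1) ^ (below j I) * c"], of j] show ?case
      using 2(2) by (simp add: dz_wedge_axis mult.assoc[symmetric] power_mult_distrib[symmetric])
  qed
  then have "P (a $ Q *s axis Q 1)" for Q by (cases Q) (simp add: scale_axis)
  then have "P (\<Sum>Q\<in>X. a $ Q *s axis Q 1)" for X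
    by (induction X rule: infinite_finite_induct) (auto intro: 0 add)
  from this[of UNIV] show ?thesis by (simp only: ext_eq_sum[of a, symmetric])
qed

lemma wedge_assoc: "wedge (wedge a b) c = wedge a (wedge b c)"
  by (induction a rule: ext_induct)
     (simp_all add: wedge_add_left wedge_scale_left wedge_dz_assoc wedge_dzbar_assoc)

text \<open>Of two distinct indices exactly one is counted by \<open>below\<close> of the other, so
  the two orders of insertion differ by one sign.\<close>

lemma dz_anticomm: "wedge (dz j) (wedge (dz k) a) = - wedge (dz k) (wedge (dz j) a)"
proof -
  have "wedge (dz j) (wedge (dz k) a) $ (I, J) = - wedge (dz k) (wedge (dz j) a) $ (I, J)" for I J
  proof (cases "j \<in> I \<and> k \<in> I \<and> j \<noteq> k")
    case True
    have 1: "I - {j} - {k} = I - {k} - {j}" by auto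
    have 2: "below k I = below k (I - {j}) + (if j < k then 1 else 0)"
      "below j I = below j (I - {k}) + (if k < j then 1 else 0)"
      using True by (blast intro: below_remove)+
    have 3: "j < k \<and> \<not> k < j \<or> k < j \<and> \<not> j < k" using True by auto
    have 4: "(-1 :: complex) ^ below j I * (-1) ^ below k (I - {j}) = - ((-1) ^ below k I * (-1) ^ below j (I - {k}))"
      unfolding 2 using 3 by (elim disjE conjE) (simp_all only: if_True if_False power_add, simp_all)
    show ?thesis
      using True 4 by (auto simp: wedge_dz_nth 1 power_add mult.assoc[symmetric])
  qed (auto simp: wedge_dz_nth)
  then show ?thesis by (simp add: vec_eq_iff split_paired_all)
qed

lemma card_remove1:
  fixes I :: "'n::finite set"
  shows "k \<in> I \<Longrightarrow> \<exists>m. card I = Suc m"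
  by (metis card.remove finite)

lemma dzbar_anticomm: "wedge (dzbar j) (wedge (dzbar k) a) = - wedge (dzbar k) (wedge (dzbar j) a)"
proof -
  have "wedge (dzbar j) (wedge (dzbar k) a) $ (I, J) = - wedge (dzbar k) (wedge (dzbar j) a) $ (I, J)" for I J
  proof (cases "j \<in> J \<and> k \<in> J \<and> j \<noteq> k")
    case True
    have 1: "J - {j} - {k} = J - {k} - {j}" by auto
    have 2: "below k J = below k (J - {j}) + (if j < k then 1 else 0)"
      "below j J = below j (J - {k}) + (if k < j then 1 else 0)"
      using True by (blast intro: below_remove)+
    have 3: "j < k \<and> \<not> k < j \<or> k < j \<and> \<not> j < k" using True by auto
    have 4: "(-1 :: complex) ^ below j J * (-1) ^ below k (J - {j}) = - ((-1) ^ below k J * (-1) ^ below j (J - {k}))"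
      unfolding 2 using 3 by (elim disjE conjE) (simp_all only: if_True if_False power_add, simp_all)
    have "(-1 :: complex) ^ (card I + m) * (-1) ^ (card I + n) = (-1) ^ m * (-1) ^ n" for m n
      by (simp add: power_add algebra_simps)
    then show ?thesis
      using True 4 by (auto simp: wedge_dzbar_nth 1 mult.assoc[symmetric])
  qed (auto simp: wedge_dzbar_nth)
  then show ?thesis by (simp add: vec_eq_iff split_paired_all)
qed

lemma dzbar_dz_anticomm: "wedge (dzbar j) (wedge (dz k) a) = - wedge (dz k) (wedge (dzbar j) a)"
proof -
  have "wedge (dzbar j) (wedge (dz k) a) $ (I, J) = - wedge (dz k) (wedge (dzbar j) a) $ (I, J)" for I J
    using card_remove1[of k I] by (auto simp: wedge_dzbar_nth wedge_dz_nth)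
  then show ?thesis by (simp add: vec_eq_iff split_paired_all)
qed

text \<open>Contraction with \<open>\<partial>/\<partial>z\<^sub>j\<close> and \<open>\<partial>/\<partial>\<bar>z\<^sub>j\<close>.\<close>

definition cz :: "'n::{finite,linorder} \<Rightarrow> 'n ext \<Rightarrow> 'n ext" where
  "cz j a = (\<chi> P. if j \<in> fst P then 0 else (-1) ^ below j (fst P) * a $ (insert j (fst P), snd P))"

definition czb :: "'n::{finite,linorder} \<Rightarrow> 'n ext \<Rightarrow> 'n ext" where
  "czb j a = (\<chi> P. if j \<in> snd P then 0
     else (-1) ^ (card (fst P) + below j (snd P)) * a $ (fst P, insert j (snd P)))"

text \<open>The canonical anticommutation relation. With \<open>ext_induct\<close> these relations
  determine the contractions, so every later identity about contractions is proved from them and not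
  from coefficients.\<close>

lemma cz_dz: "cz j (wedge (dz k) a) = (if j = k then a else 0) - wedge (dz k) (cz j a)"
proof -
  have "cz j (wedge (dz k) a) $ (I, J) = (if j = k then a $ (I, J) else 0) - wedge (dz k) (cz j a) $ (I, J)" for I J
  proof (cases "j = k")
    case True
    then show ?thesis
      by (auto simp: cz_def wedge_dz_nth insert_absorb mult.assoc[symmetric] power_mult_distrib[symmetric])
  next
    case False
    then have 1: "insert j I - {k} = insert j (I - {k})" by auto
    have 2: "below k (insert j I) = below k I + (if j < k then 1 else 0)" if "j \<notin> I"
      using that by (rule below_insert)
    have 3: "below j I = below j (I - {k}) + (if k < j then 1 else 0)" if "k \<in> I"
      using that by (rule below_remove)
    show ?thesis
    proof (cases "j \<notin> I \<and> k \<in> I")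
      case True
      have "j < k \<and> \<not> k < j \<or> k < j \<and> \<not> j < k" using False by auto
      then show ?thesis
        using True False by (elim disjE) (auto simp: cz_def wedge_dz_nth 1 2 3)
    qed (use False in \<open>auto simp: cz_def wedge_dz_nth\<close>)
  qed
  then show ?thesis by (simp add: vec_eq_iff split_paired_all)
qed

lemma czb_dzbar: "czb j (wedge (dzbar k) a) = (if j = k then a else 0) - wedge (dzbar k) (czb j a)"
proof -
  have "czb j (wedge (dzbar k) a) $ (I, J) = (if j = k then a $ (I, J) else 0) - wedge (dzbar k) (czb j a) $ (I, J)" for I J
  proof (cases "j = k")
    case True
    then show ?thesis
      by (auto simp: czb_def wedge_dzbar_nth insert_absorb mult.assoc[symmetric] power_mult_distrib[symmetric])
  next
    case False
    then have 1: "insert j J - {k} = insert j (J - {k})" by auto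
    have 2: "below k (insert j J) = below k J + (if j < k then 1 else 0)" if "j \<notin> J"
      using that by (rule below_insert)
    have 3: "below j J = below j (J - {k}) + (if k < j then 1 else 0)" if "k \<in> J"
      using that by (rule below_remove)
    show ?thesis
    proof (cases "j \<notin> J \<and> k \<in> J")
      case True
      have "j < k \<and> \<not> k < j \<or> k < j \<and> \<not> j < k" using False by auto
      then show ?thesis
        using True False by (elim disjE) (auto simp: czb_def wedge_dzbar_nth 1 2 3)
    qed (use False in \<open>auto simp: czb_def wedge_dzbar_nth\<close>)
  qed
  then show ?thesis by (simp add: vec_eq_iff split_paired_all)
qed

lemma cz_dzbar: "cz j (wedge (dzbar k) a) = - wedge (dzbar k) (cz j a)"
proof -
  have "cz j (wedge (dzbar k) a) $ (I, J) = - wedge (dzbar k) (cz j a) $ (I, J)" for I J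
    by (auto simp: cz_def wedge_dzbar_nth)
  then show ?thesis by (simp add: vec_eq_iff split_paired_all)
qed

lemma czb_dz: "czb j (wedge (dz k) a) = - wedge (dz k) (czb j a)"
proof -
  have "czb j (wedge (dz k) a) $ (I, J) = - wedge (dz k) (czb j a) $ (I, J)" for I J
    using card_remove1[of k I] by (auto simp: czb_def wedge_dz_nth)
  then show ?thesis by (simp add: vec_eq_iff split_paired_all)
qed

lemma cz_add: "cz j (a + b) = cz j a + cz j b" by (simp add: vec_eq_iff cz_def ring_distribs)
lemma czb_add: "czb j (a + b) = czb j a + czb j b" by (simp add: vec_eq_iff czb_def ring_distribs)
lemma cz_scale: "cz j (x *s b) = x *s cz j b" by (simp add: vec_eq_iff cz_def)
lemma czb_scale: "czb j (x *s b) = x *s czb j b" by (simp add: vec_eq_iff czb_def)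
lemma cz_zero [simp]: "cz j 0 = 0" by (simp add: vec_eq_iff cz_def)
lemma czb_zero [simp]: "czb j 0 = 0" by (simp add: vec_eq_iff czb_def)
lemma cz_minus: "cz j (- b) = - cz j b" by (simp add: vec_eq_iff cz_def)
lemma czb_minus: "czb j (- b) = - czb j b" by (simp add: vec_eq_iff czb_def)
lemma cz_diff: "cz j (a - b) = cz j a - cz j b" by (simp add: vec_eq_iff cz_def ring_distribs)
lemma czb_diff: "czb j (a - b) = czb j a - czb j b" by (simp add: vec_eq_iff czb_def ring_distribs)
lemma cz_sum: "cz j (\<Sum>i\<in>X. f i) = (\<Sum>i\<in>X. cz j (f i))"
  by (induction X rule: infinite_finite_induct) (auto simp: cz_add)
lemma czb_sum: "czb j (\<Sum>i\<in>X. f i) = (\<Sum>i\<in>X. czb j (f i))"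
  by (induction X rule: infinite_finite_induct) (auto simp: czb_add)
lemma cz_scalar [simp]: "cz j (scalar_ext c) = 0" by (auto simp: vec_eq_iff cz_def scalar_ext_def axis_def)
lemma czb_scalar [simp]: "czb j (scalar_ext c) = 0" by (auto simp: vec_eq_iff czb_def scalar_ext_def axis_def)

lemma cz_anticomm: "cz j (cz k a) = - cz k (cz j a)"
  by (induction a rule: ext_induct)
    (simp_all add: cz_add cz_scale cz_dz cz_dzbar cz_diff cz_minus wedge_minus_right wedge_diff_right)

lemma czb_cz_anticomm: "czb j (cz k a) = - cz k (czb j a)"
  by (induction a rule: ext_induct)
    (simp_all add: cz_add czb_add cz_scale czb_scale czb_dz czb_dzbar czb_diff czb_minus cz_dz cz_dzbar cz_diff cz_minus  wedge_minus_right wedge_diff_right)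

lemma scalar_nth_empty: "wedge (dz j) a $ ({}, {}) = 0" "wedge (dzbar j) a $ ({}, {}) = 0"
  by (simp_all add: wedge_dz_nth wedge_dzbar_nth)

text \<open>The companion of \<open>ext_induct\<close> that exposes the basis monomials. It serves
  \<open>subst_ext\<close>, whose definition through sorted lists must be evaluated before it is
  known to be multiplicative.\<close>

lemma ext_axis_induct [case_names add axis]:
  fixes a :: "'n::{finite,linorder} ext"
  assumes add: "\<And>a b. P a \<Longrightarrow> P b \<Longrightarrow> P (a + b)" and axis: "\<And>I J c. P (axis (I, J) c)"
  shows "P a"
proof -
  have 0: "P 0" using axis[of "{}" "{}" 0] by (simp add: axis_def vec_eq_iff zero_vec_def)
  have "P (a $ Q *s axis Q 1)" for Q using axis by (cases Q) (simp add: scale_axis)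
  then have "P (\<Sum>Q\<in>X. a $ Q *s axis Q 1)" for X
    by (induction X rule: infinite_finite_induct) (auto intro: 0 add)
  from this[of UNIV] show ?thesis by (simp only: ext_eq_sum[of a, symmetric])
qed

section \<open>Linear substitution of the generators\<close>

lemma subst_ext_add: "subst_ext A (a + b) = subst_ext A a + subst_ext A b"
  by (simp add: subst_ext_def sum.distrib vector_sadd_rdistrib)

lemma subst_ext_scale: "subst_ext A (x *s a) = x *s subst_ext A a"
proof -
  have "subst_ext A (x *s a) $ Q = x * subst_ext A a $ Q" for Q
    unfolding subst_ext_def sum_component by (simp add: sum_distrib_left mult.assoc)
  then show ?thesis by (simp add: vec_eq_iff)
qed

lemma subst_ext_zero [simp]: "subst_ext A 0 = 0"
  using subst_ext_scale[of A 0 0] by simp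

lemma subst_ext_minus: "subst_ext A (- a) = - subst_ext A a"
  using subst_ext_scale[of A "-1" a] by (simp add: vec_eq_iff)

lemma subst_ext_diff: "subst_ext A (a - b) = subst_ext A a - subst_ext A b"
  using subst_ext_add[of A a "- b"] by (simp add: subst_ext_minus)

lemma subst_ext_sum: "subst_ext A (\<Sum>i\<in>X. f i) = (\<Sum>i\<in>X. subst_ext A (f i))"
  by (induction X rule: infinite_finite_induct) (auto simp: subst_ext_add)

abbreviation "lift_list r I \<equiv> wedge_list (map r (sorted_list_of_set I))"

lemma subst_ext_axis:
  "subst_ext A (axis (I, J) c) = c *s wedge (lift_list (row_form A) I) (lift_list (\<lambda>j. conj_ext (row_form A j)) J)"
proof -
  have "subst_ext A (axis (I, J) c) = (\<Sum>P\<in>UNIV. if P = (I, J) then 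
     c *s wedge (lift_list (row_form A) (fst P)) (lift_list (\<lambda>j. conj_ext (row_form A j)) (snd P)) else 0)"
    unfolding subst_ext_def by (intro sum.cong refl) (auto simp: axis_def)
  then show ?thesis by simp
qed

lemma wedge_list_simps [simp]: "wedge_list [] = scalar_ext 1" "wedge_list (x # xs) = wedge x (wedge_list xs)"
  by (simp_all add: wedge_list_def)

lemma vec_eq_minus_self: "(x :: complex ^ 'm) = - x \<Longrightarrow> x = 0"
  by (simp add: vec_eq_iff)

text \<open>Sorting j into place costs one sign for each smaller entry; of the forms r i only their
  anticommutation enters, so that the lemma serves row forms and their conjugates alike.\<close>

lemma wedge_list_insort:
  fixes r :: "'n::{finite,linorder} \<Rightarrow> 'n ext"
  assumes anti: "\<And>i j x. wedge (r i) (wedge (r j) x) = - wedge (r j) (wedge (r i) x)"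
  shows "sorted xs \<Longrightarrow> j \<notin> set xs \<Longrightarrow> distinct xs \<Longrightarrow>
    wedge_list (map r (insort j xs)) = (-1) ^ below j (set xs) *s wedge (r j) (wedge_list (map r xs))"
proof (induction xs)
  case Nil
  then show ?case by (simp add: below_def)
next
  case (Cons x xs)
  show ?case
  proof (cases "j < x")
    case True
    then have "below j (set (x # xs)) = 0" using Cons.prems by (auto simp: below_def)
    then show ?thesis using True by (simp add: less_imp_le)
  next
    case False
    with Cons.prems have "x < j" by auto
    moreover have "below j (set (x # xs)) = below j (set xs) + 1"
      using Cons.prems \<open>x < j\<close> by (simp add: below_insert)
    ultimately show ?thesis using Cons
      by (simp add: wedge_scale_right anti[of x j])
  qed
qed

text \<open>Once r j has been moved next to its second occurrence, anticommutation with itself makes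
  the product equal to its own negative.\<close>

lemma wedge_list_mem:
  fixes r :: "'n::{finite,linorder} \<Rightarrow> 'n ext"
  assumes anti: "\<And>i j x. wedge (r i) (wedge (r j) x) = - wedge (r j) (wedge (r i) x)"
  shows "j \<in> set xs \<Longrightarrow> wedge (r j) (wedge_list (map r xs)) = 0"
proof (induction xs)
  case (Cons x xs)
  show ?case
  proof (cases "j = x")
    case True
    then show ?thesis using anti[of x x] by (auto intro: vec_eq_minus_self)
  next
    case False
    then show ?thesis using Cons by (simp add: anti[of j x])
  qed
qed simp

lemma wedge_list_commute:
  fixes r :: "'n::{finite,linorder} \<Rightarrow> 'n ext"
  assumes anti: "\<And>i x. wedge s (wedge (r i) x) = - wedge (r i) (wedge s x)"
  shows "wedge s (wedge (wedge_list (map r xs)) y) = (-1) ^ length xs *s wedge (wedge_list (map r xs)) (wedge s y)"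
  by (induction xs) (simp_all add: wedge_assoc anti wedge_scale_right)

lemma lift_list_insert:
  fixes r :: "'n::{finite,linorder} \<Rightarrow> 'n ext"
  assumes anti: "\<And>i j x. wedge (r i) (wedge (r j) x) = - wedge (r j) (wedge (r i) x)"
  shows "wedge (r j) (lift_list r I) = (if j \<in> I then 0 else (-1) ^ below j I *s lift_list r (insert j I))"
  using wedge_list_mem[of r j "sorted_list_of_set I", OF anti]
    wedge_list_insort[of r "sorted_list_of_set I" j, OF anti]
  by (auto simp: sorted_list_of_set_insert mult.assoc[symmetric] power_mult_distrib[symmetric] simp del: sorted_list_of_set_insert_remove)

section \<open>Conjugation and its compatibility with products and substitutions\<close>

lemma conj_ext_add: "conj_ext (a + b) = conj_ext a + conj_ext b"
  by (simp add: vec_eq_iff conj_ext_def ring_distribs)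
lemma conj_ext_scale: "conj_ext (x *s a) = cnj x *s conj_ext a"
  by (simp add: vec_eq_iff conj_ext_def)
lemma conj_ext_zero [simp]: "conj_ext 0 = 0"
  by (simp add: vec_eq_iff conj_ext_def)
lemma conj_ext_minus: "conj_ext (- a) = - conj_ext a"
  by (simp add: vec_eq_iff conj_ext_def)
lemma conj_ext_diff: "conj_ext (a - b) = conj_ext a - conj_ext b"
  by (simp add: vec_eq_iff conj_ext_def ring_distribs)
lemma conj_ext_sum: "conj_ext (\<Sum>i\<in>X. f i) = (\<Sum>i\<in>X. conj_ext (f i))"
  by (induction X rule: infinite_finite_induct) (auto simp: conj_ext_add)
lemma conj_ext_scalar [simp]: "conj_ext (scalar_ext c) = scalar_ext (cnj c)"
  by (auto simp: vec_eq_iff conj_ext_def scalar_ext_def axis_def)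
lemma conj_ext_dz [simp]: "conj_ext (dz j) = dzbar j"
  by (auto simp: vec_eq_iff conj_ext_def dz_def dzbar_def axis_def)
lemma conj_ext_dzbar [simp]: "conj_ext (dzbar j) = dz j"
  by (auto simp: vec_eq_iff conj_ext_def dz_def dzbar_def axis_def)
lemma conj_ext_conj [simp]: "conj_ext (conj_ext a) = a"
  by (auto simp: vec_eq_iff conj_ext_def minus_one_power_iff)

lemma conj_ext_wedge_dz: "conj_ext (wedge (dz j) a) = wedge (dzbar j) (conj_ext a)"
proof -
  have "conj_ext (wedge (dz j) a) $ (I, J) = wedge (dzbar j) (conj_ext a) $ (I, J)" for I J
  proof (cases "j \<in> J")
    case True
    then obtain m where "card J = Suc m" using card_remove1 by blast
    with True show ?thesis by (simp add: conj_ext_def wedge_dz_nth wedge_dzbar_nth power_add)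
  qed (simp add: conj_ext_def wedge_dz_nth wedge_dzbar_nth)
  then show ?thesis by (simp add: vec_eq_iff split_paired_all)
qed

lemma conj_ext_wedge_dzbar: "conj_ext (wedge (dzbar j) a) = wedge (dz j) (conj_ext a)"
  by (metis conj_ext_wedge_dz conj_ext_conj)

lemma conj_ext_wedge: "conj_ext (wedge a b) = wedge (conj_ext a) (conj_ext b)"
  by (induction a rule: ext_induct)
    (simp_all add: conj_ext_add conj_ext_scale wedge_add_left wedge_scale_left wedge_assoc
      conj_ext_wedge_dz conj_ext_wedge_dzbar)

lemma conj_row_form: "conj_ext (row_form A i) = (\<Sum>k\<in>UNIV. cnj (A $ i $ k) *s dzbar k)"
  by (simp add: row_form_def conj_ext_sum conj_ext_scale)

lemma row_form_wedge: "wedge (row_form A i) x = (\<Sum>k\<in>UNIV. A $ i $ k *s wedge (dz k) x)"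
  by (simp add: row_form_def wedge_sum_left wedge_scale_left)

lemma conj_row_form_wedge: "wedge (conj_ext (row_form A i)) x = (\<Sum>k\<in>UNIV. cnj (A $ i $ k) *s wedge (dzbar k) x)"
  by (simp add: conj_row_form wedge_sum_left wedge_scale_left)

lemma anticomm_row_form:
  assumes "\<And>k. wedge s (wedge (dz k) x) = - wedge (dz k) (wedge s x)"
  shows "wedge s (wedge (row_form A i) x) = - wedge (row_form A i) (wedge s x)"
  unfolding row_form_wedge by (simp add: wedge_sum_right wedge_scale_right assms sum_negf)

lemma row_form_anticomm: "wedge (row_form A i) (wedge (row_form B j) x) = - wedge (row_form B j) (wedge (row_form A i) x)"
proof (rule anticomm_row_form)
  show "wedge (row_form A i) (wedge (dz k) x) = - wedge (dz k) (wedge (row_form A i) x)" for k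
    using anticomm_row_form[of "dz k" x A i, OF dz_anticomm] by simp
qed

lemma conj_row_form_anticomm: "wedge (conj_ext (row_form A i)) (wedge (conj_ext (row_form B j)) x) = - wedge (conj_ext (row_form B j)) (wedge (conj_ext (row_form A i)) x)"
  using arg_cong[OF row_form_anticomm[of A i B j "conj_ext x"], of conj_ext]
  by (simp add: conj_ext_wedge conj_ext_minus)

lemma row_form_conj_anticomm: "wedge (conj_ext (row_form A i)) (wedge (row_form B j) x) = - wedge (row_form B j) (wedge (conj_ext (row_form A i)) x)"
proof (rule anticomm_row_form)
  have *: "wedge (dzbar k) (wedge (row_form A i) (conj_ext x)) = - wedge (row_form A i) (wedge (dzbar k) (conj_ext x))" for k
    by (rule anticomm_row_form, rule dzbar_dz_anticomm)
  show "wedge (conj_ext (row_form A i)) (wedge (dz k) x) = - wedge (dz k) (wedge (conj_ext (row_form A i)) x)" for k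
    using arg_cong[OF *[of k], of conj_ext] by (simp add: conj_ext_wedge conj_ext_minus)
qed

lemma scalar_ext_scale: "x *s scalar_ext c = scalar_ext (x * c)"
  by (simp add: scalar_ext_def scale_axis)

lemma subst_ext_one [simp]: "subst_ext A (scalar_ext c) = scalar_ext c"
  using subst_ext_axis[of A "{}" "{}" c] by (simp add: scalar_ext_def[symmetric] scalar_ext_scale)

text \<open>Multiplicativity on a generator. For j in I both sides vanish; otherwise the sign of
  \<open>dz_wedge_axis\<close> on the left is the sign of sorting the row form into the list on the
  right.\<close>

lemma subst_ext_dz_wedge: "subst_ext A (wedge (dz j) a) = wedge (row_form A j) (subst_ext A a)"
proof (induction a rule: ext_axis_induct)
  case (axis I J c)
  have *: "wedge (row_form A j) (wedge (lift_list (row_form A) I) y) = 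
    (if j \<in> I then 0 else (-1) ^ below j I *s wedge (lift_list (row_form A) (insert j I)) y)" for y
    using lift_list_insert[of "row_form A" j I, OF row_form_anticomm]
    by (simp add: wedge_assoc[symmetric] wedge_scale_left)
  show ?case
  proof (cases "j \<in> I")
    case True
    have "wedge (dz j) (axis (I, J) c) = 0"
      using True by (auto simp: vec_eq_iff wedge_dz_nth axis_def split_paired_all)
    then show ?thesis using True * by (simp add: subst_ext_axis wedge_scale_right)
  next
    case False
    then show ?thesis by (simp add: dz_wedge_axis subst_ext_axis wedge_scale_right * mult.commute)
  qed
qed (simp add: subst_ext_add wedge_add_right)

lemma subst_ext_dzbar_wedge: "subst_ext A (wedge (dzbar j) a) = wedge (conj_ext (row_form A j)) (subst_ext A a)"
proof (induction a rule: ext_axis_induct)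
  case (axis I J c)
  let ?r = "\<lambda>j. conj_ext (row_form A j)"
  have *: "wedge (?r j) (wedge (lift_list (row_form A) I) (lift_list ?r J)) = 
    (if j \<in> J then 0 else (-1) ^ (card I + below j J) *s wedge (lift_list (row_form A) I) (lift_list ?r (insert j J)))"
    using lift_list_insert[of "?r" j J, OF conj_row_form_anticomm]
    by (simp add: wedge_list_commute[OF row_form_conj_anticomm] wedge_scale_right power_add)
  show ?case
  proof (cases "j \<in> J")
    case True
    have "wedge (dzbar j) (axis (I, J) c) = 0"
      using True by (auto simp: vec_eq_iff wedge_dzbar_nth axis_def split_paired_all)
    then show ?thesis using True * by (simp add: subst_ext_axis wedge_scale_right)
  next
    case False
    then show ?thesis by (simp add: dzbar_wedge_axis subst_ext_axis wedge_scale_right * mult.commute)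
  qed
qed (simp add: subst_ext_add wedge_add_right)

lemma subst_ext_wedge: "subst_ext A (wedge a b) = wedge (subst_ext A a) (subst_ext A b)"
  by (induction a rule: ext_induct)
    (simp_all add: wedge_add_left subst_ext_add wedge_scale_left subst_ext_scale wedge_assoc
      subst_ext_dz_wedge subst_ext_dzbar_wedge)

lemma subst_ext_dz: "subst_ext A (dz j) = row_form A j"
  using subst_ext_dz_wedge[of A j "scalar_ext 1"] by simp

lemma subst_ext_conj: "subst_ext A (conj_ext a) = conj_ext (subst_ext A a)"
  by (induction a rule: ext_induct)
    (simp_all add: conj_ext_add subst_ext_add conj_ext_scale subst_ext_scale conj_ext_wedge
      subst_ext_dz_wedge subst_ext_dzbar_wedge)

lemma subst_ext_dzbar: "subst_ext A (dzbar j) = conj_ext (row_form A j)"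
  using subst_ext_dzbar_wedge[of A j "scalar_ext 1"] by simp

lemma subst_ext_row_form: "subst_ext A (row_form B j) = row_form (B ** A) j"
proof -
  have "subst_ext A (row_form B j) = (\<Sum>l\<in>UNIV. \<Sum>k\<in>UNIV. (B $ j $ k * A $ k $ l) *s dz l)"
    by (subst sum.swap)
      (simp add: row_form_def subst_ext_sum subst_ext_scale subst_ext_dz vec.scale_sum_right)
  also have "\<dots> = row_form (B ** A) j"
    by (simp add: row_form_def matrix_matrix_mult_def vec.scale_sum_left)
  finally show ?thesis .
qed

lemma subst_ext_comp: "subst_ext A (subst_ext B a) = subst_ext (B ** A) a"
  by (induction a rule: ext_induct)
    (simp_all add: subst_ext_add subst_ext_scale subst_ext_dz_wedge subst_ext_dzbar_wedge
      subst_ext_wedge subst_ext_conj subst_ext_row_form subst_ext_dz subst_ext_dzbar)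

lemma row_form_mat_1: "row_form (mat 1) j = dz j"
proof -
  have "row_form (mat 1) j = (\<Sum>k\<in>UNIV. if k = j then dz k else 0)"
    unfolding row_form_def by (intro sum.cong) (auto simp: mat_def)
  then show ?thesis by simp
qed

lemma subst_ext_id [simp]: "subst_ext (mat 1) a = a"
  by (induction a rule: ext_induct)
    (simp_all add: subst_ext_add subst_ext_scale subst_ext_dz_wedge subst_ext_dzbar_wedge row_form_mat_1)

section \<open>The bidegree as a pair of operators\<close>

definition pw :: "'n::finite ext \<Rightarrow> 'n ext" where
  "pw a = (\<chi> P. of_nat (card (fst P)) * a $ P)"

definition qw :: "'n::finite ext \<Rightarrow> 'n ext" where
  "qw a = (\<chi> P. of_nat (card (snd P)) * a $ P)"

lemma pw_add: "pw (a + b) = pw a + pw b" by (simp add: vec_eq_iff pw_def ring_distribs)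
lemma pw_scale: "pw (x *s b) = x *s pw b" by (simp add: vec_eq_iff pw_def)
lemma qw_scale: "qw (x *s b) = x *s qw b" by (simp add: vec_eq_iff qw_def)
lemma pw_scalar [simp]: "pw (scalar_ext c) = 0" by (auto simp: vec_eq_iff pw_def scalar_ext_def axis_def)
lemma pw_dz: "pw (wedge (dz j) a) = wedge (dz j) (pw a) + wedge (dz j) a"
proof -
  have "pw (wedge (dz j) a) $ (I, J) = (wedge (dz j) (pw a) + wedge (dz j) a) $ (I, J)" for I J
    using card_remove1[of j I] by (auto simp: pw_def wedge_dz_nth algebra_simps)
  then show ?thesis by (simp add: vec_eq_iff split_paired_all)
qed

lemma pw_dzbar: "pw (wedge (dzbar j) a) = wedge (dzbar j) (pw a)"
proof -
  have "pw (wedge (dzbar j) a) $ (I, J) = (wedge (dzbar j) (pw a)) $ (I, J)" for I J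
    by (auto simp: pw_def wedge_dzbar_nth algebra_simps)
  then show ?thesis by (simp add: vec_eq_iff split_paired_all)
qed

lemma qw_conj: "qw (conj_ext a) = conj_ext (pw a)"
  by (simp add: vec_eq_iff pw_def qw_def conj_ext_def)

lemma pw_sum: "pw (\<Sum>k\<in>X. f k) = (\<Sum>k\<in>X. pw (f k))"
  by (simp add: vec_eq_iff pw_def sum_distrib_left)

lemma pw_row_form: "pw (wedge (row_form A j) a) = wedge (row_form A j) (pw a) + wedge (row_form A j) a"
  by (simp add: row_form_def pw_sum wedge_sum_left wedge_scale_left pw_scale pw_dz sum.distrib[symmetric] vec.scale_right_distrib)

lemma pw_conj_row_form: "pw (wedge (conj_ext (row_form A j)) a) = wedge (conj_ext (row_form A j)) (pw a)"
  unfolding conj_row_form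
  by (simp add: pw_sum wedge_sum_left wedge_scale_left pw_scale pw_dzbar)

lemma subst_ext_pw: "subst_ext A (pw a) = pw (subst_ext A a)"
  by (induction a rule: ext_induct)
    (simp_all add: pw_add subst_ext_add pw_scale subst_ext_scale pw_dz pw_dzbar
      subst_ext_dz_wedge subst_ext_dzbar_wedge pw_row_form pw_conj_row_form)

lemma subst_ext_nth_empty: "subst_ext A a $ ({}, {}) = a $ ({}, {})"
  by (induction a rule: ext_induct)
    (simp_all add: subst_ext_add subst_ext_scale subst_ext_dz_wedge subst_ext_dzbar_wedge scalar_nth_empty
       row_form_def wedge_sum_left wedge_scale_left conj_ext_sum conj_ext_scale)

type_synonym 'n mtx = "complex ^ 'n ^ 'n"

section \<open>Hermitian products on the exterior algebra\<close>

definition "sesq (H :: complex ^ 'n ^ 'n) x y = (\<Sum>j\<in>UNIV. \<Sum>k\<in>UNIV. H $ j $ k * x $ j * cnj (y $ k))"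

lemma sesq_add_left: "sesq H (x + y) z = sesq H x z + sesq H y z"
  by (simp add: sesq_def ring_distribs sum.distrib)
lemma sesq_scale_left: "sesq H (c *s x) z = c * sesq H x z"
  by (simp add: sesq_def sum_distrib_left algebra_simps)
lemma sesq_scale_right: "sesq H z (c *s x) = cnj c * sesq H z x"
  by (simp add: sesq_def sum_distrib_left algebra_simps)
lemma sesq_diff_left: "sesq H (x - y) z = sesq H x z - sesq H y z"
  by (simp add: sesq_def ring_distribs sum_subtractf)
lemma sesq_sum_left: "sesq H (\<Sum>i\<in>X. f i) z = (\<Sum>i\<in>X. sesq H (f i) z)"
proof (induction X rule: infinite_finite_induct)
  case (insert x F)
  then show ?case by (simp add: sesq_add_left)
qed (simp_all add: sesq_def)

lemma sesq_hermitian: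
  assumes "\<And>j k. H $ j $ k = cnj (H $ k $ j)"
  shows "sesq H x y = cnj (sesq H y x)"
proof -
  have "cnj (sesq H y x) = (\<Sum>j\<in>UNIV. \<Sum>k\<in>UNIV. H $ k $ j * x $ k * cnj (y $ j))"
    unfolding sesq_def cnj_sum by (intro sum.cong refl) (subst (2) assms, simp)
  also have "\<dots> = sesq H x y" unfolding sesq_def by (rule sum.swap)
  finally show ?thesis by simp
qed

text \<open>Gram-Schmidt along the order of the index type. Orthonormality gives coframes; the
  triangular shape and the positive diagonal serve the determinant computation behind the
  volume.\<close>

lemma gram_schmidt:
  fixes H :: "'n::{finite,linorder} mtx"
  assumes herm: "\<And>j k. H $ j $ k = cnj (H $ k $ j)"
    and pos: "\<And>v. v \<noteq> 0 \<Longrightarrow> 0 < Re (sesq H v v)"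
  obtains V :: "'n mtx" where
    "\<And>s t. sesq H (V $ s) (V $ t) = (if s = t then 1 else 0)"
    "\<And>s j. s < j \<Longrightarrow> V $ s $ j = 0" "\<And>s. \<exists>r>0. V $ s $ s = of_real r"
proof -
  have "\<exists>V :: 'n mtx. (\<forall>s\<in>S. \<forall>t\<in>S. sesq H (V $ s) (V $ t) = (if s = t then 1 else 0)) \<and>
    (\<forall>s\<in>S. \<forall>j. s < j \<longrightarrow> V $ s $ j = 0) \<and> (\<forall>s\<in>S. \<exists>r>0. V $ s $ s = of_real r)" for S :: "'n set"
  proof (induction S rule: finite_linorder_max_induct[OF finite])
    case 1
    then show ?case by simp
  next
    case (2 b S)
    then obtain V :: "'n mtx" where V: "\<And>s t. s \<in> S \<Longrightarrow> t \<in> S \<Longrightarrow> sesq H (V $ s) (V $ t) = (if s = t then 1 else 0)"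
      "\<And>s j. s \<in> S \<Longrightarrow> s < j \<Longrightarrow> V $ s $ j = 0" "\<And>s. s \<in> S \<Longrightarrow> \<exists>r>0. V $ s $ s = of_real r" by blast
    have bS: "s < b" if "s \<in> S" for s using 2 that by auto
    \<comment> \<open>The new basis vector minus its projection onto the earlier rows. These rows
      vanish at b, hence \<open>u $ b = 1\<close>, which keeps u nonzero and the diagonal
      positive.\<close>
    define u where "u = axis b 1 - (\<Sum>s\<in>S. sesq H (axis b 1) (V $ s) *s V $ s)"
    have ut: "sesq H u (V $ t) = 0" if "t \<in> S" for t
    proof -
      have "sesq H u (V $ t) = sesq H (axis b 1) (V $ t) - (\<Sum>s\<in>S. sesq H (axis b 1) (V $ s) * (if s = t then 1 else 0))"
        unfolding u_def sesq_diff_left sesq_sum_left sesq_scale_left using V(1) that by simp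
      then show ?thesis using that by (simp add: if_distrib cong: if_cong)
    qed
    have ub: "u $ b = 1" using V(2) bS by (simp add: u_def axis_def)
    have uj: "u $ j = 0" if "b < j" for j
    proof -
      have "sesq H (axis b 1) (V $ s) * V $ s $ j = 0" if "s \<in> S" for s
        using V(2)[OF that, of j] bS[OF that] \<open>b < j\<close> by auto
      then have "(\<Sum>s\<in>S. sesq H (axis b 1) (V $ s) * V $ s $ j) = 0" by (intro sum.neutral) blast
      moreover have "axis b (1 :: complex) $ j = 0" using that by (simp add: axis_def)
      ultimately show ?thesis by (simp add: u_def)
    qed
    have "u \<noteq> 0" using ub by (metis zero_index zero_neq_one)
    then have r: "0 < Re (sesq H u u)" by (rule pos)
    define r where "r = Re (sesq H u u)"
    have "Im (sesq H u u) = 0"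
      using sesq_hermitian[OF herm, of u u] by (metis cnj.sel(2) eq_neg_iff_add_eq_0 add_self_div_2 div_0 mult_2 mult_eq_0_iff zero_neq_numeral)
    then have uu: "sesq H u u = of_real r" by (simp add: r_def complex_eq_iff)
    have tu: "sesq H (V $ t) u = 0" if "t \<in> S" for t
      using ut[OF that] sesq_hermitian[OF herm, of "V $ t" u] by simp
    define x where "x = complex_of_real (1 / sqrt r) *s u"
    define W where "W = (\<chi> s. if s = b then x else V $ s)"
    have r0: "r > 0" using r by (simp add: r_def)
    have xx: "sesq H x x = 1"
      using r0 by (simp add: x_def sesq_scale_left sesq_scale_right uu flip: of_real_mult)
    have xt: "sesq H x (V $ t) = 0" "sesq H (V $ t) x = 0" if "t \<in> S" for t
      using that by (simp_all add: x_def sesq_scale_left sesq_scale_right ut tu)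
    have bn: "b \<notin> S" using bS by auto
    have "sesq H (W $ s) (W $ t) = (if s = t then 1 else 0)" if "s \<in> insert b S" "t \<in> insert b S" for s t
      using that bn by (auto simp: W_def xx xt V(1))
    moreover have "W $ s $ j = 0" if "s \<in> insert b S" "s < j" for s j
      using that bn uj V(2) by (auto simp: W_def x_def)
    moreover have "\<exists>r>0. W $ s $ s = of_real r" if "s \<in> insert b S" for s
    proof (cases "s = b")
      case True
      then show ?thesis using r0 ub by (auto simp: W_def x_def intro!: exI[of _ "1 / sqrt r"])
    next
      case False
      then show ?thesis using that V(3) by (simp add: W_def)
    qed
    ultimately show ?case by blast
  qed
  from this[of UNIV] show ?thesis using that by blast
qed

definition cmat :: "complex ^ 'n ^ 'm \<Rightarrow> complex ^ 'n ^ 'm" where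
  "cmat A = (\<chi> i j. cnj (A $ i $ j))"

lemma cmat_mult: "cmat (A ** B) = cmat A ** cmat B"
  by (simp add: cmat_def matrix_matrix_mult_def vec_eq_iff)

lemma cmat_mat_1 [simp]: "cmat (mat 1) = mat 1"
  by (simp add: cmat_def mat_def vec_eq_iff)

lemma cmat_transpose: "cmat (transpose A) = transpose (cmat A)"
  by (simp add: cmat_def transpose_def vec_eq_iff)

lemma conj_dzbar_dz_axis: "wedge (dz k) (dzbar l) = axis ({k}, {l}) 1"
  using dz_wedge_axis[of k "{}" "{l}" 1] by (simp add: dzbar_def below_def)

lemma wedge_row_conj_row:
  "wedge (row_form C j) (conj_ext (row_form C j)) = (\<Sum>k\<in>UNIV. \<Sum>l\<in>UNIV. (C $ j $ k * cnj (C $ j $ l)) *s wedge (dz k) (dzbar l))"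
  unfolding row_form_wedge unfolding conj_row_form
  by (simp add: wedge_sum_right wedge_scale_right vec.scale_sum_right)

lemma axis_pair_sum:
  "(\<Sum>k\<in>UNIV. \<Sum>l\<in>UNIV. f k l *s axis ({k}, {l}) (1::complex)) $ (I, J) =
     (if card I = 1 \<and> card J = 1 then f (the_elem I) (the_elem J) else 0)" for f :: "'n::finite \<Rightarrow> 'n \<Rightarrow> complex"
proof (cases "card I = 1 \<and> card J = 1")
  case True
  then obtain i j where ij: "I = {i}" "J = {j}" by (metis card_1_singletonE)
  have "(\<Sum>k\<in>UNIV. \<Sum>l\<in>UNIV. f k l *s axis ({k}, {l}) (1::complex)) $ (I, J) =
    (\<Sum>k\<in>UNIV. if k = i then (\<Sum>l\<in>UNIV. if l = j then f k l else 0) else 0)"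
    unfolding sum_component ij
  proof (intro sum.cong refl, goal_cases)
    case (1 k)
    then show ?case
      by (cases "k = i") (auto simp: axis_def intro!: sum.cong[OF refl] sum.neutral simp del: sum.delta sum.delta')
  qed
  then show ?thesis using ij by simp
next
  case False
  then show ?thesis by (auto simp: axis_def intro!: sum.neutral)
qed

lemma coframe_expand:
  "(\<Sum>j\<in>UNIV. \<i> *s wedge (row_form C j) (conj_ext (row_form C j))) =
   (\<Sum>k\<in>UNIV. \<Sum>l\<in>UNIV. (\<i> * (\<Sum>j\<in>UNIV. C $ j $ k * cnj (C $ j $ l))) *s wedge (dz k) (dzbar l))"
proof -
  have "(\<Sum>j\<in>UNIV. \<i> *s wedge (row_form C j) (conj_ext (row_form C j))) =
    (\<Sum>j\<in>UNIV. \<Sum>k\<in>UNIV. \<Sum>l\<in>UNIV. (\<i> * (C $ j $ k * cnj (C $ j $ l))) *s wedge (dz k) (dzbar l))"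
    by (simp add: wedge_row_conj_row vec.scale_sum_right)
  also have "\<dots> = (\<Sum>k\<in>UNIV. \<Sum>l\<in>UNIV. \<Sum>j\<in>UNIV. (\<i> * (C $ j $ k * cnj (C $ j $ l))) *s wedge (dz k) (dzbar l))"
    by (subst sum.swap) (intro sum.cong refl sum.swap)
  finally show ?thesis by (simp add: sum_distrib_left vec.scale_sum_left)
qed

definition coframed :: "'n::{finite,linorder} ext \<Rightarrow> bool" where
  "coframed w \<longleftrightarrow> (\<exists>C. orthonormal_coframe w C)"

lemma herm_matrix_coframe:
  assumes "orthonormal_coframe w C"
  shows "herm_matrix w = transpose C ** cmat C"
proof -
  have "w $ ({k}, {l}) = \<i> * (\<Sum>j\<in>UNIV. C $ j $ k * cnj (C $ j $ l))" for k l
    using assms unfolding orthonormal_coframe_def coframe_expand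
    using axis_pair_sum[of "\<lambda>k l. \<i> * (\<Sum>j\<in>UNIV. C $ j $ k * cnj (C $ j $ l))" "{k}" "{l}"]
    by (simp add: conj_dzbar_dz_axis)
  then show ?thesis by (simp add: herm_matrix_def vec_eq_iff matrix_matrix_mult_def transpose_def cmat_def)
qed

text \<open>Gram-Schmidt gives V with V h V^* = 1, so h = U U^* for the inverse U of V, and the
  transpose of U is the matrix of an orthonormal coframe. This turns the positivity of a metric into
  the coframe that all later computations start from.\<close>

lemma positive_11_coframed:
  fixes w :: "'n::{finite,linorder} ext"
  assumes "positive_11 w" shows "coframed w"
proof -
  define h where "h = herm_matrix w"
  have conj: "conj_ext w = w" and supp: "\<And>I J. w $ (I, J) \<noteq> 0 \<Longrightarrow> card I = 1 \<and> card J = 1"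
    and pos: "\<And>v. v \<noteq> 0 \<Longrightarrow> 0 < Re (sesq h v v)"
    using assms by (auto simp: positive_11_def sesq_def h_def)
  have herm: "h $ j $ k = cnj (h $ k $ j)" for j k
  proof -
    have "w $ ({j}, {k}) = conj_ext w $ ({j}, {k})" by (simp add: conj)
    then show ?thesis by (simp add: h_def herm_matrix_def conj_ext_def)
  qed
  obtain V :: "'n mtx" where V: "\<And>s t. sesq h (V $ s) (V $ t) = (if s = t then 1 else 0)"
  proof (rule gram_schmidt[OF herm pos])
    fix V :: "'n mtx"
    assume *: "\<And>s t. sesq h (V $ s) (V $ t) = (if s = t then 1 else 0)"
    show thesis by (rule that) (rule *)
  qed
  have 1: "V ** h ** transpose (cmat V) = mat 1"
  proof -
    have "(V ** h ** transpose (cmat V)) $ s $ t = mat 1 $ s $ t" for s t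
    proof -
      have "(V ** h ** transpose (cmat V)) $ s $ t = (\<Sum>k\<in>UNIV. \<Sum>j\<in>UNIV. h $ j $ k * V $ s $ j * cnj (V $ t $ k))"
        by (simp add: matrix_matrix_mult_def transpose_def cmat_def sum_distrib_left sum_distrib_right mult_ac)
      also have "\<dots> = sesq h (V $ s) (V $ t)" unfolding sesq_def by (rule sum.swap)
      finally show ?thesis using V by (simp add: mat_def)
    qed
    then show ?thesis by (simp add: vec_eq_iff)
  qed
  obtain U where U: "V ** U = mat 1" "U ** V = mat 1"
    using 1 by (metis matrix_left_right_inverse matrix_mul_assoc)
  define C where "C = transpose U"
  have 2: "transpose C ** cmat C = h"
  proof -
    have "h ** transpose (cmat V) = U"
      using 1 U by (metis matrix_mul_assoc matrix_mul_lid matrix_mul_rid)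
    moreover have "transpose (cmat V) ** transpose (cmat U) = mat 1"
      using U(2) by (metis cmat_mat_1 cmat_mult matrix_transpose_mul transpose_mat)
    ultimately have "h = U ** transpose (cmat U)"
      by (metis matrix_mul_assoc matrix_mul_rid)
    then show ?thesis by (simp add: C_def cmat_transpose transpose_transpose)
  qed
  have inv: "invertible C"
    unfolding C_def invertible_def using U by (metis matrix_transpose_mul transpose_mat)
  have hkl: "h $ k $ l = (\<Sum>j\<in>UNIV. C $ j $ k * cnj (C $ j $ l))" for k l
    unfolding 2[symmetric] by (simp add: matrix_matrix_mult_def transpose_def cmat_def)
  have "w = (\<Sum>j\<in>UNIV. \<i> *s wedge (row_form C j) (conj_ext (row_form C j)))"
  proof -
    have "w $ (I, J) = (\<Sum>j\<in>UNIV. \<i> *s wedge (row_form C j) (conj_ext (row_form C j))) $ (I, J)" for I J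
      unfolding coframe_expand conj_dzbar_dz_axis axis_pair_sum
    proof (cases "card I = 1 \<and> card J = 1")
      case True
      then obtain i j where ij: "I = {i}" "J = {j}" by (metis card_1_singletonE)
      have "w $ ({i}, {j}) = \<i> * h $ i $ j" by (simp add: h_def herm_matrix_def)
      then show "w $ (I, J) = (if card I = 1 \<and> card J = 1 then \<i> * (\<Sum>k\<in>UNIV. C $ k $ (the_elem I) * cnj (C $ k $ (the_elem J))) else 0)"
        using ij hkl by simp
    qed (use supp in auto)
    then show ?thesis by (simp add: vec_eq_iff split_paired_all)
  qed
  with inv show ?thesis by (auto simp: coframed_def orthonormal_coframe_def)
qed

lemma coframed_expand:
  assumes "coframed w"
  shows "w = (\<Sum>k\<in>UNIV. \<Sum>l\<in>UNIV. (\<i> * herm_matrix w $ k $ l) *s wedge (dz k) (dzbar l))"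
proof -
  obtain C where C: "orthonormal_coframe w C" using assms by (auto simp: coframed_def)
  have "w = (\<Sum>j\<in>UNIV. \<i> *s wedge (row_form C j) (conj_ext (row_form C j)))"
    using C by (simp add: orthonormal_coframe_def)
  then show ?thesis unfolding coframe_expand herm_matrix_coframe[OF C]
    by (simp add: matrix_matrix_mult_def transpose_def cmat_def)
qed

lemma coframed_conj: assumes "coframed w" shows "conj_ext w = w"
proof -
  obtain C where C: "orthonormal_coframe w C" using assms by (auto simp: coframed_def)
  have "wedge (conj_ext (row_form C j)) (row_form C j) = - wedge (row_form C j) (conj_ext (row_form C j))" for j
    using row_form_conj_anticomm[of C j C j "scalar_ext 1"] by simp
  then have "conj_ext (\<Sum>j\<in>UNIV. \<i> *s wedge (row_form C j) (conj_ext (row_form C j))) = 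
     (\<Sum>j\<in>UNIV. \<i> *s wedge (row_form C j) (conj_ext (row_form C j)))"
    by (simp add: conj_ext_sum conj_ext_scale conj_ext_wedge)
  with C show ?thesis by (simp add: orthonormal_coframe_def)
qed

lemma coframed_subst:
  assumes "orthonormal_coframe w C" "invertible J"
  shows "orthonormal_coframe (subst_ext J w) (C ** J)"
  using assms unfolding orthonormal_coframe_def
  by (auto simp: invertible_mult subst_ext_sum subst_ext_scale subst_ext_wedge subst_ext_conj subst_ext_row_form)

text \<open>The entry at (l, j) is the product of the covectors \<open>dz l\<close> and
  \<open>dz j\<close>, as \<open>gram_coframe\<close> shows. It is inverse to the matrix of w, and
  the transpose puts the conjugate linear slot last.\<close>

definition gram :: "'n::finite ext \<Rightarrow> complex ^ 'n ^ 'n" where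
  "gram w = transpose (matrix_inv (herm_matrix w))"

lemma matrix_inv_mult:
  assumes "invertible (A :: complex ^ 'n ^ 'n)"
  shows "matrix_inv A ** A = mat 1" "A ** matrix_inv A = mat 1"
  using assms someI_ex[of "\<lambda>B. A ** B = mat 1 \<and> B ** A = mat 1"]
  unfolding invertible_def matrix_inv_def by auto

lemma matrix_inv_eqI:
  assumes "A ** B = mat 1" shows "matrix_inv A = (B :: complex ^ 'n ^ 'n)"
  using assms matrix_inv_mult[of A]
  by (metis invertible_def matrix_left_right_inverse matrix_mul_assoc matrix_mul_lid matrix_mul_rid)

lemma gram_coframe:
  assumes "orthonormal_coframe w C"
  shows "gram w = matrix_inv C ** transpose (cmat (matrix_inv C))"
proof -
  define B where "B = matrix_inv C"
  have inv: "B ** C = mat 1" "C ** B = mat 1"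
    using assms matrix_inv_mult unfolding B_def orthonormal_coframe_def by auto
  have 1: "cmat C ** cmat B = mat 1" by (metis cmat_mat_1 cmat_mult inv(2))
  have 2: "transpose C ** transpose B = mat 1" by (metis inv(1) matrix_transpose_mul transpose_mat)
  have "herm_matrix w ** (cmat B ** transpose B) = transpose C ** (cmat C ** cmat B) ** transpose B"
    unfolding herm_matrix_coframe[OF assms] by (simp add: matrix_mul_assoc)
  then have "herm_matrix w ** (cmat B ** transpose B) = mat 1"
    by (simp add: 1 2)
  then have "matrix_inv (herm_matrix w) = cmat B ** transpose B" by (rule matrix_inv_eqI)
  then show ?thesis by (simp add: gram_def matrix_transpose_mul transpose_transpose B_def)
qed

lemma herm_matrix_invertible: assumes "coframed (w :: 'n::{finite,linorder} ext)" shows "invertible (herm_matrix w)"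
proof -
  obtain C where C: "orthonormal_coframe w C" using assms by (auto simp: coframed_def)
  then have "invertible C" by (simp add: orthonormal_coframe_def)
  moreover from this have "invertible (cmat C)"
    unfolding invertible_def by (metis cmat_mat_1 cmat_mult)
  moreover have "invertible (transpose A)" if "invertible A" for A :: "'n mtx"
    using that unfolding invertible_def by (metis matrix_transpose_mul transpose_mat)
  ultimately show ?thesis
    unfolding herm_matrix_coframe[OF C] by (intro invertible_mult)
qed

lemma herm_matrix_hermitian: assumes "coframed w" shows "herm_matrix w $ j $ k = cnj (herm_matrix w $ k $ j)"
proof -
  obtain C where C: "orthonormal_coframe w C" using assms by (auto simp: coframed_def)
  show ?thesis unfolding herm_matrix_coframe[OF C]
    by (simp add: matrix_matrix_mult_def transpose_def cmat_def mult.commute)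
qed

lemma gram_hermitian: assumes "coframed w" shows "gram w $ j $ k = cnj (gram w $ k $ j)"
proof -
  obtain C where C: "orthonormal_coframe w C" using assms by (auto simp: coframed_def)
  show ?thesis unfolding gram_coframe[OF C]
    by (simp add: matrix_matrix_mult_def transpose_def cmat_def mult.commute)
qed

lemma herm_gram: assumes "coframed w"
  shows "(\<Sum>k\<in>UNIV. herm_matrix w $ j $ k * gram w $ l $ k) = (if j = l then 1 else 0)"
proof -
  have "(herm_matrix w ** transpose (gram w)) $ j $ l = mat 1 $ j $ l"
    unfolding gram_def transpose_transpose using matrix_inv_mult(2)[OF herm_matrix_invertible[OF assms]] by simp
  then show ?thesis by (simp add: matrix_matrix_mult_def transpose_def mat_def)
qed

lemma herm_gram': assumes "coframed w"
  shows "(\<Sum>k\<in>UNIV. herm_matrix w $ k $ j * gram w $ k $ l) = (if j = l then 1 else 0)"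
proof -
  have "(\<Sum>k\<in>UNIV. herm_matrix w $ k $ j * gram w $ k $ l) = cnj (\<Sum>k\<in>UNIV. herm_matrix w $ j $ k * gram w $ l $ k)"
    unfolding cnj_sum by (intro sum.cong refl) (metis complex_cnj_mult gram_hermitian[OF assms] herm_matrix_hermitian[OF assms])
  then show ?thesis using herm_gram[OF assms] by simp
qed

section \<open>The product in a coframe and the adjoints of the generators\<close>

definition sp :: "'n::finite ext \<Rightarrow> 'n ext \<Rightarrow> complex" where
  "sp a b = (\<Sum>P\<in>UNIV. a $ P * cnj (b $ P))"

lemma sp_add_left: "sp (a + b) c = sp a c + sp b c" by (simp add: sp_def ring_distribs sum.distrib)
lemma sp_add_right: "sp c (a + b) = sp c a + sp c b" by (simp add: sp_def ring_distribs sum.distrib)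
lemma sp_scale_left: "sp (x *s a) c = x * sp a c" by (simp add: sp_def sum_distrib_left algebra_simps)
lemma sp_scale_right: "sp a (x *s c) = cnj x * sp a c" by (simp add: sp_def sum_distrib_left algebra_simps)
lemma sp_sum_left: "sp (\<Sum>i\<in>X. f i) c = (\<Sum>i\<in>X. sp (f i) c)"
  by (simp add: sp_def sum_distrib_right) (rule sum.swap)
lemma sp_sum_right: "sp c (\<Sum>i\<in>X. f i) = (\<Sum>i\<in>X. sp c (f i))"
  by (simp add: sp_def sum_distrib_left) (rule sum.swap)
lemma sp_cnj: "sp a b = cnj (sp b a)" by (simp add: sp_def mult.commute)

text \<open>Removing k is a bijection from the index sets that contain k to those that do not, and
  it carries one sum to the other.\<close>

lemma sp_dz: "sp (wedge (dz k) a) b = sp a (cz k b)"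
proof -
  have "sp (wedge (dz k) a) b = (\<Sum>P\<in>{P. k \<in> fst P}. (-1) ^ below k (fst P) * a $ (fst P - {k}, snd P) * cnj (b $ P))"
    unfolding sp_def by (intro sum.mono_neutral_cong_right) (auto simp: wedge_dz_nth)
  also have "\<dots> = (\<Sum>P\<in>{P. k \<notin> fst P}. a $ P * cnj ((-1) ^ below k (fst P) * b $ (insert k (fst P), snd P)))"
    by (rule sum.reindex_bij_witness[of _ "\<lambda>P. (insert k (fst P), snd P)" "\<lambda>P. (fst P - {k}, snd P)"])
      (auto simp: insert_absorb)
  also have "\<dots> = sp a (cz k b)"
    unfolding sp_def by (intro sum.mono_neutral_cong_left) (auto simp: cz_def)
  finally show ?thesis .
qed

lemma sp_conj: "sp (conj_ext a) (conj_ext b) = cnj (sp a b)"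
proof -
  have "sp (conj_ext a) (conj_ext b) = (\<Sum>P\<in>UNIV. cnj (a $ (snd P, fst P)) * b $ (snd P, fst P))"
    unfolding sp_def conj_ext_def by (intro sum.cong refl) (simp add: minus_one_power_iff)
  also have "\<dots> = (\<Sum>P\<in>UNIV. cnj (a $ P) * b $ P)"
    by (rule sum.reindex_bij_witness[of _ prod.swap prod.swap]) auto
  finally show ?thesis by (simp add: sp_def)
qed

lemma conj_cz: "conj_ext (cz j a) = czb j (conj_ext a)"
  by (induction a rule: ext_induct)
    (simp_all add: cz_add czb_add conj_ext_add cz_scale czb_scale conj_ext_scale cz_dz cz_dzbar
      conj_ext_wedge czb_dz czb_dzbar conj_ext_diff conj_ext_minus)

text \<open>Naturality of contraction: contracting a substituted form with the k-th basis vector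
  contracts the original form with the image of that vector, whose components are
  \<open>B $ l $ k\<close>.\<close>

lemma cz_subst: "cz k (subst_ext B b) = (\<Sum>l\<in>UNIV. B $ l $ k *s subst_ext B (cz l b))"
proof (induction b rule: ext_induct)
  case (dz j a)
  have 1: "cz k (wedge (row_form B j) x) = B $ j $ k *s x - wedge (row_form B j) (cz k x)" for x
  proof -
    have "cz k (wedge (row_form B j) x) = (\<Sum>l\<in>UNIV. B $ j $ l *s ((if k = l then x else 0) - wedge (dz l) (cz k x)))"
      by (simp add: row_form_wedge cz_sum cz_scale cz_dz)
    also have "\<dots> = (\<Sum>l\<in>UNIV. if k = l then B $ j $ l *s x else 0) - wedge (row_form B j) (cz k x)"
      unfolding row_form_wedge sum_subtractf[symmetric] by (intro sum.cong refl) (auto simp: vec.scale_right_diff_distrib)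
    finally show ?thesis by simp
  qed
  have 2: "B $ l $ k *s subst_ext B (cz l (wedge (dz j) a)) =
    (if l = j then B $ l $ k *s subst_ext B a else 0) - wedge (row_form B j) (B $ l $ k *s subst_ext B (cz l a))" for l
    by (simp add: cz_dz subst_ext_diff subst_ext_dz_wedge wedge_scale_right vec.scale_right_diff_distrib)
  show ?case
    unfolding subst_ext_dz_wedge 1 2 dz.IH wedge_sum_right sum_subtractf by simp
next
  case (dzbar j a)
  have 1: "cz k (wedge (conj_ext (row_form B j)) x) = - wedge (conj_ext (row_form B j)) (cz k x)" for x
    by (simp add: conj_row_form_wedge cz_sum cz_scale cz_dzbar sum_negf)
  show ?case
    unfolding subst_ext_dzbar_wedge 1 dzbar.IH wedge_sum_right
    by (simp add: cz_dzbar subst_ext_minus subst_ext_dzbar_wedge sum_negf wedge_scale_right)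
qed (simp_all add: subst_ext_add cz_add vec.scale_right_distrib sum.distrib subst_ext_scale cz_scale
      vec.scale_sum_right mult.commute)

text \<open>The adjoints of \<open>dz\<^sub>j \<and> \<cdot>\<close> and \<open>d\<bar>z\<^sub>j \<and> \<cdot>\<close>.\<close>

definition ezs :: "'n::{finite,linorder} ext \<Rightarrow> 'n \<Rightarrow> 'n ext \<Rightarrow> 'n ext" where
  "ezs w j b = (\<Sum>l\<in>UNIV. gram w $ l $ j *s cz l b)"

definition ezbs :: "'n::{finite,linorder} ext \<Rightarrow> 'n \<Rightarrow> 'n ext \<Rightarrow> 'n ext" where
  "ezbs w j b = (\<Sum>l\<in>UNIV. cnj (gram w $ l $ j) *s czb l b)"

text \<open>\<open>ext_inner\<close> with its chosen coframe replaced by a given one;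
  \<open>ext_inner_frame\<close> shows that the two agree.\<close>

definition frame_inner :: "'n mtx \<Rightarrow> 'n::{finite,linorder} ext \<Rightarrow> 'n ext \<Rightarrow> complex" where
  "frame_inner C a b = sp (subst_ext (matrix_inv C) a) (subst_ext (matrix_inv C) b)"

lemma conj_ezs: "conj_ext (ezs w j b) = ezbs w j (conj_ext b)"
  by (simp add: ezs_def ezbs_def conj_ext_sum conj_ext_scale conj_cz)

lemma conj_ezbs: "conj_ext (ezbs w j b) = ezs w j (conj_ext b)"
  by (metis conj_ezs conj_ext_conj)

text \<open>For \<open>sp\<close> the adjoint of \<open>dz k\<close> is plain contraction. Carrying
  it back through the substitution by \<open>cz_subst\<close> produces the coefficients of B B^*,
  which is the Gram matrix.\<close>

lemma frame_inner_dz: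
  assumes "orthonormal_coframe w C"
  shows "frame_inner C (wedge (dz j) a) b = frame_inner C a (ezs w j b)"
proof -
  define B where "B = matrix_inv C"
  have g: "gram w $ l $ j = (\<Sum>k\<in>UNIV. B $ l $ k * cnj (B $ j $ k))" for l
    unfolding gram_coframe[OF assms] by (simp add: B_def matrix_matrix_mult_def transpose_def cmat_def)
  have "frame_inner C (wedge (dz j) a) b = (\<Sum>k\<in>UNIV. \<Sum>l\<in>UNIV. B $ j $ k * cnj (B $ l $ k) * sp (subst_ext B a) (subst_ext B (cz l b)))"
    by (simp add: frame_inner_def B_def[symmetric] subst_ext_dz_wedge row_form_wedge sp_sum_left sp_scale_left sp_dz
       cz_subst sp_sum_right sp_scale_right sum_distrib_left mult.assoc)
  also have "\<dots> = (\<Sum>l\<in>UNIV. \<Sum>k\<in>UNIV. B $ j $ k * cnj (B $ l $ k) * sp (subst_ext B a) (subst_ext B (cz l b)))"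
    by (rule sum.swap)
  also have "\<dots> = frame_inner C a (ezs w j b)"
    by (simp add: frame_inner_def B_def[symmetric] ezs_def subst_ext_sum subst_ext_scale sp_sum_right sp_scale_right g
      sum_distrib_left sum_distrib_right mult.commute)
  finally show ?thesis .
qed

lemma frame_inner_conj: "frame_inner C (conj_ext a) (conj_ext b) = cnj (frame_inner C a b)"
  by (simp add: frame_inner_def subst_ext_conj sp_conj)

lemma frame_inner_dzbar:
  assumes "orthonormal_coframe w C"
  shows "frame_inner C (wedge (dzbar j) a) b = frame_inner C a (ezbs w j b)"
proof -
  have "frame_inner C (wedge (dzbar j) a) b = cnj (frame_inner C (wedge (dz j) (conj_ext a)) (conj_ext b))"
    by (simp flip: frame_inner_conj add: conj_ext_wedge)
  also have "\<dots> = frame_inner C a (ezbs w j b)"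
    unfolding frame_inner_dz[OF assms] by (simp flip: frame_inner_conj add: conj_ezs)
  finally show ?thesis .
qed

lemma frame_inner_one: "frame_inner C (scalar_ext 1) b = cnj (b $ ({}, {}))"
proof -
  have "frame_inner C (scalar_ext 1) b = (\<Sum>P\<in>UNIV. if P = ({}, {}) then cnj (subst_ext (matrix_inv C) b $ P) else 0)"
    unfolding frame_inner_def sp_def subst_ext_one by (intro sum.cong refl) (auto simp: scalar_ext_def axis_def)
  then show ?thesis by (simp add: subst_ext_nth_empty)
qed

lemma frame_inner_linear:
  "frame_inner C (a + b) c = frame_inner C a c + frame_inner C b c"
  "frame_inner C (x *s a) c = x * frame_inner C a c"
  "frame_inner C c (a + b) = frame_inner C c a + frame_inner C c b"
  "frame_inner C c (x *s a) = cnj x * frame_inner C c a"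
  by (simp_all add: frame_inner_def subst_ext_add sp_add_left sp_add_right subst_ext_scale sp_scale_left sp_scale_right)

text \<open>Independence of the coframe without the unitary matrix: the product is determined by its
  values on 1 and by the adjoints of the generators, and both depend on w alone.\<close>

lemma frame_inner_unique:
  assumes "orthonormal_coframe w C" "orthonormal_coframe w C'"
  shows "frame_inner C a b = frame_inner C' a b"
  by (induction a arbitrary: b rule: ext_induct)
    (simp_all add: frame_inner_linear frame_inner_one frame_inner_dz[OF assms(1)] frame_inner_dz[OF assms(2)]
      frame_inner_dzbar[OF assms(1)] frame_inner_dzbar[OF assms(2)])

lemma ext_inner_frame:
  assumes "orthonormal_coframe w C"
  shows "ext_inner w a b = frame_inner C a b"
proof -
  have "orthonormal_coframe w (SOME C. orthonormal_coframe w C)" using assms by (rule someI)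
  from frame_inner_unique[OF this assms]
  show ?thesis by (simp add: ext_inner_def frame_inner_def sp_def)
qed

lemma ext_inner_dz: "coframed w \<Longrightarrow> ext_inner w (wedge (dz j) a) b = ext_inner w a (ezs w j b)"
  unfolding coframed_def by (auto simp: ext_inner_frame frame_inner_dz)

lemma ext_inner_dzbar: "coframed w \<Longrightarrow> ext_inner w (wedge (dzbar j) a) b = ext_inner w a (ezbs w j b)"
  unfolding coframed_def by (auto simp: ext_inner_frame frame_inner_dzbar)

lemma ext_inner_one: "coframed w \<Longrightarrow> ext_inner w (scalar_ext 1) b = cnj (b $ ({}, {}))"
  unfolding coframed_def by (auto simp: ext_inner_frame frame_inner_one)

lemma ext_inner_conj: "coframed w \<Longrightarrow> ext_inner w (conj_ext a) (conj_ext b) = cnj (ext_inner w a b)"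
  unfolding coframed_def by (auto simp: ext_inner_frame frame_inner_conj)

lemma ext_inner_sp: "\<exists>B. ext_inner w = (\<lambda>a b. sp (subst_ext B a) (subst_ext B b))"
  unfolding ext_inner_def sp_def Let_def by blast

lemma ext_inner_add_left: "ext_inner w (a + b) c = ext_inner w a c + ext_inner w b c"
  and ext_inner_scale_left: "ext_inner w (x *s a) c = x * ext_inner w a c"
  and ext_inner_add_right: "ext_inner w c (a + b) = ext_inner w c a + ext_inner w c b"
  and ext_inner_scale_right: "ext_inner w c (x *s a) = cnj x * ext_inner w c a"
  and ext_inner_cnj: "ext_inner w a b = cnj (ext_inner w b a)"
  and ext_inner_sum_left: "ext_inner w (\<Sum>i\<in>X. f i) c = (\<Sum>i\<in>X. ext_inner w (f i) c)"
  and ext_inner_sum_right: "ext_inner w c (\<Sum>i\<in>X. f i) = (\<Sum>i\<in>X. ext_inner w c (f i))"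
proof -
  obtain B where B: "ext_inner w = (\<lambda>a b. sp (subst_ext B a) (subst_ext B b))" using ext_inner_sp by blast
  show "ext_inner w (a + b) c = ext_inner w a c + ext_inner w b c"
    "ext_inner w (x *s a) c = x * ext_inner w a c"
    "ext_inner w c (a + b) = ext_inner w c a + ext_inner w c b"
    "ext_inner w c (x *s a) = cnj x * ext_inner w c a"
    "ext_inner w (\<Sum>i\<in>X. f i) c = (\<Sum>i\<in>X. ext_inner w (f i) c)"
    "ext_inner w c (\<Sum>i\<in>X. f i) = (\<Sum>i\<in>X. ext_inner w c (f i))"
    by (simp_all add: B subst_ext_add sp_add_left sp_add_right subst_ext_scale sp_scale_left sp_scale_right
      subst_ext_sum sp_sum_left sp_sum_right)
  show "ext_inner w a b = cnj (ext_inner w b a)" unfolding B by (rule sp_cnj)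
qed

lemma ext_inner_minus_left: "ext_inner w (- a) c = - ext_inner w a c"
  using ext_inner_scale_left[of w "-1" a c] by (simp add: vec_eq_iff)
lemma ext_inner_minus_right: "ext_inner w c (- a) = - ext_inner w c a"
  using ext_inner_scale_right[of w c "-1" a] by (simp add: vec_eq_iff)
lemma ext_inner_diff_left: "ext_inner w (a - b) c = ext_inner w a c - ext_inner w b c"
  using ext_inner_add_left[of w a "-b" c] by (simp add: ext_inner_minus_left)
lemma ext_inner_diff_right: "ext_inner w c (a - b) = ext_inner w c a - ext_inner w c b"
  using ext_inner_add_right[of w c a "-b"] by (simp add: ext_inner_minus_right)
lemma ext_inner_zero_left [simp]: "ext_inner w 0 c = 0"
  using ext_inner_scale_left[of w 0 0 c] by simp
lemma ext_inner_zero_right [simp]: "ext_inner w c 0 = 0"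
  using ext_inner_scale_right[of w c 0 0] by simp

lemma ext_inner_pos:
  assumes "coframed w"
  shows "\<exists>r\<ge>0. ext_inner w a a = complex_of_real r \<and> (r = 0 \<longleftrightarrow> a = 0)"
proof -
  obtain C where C: "orthonormal_coframe w C" using assms by (auto simp: coframed_def)
  define B where "B = matrix_inv C"
  have CB: "C ** B = mat 1" "B ** C = mat 1"
    using C matrix_inv_mult unfolding B_def orthonormal_coframe_def by auto
  define r where "r = (\<Sum>P\<in>UNIV. (cmod (subst_ext B a $ P))\<^sup>2)"
  have "ext_inner w a a = of_real r"
    unfolding ext_inner_frame[OF C] frame_inner_def sp_def r_def B_def[symmetric] of_real_sum
    by (intro sum.cong refl) (simp only: complex_norm_square)
  moreover have "r \<ge> 0" by (simp add: r_def sum_nonneg)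
  moreover have "r = 0 \<longleftrightarrow> subst_ext B a = 0"
    by (simp add: r_def sum_nonneg_eq_0_iff vec_eq_iff)
  moreover have "subst_ext B a = 0 \<longleftrightarrow> a = 0"
    by (metis subst_ext_comp subst_ext_id subst_ext_zero CB(2))
  ultimately show ?thesis by metis
qed

lemma ext_inner_eqI:
  assumes "coframed w" "\<And>a. ext_inner w a b = ext_inner w a c"
  shows "b = c"
proof -
  have "ext_inner w (b - c) (b - c) = 0" by (simp add: ext_inner_diff_right assms(2))
  with ext_inner_pos[OF assms(1), of "b - c"] show ?thesis by auto
qed

text \<open>If C is a coframe of w, then \<open>C ** J\<close> is one of the substituted metric, and
  in these two coframes a form and its substitution have the same coefficients.\<close>

lemma ext_inner_subst:
  assumes "coframed w" "invertible J"
  shows "ext_inner (subst_ext J w) (subst_ext J a) (subst_ext J b) = ext_inner w a b"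
proof -
  obtain C where C: "orthonormal_coframe w C" using assms by (auto simp: coframed_def)
  note C' = coframed_subst[OF C assms(2)]
  define B where "B = matrix_inv C"
  have CB: "C ** B = mat 1" "B ** C = mat 1"
    using C matrix_inv_mult unfolding B_def orthonormal_coframe_def by auto
  have J: "J ** matrix_inv J = mat 1" using matrix_inv_mult(2)[OF assms(2)] .
  have "C ** J ** (matrix_inv J ** B) = mat 1"
    by (metis CB(1) J matrix_mul_assoc matrix_mul_rid)
  then have inv: "matrix_inv (C ** J) = matrix_inv J ** B" by (rule matrix_inv_eqI)
  have "subst_ext (matrix_inv J ** B) (subst_ext J x) = subst_ext B x" for x
    by (simp add: subst_ext_comp matrix_mul_assoc J)
  then show ?thesis
    unfolding ext_inner_frame[OF C] ext_inner_frame[OF C'] frame_inner_def inv by (simp add: B_def)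
qed

lemma ezs_add: "ezs w j (a + b) = ezs w j a + ezs w j b"
  by (simp add: ezs_def cz_add vec.scale_right_distrib sum.distrib)
lemma ezs_scale: "ezs w j (x *s a) = x *s ezs w j a"
  by (simp add: ezs_def cz_scale vec.scale_sum_right mult.commute)
lemma ezs_zero [simp]: "ezs w j 0 = 0" by (simp add: ezs_def)
lemma ezs_minus: "ezs w j (- a) = - ezs w j a"
  by (simp add: ezs_def cz_minus sum_negf)
lemma ezs_diff: "ezs w j (a - b) = ezs w j a - ezs w j b"
  by (simp add: ezs_def cz_diff vec.scale_right_diff_distrib sum_subtractf)
lemma ezs_sum: "ezs w j (\<Sum>i\<in>X. f i) = (\<Sum>i\<in>X. ezs w j (f i))"
  by (induction X rule: infinite_finite_induct) (auto simp: ezs_add)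

lemma ezbs_add: "ezbs w j (a + b) = ezbs w j a + ezbs w j b"
  by (simp add: ezbs_def czb_add vec.scale_right_distrib sum.distrib)
lemma ezbs_scale: "ezbs w j (x *s a) = x *s ezbs w j a"
  by (simp add: ezbs_def czb_scale vec.scale_sum_right mult.commute)
lemma ezbs_zero [simp]: "ezbs w j 0 = 0" by (simp add: ezbs_def)
lemma ezbs_minus: "ezbs w j (- a) = - ezbs w j a"
  by (simp add: ezbs_def czb_minus sum_negf)
lemma ezbs_diff: "ezbs w j (a - b) = ezbs w j a - ezbs w j b"
  by (simp add: ezbs_def czb_diff vec.scale_right_diff_distrib sum_subtractf)
lemma ezbs_sum: "ezbs w j (\<Sum>i\<in>X. f i) = (\<Sum>i\<in>X. ezbs w j (f i))"
  by (induction X rule: infinite_finite_induct) (auto simp: ezbs_add)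

lemma sum_if_scale: "(\<Sum>l\<in>(UNIV :: 'n::finite set). g l *s (if l = k then x else 0)) = g k *s (x :: 'a::comm_ring_1 ^ 'm)"
proof -
  have "(\<Sum>l\<in>UNIV. g l *s (if l = k then x else 0)) = (\<Sum>l\<in>UNIV. if l = k then g l *s x else 0)"
    by (intro sum.cong) auto
  then show ?thesis by simp
qed

lemma ezs_dz: "ezs w j (wedge (dz k) a) = gram w $ k $ j *s a - wedge (dz k) (ezs w j a)"
  by (simp add: ezs_def cz_dz vec.scale_right_diff_distrib sum_subtractf wedge_sum_right wedge_scale_right sum_if_scale)

lemma ezs_dzbar: "ezs w j (wedge (dzbar k) a) = - wedge (dzbar k) (ezs w j a)"
  by (simp add: ezs_def cz_dzbar sum_negf wedge_sum_right wedge_scale_right)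

lemma ezbs_dzbar: "ezbs w j (wedge (dzbar k) a) = cnj (gram w $ k $ j) *s a - wedge (dzbar k) (ezbs w j a)"
  by (simp add: ezbs_def czb_dzbar vec.scale_right_diff_distrib sum_subtractf wedge_sum_right wedge_scale_right sum_if_scale)

lemma ezbs_dz: "ezbs w j (wedge (dz k) a) = - wedge (dz k) (ezbs w j a)"
  by (simp add: ezbs_def czb_dz sum_negf wedge_sum_right wedge_scale_right)

lemma ezs_anticomm: "ezs w j (ezs w k a) = - ezs w k (ezs w j a)"
proof -
  have "ezs w j (ezs w k a) = (\<Sum>l\<in>UNIV. \<Sum>m\<in>UNIV. (gram w $ l $ j * gram w $ m $ k) *s cz l (cz m a))"
    by (simp add: ezs_def cz_sum cz_scale vec.scale_sum_right)
  also have "\<dots> = (\<Sum>m\<in>UNIV. \<Sum>l\<in>UNIV. - ((gram w $ m $ k * gram w $ l $ j) *s cz m (cz l a)))"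
    by (subst sum.swap, intro sum.cong refl, subst cz_anticomm) (simp add: mult.commute)
  also have "\<dots> = - ezs w k (ezs w j a)"
    by (simp add: ezs_def cz_sum cz_scale vec.scale_sum_right sum_negf)
  finally show ?thesis .
qed

lemma ezbs_anticomm: "ezbs w j (ezbs w k a) = - ezbs w k (ezbs w j a)"
  using arg_cong[OF ezs_anticomm[of w j k "conj_ext a"], of conj_ext]
  by (simp add: conj_ezs conj_ext_minus)

lemma ezbs_ezs_anticomm: "ezbs w j (ezs w k a) = - ezs w k (ezbs w j a)"
proof -
  have "ezbs w j (ezs w k a) = (\<Sum>l\<in>UNIV. \<Sum>m\<in>UNIV. (cnj (gram w $ l $ j) * gram w $ m $ k) *s czb l (cz m a))"
    by (simp add: ezs_def ezbs_def czb_sum czb_scale vec.scale_sum_right)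
  also have "\<dots> = (\<Sum>m\<in>UNIV. \<Sum>l\<in>UNIV. - ((gram w $ m $ k * cnj (gram w $ l $ j)) *s cz m (czb l a)))"
    by (subst sum.swap, intro sum.cong refl, subst czb_cz_anticomm) (simp add: mult.commute)
  also have "\<dots> = - ezs w k (ezbs w j a)"
    by (simp add: ezs_def ezbs_def cz_sum cz_scale vec.scale_sum_right sum_negf)
  finally show ?thesis .
qed

text \<open>The metric matrix inverts the Gram matrix, so it recovers plain contraction from the
  adjoints.\<close>

lemma herm_ezs: assumes "coframed w"
  shows "(\<Sum>k\<in>UNIV. herm_matrix w $ j $ k *s ezs w k b) = cz j b"
proof -
  have "(\<Sum>k\<in>UNIV. herm_matrix w $ j $ k *s ezs w k b) =
     (\<Sum>l\<in>UNIV. \<Sum>k\<in>UNIV. (herm_matrix w $ j $ k * gram w $ l $ k) *s cz l b)"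
    by (subst sum.swap) (simp add: ezs_def vec.scale_sum_right)
  also have "\<dots> = (\<Sum>l\<in>UNIV. if j = l then cz l b else 0)"
    by (intro sum.cong refl) (simp add: vec.scale_sum_left[symmetric] herm_gram[OF assms])
  finally show ?thesis by simp
qed

lemma herm_ezbs: assumes "coframed w"
  shows "(\<Sum>k\<in>UNIV. herm_matrix w $ k $ j *s ezbs w k b) = czb j b"
proof -
  have "(\<Sum>k\<in>UNIV. herm_matrix w $ k $ j *s ezbs w k b) = conj_ext (\<Sum>k\<in>UNIV. herm_matrix w $ j $ k *s ezs w k (conj_ext b))"
    by (simp add: herm_matrix_hermitian[OF assms, symmetric] conj_ext_sum conj_ext_scale conj_ezs) 
  then show ?thesis by (simp add: herm_ezs[OF assms] conj_cz)
qed

text \<open>The number operator of the relations \<open>cz_dz\<close>: each generator that passes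
  through the sum leaves one copy of itself.\<close>

lemma pw_number: "(\<Sum>j\<in>UNIV. wedge (dz j) (cz j a)) = pw a"
proof (induction a rule: ext_induct)
  case (dz k a)
  have "wedge (dz j) (cz j (wedge (dz k) a)) = (if j = k then wedge (dz j) a else 0) + wedge (dz k) (wedge (dz j) (cz j a))" for j
    using dz_anticomm[of j k "cz j a"] by (simp add: cz_dz wedge_diff_right)
  then show ?case by (simp add: sum.distrib wedge_sum_right[symmetric] dz pw_dz)
next
  case (dzbar k a)
  have "wedge (dz j) (cz j (wedge (dzbar k) a)) = wedge (dzbar k) (wedge (dz j) (cz j a))" for j
    using dzbar_dz_anticomm[of k j "cz j a"] by (simp add: cz_dzbar wedge_minus_right)
  then show ?case by (simp add: wedge_sum_right[symmetric] dzbar pw_dzbar)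
qed (simp_all add: pw_add cz_add wedge_add_right sum.distrib pw_scale cz_scale wedge_scale_right vec.scale_sum_right[symmetric])

lemma qw_number: "(\<Sum>j\<in>UNIV. wedge (dzbar j) (czb j a)) = qw a"
  using arg_cong[OF pw_number[of "conj_ext a"], of conj_ext]
  by (simp add: conj_ext_sum conj_ext_wedge conj_cz qw_conj[symmetric])

section \<open>Adjoints of exterior multiplication\<close>

definition wadj :: "'n::{finite,linorder} ext \<Rightarrow> 'n ext \<Rightarrow> 'n ext \<Rightarrow> 'n ext" where
  "wadj w \<alpha> v = (THE b. \<forall>a. ext_inner w (wedge \<alpha> a) v = ext_inner w a b)"

lemma wadj_eqI:
  assumes "coframed w" "\<And>a. ext_inner w (wedge \<alpha> a) v = ext_inner w a b"
  shows "wadj w \<alpha> v = b"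
  unfolding wadj_def
proof (rule the_equality)
  show "\<And>c. \<forall>a. ext_inner w (wedge \<alpha> a) v = ext_inner w a c \<Longrightarrow> c = b"
    by (rule ext_inner_eqI[OF assms(1)]) (simp flip: assms(2))
qed (use assms(2) in blast)

text \<open>Existence of the adjoint by induction on \<alpha>: the adjoint of a product is the
  product of the adjoints in reverse order, and the generators have the explicit adjoints
  \<open>ezs\<close> and \<open>ezbs\<close>.\<close>

lemma wadj_adj:
  assumes "coframed w"
  shows "ext_inner w (wedge \<alpha> a) v = ext_inner w a (wadj w \<alpha> v)"
proof -
  have "\<exists>b. \<forall>a. ext_inner w (wedge \<alpha> a) v = ext_inner w a b" for v
  proof (induction \<alpha> arbitrary: v rule: ext_induct)
    case (add \<alpha> \<beta>)
    then show ?case by (metis ext_inner_add_left ext_inner_add_right wedge_add_left)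
  next
    case (scale x \<alpha>)
    then obtain b where "\<forall>a. ext_inner w (wedge \<alpha> a) v = ext_inner w a b" by blast
    then have "\<forall>a. ext_inner w (wedge (x *s \<alpha>) a) v = ext_inner w a (cnj x *s b)"
      by (simp add: wedge_scale_left ext_inner_scale_left ext_inner_scale_right)
    then show ?case by blast
  next
    case one
    then show ?case by auto
  next
    case (dz j \<alpha>)
    then show ?case by (simp add: wedge_assoc ext_inner_dz[OF assms])
  next
    case (dzbar j \<alpha>)
    then show ?case by (simp add: wedge_assoc ext_inner_dzbar[OF assms])
  qed
  then obtain b where "\<And>a. ext_inner w (wedge \<alpha> a) v = ext_inner w a b" by blast
  then show ?thesis using wadj_eqI[OF assms] by metis
qed

context
  fixes w :: "'n::{finite,linorder} ext"
  assumes w: "coframed w"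
begin

lemma wadj_add_left: "wadj w (\<alpha> + \<beta>) v = wadj w \<alpha> v + wadj w \<beta> v"
  by (rule wadj_eqI[OF w]) (simp add: wedge_add_left ext_inner_add_left ext_inner_add_right wadj_adj[OF w])

lemma wadj_scale_left: "wadj w (x *s \<alpha>) v = cnj x *s wadj w \<alpha> v"
  by (rule wadj_eqI[OF w]) (simp add: wedge_scale_left ext_inner_scale_left ext_inner_scale_right wadj_adj[OF w])

lemma wadj_add: "wadj w \<alpha> (u + v) = wadj w \<alpha> u + wadj w \<alpha> v"
  by (rule wadj_eqI[OF w]) (simp add: ext_inner_add_right wadj_adj[OF w])

lemma wadj_scale: "wadj w \<alpha> (x *s v) = x *s wadj w \<alpha> v"
  by (rule wadj_eqI[OF w]) (simp add: ext_inner_scale_right wadj_adj[OF w])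

lemma wadj_zero: "wadj w \<alpha> 0 = 0" "wadj w 0 v = 0"
  by (rule wadj_eqI[OF w], simp)+

lemma wadj_minus: "wadj w \<alpha> (- v) = - wadj w \<alpha> v"
  by (rule wadj_eqI[OF w]) (simp add: ext_inner_minus_right wadj_adj[OF w])

lemma wadj_diff: "wadj w \<alpha> (u - v) = wadj w \<alpha> u - wadj w \<alpha> v"
  by (rule wadj_eqI[OF w]) (simp add: ext_inner_diff_right wadj_adj[OF w])

lemma wadj_diff_left: "wadj w (\<alpha> - \<beta>) v = wadj w \<alpha> v - wadj w \<beta> v"
  by (rule wadj_eqI[OF w]) (simp add: wedge_diff_left ext_inner_diff_left ext_inner_diff_right wadj_adj[OF w])

lemma wadj_sum_left: "wadj w (\<Sum>i\<in>X. f i) v = (\<Sum>i\<in>X. wadj w (f i) v)"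
  by (induction X rule: infinite_finite_induct) (auto simp: wadj_add_left wadj_zero)

lemma wadj_sum: "wadj w \<alpha> (\<Sum>i\<in>X. f i) = (\<Sum>i\<in>X. wadj w \<alpha> (f i))"
  by (induction X rule: infinite_finite_induct) (auto simp: wadj_add wadj_zero)

lemma wadj_wedge: "wadj w (wedge \<alpha> \<beta>) v = wadj w \<beta> (wadj w \<alpha> v)"
  by (rule wadj_eqI[OF w]) (simp add: wedge_assoc wadj_adj[OF w])

lemma wadj_dz: "wadj w (dz j) v = ezs w j v"
  by (rule wadj_eqI[OF w]) (simp add: ext_inner_dz[OF w])

lemma wadj_dzbar: "wadj w (dzbar j) v = ezbs w j v"
  by (rule wadj_eqI[OF w]) (simp add: ext_inner_dzbar[OF w])

lemma wadj_scalar: "wadj w (scalar_ext c) v = cnj c *s v"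
  by (rule wadj_eqI[OF w]) (simp add: ext_inner_scale_left ext_inner_scale_right)

lemma wadj_conj: "wadj w (conj_ext \<alpha>) (conj_ext v) = conj_ext (wadj w \<alpha> v)"
proof (rule wadj_eqI[OF w])
  fix a
  have "ext_inner w (wedge (conj_ext \<alpha>) a) (conj_ext v) = cnj (ext_inner w (wedge \<alpha> (conj_ext a)) v)"
    using ext_inner_conj[OF w, of "wedge \<alpha> (conj_ext a)" v] by (simp add: conj_ext_wedge)
  also have "\<dots> = ext_inner w a (conj_ext (wadj w \<alpha> v))"
    using ext_inner_conj[OF w, of "conj_ext a" "wadj w \<alpha> v"] by (simp add: wadj_adj[OF w])
  finally show "ext_inner w (wedge (conj_ext \<alpha>) a) (conj_ext v) = ext_inner w a (conj_ext (wadj w \<alpha> v))" .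
qed

lemma wadj_subst:
  assumes J: "invertible J"
  shows "wadj (subst_ext J w) (subst_ext J \<alpha>) (subst_ext J v) = subst_ext J (wadj w \<alpha> v)"
proof (rule wadj_eqI)
  show "coframed (subst_ext J w)"
    using w coframed_subst J unfolding coframed_def by blast
  fix a
  obtain b where b: "a = subst_ext J b"
    using matrix_inv_mult(1)[OF J] by (metis subst_ext_comp subst_ext_id)
  show "ext_inner (subst_ext J w) (wedge (subst_ext J \<alpha>) a) (subst_ext J v) =
    ext_inner (subst_ext J w) a (subst_ext J (wadj w \<alpha> v))"
    unfolding b subst_ext_wedge[symmetric] ext_inner_subst[OF w J] by (rule wadj_adj[OF w])
qed

lemma metric_wedge_dz: "wedge w (wedge (dz j) a) = wedge (dz j) (wedge w a)"
proof -
  have "wedge (dz k) (wedge (dzbar l) (wedge (dz j) a)) = wedge (dz j) (wedge (dz k) (wedge (dzbar l) a))" for k l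
    by (simp add: dzbar_dz_anticomm[of l j] dz_anticomm[of k j] wedge_minus_right)
  then show ?thesis
    using arg_cong[OF coframed_expand[OF w], of "\<lambda>x. wedge x (wedge (dz j) a)"]
      arg_cong[OF coframed_expand[OF w], of "\<lambda>x. wedge (dz j) (wedge x a)"]
    by (simp add: wedge_sum_left wedge_scale_left wedge_sum_right wedge_scale_right wedge_assoc)
qed

lemma metric_wedge_dzbar: "wedge w (wedge (dzbar j) a) = wedge (dzbar j) (wedge w a)"
  using arg_cong[OF metric_wedge_dz[of j "conj_ext a"], of conj_ext]
  by (simp add: conj_ext_wedge coframed_conj[OF w])

section \<open>The operator \<Lambda> at a point and its commutators\<close>

definition lam :: "'n ext \<Rightarrow> 'n ext" where "lam v = wadj w w v"

lemma lam_expand: "lam v = (\<Sum>k\<in>UNIV. \<Sum>l\<in>UNIV. - (\<i> * herm_matrix w $ l $ k) *s ezbs w l (ezs w k v))"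
proof -
  have "lam v = wadj w (\<Sum>k\<in>UNIV. \<Sum>l\<in>UNIV. (\<i> * herm_matrix w $ k $ l) *s wedge (dz k) (dzbar l)) v"
    unfolding lam_def by (rule arg_cong[OF coframed_expand[OF w]])
  then show ?thesis
    by (simp add: herm_matrix_hermitian[OF w, symmetric] wadj_sum_left wadj_scale_left wadj_wedge wadj_dz wadj_dzbar)
qed

lemma lam_add: "lam (a + b) = lam a + lam b" by (simp add: lam_def wadj_add)
lemma lam_scale: "lam (x *s b) = x *s lam b" by (simp add: lam_def wadj_scale)
lemma lam_minus: "lam (- b) = - lam b" by (simp add: lam_def wadj_minus)
lemma lam_diff: "lam (a - b) = lam a - lam b" by (simp add: lam_def wadj_diff)
lemma lam_sum: "lam (\<Sum>i\<in>X. f i) = (\<Sum>i\<in>X. lam (f i))" by (simp add: lam_def wadj_sum)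

lemma lam_conj: "lam (conj_ext a) = conj_ext (lam a)"
  using wadj_conj[of w a] by (simp add: lam_def coframed_conj[OF w])

text \<open>Moving \<open>dz j\<close> past \<open>ezs w k\<close> leaves
  \<open>gram w $ j $ k\<close>, and the sum of this against the metric matrix collapses to a
  Kronecker delta by \<open>herm_gram\<close>. What remains is a single adjoint of the conjugate
  generator.\<close>

lemma lam_dz: "lam (wedge (dz j) a) = wedge (dz j) (lam a) - \<i> *s ezbs w j a"
proof -
  have 1: "ezbs w l (ezs w k (wedge (dz j) a)) = gram w $ j $ k *s ezbs w l a + wedge (dz j) (ezbs w l (ezs w k a))" for k l
    by (simp add: ezs_dz ezbs_diff ezbs_scale ezbs_dz)
  have "lam (wedge (dz j) a) = (\<Sum>k\<in>UNIV. \<Sum>l\<in>UNIV. - (\<i> * herm_matrix w $ l $ k) *s (gram w $ j $ k *s ezbs w l a)) + wedge (dz j) (lam a)"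
    unfolding lam_expand 1 by (simp add: vec.scale_right_distrib sum.distrib sum_subtractf sum_negf wedge_sum_right wedge_minus_right wedge_scale_right)
  also have "(\<Sum>k\<in>UNIV. \<Sum>l\<in>UNIV. - (\<i> * herm_matrix w $ l $ k) *s (gram w $ j $ k *s ezbs w l a)) =
    (\<Sum>l\<in>UNIV. (- \<i> * (\<Sum>k\<in>UNIV. herm_matrix w $ l $ k * gram w $ j $ k)) *s ezbs w l a)"
    by (subst sum.swap) (simp add: sum_distrib_left vec.scale_sum_left sum_negf mult.assoc)
  also have "\<dots> = - \<i> *s ezbs w j a"
    unfolding herm_gram[OF w] using sum_if_scale[of "\<lambda>l. - \<i>" j]
  proof -
    have "(\<Sum>l\<in>UNIV. (- \<i> * (if l = j then 1 else 0)) *s ezbs w l a) = (\<Sum>l\<in>UNIV. if l = j then - \<i> *s ezbs w l a else 0)"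
      by (intro sum.cong) auto
    then show "(\<Sum>l\<in>UNIV. (- \<i> * (if l = j then 1 else 0)) *s ezbs w l a) = - \<i> *s ezbs w j a" by simp
  qed
  finally show ?thesis by simp
qed

lemma lam_dzbar: "lam (wedge (dzbar j) a) = wedge (dzbar j) (lam a) + \<i> *s ezs w j a"
  using arg_cong[OF lam_dz[of j "conj_ext a"], of conj_ext]
  by (simp add: conj_ext_wedge lam_conj[symmetric] conj_ezbs conj_ext_scale conj_ext_diff vec_eq_iff)

text \<open>This is the adjoint statement of \<open>lam_dz\<close>, so it is read off by pairing
  with an arbitrary b.\<close>

lemma ezs_metric: "ezs w j (wedge w a) = wedge w (ezs w j a) + \<i> *s wedge (dzbar j) a"
proof (rule ext_inner_eqI[OF w])
  fix b
  have "ext_inner w b (ezs w j (wedge w a)) = ext_inner w (lam (wedge (dz j) b)) a"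
    by (metis ext_inner_dz[OF w] lam_def wadj_adj[OF w] ext_inner_cnj)
  also have "\<dots> = ext_inner w (wedge (dz j) (lam b)) a - \<i> * ext_inner w (ezbs w j b) a"
    by (simp add: lam_dz ext_inner_diff_left ext_inner_scale_left)
  also have "ext_inner w (wedge (dz j) (lam b)) a = ext_inner w b (wedge w (ezs w j a))"
    by (metis ext_inner_dz[OF w] lam_def wadj_adj[OF w] ext_inner_cnj)
  also have "ext_inner w (ezbs w j b) a = ext_inner w b (wedge (dzbar j) a)"
    by (metis ext_inner_dzbar[OF w] ext_inner_cnj)
  finally show "ext_inner w b (ezs w j (wedge w a)) = ext_inner w b (wedge w (ezs w j a) + \<i> *s wedge (dzbar j) a)"
    by (simp add: ext_inner_add_right ext_inner_scale_right)
qed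

lemma ezbs_metric: "ezbs w j (wedge w a) = wedge w (ezbs w j a) - \<i> *s wedge (dz j) a"
  using arg_cong[OF ezs_metric[of j "conj_ext a"], of conj_ext]
  by (simp add: conj_ext_wedge conj_ezs conj_ext_scale conj_ext_add coframed_conj[OF w] vec_eq_iff)

lemma lam_ezs: "lam (ezs w j a) = ezs w j (lam a)"
proof -
  have "wedge w (dz j) = wedge (dz j) w" using metric_wedge_dz[of j "scalar_ext 1"] by simp
  then have "wadj w (wedge w (dz j)) a = wadj w (wedge (dz j) w) a" by simp
  then show ?thesis by (simp add: wadj_wedge wadj_dz lam_def)
qed

lemma lam_ezbs: "lam (ezbs w j a) = ezbs w j (lam a)"
proof -
  have "wedge w (dzbar j) = wedge (dzbar j) w" using metric_wedge_dzbar[of j "scalar_ext 1"] by simp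
  then have "wadj w (wedge w (dzbar j)) a = wadj w (wedge (dzbar j) w) a" by simp
  then show ?thesis by (simp add: wadj_wedge wadj_dzbar lam_def)
qed

text \<open>The relation [\<Lambda>, \<omega> \<and> .] = n - p - q. Commuting \<Lambda> past
  \<open>dz k\<close> and \<open>dzbar l\<close> leaves three sums: the metric matrix against the
  Gram matrix has trace n, and against the adjoints it restores plain contractions, which gives the
  two number operators.\<close>

lemma lam_metric: "lam (wedge w a) = wedge w (lam a) + (of_nat CARD('n) *s a - pw a - qw a)"
proof -
  let ?h = "herm_matrix w"
  have L: "wedge w b = (\<Sum>k\<in>UNIV. \<Sum>l\<in>UNIV. (\<i> * ?h $ k $ l) *s wedge (dz k) (wedge (dzbar l) b))" for b
    using arg_cong[OF coframed_expand[OF w], of "\<lambda>x. wedge x b"] by (simp add: wedge_sum_left wedge_scale_left wedge_assoc)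
  have 1: "lam (wedge (dz k) (wedge (dzbar l) a)) = wedge (dz k) (wedge (dzbar l) (lam a)) + \<i> *s wedge (dz k) (ezs w l a)
    - \<i> *s (cnj (gram w $ l $ k) *s a) + \<i> *s wedge (dzbar l) (ezbs w k a)" for k l
    by (simp add: lam_dz lam_dzbar ezbs_dzbar wedge_add_right wedge_scale_right vec.scale_right_diff_distrib)
  have 2: "(\<i> * ?h $ k $ l) *s lam (wedge (dz k) (wedge (dzbar l) a)) =
     (\<i> * ?h $ k $ l) *s wedge (dz k) (wedge (dzbar l) (lam a)) - ?h $ k $ l *s wedge (dz k) (ezs w l a)
     + (?h $ k $ l * gram w $ k $ l) *s a - ?h $ k $ l *s wedge (dzbar l) (ezbs w k a)" for k l
    unfolding 1 gram_hermitian[OF w, symmetric] by (simp add: vec_eq_iff algebra_simps)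
  have "lam (wedge w a) = (\<Sum>k\<in>UNIV. \<Sum>l\<in>UNIV. (\<i> * ?h $ k $ l) *s lam (wedge (dz k) (wedge (dzbar l) a)))"
    by (subst L) (simp add: lam_sum lam_scale)
  also have "\<dots> = wedge w (lam a) - (\<Sum>k\<in>UNIV. \<Sum>l\<in>UNIV. ?h $ k $ l *s wedge (dz k) (ezs w l a)) +
     (\<Sum>k\<in>UNIV. \<Sum>l\<in>UNIV. (?h $ k $ l * gram w $ k $ l) *s a) - (\<Sum>k\<in>UNIV. \<Sum>l\<in>UNIV. ?h $ k $ l *s wedge (dzbar l) (ezbs w k a))"
    unfolding 2 L[of "lam a"] by (simp add: sum.distrib sum_subtractf)
  also have "(\<Sum>k\<in>UNIV. \<Sum>l\<in>UNIV. ?h $ k $ l *s wedge (dz k) (ezs w l a)) = pw a"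
    by (simp add: wedge_scale_right[symmetric] wedge_sum_right[symmetric] herm_ezs[OF w] pw_number)
  also have "(\<Sum>k\<in>UNIV. \<Sum>l\<in>UNIV. ?h $ k $ l *s wedge (dzbar l) (ezbs w k a)) = qw a"
    by (subst sum.swap) (simp add: wedge_scale_right[symmetric] wedge_sum_right[symmetric] herm_ezbs[OF w] qw_number)
  also have "(\<Sum>k\<in>UNIV. \<Sum>l\<in>UNIV. (?h $ k $ l * gram w $ k $ l) *s a) = of_nat CARD('n) *s a"
    unfolding vec.scale_sum_left[symmetric] using herm_gram[OF w] by simp
  finally show ?thesis by simp
qed

end

lemma qw_czb: "qw (czb j a) = czb j (qw a) - czb j a"
  by (auto simp: vec_eq_iff qw_def czb_def algebra_simps)

lemma qw_cz: "qw (cz j a) = cz j (qw a)"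
  by (auto simp: vec_eq_iff qw_def cz_def algebra_simps)

lemma qw_sum: "qw (\<Sum>k\<in>X. f k) = (\<Sum>k\<in>X. qw (f k))"
  by (simp add: vec_eq_iff qw_def sum_distrib_left)

lemma qw_minus: "qw (- a) = - qw a" by (simp add: vec_eq_iff qw_def)

lemma qw_ezbs: "qw (ezbs w j a) = ezbs w j (qw a) - ezbs w j a"
  by (simp add: ezbs_def qw_sum qw_scale qw_czb vec.scale_right_diff_distrib sum_subtractf)

lemma qw_ezs: "qw (ezs w j a) = ezs w j (qw a)"
  by (simp add: ezs_def qw_sum qw_scale qw_cz)

text \<open>Substitution commutes with the weight, and in the basis of the coframe the weight is
  diagonal with real entries.\<close>

lemma ext_inner_pw: 
  assumes "coframed w" shows "ext_inner w (pw a) b = ext_inner w a (pw b)"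
proof -
  obtain C where C: "orthonormal_coframe w C" using assms by (auto simp: coframed_def)
  have "sp (pw a) b = sp a (pw b)" for a b :: "'a ext" by (simp add: sp_def pw_def mult_ac)
  then show ?thesis by (simp add: ext_inner_frame[OF C] frame_inner_def subst_ext_pw)
qed

lemma pw_metric: assumes "coframed w" shows "pw w = w"
proof -
  have 1: "pw (wedge (dz k) (dzbar l)) = wedge (dz k) (dzbar l)" for k l
    using pw_dz[of k "dzbar l"] pw_dzbar[of l "scalar_ext 1"] by simp
  have "pw w = pw (\<Sum>k\<in>UNIV. \<Sum>l\<in>UNIV. (\<i> * herm_matrix w $ k $ l) *s wedge (dz k) (dzbar l))"
    by (rule arg_cong[OF coframed_expand[OF assms]])
  also have "\<dots> = w"
    unfolding pw_sum pw_scale 1 by (rule coframed_expand[OF assms, symmetric])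
  finally show ?thesis .
qed

context
  fixes w :: "'n::{finite,linorder} ext"
  assumes w: "coframed w"
begin

lemma qw_lam: "qw (lam w a) = lam w (qw a) - lam w a"
  unfolding lam_expand[OF w]
  by (simp add: qw_sum qw_minus qw_scale qw_ezbs qw_ezs sum_subtractf sum_negf vec.scale_right_diff_distrib)

text \<open>The zero-order terms of the twist: \<open>\<i>[\<Lambda>, \<beta>Q] + [\<Lambda>, \<bar>\<beta>L]\<^sup>* + \<i>n[\<beta>, \<Lambda>] = -P\<bar>\<beta>\<^sup>*\<close> for \<open>\<beta> = dz\<^sub>j\<close>.\<close>

lemma twist_identity:
  "\<i> *s (lam w (wedge (dz j) (qw v)) - wedge (dz j) (qw (lam w v)))
   + (lam w (ezbs w j (wedge w v)) - wedge w (lam w (ezbs w j v)))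
   + (\<i> * of_nat CARD('n)) *s (wedge (dz j) (lam w v) - lam w (wedge (dz j) v))
   = - pw (ezbs w j v)"
proof -
  have "lam w (ezbs w j (wedge w v)) = lam w (wedge w (ezbs w j v)) - \<i> *s (wedge (dz j) (lam w v) - \<i> *s ezbs w j v)"
    by (simp add: ezbs_metric[OF w] lam_diff[OF w] lam_scale[OF w] lam_dz[OF w])
  also have "\<dots> = wedge w (lam w (ezbs w j v)) + (of_nat CARD('n) *s ezbs w j v - pw (ezbs w j v) - qw (ezbs w j v))
      - \<i> *s wedge (dz j) (lam w v) - ezbs w j v"
    by (simp add: lam_metric[OF w] vec_eq_iff algebra_simps)
  \<comment> \<open>The drop of q by one under \<open>ezbs\<close> cancels the stray
    \<open>- ezbs w j v\<close>, and its drop under \<Lambda> cancels the term with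
    \<open>wedge (dz j) (lam w v)\<close>.\<close>
  finally show ?thesis
    by (simp add: qw_lam lam_dz[OF w] wedge_diff_right qw_ezbs vec_eq_iff algebra_simps)
qed

text \<open>The contribution of \<open>\<partial>\<^sub>j h\<^sub>l\<^sub>p\<close> to the torsion term of the first-order commutation relation.\<close>

lemma torsion_identity:
  "ezbs w j (ezs w p (wedge (dz l) v)) - ezbs w j (wedge (dzbar p) (ezbs w l v)) - wedge (dz j) (ezbs w l (ezs w p v))
   = - \<i> *s (ezbs w l (ezs w p (ezbs w j (wedge w v))) - wedge w (ezbs w l (ezs w p (ezbs w j v))))"
proof -
  let ?g = "gram w"
  have g: "cnj (?g $ a $ b) = ?g $ b $ a" for a b using gram_hermitian[OF w, of b a] by simp
  have jl: "ezbs w j (ezbs w l x) = - ezbs w l (ezbs w j x)" for x by (rule ezbs_anticomm)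
  have jp: "ezbs w j (ezs w p x) = - ezs w p (ezbs w j x)" for x by (rule ezbs_ezs_anticomm)
  have lp: "ezbs w l (ezs w p x) = - ezs w p (ezbs w l x)" for x by (rule ezbs_ezs_anticomm)
  \<comment> \<open>Both sides are brought to normal order, with generators to the left of adjoints
    and the adjoints in a fixed order; then the terms match one by one.\<close>
  have L: "ezbs w j (ezs w p (wedge (dz l) v)) - ezbs w j (wedge (dzbar p) (ezbs w l v)) - wedge (dz j) (ezbs w l (ezs w p v))
    = ?g $ l $ p *s ezbs w j v - wedge (dz l) (ezs w p (ezbs w j v)) - ?g $ j $ p *s ezbs w l v
     - wedge (dzbar p) (ezbs w l (ezbs w j v)) + wedge (dz j) (ezs w p (ezbs w l v))"
    by (simp add: ezs_dz ezbs_diff ezbs_scale ezbs_dz ezbs_dzbar g jl jp lp wedge_minus_right)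
  have 1: "ezs w p (ezbs w j (wedge w v)) = wedge w (ezs w p (ezbs w j v)) + \<i> *s wedge (dzbar p) (ezbs w j v)
     - \<i> *s (?g $ j $ p *s v - wedge (dz j) (ezs w p v))"
    by (simp add: ezbs_metric[OF w] ezs_diff ezs_scale ezs_metric[OF w] ezs_dz)
  have R: "ezbs w l (ezs w p (ezbs w j (wedge w v))) - wedge w (ezbs w l (ezs w p (ezbs w j v)))
    = \<i> *s (?g $ l $ p *s ezbs w j v - wedge (dzbar p) (ezbs w l (ezbs w j v))) - \<i> *s wedge (dz l) (ezs w p (ezbs w j v)) 
      - \<i> *s (?g $ j $ p *s ezbs w l v - wedge (dz j) (ezs w p (ezbs w l v)))"
    unfolding 1 by (simp add: ezbs_add ezbs_diff ezbs_scale ezbs_metric[OF w] ezbs_dz ezbs_dzbar g lp wedge_minus_right vec_eq_iff algebra_simps)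
  show ?thesis unfolding L R by (simp add: vec_eq_iff algebra_simps)
qed

end

section \<open>Smooth functions\<close>

text \<open>The direction comes first and the point last, so that \<open>dd f v\<close> is again a
  function of the point and can be differentiated once more.\<close>

abbreviation dd :: "('a::real_normed_vector \<Rightarrow> 'b::real_normed_vector) \<Rightarrow> 'a \<Rightarrow> 'a \<Rightarrow> 'b" where
  "dd f v \<equiv> \<lambda>x. frechet_derivative f (at x) v"

lemma dd_eq: "(f has_derivative f') (at x) \<Longrightarrow> dd f v x = f' v"
  using frechet_derivative_at by metis

lemma dd_cong:
  assumes "open S" "x \<in> S" "\<And>y. y \<in> S \<Longrightarrow> f y = g y" "f differentiable (at x)"
  shows "g differentiable (at x)" "dd g v x = dd f v x"
proof -
  have "(f has_derivative frechet_derivative f (at x)) (at x)"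
    using assms(4) frechet_derivative_works by blast
  then have "(g has_derivative frechet_derivative f (at x)) (at x)"
    using has_derivative_transform_within_open assms(1,2,3) by blast
  then show "g differentiable (at x)" "dd g v x = dd f v x"
    by (auto simp: differentiable_def dd_eq)
qed

lemma Ck_on_cong:
  assumes "open S" "\<And>x. x \<in> S \<Longrightarrow> f x = g x" "Ck_on k S f"
  shows "Ck_on k S g"
  using assms(2,3)
proof (induction k arbitrary: f g)
  case 0
  then show ?case by (auto cong: continuous_on_cong)
next
  case (Suc k)
  have "g differentiable (at x)" "dd g v x = dd f v x" if "x \<in> S" for x v
    using dd_cong[OF assms(1) that, of f g] Suc.prems that by auto
  then show ?case using Suc.prems(2) Suc.IH[of "dd f v" "dd g v" for v] by auto
qed

lemma Ck_on_Suc_imp: "Ck_on (Suc k) S f \<Longrightarrow> Ck_on k S f"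
proof (induction k arbitrary: f)
  case 0
  then show ?case
    by (auto intro!: continuous_at_imp_continuous_on differentiable_imp_continuous_within)
qed auto

lemma Ck_on_local:
  assumes "\<And>x. x \<in> S \<Longrightarrow> \<exists>T. open T \<and> x \<in> T \<and> Ck_on k T f"
  shows "Ck_on k S f"
  using assms
proof (induction k arbitrary: f)
  case 0
  then show ?case
    by (auto intro!: continuous_at_imp_continuous_on) (metis continuous_on_eq_continuous_at)
next
  case (Suc k)
  have "f differentiable (at x)" if "x \<in> S" for x
    using Suc.prems[OF that] by auto
  moreover have "Ck_on k S (dd f v)" for v
  proof (rule Suc.IH)
    show "\<exists>T. open T \<and> x \<in> T \<and> Ck_on k T (dd f v)" if "x \<in> S" for x
      using Suc.prems[OF that] by (metis Ck_on.simps(2))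
  qed
  ultimately show ?case by simp
qed

lemma Ck_on_const [simp]: "Ck_on k S (\<lambda>x. c)"
  by (induction k arbitrary: c) auto

lemma dd_bounded_linear_comp:
  assumes "bounded_linear L" "f differentiable (at x)"
  shows "(\<lambda>x. L (f x)) differentiable (at x)" "dd (\<lambda>x. L (f x)) v x = L (dd f v x)"
proof -
  have "((\<lambda>x. L (f x)) has_derivative (\<lambda>v. L (dd f v x))) (at x)"
    using bounded_linear.has_derivative[OF assms(1)] assms(2) frechet_derivative_works by blast
  then show "(\<lambda>x. L (f x)) differentiable (at x)" "dd (\<lambda>x. L (f x)) v x = L (dd f v x)"
    by (auto simp: differentiable_def dd_eq)
qed

lemma Ck_on_bounded_linear:
  assumes "bounded_linear L" "open S" "Ck_on k S f"
  shows "Ck_on k S (\<lambda>x. L (f x))"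
  using assms(3)
proof (induction k arbitrary: f)
  case 0
  then show ?case using linear_continuous_on_compose assms(1)
    by (auto intro: bounded_linear.continuous_on)
next
  case (Suc k)
  have "Ck_on k S (dd (\<lambda>x. L (f x)) v)" for v
    by (rule Ck_on_cong[OF assms(2) dd_bounded_linear_comp(2)[OF assms(1), symmetric] Suc.IH[of "dd f v"]])
      (use Suc.prems in auto)
  then show ?case using Suc.prems dd_bounded_linear_comp(1)[OF assms(1)] by auto
qed

lemma Ck_on_add:
  assumes "open S" "Ck_on k S f" "Ck_on k S g"
  shows "Ck_on k S (\<lambda>x. f x + g x)"
  using assms(2,3)
proof (induction k arbitrary: f g)
  case 0
  then show ?case by (auto intro: continuous_on_add)
next
  case (Suc k)
  have 1: "dd f v x + dd g v x = dd (\<lambda>x. f x + g x) v x" if "x \<in> S" for v x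
    using that Suc.prems by (intro dd_eq[symmetric] has_derivative_add) (auto simp: frechet_derivative_works[symmetric])
  have "Ck_on k S (dd (\<lambda>x. f x + g x) v)" for v
    by (rule Ck_on_cong[OF assms(1) 1 Suc.IH[of "dd f v" "dd g v"]]) (use Suc.prems in auto)
  then show ?case using Suc.prems by (auto intro: differentiable_add)
qed

lemma Ck_on_sum:
  assumes "open S" "\<And>i. i \<in> I \<Longrightarrow> Ck_on k S (f i)"
  shows "Ck_on k S (\<lambda>x. \<Sum>i\<in>I. f i x)"
  using assms(2) by (induction I rule: infinite_finite_induct) (auto intro: Ck_on_add[OF assms(1)])

lemma Ck_on_bilinear:
  assumes "bounded_bilinear B" "open S" "Ck_on k S f" "Ck_on k S g"
  shows "Ck_on k S (\<lambda>x. B (f x) (g x))"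
  using assms(3,4)
proof (induction k arbitrary: f g)
  case 0
  then show ?case by (auto intro: bounded_bilinear.continuous_on[OF assms(1)])
next
  case (Suc k)
  have d: "((\<lambda>x. B (f x) (g x)) has_derivative (\<lambda>v. B (f x) (dd g v x) + B (dd f v x) (g x))) (at x)" if "x \<in> S" for x
    using that Suc.prems by (intro bounded_bilinear.FDERIV[OF assms(1)]) (auto simp: frechet_derivative_works[symmetric])
  have 1: "B (f x) (dd g v x) + B (dd f v x) (g x) = dd (\<lambda>x. B (f x) (g x)) v x" if "x \<in> S" for v x
    by (rule dd_eq[OF d[OF that], symmetric])
  have "Ck_on k S (dd (\<lambda>x. B (f x) (g x)) v)" for v
    by (rule Ck_on_cong[OF assms(2) 1 Ck_on_add[OF assms(2) Suc.IH[of f "dd g v"] Suc.IH[of "dd f v" g]]])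
      (use Suc.prems Ck_on_Suc_imp[of k S f] Ck_on_Suc_imp[of k S g] in auto)
  then show ?case using d by (auto simp: differentiable_def)
qed

lemma Ck_on_bounded_linear_id: "bounded_linear L \<Longrightarrow> Ck_on k S L"
proof (induction k)
  case 0
  then show ?case by (simp add: linear_continuous_on)
next
  case (Suc k)
  have d: "(L has_derivative L) (at x)" for x using Suc.prems by (rule bounded_linear_imp_has_derivative)
  then have "dd L v = (\<lambda>x. L v)" for v by (auto simp: dd_eq)
  then show ?case using d by (auto simp: differentiable_def)
qed

lemma dd_comp:
  assumes "\<phi> differentiable (at x)" "f differentiable (at (\<phi> x))"
  shows "(\<lambda>x. f (\<phi> x)) differentiable (at x)" "dd (\<lambda>x. f (\<phi> x)) v x = frechet_derivative f (at (\<phi> x)) (dd \<phi> v x)"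
proof -
  have "((\<lambda>x. f (\<phi> x)) has_derivative (\<lambda>v. frechet_derivative f (at (\<phi> x)) (dd \<phi> v x))) (at x)"
    using diff_chain_at[OF assms[THEN frechet_derivative_works[THEN iffD1]]] by (simp add: o_def)
  then show "(\<lambda>x. f (\<phi> x)) differentiable (at x)" "dd (\<lambda>x. f (\<phi> x)) v x = frechet_derivative f (at (\<phi> x)) (dd \<phi> v x)"
    by (auto simp: differentiable_def dd_eq)
qed

lemma linear_frechet: "f differentiable (at x) \<Longrightarrow> linear (frechet_derivative f (at x))"
  using frechet_derivative_works has_derivative_linear by blast

text \<open>Expanding the inner derivative over a basis of the middle space writes the derivative of
  the composite as a finite sum of products of functions of class k, to which the induction
  hypothesis applies. The middle space is Euclidean for this reason.\<close>

lemma Ck_on_comp: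
  fixes \<phi> :: "'a::real_normed_vector \<Rightarrow> 'b::euclidean_space"
  assumes "open S" "open T" "\<phi> ` S \<subseteq> T" "\<And>k. Ck_on k S \<phi>" "Ck_on k T f"
  shows "Ck_on k S (\<lambda>x. f (\<phi> x))"
  using assms(5)
proof (induction k arbitrary: f)
  case 0
  then show ?case using assms(4)[of 0] assms(3)
    by (auto intro: continuous_on_compose2)
next
  case (Suc k)
  have d: "\<phi> differentiable (at x)" "f differentiable (at (\<phi> x))" if "x \<in> S" for x
    using assms(3) assms(4)[of "Suc k"] Suc.prems that by auto
  have 1: "(\<Sum>b\<in>Basis. (dd \<phi> v x \<bullet> b) *\<^sub>R frechet_derivative f (at (\<phi> x)) b) = dd (\<lambda>x. f (\<phi> x)) v x" if "x \<in> S" for v x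
  proof -
    have "dd (\<lambda>x. f (\<phi> x)) v x = frechet_derivative f (at (\<phi> x)) (\<Sum>b\<in>Basis. (dd \<phi> v x \<bullet> b) *\<^sub>R b)"
      using dd_comp(2)[OF d[OF that]] by (simp add: euclidean_representation)
    then show ?thesis
      using linear_frechet[OF d(2)[OF that]] by (simp add: linear_sum linear_scale)
  qed
  have "Ck_on k S (\<lambda>x. \<Sum>b\<in>Basis. (dd \<phi> v x \<bullet> b) *\<^sub>R frechet_derivative f (at (\<phi> x)) b)" for v
  proof (intro Ck_on_sum Ck_on_bilinear[OF bounded_bilinear_scaleR] assms)
    fix b :: 'b
    show "Ck_on k S (\<lambda>x. dd \<phi> v x \<bullet> b)"
      using Ck_on_bounded_linear[OF bounded_linear_inner_left[of b] assms(1)] assms(4)[of "Suc k"] by simp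
    show "Ck_on k S (\<lambda>x. frechet_derivative f (at (\<phi> x)) b)"
      using Suc.IH[of "dd f b"] Suc.prems by simp
  qed
  then have "Ck_on k S (dd (\<lambda>x. f (\<phi> x)) v)" for v
    by (rule Ck_on_cong[OF assms(1) 1, rotated])
  moreover have "(\<lambda>x. f (\<phi> x)) differentiable (at x)" if "x \<in> S" for x
    by (rule dd_comp(1)[OF d[OF that]])
  ultimately show ?case by simp
qed

lemma Ck_on_inverse:
  fixes f :: "'a::real_normed_vector \<Rightarrow> 'b::{real_normed_field}"
  assumes "open S" "Ck_on k S f" "\<And>x. x \<in> S \<Longrightarrow> f x \<noteq> 0"
  shows "Ck_on k S (\<lambda>x. inverse (f x))"
  using assms(2)
proof (induction k)
  case 0
  then show ?case using assms by (auto intro: continuous_on_inverse)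
next
  case (Suc k)
  have d: "((\<lambda>x. inverse (f x)) has_derivative (\<lambda>v. - (inverse (f x) * dd f v x * inverse (f x)))) (at x)" if "x \<in> S" for x
    using that Suc.prems assms(3) by (intro Deriv.has_derivative_inverse) (auto simp: frechet_derivative_works[symmetric])
  have "Ck_on k S (\<lambda>x. inverse (f x))" using Suc Ck_on_Suc_imp by blast
  then have "Ck_on k S (\<lambda>x. - (inverse (f x) * dd f v x * inverse (f x)))" for v
    using Suc.prems
    by (intro Ck_on_bounded_linear[OF bounded_linear_minus[OF bounded_linear_ident]] Ck_on_bilinear[OF bounded_bilinear_mult] assms) auto
  then have "Ck_on k S (dd (\<lambda>x. inverse (f x)) v)" for v
    by (rule Ck_on_cong[OF assms(1) dd_eq[OF d, symmetric], rotated])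
  then show ?case using d by (auto simp: differentiable_def)
qed

lemma smooth_on_cong: "open S \<Longrightarrow> (\<And>x. x \<in> S \<Longrightarrow> f x = g x) \<Longrightarrow> smooth_on S f \<Longrightarrow> smooth_on S g"
  unfolding smooth_on_def using Ck_on_cong by blast
lemma smooth_on_const [simp]: "smooth_on S (\<lambda>x. c)" unfolding smooth_on_def by simp
lemma smooth_on_bounded_linear: "bounded_linear L \<Longrightarrow> open S \<Longrightarrow> smooth_on S f \<Longrightarrow> smooth_on S (\<lambda>x. L (f x))"
  by (unfold smooth_on_def, intro allI, rule Ck_on_bounded_linear) auto
lemma smooth_on_linear: "bounded_linear L \<Longrightarrow> smooth_on S L"
  by (unfold smooth_on_def, intro allI, rule Ck_on_bounded_linear_id) auto
lemma smooth_on_add: "open S \<Longrightarrow> smooth_on S f \<Longrightarrow> smooth_on S g \<Longrightarrow> smooth_on S (\<lambda>x. f x + g x)"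
  by (unfold smooth_on_def, intro allI, rule Ck_on_add) auto
lemma smooth_on_sum: "open S \<Longrightarrow> (\<And>i. i \<in> I \<Longrightarrow> smooth_on S (f i)) \<Longrightarrow> smooth_on S (\<lambda>x. \<Sum>i\<in>I. f i x)"
  by (unfold smooth_on_def, intro allI, rule Ck_on_sum) auto
lemma smooth_on_bilinear: "bounded_bilinear B \<Longrightarrow> open S \<Longrightarrow> smooth_on S f \<Longrightarrow> smooth_on S g \<Longrightarrow> smooth_on S (\<lambda>x. B (f x) (g x))"
  by (unfold smooth_on_def, intro allI, rule Ck_on_bilinear) auto
lemma smooth_on_comp:
  fixes \<phi> :: "'a::real_normed_vector \<Rightarrow> 'b::euclidean_space"
  shows "open S \<Longrightarrow> open T \<Longrightarrow> \<phi> ` S \<subseteq> T \<Longrightarrow> smooth_on S \<phi> \<Longrightarrow> smooth_on T f \<Longrightarrow> smooth_on S (\<lambda>x. f (\<phi> x))"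
  by (unfold smooth_on_def, intro allI, rule Ck_on_comp) auto
lemma smooth_on_inverse:
  fixes f :: "'a::real_normed_vector \<Rightarrow> 'b::real_normed_field"
  shows "open S \<Longrightarrow> smooth_on S f \<Longrightarrow> (\<And>x. x \<in> S \<Longrightarrow> f x \<noteq> 0) \<Longrightarrow> smooth_on S (\<lambda>x. inverse (f x))"
  by (unfold smooth_on_def, intro allI, rule Ck_on_inverse) auto
lemma smooth_on_local:
  "(\<And>x. x \<in> S \<Longrightarrow> \<exists>T. open T \<and> x \<in> T \<and> smooth_on T f) \<Longrightarrow> smooth_on S f"
  unfolding smooth_on_def using Ck_on_local by metis
lemma smooth_on_minus: "open S \<Longrightarrow> smooth_on S f \<Longrightarrow> smooth_on S (\<lambda>x. - f x)"
  by (rule smooth_on_bounded_linear[OF bounded_linear_minus[OF bounded_linear_ident]])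
lemma smooth_on_diff: "open S \<Longrightarrow> smooth_on S f \<Longrightarrow> smooth_on S g \<Longrightarrow> smooth_on S (\<lambda>x. f x - g x)"
  using smooth_on_add[of S f "\<lambda>x. - g x"] smooth_on_minus[of S g] by simp
lemma smooth_on_mult:
  fixes f g :: "'a::real_normed_vector \<Rightarrow> 'b::real_normed_algebra"
  shows "open S \<Longrightarrow> smooth_on S f \<Longrightarrow> smooth_on S g \<Longrightarrow> smooth_on S (\<lambda>x. f x * g x)"
  by (rule smooth_on_bilinear[OF bounded_bilinear_mult])
lemma smooth_on_prod:
  fixes f :: "'i \<Rightarrow> 'a::real_normed_vector \<Rightarrow> 'b::real_normed_field"
  assumes "open S" "\<And>i. i \<in> I \<Longrightarrow> smooth_on S (f i)" shows "smooth_on S (\<lambda>x. \<Prod>i\<in>I. f i x)"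
  using assms(2) by (induction I rule: infinite_finite_induct) (auto intro: smooth_on_mult[OF assms(1)])
lemma smooth_on_dd: "smooth_on S f \<Longrightarrow> smooth_on S (dd f v)"
  unfolding smooth_on_def by (metis Ck_on.simps(2))
lemma smooth_on_differentiable: "smooth_on S f \<Longrightarrow> x \<in> S \<Longrightarrow> f differentiable (at x)"
  unfolding smooth_on_def by (metis Ck_on.simps(2))
lemma smooth_on_continuous: "smooth_on S f \<Longrightarrow> continuous_on S f"
  unfolding smooth_on_def by (metis Ck_on.simps(1))

section \<open>Symmetry of second derivatives\<close>

lemma dd_mvt:
  fixes f :: "'a::real_normed_vector \<Rightarrow> real"
  assumes t: "0 < t" and diff: "\<And>s. 0 \<le> s \<Longrightarrow> s \<le> t \<Longrightarrow> f differentiable (at (x + s *\<^sub>R v))"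
  obtains \<xi> where "0 < \<xi>" "\<xi> < t" "f (x + t *\<^sub>R v) - f x = t * dd f v (x + \<xi> *\<^sub>R v)"
proof -
  have d: "((\<lambda>s. f (x + s *\<^sub>R v)) has_real_derivative dd f v (x + s *\<^sub>R v)) (at s)" if "0 \<le> s" "s \<le> t" for s
  proof -
    have "((\<lambda>s. x + s *\<^sub>R v) has_derivative (\<lambda>h. h *\<^sub>R v)) (at s)" by (auto intro!: derivative_eq_intros)
    moreover have "(f has_derivative frechet_derivative f (at (x + s *\<^sub>R v))) (at (x + s *\<^sub>R v))"
      using diff[OF that] frechet_derivative_works by blast
    ultimately have "((\<lambda>s. f (x + s *\<^sub>R v)) has_derivative (\<lambda>h. frechet_derivative f (at (x + s *\<^sub>R v)) (h *\<^sub>R v))) (at s)"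
      using diff_chain_at[of "\<lambda>s. x + s *\<^sub>R v" _ s f] by (simp add: o_def)
    then show ?thesis
      using linear_frechet[OF diff[OF that]] by (simp add: has_field_derivative_def linear_scale mult.commute[of _ "frechet_derivative f _ _"])
  qed
  from MVT2[OF t, of "\<lambda>s. f (x + s *\<^sub>R v)" "\<lambda>s. dd f v (x + s *\<^sub>R v)"] d
  obtain z where "z > 0" "z < t" "f (x + t *\<^sub>R v) - f (x + 0 *\<^sub>R v) = (t - 0) * dd f v (x + z *\<^sub>R v)" by blast
  then show ?thesis using that by simp
qed

text \<open>The second difference is the first difference in direction v of the difference g in
  direction w. The mean value theorem is applied to g, and then to \<open>dd f v\<close> along
  w.\<close>

lemma second_difference:
  fixes f :: "'a::real_normed_vector \<Rightarrow> real"
  assumes S: "smooth_on S f" and t: "0 < t"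
    and sub: "\<And>a b. 0 \<le> a \<Longrightarrow> a \<le> t \<Longrightarrow> 0 \<le> b \<Longrightarrow> b \<le> t \<Longrightarrow> x + a *\<^sub>R v + b *\<^sub>R w \<in> S"
  shows "\<exists>a b. 0 < a \<and> a < t \<and> 0 < b \<and> b < t \<and>
    f (x + t *\<^sub>R v + t *\<^sub>R w) - f (x + t *\<^sub>R v) - f (x + t *\<^sub>R w) + f x = t * t * dd (dd f v) w (x + a *\<^sub>R v + b *\<^sub>R w)"
proof -
  define g where "g = (\<lambda>y. f (y + t *\<^sub>R w) - f y)"
  have d: "(g has_derivative (\<lambda>h. frechet_derivative f (at (y + t *\<^sub>R w)) h - frechet_derivative f (at y) h)) (at y)"
    if "y \<in> S" "y + t *\<^sub>R w \<in> S" for y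
  proof -
    have 1: "(f has_derivative frechet_derivative f (at z)) (at z)" if "z \<in> S" for z
      using smooth_on_differentiable[OF S that] frechet_derivative_works by blast
    have "((\<lambda>y. y + t *\<^sub>R w) has_derivative (\<lambda>h. h)) (at y)" by (auto intro!: derivative_eq_intros)
    from diff_chain_at[OF this 1[OF that(2)]]
    have "((\<lambda>y. f (y + t *\<^sub>R w)) has_derivative (\<lambda>h. frechet_derivative f (at (y + t *\<^sub>R w)) h)) (at y)"
      by (simp add: o_def)
    then show ?thesis unfolding g_def using 1[OF that(1)] by (rule has_derivative_diff)
  qed
  have in1: "x + s *\<^sub>R v \<in> S" "x + s *\<^sub>R v + t *\<^sub>R w \<in> S" if "0 \<le> s" "s \<le> t" for s
    using sub[of s 0] sub[of s t] that t by auto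
  obtain a where a: "0 < a" "a < t" "g (x + t *\<^sub>R v) - g x = t * dd g v (x + a *\<^sub>R v)"
  proof (rule dd_mvt[OF t, of g x v])
    show "g differentiable at (x + s *\<^sub>R v)" if "0 \<le> s" "s \<le> t" for s
      using d in1[OF that] by (auto simp: differentiable_def)
  qed auto
  have "dd g v (x + a *\<^sub>R v) = dd f v (x + a *\<^sub>R v + t *\<^sub>R w) - dd f v (x + a *\<^sub>R v)"
    using d in1[of a] a by (intro dd_eq) auto
  moreover obtain b where "0 < b" "b < t" "dd f v (x + a *\<^sub>R v + t *\<^sub>R w) - dd f v (x + a *\<^sub>R v) = t * dd (dd f v) w (x + a *\<^sub>R v + b *\<^sub>R w)"
  proof (rule dd_mvt[OF t, of "dd f v" "x + a *\<^sub>R v" w])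
    show "dd f v differentiable at (x + a *\<^sub>R v + s *\<^sub>R w)" if "0 \<le> s" "s \<le> t" for s
      using smooth_on_differentiable[OF smooth_on_dd[OF S]] sub[of a s] a that by auto
  qed auto
  ultimately show ?thesis using a by (intro exI[of _ a] exI[of _ b]) (simp add: g_def algebra_simps)
qed

text \<open>The second difference is symmetric in v and w, and divided by \<open>t * t\<close> it is
  a value of either mixed derivative near x. If these differed by 2 e at x, continuity would place
  one number within e of both.\<close>

lemma dd_commute_real:
  fixes f :: "'a::real_normed_vector \<Rightarrow> real"
  assumes "open S" "smooth_on S f" "x \<in> S"
  shows "dd (dd f v) w x = dd (dd f w) v x"
proof (rule ccontr)
  assume ne: "dd (dd f v) w x \<noteq> dd (dd f w) v x"
  define e where "e = \<bar>dd (dd f v) w x - dd (dd f w) v x\<bar> / 2"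
  have e: "e > 0" using ne by (simp add: e_def)
  have c: "isCont (dd (dd f v) w) x" "isCont (dd (dd f w) v) x"
    using assms smooth_on_continuous[OF smooth_on_dd[OF smooth_on_dd[OF assms(2)]]] continuous_on_eq_continuous_at by blast+
  obtain d1 where d1: "d1 > 0" "\<And>y. dist y x < d1 \<Longrightarrow> dist (dd (dd f v) w y) (dd (dd f v) w x) < e"
    using c(1) e unfolding continuous_at_eps_delta by blast
  obtain d2 where d2: "d2 > 0" "\<And>y. dist y x < d2 \<Longrightarrow> dist (dd (dd f w) v y) (dd (dd f w) v x) < e"
    using c(2) e unfolding continuous_at_eps_delta by blast
  obtain d3 where d3: "d3 > 0" "ball x d3 \<subseteq> S" using assms open_contains_ball by blast
  define d where "d = min d1 (min d2 d3)"
  \<comment> \<open>Small enough for the whole parallelogram with sides t v and t w to lie within d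
    of x; the summand 1 avoids division by zero.\<close>
  define t where "t = d / (2 * (norm v + norm w + 1))"
  have d: "d > 0" using d1 d2 d3 by (simp add: d_def)
  then have t: "t > 0" by (simp add: t_def add_nonneg_pos)
  have near: "dist (x + a *\<^sub>R v + b *\<^sub>R w) x < d" if "0 \<le> a" "a \<le> t" "0 \<le> b" "b \<le> t" for a b
  proof -
    have "dist (x + a *\<^sub>R v + b *\<^sub>R w) x \<le> a * norm v + b * norm w"
      using that norm_triangle_ineq[of "a *\<^sub>R v" "b *\<^sub>R w"] by (simp add: dist_norm algebra_simps)
    also have "\<dots> \<le> t * norm v + t * norm w" using that by (intro add_mono mult_right_mono) auto
    also have "\<dots> < t * (2 * (norm v + norm w + 1))" 
      using t by (simp add: algebra_simps add_pos_nonneg add_nonneg_pos)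
    also have "\<dots> = d"
    proof -
      have "2 * (norm v + norm w + 1) \<noteq> 0"
        by (smt (verit) norm_ge_zero)
      then show ?thesis by (simp add: t_def)
    qed
    finally show ?thesis .
  qed
  have sub: "x + a *\<^sub>R v + b *\<^sub>R w \<in> S" if "0 \<le> a" "a \<le> t" "0 \<le> b" "b \<le> t" for a b
    using near[OF that] d3 by (auto simp: d_def dist_commute subset_iff)
  obtain a b where ab: "0 < a" "a < t" "0 < b" "b < t"
    "f (x + t *\<^sub>R v + t *\<^sub>R w) - f (x + t *\<^sub>R v) - f (x + t *\<^sub>R w) + f x = t * t * dd (dd f v) w (x + a *\<^sub>R v + b *\<^sub>R w)"
    using second_difference[OF assms(2) t sub] by blast
  obtain a' b' where ab': "0 < a'" "a' < t" "0 < b'" "b' < t"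
    "f (x + t *\<^sub>R w + t *\<^sub>R v) - f (x + t *\<^sub>R w) - f (x + t *\<^sub>R v) + f x = t * t * dd (dd f w) v (x + a' *\<^sub>R w + b' *\<^sub>R v)"
  proof -
    have "x + a *\<^sub>R w + b *\<^sub>R v \<in> S" if "0 \<le> a" "a \<le> t" "0 \<le> b" "b \<le> t" for a b
      using sub[OF that(3,4,1,2)] by (simp add: add_ac)
    from second_difference[OF assms(2) t this] show ?thesis using that by blast
  qed
  have "t * t * dd (dd f v) w (x + a *\<^sub>R v + b *\<^sub>R w) = t * t * dd (dd f w) v (x + a' *\<^sub>R w + b' *\<^sub>R v)"
    using ab(5) ab'(5) by (simp add: algebra_simps)
  then have eq: "dd (dd f v) w (x + a *\<^sub>R v + b *\<^sub>R w) = dd (dd f w) v (x + a' *\<^sub>R w + b' *\<^sub>R v)" using t by simp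
  have "dist (dd (dd f v) w (x + a *\<^sub>R v + b *\<^sub>R w)) (dd (dd f v) w x) < e"
    using near[of a b] ab by (intro d1) (auto simp: d_def)
  moreover have "dist (dd (dd f w) v (x + a' *\<^sub>R w + b' *\<^sub>R v)) (dd (dd f w) v x) < e"
    using near[of b' a'] ab' by (intro d2) (auto simp: d_def algebra_simps)
  ultimately show False unfolding eq e_def dist_real_def by argo
qed

lemma dd_commute:
  fixes f :: "'a::real_normed_vector \<Rightarrow> 'b::euclidean_space"
  assumes "open S" "smooth_on S f" "x \<in> S"
  shows "dd (dd f v) w x = dd (dd f w) v x"
proof (rule euclidean_eqI)
  fix b :: 'b assume "b \<in> Basis"
  let ?f = "\<lambda>x. f x \<bullet> b"
  have 1: "dd ?f v y = dd f v y \<bullet> b" if "y \<in> S" for v y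
    using dd_bounded_linear_comp(2)[OF bounded_linear_inner_left smooth_on_differentiable[OF assms(2) that]] .
  have 2: "dd (dd ?f v) w x = dd (dd f v) w x \<bullet> b" for v w
  proof -
    have d: "(\<lambda>y. dd f v y \<bullet> b) differentiable (at x)" "dd (\<lambda>y. dd f v y \<bullet> b) w x = dd (dd f v) w x \<bullet> b"
      using dd_bounded_linear_comp[OF bounded_linear_inner_left smooth_on_differentiable[OF smooth_on_dd[OF assms(2)] assms(3)]] by auto
    show ?thesis using dd_cong(2)[OF assms(1,3), of "\<lambda>y. dd f v y \<bullet> b" "dd ?f v" w] d 1 by auto
  qed
  have "smooth_on S ?f" by (rule smooth_on_bounded_linear[OF bounded_linear_inner_left assms(1,2)])
  from dd_commute_real[OF assms(1) this assms(3), of v w]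
  show "dd (dd f v) w x \<bullet> b = dd (dd f w) v x \<bullet> b" unfolding 2 .
qed

text \<open>The function exp(-1/t) extended by zero, with a polynomial in 1/t as a factor. The
  polynomials make the family closed under differentiation, so smoothness is a single
  induction.\<close>

definition flat :: "real poly \<Rightarrow> real \<Rightarrow> real" where
  "flat p t = (if t > 0 then poly p (inverse t) * exp (- inverse t) else 0)"

lemma poly_exp_tendsto_0: "((\<lambda>x. poly p x * exp (- x)) \<longlongrightarrow> (0::real)) at_top"
proof -
  have "((\<lambda>x. \<Sum>i\<le>degree p. coeff p i * (x ^ i / exp x)) \<longlongrightarrow> (\<Sum>i\<le>degree p. coeff p i * 0)) at_top"
    by (intro tendsto_intros tendsto_power_div_exp_0)
  then show ?thesis by (simp add: poly_altdef sum_distrib_right exp_minus divide_inverse mult.assoc)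
qed

text \<open>With s = 1/t the chain rule contributes - s^2, which is the polynomial
  \<open>[:0, 0, 1:]\<close> up to sign, and p(s) exp(-s) differentiates to (p' - p)(s) exp(-s). At
  0 the right-hand difference quotient is again a polynomial in s times exp(-s), hence tends to
  0.\<close>

lemma flat_deriv: "(flat p has_real_derivative flat ([:0, 0, 1:] * (p - pderiv p)) t) (at t)"
proof (cases "t = 0")
  case False
  show ?thesis
  proof (cases "t > 0")
    case True
    have "((\<lambda>t. poly p (inverse t) * exp (- inverse t)) has_real_derivative flat ([:0, 0, 1:] * (p - pderiv p)) t) (at t)"
      using True by (auto intro!: derivative_eq_intros simp: flat_def power2_eq_square algebra_simps)
    then show ?thesis
      by (rule has_field_derivative_transform_within_open[of _ _ _ "{0<..}"]) (use True in \<open>auto simp: flat_def\<close>)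
  next
    case neg: False
    have "((\<lambda>t. 0) has_real_derivative flat ([:0, 0, 1:] * (p - pderiv p)) t) (at t)"
      using neg by (simp add: flat_def)
    then show ?thesis
      by (rule has_field_derivative_transform_within_open[of _ _ _ "{..<0}"]) (use neg False in \<open>auto simp: flat_def\<close>)
  qed
next
  case True
  have "((\<lambda>h. (flat p h - flat p 0) / h) \<longlongrightarrow> 0) (at 0)"
    unfolding filterlim_at_split
  proof
    show "((\<lambda>h. (flat p h - flat p 0) / h) \<longlongrightarrow> 0) (at_left 0)"
      by (rule tendsto_eventually) (auto simp: flat_def eventually_at_filter)
    have "((\<lambda>h. poly ([:0, 1:] * p) (inverse h) * exp (- inverse h)) \<longlongrightarrow> 0) (at_right (0::real))"
      by (rule filterlim_compose[OF poly_exp_tendsto_0 filterlim_inverse_at_top_right])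
    moreover have "\<forall>\<^sub>F h in at_right 0. poly ([:0, 1:] * p) (inverse h) * exp (- inverse h) = (flat p h - flat p 0) / h"
      by (auto simp: eventually_at_filter flat_def field_simps)
    ultimately show "((\<lambda>h. (flat p h - flat p 0) / h) \<longlongrightarrow> 0) (at_right 0)"
      by (rule Lim_transform_eventually)
  qed
  then show ?thesis using True by (simp add: has_field_derivative_iff flat_def)
qed

lemma smooth_on_flat: "smooth_on S (flat p)"
proof -
  have "Ck_on k S (flat p)" for k
  proof (induction k arbitrary: p)
    case 0
    show ?case by (auto intro!: continuous_at_imp_continuous_on DERIV_isCont[OF flat_deriv])
  next
    case (Suc k)
    have d: "(flat p has_derivative (\<lambda>v. flat ([:0, 0, 1:] * (p - pderiv p)) x * v)) (at x)" for x
      using flat_deriv by (simp add: has_field_derivative_def)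
    have "dd (flat p) v = (\<lambda>x. flat (smult v ([:0, 0, 1:] * (p - pderiv p))) x)" for v
      using dd_eq[OF d] by (auto simp: flat_def)
    then show ?case using Suc d by (auto simp: differentiable_def simp del: mult_pCons_left)
  qed
  then show ?thesis by (simp add: smooth_on_def)
qed

definition cutoff :: "real \<Rightarrow> real" where
  "cutoff t = flat 1 (2 - t) / (flat 1 (2 - t) + flat 1 (t - 1))"

lemma flat_nonneg: "flat 1 t \<ge> 0" and flat_pos: "t > 0 \<Longrightarrow> flat 1 t > 0"
  by (simp_all add: flat_def)

text \<open>One of 2 - t and t - 1 is always positive.\<close>

lemma cutoff_denom: "flat 1 (2 - t) + flat 1 (t - 1) > 0"
  using flat_nonneg[of "2 - t"] flat_nonneg[of "t - 1"] flat_pos[of "2 - t"] flat_pos[of "t - 1"] by linarith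

lemma cutoff_values: "t \<le> 1 \<Longrightarrow> cutoff t = 1" "t \<ge> 2 \<Longrightarrow> cutoff t = 0" "0 \<le> cutoff t" "cutoff t \<le> 1"
  using cutoff_denom[of t] flat_nonneg[of "2 - t"] flat_nonneg[of "t - 1"]
  by (auto simp: cutoff_def flat_def field_simps)

lemma smooth_on_cutoff: "smooth_on UNIV cutoff"
proof -
  have 1: "smooth_on UNIV (\<lambda>t::real. flat 1 (2 - t))" "smooth_on UNIV (\<lambda>t::real. flat 1 (t - 1))"
    by (rule smooth_on_comp[OF _ open_UNIV _ _ smooth_on_flat], 
      auto intro: smooth_on_diff smooth_on_linear[OF bounded_linear_ident])+
  have "smooth_on UNIV (\<lambda>t. inverse (flat 1 (2 - t) + flat 1 (t - 1)))"
    using cutoff_denom by (intro smooth_on_inverse smooth_on_add 1) (auto simp: less_imp_neq[symmetric])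
  then have "smooth_on UNIV (\<lambda>t. flat 1 (2 - t) * inverse (flat 1 (2 - t) + flat 1 (t - 1)))"
    by (intro smooth_on_mult 1) auto
  then show ?thesis by (simp add: cutoff_def[abs_def] divide_inverse)
qed

lemma bump_exists:
  fixes z0 :: "'a::real_inner"
  assumes "0 < r"
  obtains \<psi> :: "'a \<Rightarrow> real" where "smooth_on UNIV \<psi>" "\<And>z. dist z0 z \<le> r \<Longrightarrow> \<psi> z = 1"
    "\<And>z. dist z0 z \<ge> 2 * r \<Longrightarrow> \<psi> z = 0" "\<And>z. 0 \<le> \<psi> z" "\<And>z. \<psi> z \<le> 1"
proof
  \<comment> \<open>The squared distance is used because it is smooth at z0 as well. After division
    by the square of r it is at most 1 up to radius r and at least 4 from radius 2 r on, which is
    past the threshold 2 of \<open>cutoff\<close>.\<close>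
  define q where "q = (\<lambda>z. ((z - z0) \<bullet> (z - z0)) * inverse (r\<^sup>2))"
  have q: "q z = (dist z0 z / r)\<^sup>2" for z
    by (simp add: q_def dist_norm norm_minus_commute power2_norm_eq_inner[symmetric] divide_inverse power_mult_distrib power_inverse)
  have "smooth_on UNIV q"
    unfolding q_def
    by (intro smooth_on_mult smooth_on_bilinear[OF bounded_bilinear_inner] smooth_on_diff
         smooth_on_linear[OF bounded_linear_ident] smooth_on_const open_UNIV)
  then show "smooth_on UNIV (\<lambda>z. cutoff (q z))"
    by (rule smooth_on_comp[OF open_UNIV open_UNIV _ _ smooth_on_cutoff, rotated]) auto
  show "cutoff (q z) = 1" if "dist z0 z \<le> r" for z
    using that assms unfolding q by (intro cutoff_values) (simp add: power_le_one_iff)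
  show "cutoff (q z) = 0" if "dist z0 z \<ge> 2 * r" for z
  proof -
    have "2 \<le> dist z0 z / r" using that assms by (simp add: field_simps)
    then have "2\<^sup>2 \<le> (dist z0 z / r)\<^sup>2" by (intro power_mono) auto
    then show ?thesis unfolding q by (intro cutoff_values) simp
  qed
qed (auto intro: cutoff_values)

section \<open>Smoothness of the operations on forms and matrices\<close>

lemma scaleR_vec_complex: "r *\<^sub>R (x :: complex ^ 'm) = complex_of_real r *s x"
  unfolding vec_eq_iff vector_scaleR_component vector_smult_component by (simp add: scaleR_conv_of_real)

lemma bounded_linear_clinear:
  fixes f :: "complex ^ 'm \<Rightarrow> complex ^ 'k"
  assumes "\<And>x y. f (x + y) = f x + f y" "\<And>c x. f (c *s x) = c *s f x"
  shows "bounded_linear f"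
  unfolding linear_conv_bounded_linear[symmetric]
  by (rule linearI) (simp_all add: assms scaleR_vec_complex)

lemma bounded_linear_antilinear:
  fixes f :: "complex ^ 'm \<Rightarrow> complex ^ 'k"
  assumes "\<And>x y. f (x + y) = f x + f y" "\<And>c x. f (c *s x) = cnj c *s f x"
  shows "bounded_linear f"
  unfolding linear_conv_bounded_linear[symmetric]
  by (rule linearI) (simp_all add: assms scaleR_vec_complex)

lemma bounded_bilinear_smult: "bounded_bilinear ((*s) :: complex \<Rightarrow> complex ^ 'm \<Rightarrow> _)"
  unfolding bilinear_conv_bounded_bilinear[symmetric] bilinear_def
  by (auto intro!: linearI simp: scaleR_vec_complex vec.scale_right_distrib vec.scale_left_distrib scaleR_conv_of_real mult.commute)

lemma bounded_bilinear_wedge: "bounded_bilinear (wedge :: 'n::{finite,linorder} ext \<Rightarrow> _)"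
  unfolding bilinear_conv_bounded_bilinear[symmetric] bilinear_def
  by (auto intro!: linearI simp: scaleR_vec_complex wedge_add_left wedge_add_right wedge_scale_left wedge_scale_right)

lemma bounded_linear_conj_ext: "bounded_linear (conj_ext :: 'n::finite ext \<Rightarrow> _)"
  by (rule bounded_linear_antilinear) (simp_all add: conj_ext_add conj_ext_scale)

lemma bounded_linear_cz: "bounded_linear (cz j)" and bounded_linear_czb: "bounded_linear (czb j)"
  by (rule bounded_linear_clinear, simp_all add: cz_add cz_scale czb_add czb_scale)+

lemma bounded_linear_pw: "bounded_linear (pw :: 'n::finite ext \<Rightarrow> _)"
  by (rule bounded_linear_clinear) (simp_all add: pw_add pw_scale)

lemma bounded_linear_scalar_ext: "bounded_linear (scalar_ext :: complex \<Rightarrow> 'n::finite ext)"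
  unfolding linear_conv_bounded_linear[symmetric]
  by (rule linearI) (auto simp: vec_eq_iff scalar_ext_def axis_def)

lemma vec_expand: "x = (\<Sum>i\<in>UNIV. x $ i *s axis i (1 :: complex))"
  by (simp add: basis_expansion)

lemma smooth_on_nth: "open S \<Longrightarrow> smooth_on S f \<Longrightarrow> smooth_on S (\<lambda>x. f x $ i)"
  by (rule smooth_on_bounded_linear[OF bounded_linear_vec_nth])

lemma smooth_on_smult: "open S \<Longrightarrow> smooth_on S f \<Longrightarrow> smooth_on S g \<Longrightarrow> smooth_on S (\<lambda>x. f x *s (g x :: complex ^ 'm))"
  by (rule smooth_on_bilinear[OF bounded_bilinear_smult])

lemma smooth_on_wedge: "open S \<Longrightarrow> smooth_on S f \<Longrightarrow> smooth_on S g \<Longrightarrow> smooth_on S (\<lambda>x. wedge (f x) (g x))"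
  by (rule smooth_on_bilinear[OF bounded_bilinear_wedge])

lemma smooth_on_cnj: "open S \<Longrightarrow> smooth_on S f \<Longrightarrow> smooth_on S (\<lambda>x. cnj (f x))"
  by (rule smooth_on_bounded_linear[OF bounded_linear_cnj])

lemma smooth_on_of_real: "open S \<Longrightarrow> smooth_on S f \<Longrightarrow> smooth_on S (\<lambda>x. complex_of_real (f x))"
  by (rule smooth_on_bounded_linear[OF bounded_linear_of_real])

lemma smooth_on_det:
  fixes A :: "'a::real_normed_vector \<Rightarrow> complex ^ 'n ^ 'n"
  assumes "open S" "\<And>i j. smooth_on S (\<lambda>x. A x $ i $ j)"
  shows "smooth_on S (\<lambda>x. det (A x))"
  unfolding det_def by (intro smooth_on_sum smooth_on_mult smooth_on_prod smooth_on_const assms)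

text \<open>Cramer's rule writes the entries of the inverse as quotients of determinants.\<close>

lemma smooth_on_matrix_inv:
  fixes A :: "'a::real_normed_vector \<Rightarrow> complex ^ 'n ^ 'n"
  assumes S: "open S" and A: "\<And>i j. smooth_on S (\<lambda>x. A x $ i $ j)" and inv: "\<And>x. x \<in> S \<Longrightarrow> invertible (A x)"
  shows "smooth_on S (\<lambda>x. matrix_inv (A x) $ i $ j)"
proof -
  have d: "det (A x) \<noteq> 0" if "x \<in> S" for x using inv[OF that] invertible_det_nz by blast
  have eq: "matrix_inv (A x) $ i $ j = det (\<chi> k l. if l = i then axis j 1 $ k else A x $ k $ l) * inverse (det (A x))"
    if "x \<in> S" for x
  proof -
    have "A x *v (matrix_inv (A x) *v axis j 1) = axis j 1"
      by (simp add: matrix_vector_mul_assoc matrix_inv_mult(2)[OF inv[OF that]])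
    then have "matrix_inv (A x) *v axis j 1 = (\<chi> k. det (\<chi> i l. if l = k then axis j 1 $ i else A x $ i $ l) / det (A x))"
      using cramer[OF d[OF that]] by blast
    then have "(matrix_inv (A x) *v axis j 1) $ i = det (\<chi> k l. if l = i then axis j 1 $ k else A x $ k $ l) / det (A x)"
      by simp
    moreover have "(matrix_inv (A x) *v axis j 1) $ i = matrix_inv (A x) $ i $ j"
    proof -
      have "(matrix_inv (A x) *v axis j 1) $ i = (\<Sum>k\<in>UNIV. if k = j then matrix_inv (A x) $ i $ k else 0)"
        unfolding matrix_vector_mult_def vec_lambda_beta by (intro sum.cong) (auto simp: axis_def)
      then show ?thesis by simp
    qed
    ultimately show ?thesis by (simp add: divide_inverse)
  qed
  have "smooth_on S (\<lambda>x. (\<chi> k l. if l = i then axis j 1 $ k else A x $ k $ l) $ k $ l)" for k l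
    using A by (cases "l = i") simp_all
  then have "smooth_on S (\<lambda>x. det (\<chi> k l. if l = i then axis j 1 $ k else A x $ k $ l) * inverse (det (A x)))"
    using d by (intro smooth_on_mult smooth_on_inverse smooth_on_det A S) auto
  then show ?thesis by (rule smooth_on_cong[OF S eq[symmetric], rotated])
qed

lemma differentiable_has_derivative: "f differentiable (at x) \<Longrightarrow> (f has_derivative frechet_derivative f (at x)) (at x)"
  by (simp add: frechet_derivative_works[symmetric])

lemma dd_add: "f differentiable (at x) \<Longrightarrow> g differentiable (at x) \<Longrightarrow> dd (\<lambda>x. f x + g x) v x = dd f v x + dd g v x"
  by (rule dd_eq) (intro has_derivative_add differentiable_has_derivative)

lemma dd_sum: "(\<And>i. i \<in> I \<Longrightarrow> f i differentiable (at x)) \<Longrightarrow> dd (\<lambda>x. \<Sum>i\<in>I. f i x) v x = (\<Sum>i\<in>I. dd (f i) v x)"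
  by (rule dd_eq) (intro has_derivative_sum differentiable_has_derivative, auto)

lemma has_derivative_bilinear:
  assumes "bounded_bilinear B" "f differentiable (at x)" "g differentiable (at x)"
  shows "((\<lambda>x. B (f x) (g x)) has_derivative (\<lambda>v. B (f x) (dd g v x) + B (dd f v x) (g x))) (at x)"
  by (intro bounded_bilinear.FDERIV[OF assms(1)] differentiable_has_derivative assms)

lemma dd_bilinear:
  assumes "bounded_bilinear B" "f differentiable (at x)" "g differentiable (at x)"
  shows "dd (\<lambda>x. B (f x) (g x)) v x = B (f x) (dd g v x) + B (dd f v x) (g x)"
  by (rule dd_eq[OF has_derivative_bilinear[OF assms]])

lemma differentiable_bilinear:
  assumes "bounded_bilinear B" "f differentiable (at x)" "g differentiable (at x)"
  shows "(\<lambda>x. B (f x) (g x)) differentiable (at x)"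
  using has_derivative_bilinear[OF assms] by (auto simp: differentiable_def)

section \<open>Wirtinger derivatives\<close>

text \<open>The scalar counterparts of \<open>wirt\<close> and \<open>wirtbar\<close>, for functions
  with values in the complex numbers.\<close>

definition ws :: "'n::finite \<Rightarrow> (complex ^ 'n \<Rightarrow> complex) \<Rightarrow> complex ^ 'n \<Rightarrow> complex" where
  "ws j f z = (dd f (axis j 1) z - \<i> * dd f (axis j \<i>) z) / 2"

definition wsb :: "'n::finite \<Rightarrow> (complex ^ 'n \<Rightarrow> complex) \<Rightarrow> complex ^ 'n \<Rightarrow> complex" where
  "wsb j f z = (dd f (axis j 1) z + \<i> * dd f (axis j \<i>) z) / 2"

lemma cnj_ws: "f differentiable (at z) \<Longrightarrow> cnj (ws j f z) = wsb j (\<lambda>z. cnj (f z)) z"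
  by (simp add: ws_def wsb_def dd_bounded_linear_comp(2)[OF bounded_linear_cnj])

lemma wirtbar_nth: "f differentiable (at z) \<Longrightarrow> wirtbar j f z $ P = wsb j (\<lambda>z. f z $ P) z"
  by (simp add: wirtbar_def wsb_def dd_bounded_linear_comp(2)[OF bounded_linear_vec_nth])

lemma wirtbar_conj: "f differentiable (at z) \<Longrightarrow> wirtbar j (\<lambda>z. conj_ext (f z)) z = conj_ext (wirt j f z)"
  by (simp add: wirt_def wirtbar_def dd_bounded_linear_comp(2)[OF bounded_linear_conj_ext] conj_ext_scale conj_ext_diff conj_ext_add)

lemma wirt_clinear:
  fixes L :: "complex ^ 'm \<Rightarrow> complex ^ 'k"
  assumes add: "\<And>x y. L (x + y) = L x + L y" and scale: "\<And>c x. L (c *s x) = c *s L x" and f: "f differentiable (at z)"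
  shows "wirt j (\<lambda>z. L (f z)) z = L (wirt j f z)" "wirtbar j (\<lambda>z. L (f z)) z = L (wirtbar j f z)"
proof -
  have "L (x - y) = L x - L y" for x y using add[of "x - y" y] by simp
  then show "wirt j (\<lambda>z. L (f z)) z = L (wirt j f z)" "wirtbar j (\<lambda>z. L (f z)) z = L (wirtbar j f z)"
    by (simp_all add: wirt_def wirtbar_def dd_bounded_linear_comp(2)[OF bounded_linear_clinear[OF add scale] f] add scale)
qed

lemma
  assumes "f differentiable (at z)" "g differentiable (at z)"
  shows wirt_add: "wirt j (\<lambda>z. f z + g z) z = wirt j f z + wirt j g z"
    and wirtbar_add: "wirtbar j (\<lambda>z. f z + g z) z = wirtbar j f z + wirtbar j g z"
  by (simp_all add: wirt_def wirtbar_def dd_add[OF assms] vec_eq_iff algebra_simps)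

lemma vec_scale_sum: "c *s (\<Sum>i\<in>I. f i) = (\<Sum>i\<in>I. c *s (f i :: complex ^ 'm))"
  by (rule vec.scale_sum_right)

lemma
  assumes "\<And>i. i \<in> I \<Longrightarrow> f i differentiable (at z)"
  shows wirt_sum: "wirt j (\<lambda>z. \<Sum>i\<in>I. f i z) z = (\<Sum>i\<in>I. wirt j (f i) z)"
    and wirtbar_sum: "wirtbar j (\<lambda>z. \<Sum>i\<in>I. f i z) z = (\<Sum>i\<in>I. wirtbar j (f i) z)"
  unfolding wirt_def wirtbar_def
  by (simp_all add: dd_sum assms vec_scale_sum sum.distrib[symmetric] sum_subtractf[symmetric])

lemma
  assumes "f differentiable (at z)" "g differentiable (at z)"
  shows wirt_smult: "wirt j (\<lambda>z. f z *s g z) z = ws j f z *s g z + f z *s wirt j g z"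
    and wirtbar_smult: "wirtbar j (\<lambda>z. f z *s g z) z = wsb j f z *s g z + f z *s wirtbar j g z"
  by (simp_all add: wirt_def wirtbar_def ws_def wsb_def dd_bilinear[OF bounded_bilinear_smult assms] vec_eq_iff field_simps)

lemma
  assumes "f differentiable (at z)" "g differentiable (at z)"
  shows ws_mult: "ws j (\<lambda>z. f z * g z) z = ws j f z * g z + f z * ws j g z"
    and wsb_mult: "wsb j (\<lambda>z. f z * g z) z = wsb j f z * g z + f z * wsb j g z"
  by (simp_all add: ws_def wsb_def dd_bilinear[OF bounded_bilinear_mult assms] field_simps)

lemma wirt_const [simp]: "wirt j (\<lambda>z. c) z = 0" "wirtbar j (\<lambda>z. c) z = 0" "ws j (\<lambda>z. c') z = 0" "wsb j (\<lambda>z. c') z = 0"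
  by (simp_all add: wirt_def wirtbar_def ws_def wsb_def)

lemma scalar_ext_add: "scalar_ext (a + b) = scalar_ext a + scalar_ext b"
  by (auto simp: vec_eq_iff scalar_ext_def axis_def)

lemma scalar_ext_diff: "scalar_ext (a - b) = scalar_ext a - scalar_ext b"
  by (auto simp: vec_eq_iff scalar_ext_def axis_def)

lemma wirt_wedge_const:
  assumes "f differentiable (at z)"
  shows "wirt j (\<lambda>z. wedge a (f z)) z = wedge a (wirt j f z)" "wirtbar j (\<lambda>z. wedge a (f z)) z = wedge a (wirtbar j f z)"
  using wirt_clinear[OF wedge_add_right wedge_scale_right assms] .

lemma wirt_scalar_ext:
  fixes f :: "complex ^ 'n::finite \<Rightarrow> complex"
  assumes "f differentiable (at z)"
  shows "wirt j (\<lambda>z. scalar_ext (f z) :: 'n ext) z = scalar_ext (ws j f z)"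
    "wirtbar j (\<lambda>z. scalar_ext (f z) :: 'n ext) z = scalar_ext (wsb j f z)"
  by (simp_all add: wirt_def wirtbar_def ws_def wsb_def dd_bounded_linear_comp(2)[OF bounded_linear_scalar_ext assms]
      scalar_ext_scale scalar_ext_add[symmetric] scalar_ext_diff[symmetric] add_divide_distrib diff_divide_distrib)

lemma
  assumes "open S" "z \<in> S" "\<And>y. y \<in> S \<Longrightarrow> f y = g y" "f differentiable (at z)"
  shows wirt_cong: "wirt j g z = wirt j f z" and wirtbar_cong: "wirtbar j g z = wirtbar j f z"
  using dd_cong(2)[OF assms] by (simp_all add: wirt_def wirtbar_def)

lemma
  assumes "open S" "z \<in> S" "\<And>y. y \<in> S \<Longrightarrow> f y = g y" "f differentiable (at z)"
  shows ws_cong: "ws j g z = ws j f z" and wsb_cong: "wsb j g z = wsb j f z"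
  using dd_cong(2)[OF assms] by (simp_all add: ws_def wsb_def)

lemma smooth_on_wirtbar: "open S \<Longrightarrow> smooth_on S f \<Longrightarrow> smooth_on S (wirtbar j f)"
  unfolding wirtbar_def[abs_def] by (intro smooth_on_smult smooth_on_add smooth_on_dd smooth_on_const)

section \<open>Holomorphic maps and the pullback of forms\<close>

definition jac :: "(complex ^ 'n \<Rightarrow> complex ^ 'n) \<Rightarrow> complex ^ 'n \<Rightarrow> complex ^ 'n ^ 'n::finite" where
  "jac \<phi> z = (\<chi> i k. frechet_derivative \<phi> (at z) (axis k 1) $ i)"

text \<open>The derivative of a holomorphic inner map in the direction of \<open>axis j \<i>\<close>
  is \<i> times that in the direction of \<open>axis j 1\<close>. Hence the chain rule contains no
  derivatives of type (1,0), and its coefficients are conjugates of the holomorphic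
  Jacobian.\<close>

lemma wirtbar_holomorphic_comp:
  fixes \<phi> :: "complex ^ 'n::finite \<Rightarrow> complex ^ 'n" and a :: "complex ^ 'n \<Rightarrow> complex ^ 'm"
  assumes \<phi>: "\<phi> differentiable (at z)" "\<And>c v. frechet_derivative \<phi> (at z) (c *s v) = c *s frechet_derivative \<phi> (at z) v"
    and a: "a differentiable (at (\<phi> z))"
  shows "wirtbar j (\<lambda>z. a (\<phi> z)) z = (\<Sum>l\<in>UNIV. cnj (jac \<phi> z $ l $ j) *s wirtbar l a (\<phi> z))"
proof -
  define c where "c = frechet_derivative \<phi> (at z) (axis j 1)"
  let ?D = "frechet_derivative a (at (\<phi> z))"
  have "axis j \<i> = \<i> *s axis j (1 :: complex)" by (simp add: vec_eq_iff axis_def)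
  then have 1: "frechet_derivative \<phi> (at z) (axis j \<i>) = \<i> *s c" by (simp add: \<phi>(2) c_def)
  have lin: "linear ?D" by (rule linear_frechet[OF a])
  have ax: "x *s axis l 1 = Re x *\<^sub>R axis l 1 + Im x *\<^sub>R axis l \<i>" for x :: complex and l :: 'n
    unfolding scaleR_vec_complex using complex_eq[of x] by (auto simp: vec_eq_iff axis_def mult.commute)
  \<comment> \<open>\<open>?D\<close> is only real linear, so a direction is expanded over the real
    basis formed by the \<open>axis l 1\<close> and \<open>axis l \<i>\<close>.\<close>
  have D: "?D x = (\<Sum>l\<in>UNIV. complex_of_real (Re (x $ l)) *s ?D (axis l 1) + complex_of_real (Im (x $ l)) *s ?D (axis l \<i>))" for x
  proof -
    have "?D x = ?D (\<Sum>l\<in>UNIV. Re (x $ l) *\<^sub>R axis l 1 + Im (x $ l) *\<^sub>R axis l \<i>)"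
      using vec_expand[of x] by (simp only: ax)
    then show ?thesis using lin by (simp add: linear_sum linear_add linear_scale) (simp add: scaleR_vec_complex)
  qed
  have "wirtbar j (\<lambda>z. a (\<phi> z)) z = (1/2) *s (?D c + \<i> *s ?D (\<i> *s c))"
    by (simp add: wirtbar_def dd_comp(2)[OF \<phi>(1) a] 1 c_def)
  also have "\<dots> = (\<Sum>l\<in>UNIV. cnj (c $ l) *s wirtbar l a (\<phi> z))"
  proof -
    have "cnj (c $ l) *s wirtbar l a (\<phi> z) = (1/2) *s ((complex_of_real (Re (c $ l)) *s ?D (axis l 1) + complex_of_real (Im (c $ l)) *s ?D (axis l \<i>))
      + \<i> *s (complex_of_real (Re ((\<i> *s c) $ l)) *s ?D (axis l 1) + complex_of_real (Im ((\<i> *s c) $ l)) *s ?D (axis l \<i>)))" for l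
    proof -
      have "cnj (c $ l) = of_real (Re (c $ l)) - \<i> * of_real (Im (c $ l))" by (simp add: complex_eq_iff)
      then show ?thesis
        unfolding wirtbar_def by (simp only:) (simp add: vec_eq_iff algebra_simps) 
    qed
    then show ?thesis unfolding D[of c] D[of "\<i> *s c"] by (simp add: vec_scale_sum sum.distrib vec.scale_right_distrib)
  qed
  finally show ?thesis by (simp add: jac_def c_def)
qed

type_synonym 'n cvec = "complex ^ 'n"

context
  fixes \<Omega> :: "'n::{finite,linorder} cvec set" and \<phi> :: "'n cvec \<Rightarrow> 'n cvec"
  assumes \<Omega>: "open \<Omega>" and \<phi>: "holomorphic_map_on \<Omega> \<phi>"
begin

lemma smooth_on_jac: "smooth_on \<Omega> (\<lambda>z. jac \<phi> z $ l $ k)"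
  unfolding jac_def using smooth_on_nth[OF \<Omega> smooth_on_dd[of \<Omega> \<phi> "axis k 1"]] \<phi>
  by (simp add: holomorphic_map_on_def)

text \<open>Both facts combine the symmetry of second derivatives with the complex linearity of the
  first derivative. They say that the pulled back \<open>dz l\<close> has holomorphic coefficients
  and that the Hessian of each component is symmetric, which is what closedness of the pulled back
  generators comes down to.\<close>

lemma jac_holomorphic:
  assumes z: "z \<in> \<Omega>"
  shows "wsb j (\<lambda>z. jac \<phi> z $ l $ k) z = 0" "ws j (\<lambda>z. jac \<phi> z $ l $ k) z = ws k (\<lambda>z. jac \<phi> z $ l $ j) z"
proof -
  have sm: "smooth_on \<Omega> \<phi>" using \<phi> by (simp add: holomorphic_map_on_def)
  have ax: "axis j \<i> = \<i> *s axis j (1 :: complex)" for j :: 'n by (simp add: vec_eq_iff axis_def)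
  have dm: "dd \<phi> v differentiable (at z)" for v by (rule smooth_on_differentiable[OF smooth_on_dd[OF sm] z])
  have 1: "dd (dd \<phi> (axis k 1)) (axis j \<i>) z = \<i> *s dd (dd \<phi> (axis k 1)) (axis j 1) z" for j k
  proof -
    have "dd (dd \<phi> (axis k 1)) (axis j \<i>) z = dd (dd \<phi> (axis j \<i>)) (axis k 1) z"
      by (rule dd_commute[OF \<Omega> sm z])
    also have "\<dots> = dd (\<lambda>z. \<i> *s dd \<phi> (axis j 1) z) (axis k 1) z"
    proof (rule dd_cong(2)[OF \<Omega> z])
      show "\<i> *s dd \<phi> (axis j 1) y = dd \<phi> (axis j \<i>) y" if "y \<in> \<Omega>" for y
        using \<phi> that unfolding ax holomorphic_map_on_def by simp
      show "(\<lambda>z. \<i> *s dd \<phi> (axis j 1) z) differentiable at z"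
        by (rule differentiable_bilinear[OF bounded_bilinear_smult _ dm]) simp
    qed
    also have "\<dots> = \<i> *s dd (dd \<phi> (axis j 1)) (axis k 1) z"
      using dd_bilinear[OF bounded_bilinear_smult _ dm, of "\<lambda>z. \<i>"] by simp
    also have "dd (dd \<phi> (axis j 1)) (axis k 1) z = dd (dd \<phi> (axis k 1)) (axis j 1) z"
      by (rule dd_commute[OF \<Omega> sm z])
    finally show ?thesis .
  qed
  have 2: "dd (\<lambda>z. jac \<phi> z $ l $ k) v z = dd (dd \<phi> (axis k 1)) v z $ l" for v k
    using dd_bounded_linear_comp(2)[OF bounded_linear_vec_nth dm] by (simp add: jac_def)
  show "wsb j (\<lambda>z. jac \<phi> z $ l $ k) z = 0"
    by (simp add: wsb_def 2 1)
  have 3: "ws j (\<lambda>z. jac \<phi> z $ l $ k) z = dd (dd \<phi> (axis k 1)) (axis j 1) z $ l" for j k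
    by (simp add: ws_def 2 1)
  show "ws j (\<lambda>z. jac \<phi> z $ l $ k) z = ws k (\<lambda>z. jac \<phi> z $ l $ j) z"
    unfolding 3 by (subst dd_commute[OF \<Omega> sm z]) rule
qed

lemma smooth_on_subst_jac: "smooth_on \<Omega> (\<lambda>z. subst_ext (jac \<phi> z) x)"
proof (induction x rule: ext_induct)
  case (add a b)
  then show ?case by (simp add: subst_ext_add smooth_on_add \<Omega>)
next
  case (scale c a)
  then show ?case by (simp add: subst_ext_scale smooth_on_smult \<Omega>)
next
  case one
  then show ?case by simp
next
  case (dz l a)
  show ?case unfolding subst_ext_dz_wedge row_form_wedge
    by (intro smooth_on_sum smooth_on_smult smooth_on_wedge smooth_on_const smooth_on_jac dz \<Omega>)
next
  case (dzbar l a)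
  show ?case unfolding subst_ext_dzbar_wedge conj_row_form_wedge
    by (intro smooth_on_sum smooth_on_smult smooth_on_wedge smooth_on_const smooth_on_jac smooth_on_cnj dzbar \<Omega>)
qed

text \<open>The pullback of a form with constant coefficients is \<bar>\<partial>-closed, because
  each pulled back generator is. For \<open>dz l\<close> the coefficients are holomorphic; for
  \<open>dzbar l\<close> the symmetric conjugate Hessian meets an antisymmetric product, so that the
  double sum is its own negative.\<close>

lemma subst_jac_closed:
  assumes z: "z \<in> \<Omega>"
  shows "(\<Sum>j\<in>UNIV. wedge (dzbar j) (wirtbar j (\<lambda>z. subst_ext (jac \<phi> z) x) z)) = 0"
proof (induction x rule: ext_induct)
  case (add a b)
  have "wirtbar j (\<lambda>z. subst_ext (jac \<phi> z) (a + b)) z = wirtbar j (\<lambda>z. subst_ext (jac \<phi> z) a) z + wirtbar j (\<lambda>z. subst_ext (jac \<phi> z) b) z" for j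
    unfolding subst_ext_add by (intro wirtbar_add smooth_on_differentiable[OF smooth_on_subst_jac z])
  then show ?case using add by (simp add: wedge_add_right sum.distrib)
next
  case (scale c a)
  have "wirtbar j (\<lambda>z. subst_ext (jac \<phi> z) (c *s a)) z = c *s wirtbar j (\<lambda>z. subst_ext (jac \<phi> z) a) z" for j
    unfolding subst_ext_scale by (subst wirtbar_smult) (auto intro: smooth_on_differentiable[OF smooth_on_subst_jac z])
  then show ?case using scale by (simp add: wedge_scale_right vec_scale_sum[symmetric])
next
  case one
  then show ?case by simp
next
  case (dz l a)
  note dm = smooth_on_differentiable[OF smooth_on_subst_jac z] smooth_on_differentiable[OF smooth_on_jac z]
  have w: "(\<lambda>z. wedge (dz k) (subst_ext (jac \<phi> z) a)) differentiable (at z)" for k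
    by (rule differentiable_bilinear[OF bounded_bilinear_wedge]) (auto intro: dm)
  have "wirtbar j (\<lambda>z. subst_ext (jac \<phi> z) (wedge (dz l) a)) z =
    (\<Sum>k\<in>UNIV. jac \<phi> z $ l $ k *s wedge (dz k) (wirtbar j (\<lambda>z. subst_ext (jac \<phi> z) a) z))" for j
    unfolding subst_ext_dz_wedge row_form_wedge
    by (subst wirtbar_sum) (auto intro!: differentiable_bilinear[OF bounded_bilinear_smult] w dm 
       simp: wirtbar_smult[OF dm(2) w] jac_holomorphic(1)[OF z] wirt_wedge_const(2)[OF dm(1)])
  then have "(\<Sum>j\<in>UNIV. wedge (dzbar j) (wirtbar j (\<lambda>z. subst_ext (jac \<phi> z) (wedge (dz l) a)) z)) =
    (\<Sum>j\<in>UNIV. \<Sum>k\<in>UNIV. - (jac \<phi> z $ l $ k *s wedge (dz k) (wedge (dzbar j) (wirtbar j (\<lambda>z. subst_ext (jac \<phi> z) a) z))))"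
    by (simp add: wedge_sum_right wedge_scale_right dzbar_dz_anticomm)
  also have "\<dots> = (\<Sum>k\<in>UNIV. - (jac \<phi> z $ l $ k *s wedge (dz k) (\<Sum>j\<in>UNIV. wedge (dzbar j) (wirtbar j (\<lambda>z. subst_ext (jac \<phi> z) a) z))))"
    by (subst sum.swap) (simp add: wedge_sum_right vec_scale_sum sum_negf)
  finally show ?case using dz by simp
next
  case (dzbar l a)
  note dm = smooth_on_differentiable[OF smooth_on_subst_jac z] smooth_on_differentiable[OF smooth_on_jac z]
    smooth_on_differentiable[OF smooth_on_cnj[OF \<Omega> smooth_on_jac] z]
  have w: "(\<lambda>z. wedge (dzbar k) (subst_ext (jac \<phi> z) a)) differentiable (at z)" for k
    by (rule differentiable_bilinear[OF bounded_bilinear_wedge]) (auto intro: dm)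
  let ?H = "\<lambda>j k. cnj (ws j (\<lambda>z. jac \<phi> z $ l $ k) z)" and ?S = "subst_ext (jac \<phi> z) a"
  have 4: "wedge (dzbar j) (wedge (dzbar k) (wirtbar j (\<lambda>z. subst_ext (jac \<phi> z) a) z))
    = - wedge (dzbar k) (wedge (dzbar j) (wirtbar j (\<lambda>z. subst_ext (jac \<phi> z) a) z))" for j k
    by (rule dzbar_anticomm)
  have "wirtbar j (\<lambda>z. subst_ext (jac \<phi> z) (wedge (dzbar l) a)) z =
    (\<Sum>k\<in>UNIV. ?H j k *s wedge (dzbar k) ?S + cnj (jac \<phi> z $ l $ k) *s wedge (dzbar k) (wirtbar j (\<lambda>z. subst_ext (jac \<phi> z) a) z))" for j
    unfolding subst_ext_dzbar_wedge conj_row_form_wedge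
    by (subst wirtbar_sum) (auto intro!: differentiable_bilinear[OF bounded_bilinear_smult] w dm 
       simp: wirtbar_smult[OF dm(3) w] cnj_ws[OF dm(2)] wirt_wedge_const(2)[OF dm(1)])
  then have "(\<Sum>j\<in>UNIV. wedge (dzbar j) (wirtbar j (\<lambda>z. subst_ext (jac \<phi> z) (wedge (dzbar l) a)) z)) =
    (\<Sum>j\<in>UNIV. \<Sum>k\<in>UNIV. ?H j k *s wedge (dzbar j) (wedge (dzbar k) ?S)) + 
    (\<Sum>j\<in>UNIV. \<Sum>k\<in>UNIV. - (cnj (jac \<phi> z $ l $ k) *s wedge (dzbar k) (wedge (dzbar j) (wirtbar j (\<lambda>z. subst_ext (jac \<phi> z) a) z))))"
    (is "_ = ?X + ?Y")
    by (simp add: wedge_sum_right wedge_scale_right wedge_add_right sum.distrib 4)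
  moreover have "?Y = (\<Sum>k\<in>UNIV. - (cnj (jac \<phi> z $ l $ k) *s wedge (dzbar k) (\<Sum>j\<in>UNIV. wedge (dzbar j) (wirtbar j (\<lambda>z. subst_ext (jac \<phi> z) a) z))))"
    by (subst sum.swap) (simp add: wedge_sum_right vec_scale_sum sum_negf)
  moreover have "?X = - ?X"
  proof -
    have "?X = (\<Sum>k\<in>UNIV. \<Sum>j\<in>UNIV. ?H j k *s wedge (dzbar j) (wedge (dzbar k) ?S))" by (rule sum.swap)
    also have "\<dots> = (\<Sum>k\<in>UNIV. \<Sum>j\<in>UNIV. - (?H k j *s wedge (dzbar k) (wedge (dzbar j) ?S)))"
      by (intro sum.cong refl, subst jac_holomorphic(2)[OF z], subst dzbar_anticomm) simp
    finally show ?thesis by (simp add: sum_negf)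
  qed
  ultimately show ?case using dzbar vec_eq_minus_self[of ?X] by simp
qed

text \<open>Naturality of \<bar>\<partial>. In the Leibniz rule the terms that differentiate the
  Jacobian vanish by \<open>subst_jac_closed\<close>, and the chain rule assembles the others into
  pulled back generators.\<close>

lemma wirtbar_pullback:
  assumes T: "open T" "\<phi> ` \<Omega> \<subseteq> T" "smooth_on T a" and z: "z \<in> \<Omega>"
  shows "(\<Sum>j\<in>UNIV. wedge (dzbar j) (wirtbar j (\<lambda>z. subst_ext (jac \<phi> z) (a (\<phi> z))) z)) =
     subst_ext (jac \<phi> z) (\<Sum>l\<in>UNIV. wedge (dzbar l) (wirtbar l a (\<phi> z)))"
proof -
  have sm: "smooth_on \<Omega> \<phi>" using \<phi> by (simp add: holomorphic_map_on_def)
  have \<phi>d: "\<phi> differentiable (at z)" by (rule smooth_on_differentiable[OF sm z])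
  have ad: "a differentiable (at (\<phi> z))" using T z by (intro smooth_on_differentiable[OF T(3)]) auto
  have sma: "smooth_on \<Omega> (\<lambda>z. a (\<phi> z))" by (rule smooth_on_comp[OF \<Omega> T(1,2) sm T(3)])
  note afd = smooth_on_differentiable[OF sma z]
  have afP: "(\<lambda>z. a (\<phi> z) $ P) differentiable (at z)" for P by (rule smooth_on_differentiable[OF smooth_on_nth[OF \<Omega> sma] z])
  let ?S = "subst_ext (jac \<phi> z)"
  have 1: "subst_ext (jac \<phi> z) (a (\<phi> z)) = (\<Sum>P\<in>UNIV. a (\<phi> z) $ P *s subst_ext (jac \<phi> z) (axis P 1))" for z
    by (subst ext_eq_sum[of "a (\<phi> z)"]) (simp add: subst_ext_sum subst_ext_scale)
  note Sd = smooth_on_differentiable[OF smooth_on_subst_jac z]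
  have 2: "wirtbar j (\<lambda>z. subst_ext (jac \<phi> z) (a (\<phi> z))) z =
    ?S (wirtbar j (\<lambda>z. a (\<phi> z)) z) + (\<Sum>P\<in>UNIV. a (\<phi> z) $ P *s wirtbar j (\<lambda>z. subst_ext (jac \<phi> z) (axis P 1)) z)" for j
  proof -
    have "wirtbar j (\<lambda>z. subst_ext (jac \<phi> z) (a (\<phi> z))) z = (\<Sum>P\<in>UNIV. wsb j (\<lambda>z. a (\<phi> z) $ P) z *s ?S (axis P 1) 
       + a (\<phi> z) $ P *s wirtbar j (\<lambda>z. subst_ext (jac \<phi> z) (axis P 1)) z)"
      unfolding 1 by (subst wirtbar_sum) (auto intro!: differentiable_bilinear[OF bounded_bilinear_smult] Sd afP simp: wirtbar_smult[OF afP Sd])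
    moreover have "?S (wirtbar j (\<lambda>z. a (\<phi> z)) z) = (\<Sum>P\<in>UNIV. wsb j (\<lambda>z. a (\<phi> z) $ P) z *s ?S (axis P 1))"
      by (subst ext_eq_sum[of "wirtbar j (\<lambda>z. a (\<phi> z)) z"]) (simp add: subst_ext_sum subst_ext_scale wirtbar_nth[OF afd])
    ultimately show ?thesis by (simp add: sum.distrib)
  qed
  have "(\<Sum>j\<in>UNIV. wedge (dzbar j) (wirtbar j (\<lambda>z. subst_ext (jac \<phi> z) (a (\<phi> z))) z)) =
    (\<Sum>j\<in>UNIV. wedge (dzbar j) (?S (wirtbar j (\<lambda>z. a (\<phi> z)) z))) + 
    (\<Sum>j\<in>UNIV. \<Sum>P\<in>UNIV. a (\<phi> z) $ P *s wedge (dzbar j) (wirtbar j (\<lambda>z. subst_ext (jac \<phi> z) (axis P 1)) z))"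
    unfolding 2 by (simp add: wedge_add_right sum.distrib wedge_sum_right wedge_scale_right)
  also have "(\<Sum>j\<in>UNIV. \<Sum>P\<in>UNIV. a (\<phi> z) $ P *s wedge (dzbar j) (wirtbar j (\<lambda>z. subst_ext (jac \<phi> z) (axis P 1)) z)) = 0"
    by (subst sum.swap) (simp add: vec_scale_sum[symmetric] subst_jac_closed[OF z])
  also have "(\<Sum>j\<in>UNIV. wedge (dzbar j) (?S (wirtbar j (\<lambda>z. a (\<phi> z)) z))) = 
     (\<Sum>j\<in>UNIV. \<Sum>l\<in>UNIV. cnj (jac \<phi> z $ l $ j) *s wedge (dzbar j) (?S (wirtbar l a (\<phi> z))))"
    using \<phi> z by (subst wirtbar_holomorphic_comp[OF \<phi>d _ ad])
      (auto simp: holomorphic_map_on_def subst_ext_sum subst_ext_scale wedge_sum_right wedge_scale_right)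
  also have "\<dots> = (\<Sum>l\<in>UNIV. ?S (wedge (dzbar l) (wirtbar l a (\<phi> z))))"
    by (subst sum.swap) (simp add: subst_ext_dzbar_wedge conj_row_form_wedge)
  finally show ?thesis by (simp add: subst_ext_sum)
qed

end

section \<open>The Hermitian commutation relation in a chart\<close>

text \<open>In the Leibniz expansion a permutation other than the identity moves at least two
  indices. Each term of its derivative differentiates one factor only and therefore keeps an
  off-diagonal factor, which is 0 at the identity matrix.\<close>

lemma has_derivative_det_at_1:
  fixes C :: "'a::real_normed_vector \<Rightarrow> complex ^ 'n::finite ^ 'n"
  assumes "\<And>i j. (\<lambda>x. C x $ i $ j) differentiable (at z)" "C z = mat 1"
  shows "((\<lambda>x. det (C x)) has_derivative (\<lambda>v. \<Sum>i\<in>UNIV. dd (\<lambda>x. C x $ i $ i) v z)) (at z)"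
proof -
  let ?P = "{p :: 'n \<Rightarrow> 'n. p permutes UNIV}"
  let ?D = "\<lambda>p v. \<Sum>i\<in>UNIV. dd (\<lambda>x. C x $ i $ p i) v z * (\<Prod>k\<in>UNIV - {i}. C z $ k $ p k)"
  have "((\<lambda>x. \<Sum>p\<in>?P. of_int (sign p) * (\<Prod>i\<in>UNIV. C x $ i $ p i)) has_derivative
     (\<lambda>v. \<Sum>p\<in>?P. of_int (sign p) * ?D p v)) (at z)"
    by (intro has_derivative_sum has_derivative_mult_right has_derivative_prod differentiable_has_derivative assms)
  moreover have "(\<Sum>p\<in>?P. of_int (sign p) * ?D p v) = (\<Sum>i\<in>UNIV. dd (\<lambda>x. C x $ i $ i) v z)" for v
  proof -
    have 1: "of_int (sign p) * ?D p v = (if p = id then (\<Sum>i\<in>UNIV. dd (\<lambda>x. C x $ i $ i) v z) else 0)" if "p \<in> ?P" for p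
    proof (cases "p = id")
      case True
      have "(\<Prod>k\<in>UNIV - {i}. C z $ k $ k) = 1" for i by (simp add: assms(2) mat_def)
      then show ?thesis using True by (simp add: sign_id)
    next
      case False
      then obtain m where m: "p m \<noteq> m" by (metis ext id_apply)
      have "(\<Prod>k\<in>UNIV - {i}. C z $ k $ p k) = 0" for i
      proof -
        \<comment> \<open>Both m and p m are moved, so one of them differs from the index i of the
          differentiated factor.\<close>
        have "p (p m) \<noteq> p m" using m that by (metis permutes_inj injD mem_Collect_eq)
        then obtain k where "k \<noteq> i" "p k \<noteq> k" using m by metis
        then show ?thesis by (intro prod_zero) (auto simp: assms(2) mat_def intro!: bexI[of _ k])
      qed
      then show ?thesis using False by (simp del: prod_zero_iff)
    qed
    show ?thesis
      by (subst sum.cong[OF refl 1]) (auto simp: permutes_id sum.delta finite_permutations)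
  qed
  ultimately show ?thesis by (simp add: det_def)
qed

text \<open>Jacobi's formula. Multiplying by the inverse at z reduces it to a matrix function that
  is the identity at z.\<close>

lemma dd_det:
  fixes A :: "'a::real_normed_vector \<Rightarrow> complex ^ 'n::finite ^ 'n"
  assumes A: "\<And>i j. (\<lambda>x. A x $ i $ j) differentiable (at z)" and inv: "invertible (A z)"
  shows "dd (\<lambda>x. det (A x)) v z = det (A z) * (\<Sum>i\<in>UNIV. \<Sum>j\<in>UNIV. matrix_inv (A z) $ j $ i * dd (\<lambda>x. A x $ i $ j) v z)"
    and "(\<lambda>x. det (A x)) differentiable (at z)"
proof -
  let ?B = "matrix_inv (A z)"
  define C where "C = (\<lambda>x. ?B ** A x)"
  have Cij: "C x $ i $ j = (\<Sum>k\<in>UNIV. ?B $ i $ k * A x $ k $ j)" for x i j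
    by (simp add: C_def matrix_matrix_mult_def)
  have m: "(\<lambda>x. ?B $ i $ k * A x $ k $ j) differentiable (at z)" for i j k
    by (intro differentiable_mult differentiable_const A)
  have Cd: "(\<lambda>x. C x $ i $ j) differentiable (at z)" for i j
    unfolding Cij by (rule differentiable_sum, simp, intro ballI m)
  have ddC: "dd (\<lambda>x. C x $ i $ j) v z = (\<Sum>k\<in>UNIV. ?B $ i $ k * dd (\<lambda>x. A x $ k $ j) v z)" for i j v
    unfolding Cij using dd_bilinear[OF bounded_bilinear_mult differentiable_const A] m
    by (subst dd_sum) simp_all
  have C1: "C z = mat 1" using matrix_inv_mult(1)[OF inv] by (simp add: C_def)
  have det: "det (A x) = det (A z) * det (C x)" for x
  proof -
    have "det (A z) * det ?B = 1" using matrix_inv_mult(2)[OF inv] by (metis det_I det_mul)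
    then show ?thesis by (simp add: C_def det_mul mult.assoc[symmetric])
  qed
  have "((\<lambda>x. det (A z) * det (C x)) has_derivative (\<lambda>v. det (A z) * (\<Sum>i\<in>UNIV. dd (\<lambda>x. C x $ i $ i) v z))) (at z)"
    by (intro has_derivative_mult_right has_derivative_det_at_1 Cd C1)
  then have d: "((\<lambda>x. det (A x)) has_derivative (\<lambda>v. det (A z) * (\<Sum>i\<in>UNIV. dd (\<lambda>x. C x $ i $ i) v z))) (at z)"
    unfolding det[symmetric] .
  have "(\<Sum>i\<in>UNIV. \<Sum>k\<in>UNIV. ?B $ i $ k * dd (\<lambda>x. A x $ k $ i) v z) = (\<Sum>i\<in>UNIV. \<Sum>j\<in>UNIV. ?B $ j $ i * dd (\<lambda>x. A x $ i $ j) v z)"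
    by (rule sum.swap)
  then show "dd (\<lambda>x. det (A x)) v z = det (A z) * (\<Sum>i\<in>UNIV. \<Sum>j\<in>UNIV. ?B $ j $ i * dd (\<lambda>x. A x $ i $ j) v z)"
    unfolding dd_eq[OF d] ddC by simp
  show "(\<lambda>x. det (A x)) differentiable (at z)" using d by (auto simp: differentiable_def)
qed

section \<open>A metric on an open set of coordinates and its first variation\<close>

locale smooth_metric =
  fixes U :: "'n::{finite,linorder} cvec set" and w :: "'n cvec \<Rightarrow> 'n ext"
  assumes U: "open U" and w: "smooth_on U w" and cof: "\<And>z. z \<in> U \<Longrightarrow> coframed (w z)"
begin

definition "h l p z = herm_matrix (w z) $ l $ p"
definition "g l p z = gram (w z) $ l $ p"

lemma smooth_h: "smooth_on U (h l p)"
  unfolding h_def[abs_def] herm_matrix_def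
  by (simp, intro smooth_on_minus smooth_on_mult smooth_on_const smooth_on_nth U w)

lemma smooth_g: "smooth_on U (g l p)"
  unfolding g_def[abs_def] gram_def transpose_def
  using smooth_on_matrix_inv[OF U smooth_h[unfolded h_def] herm_matrix_invertible[OF cof], of p l] by simp

lemma diff_h: "z \<in> U \<Longrightarrow> h l p differentiable (at z)"
  by (rule smooth_on_differentiable[OF smooth_h])

lemma diff_g: "z \<in> U \<Longrightarrow> g l p differentiable (at z)"
  by (rule smooth_on_differentiable[OF smooth_g])

lemma h_cnj: "z \<in> U \<Longrightarrow> cnj (h l p z) = h p l z"
  unfolding h_def using herm_matrix_hermitian[OF cof, of z p l] by simp

lemma g_cnj: "z \<in> U \<Longrightarrow> cnj (g l p z) = g p l z"
  unfolding g_def using gram_hermitian[OF cof, of z p l] by simp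

lemma dd_h_cnj: assumes "z \<in> U" shows "cnj (dd (h l p) v z) = dd (h p l) v z"
proof -
  have "cnj (dd (h l p) v z) = dd (\<lambda>z. cnj (h l p z)) v z"
    using dd_bounded_linear_comp(2)[OF bounded_linear_cnj diff_h[OF assms]] by simp
  also have "\<dots> = dd (h p l) v z"
    using h_cnj dd_bounded_linear_comp(1)[OF bounded_linear_cnj diff_h[OF assms]]
    by (intro dd_cong(2)[OF U assms, symmetric]) auto
  finally show ?thesis .
qed

text \<open>The derivative of an inverse matrix: differentiate \<open>herm_gram\<close> and solve
  for the derivative of the Gram matrix by \<open>herm_gram'\<close>.\<close>

lemma dd_g:
  assumes z: "z \<in> U"
  shows "dd (g l m) v z = - (\<Sum>j\<in>UNIV. \<Sum>k\<in>UNIV. dd (h j k) v z * g l k z * g j m z)"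
proof -
  have 1: "(\<Sum>k\<in>UNIV. h j k z * dd (g l k) v z) = - (\<Sum>k\<in>UNIV. dd (h j k) v z * g l k z)" for j
  proof -
    have dm: "(\<lambda>y. h j k y * g l k y) differentiable (at z)" for k
      by (intro differentiable_mult diff_h diff_g z)
    have "dd (\<lambda>y. \<Sum>k\<in>UNIV. h j k y * g l k y) v z = dd (\<lambda>y. if j = l then 1 else 0) v z"
    proof (rule dd_cong(2)[OF U z])
      show "(if j = l then 1 else 0) = (\<Sum>k\<in>UNIV. h j k y * g l k y)" if "y \<in> U" for y
        using herm_gram[OF cof[OF that], of j l] by (simp add: h_def g_def)
    qed simp
    then have "0 = dd (\<lambda>y. \<Sum>k\<in>UNIV. h j k y * g l k y) v z" by simp
    also have "\<dots> = (\<Sum>k\<in>UNIV. h j k z * dd (g l k) v z) + (\<Sum>k\<in>UNIV. dd (h j k) v z * g l k z)"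
      by (subst dd_sum) (simp_all add: dm dd_bilinear[OF bounded_bilinear_mult diff_h[OF z] diff_g[OF z]] sum.distrib)
    finally show ?thesis by (simp add: eq_neg_iff_add_eq_0)
  qed
  have "dd (g l m) v z = (\<Sum>k\<in>UNIV. (if k = m then 1 else 0) * dd (g l k) v z)"
    by (simp add: if_distrib if_distribR cong: if_cong)
  also have "\<dots> = (\<Sum>k\<in>UNIV. (\<Sum>j\<in>UNIV. h j k z * g j m z) * dd (g l k) v z)"
    using herm_gram'[OF cof[OF z]] by (simp add: h_def g_def)
  also have "\<dots> = (\<Sum>j\<in>UNIV. g j m z * (\<Sum>k\<in>UNIV. h j k z * dd (g l k) v z))"
    by (simp add: sum_distrib_left sum_distrib_right mult_ac) (rule sum.swap)
  finally show ?thesis unfolding 1 by (simp add: sum_distrib_left sum_negf mult_ac)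
qed

text \<open>For real \<open>v\<close>, \<open>metric_variation (\<lambda>l p. D\<^sub>v h\<^sub>l\<^sub>p)\<close> is the first variation of the metric: \<open>D\<^sub>v\<langle>a, b\<rangle> = \<langle>a, metric_variation b\<rangle>\<close> for constant \<open>a, b\<close>.\<close>

definition metric_variation :: "('n \<Rightarrow> 'n \<Rightarrow> complex) \<Rightarrow> 'n cvec \<Rightarrow> 'n ext \<Rightarrow> 'n ext" where
  "metric_variation H z b = - (\<Sum>l\<in>UNIV. \<Sum>p\<in>UNIV. H l p *s (wedge (dz l) (ezs (w z) p b) + wedge (dzbar p) (ezbs (w z) l b)))"

lemma metric_variation_add: "metric_variation H z (a + b) = metric_variation H z a + metric_variation H z b"
  by (simp add: metric_variation_def ezs_add ezbs_add wedge_add_right vec.scale_right_distrib sum.distrib)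

lemma metric_variation_scale: "metric_variation H z (c *s b) = c *s metric_variation H z b"
  by (simp add: metric_variation_def ezs_scale ezbs_scale wedge_scale_right vec.scale_right_distrib vec_scale_sum sum.distrib mult.commute)

lemma metric_variation_sum: "metric_variation H z (\<Sum>i\<in>I. f i) = (\<Sum>i\<in>I. metric_variation H z (f i))"
proof -
  have "metric_variation H z 0 = 0" using metric_variation_scale[of H z 0 0] by simp
  then show ?thesis by (induction I rule: infinite_finite_induct) (simp_all add: metric_variation_add)
qed

lemma metric_variation_lin: "metric_variation (\<lambda>l p. a * H l p + b * K l p) z x = a *s metric_variation H z x + b *s metric_variation K z x"
  unfolding metric_variation_def by (simp add: vec_scale_sum sum.distrib vec.scale_left_distrib)

lemma metric_variation_nth_empty: "metric_variation H z b $ ({}, {}) = 0"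
  by (simp add: metric_variation_def scalar_nth_empty)

text \<open>The extra sum of this commutator is what the derivative of the Gram matrix inside
  \<open>ezs\<close> contributes to the derivative of the product, which is how the induction step
  of \<open>dd_inner_const\<close> closes.\<close>

lemma ezs_metric_variation:
  assumes z: "z \<in> U"
  shows "ezs (w z) k (metric_variation H z b) = metric_variation H z (ezs (w z) k b) - (\<Sum>l\<in>UNIV. \<Sum>p\<in>UNIV. (H l p * g l k z) *s ezs (w z) p b)"
proof -
  have 1: "ezs (w z) k (wedge (dz l) (ezs (w z) p b) + wedge (dzbar p) (ezbs (w z) l b)) =
    g l k z *s ezs (w z) p b + (wedge (dz l) (ezs (w z) p (ezs (w z) k b)) + wedge (dzbar p) (ezbs (w z) l (ezs (w z) k b)))" for l p
    using ezs_anticomm[of "w z" k p b] ezbs_ezs_anticomm[of "w z" l k b]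
    by (simp add: ezs_add ezs_dz ezs_dzbar g_def wedge_minus_right)
  show ?thesis unfolding metric_variation_def ezs_minus ezs_sum ezs_scale 1
    by (simp add: vec.scale_right_distrib sum.distrib)
qed

lemma ezbs_metric_variation:
  assumes z: "z \<in> U"
  shows "ezbs (w z) k (metric_variation H z b) = metric_variation H z (ezbs (w z) k b) - (\<Sum>l\<in>UNIV. \<Sum>p\<in>UNIV. (H l p * cnj (g p k z)) *s ezbs (w z) l b)"
proof -
  have 1: "ezbs (w z) k (wedge (dz l) (ezs (w z) p b) + wedge (dzbar p) (ezbs (w z) l b)) =
    cnj (g p k z) *s ezbs (w z) l b + (wedge (dz l) (ezs (w z) p (ezbs (w z) k b)) + wedge (dzbar p) (ezbs (w z) l (ezbs (w z) k b)))" for l p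
    using ezbs_anticomm[of "w z" k l b] ezbs_ezs_anticomm[of "w z" k p b]
    by (simp add: ezbs_add ezbs_dz ezbs_dzbar g_def wedge_minus_right)
  show ?thesis unfolding metric_variation_def ezbs_minus ezbs_sum ezbs_scale 1
    by (simp add: vec.scale_right_distrib sum.distrib)
qed

abbreviation "ip z a b \<equiv> ext_inner (w z) a b"

text \<open>Induction over the generators of a with b arbitrary: a generator moves to the second
  argument as a sum of constant contractions with Gram coefficients, and the product rule splits the
  derivative into the hypothesis and \<open>dd_g\<close>. Smoothness is proved along, since each
  stage differentiates the preceding one.\<close>

lemma dd_inner_const:
  shows "smooth_on U (\<lambda>z. ip z a b) \<and> (\<forall>z\<in>U. \<forall>v. dd (\<lambda>z. ip z a b) v z = ip z a (metric_variation (\<lambda>l p. dd (h l p) v z) z b))"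
proof (induction a arbitrary: b rule: ext_induct)
  case (add a a')
  have d: "(\<lambda>z. ip z a b) differentiable (at z)" "(\<lambda>z. ip z a' b) differentiable (at z)" if "z \<in> U" for z b
    using add smooth_on_differentiable that by blast+
  show ?case
    using add by (auto simp: ext_inner_add_left dd_add[OF d] intro!: smooth_on_add[OF U])
next
  case (scale c a)
  have d: "(\<lambda>z. ip z a b) differentiable (at z)" if "z \<in> U" for z b
    using scale smooth_on_differentiable that by blast
  show ?case
    using scale by (auto simp: ext_inner_scale_left dd_bilinear[OF bounded_bilinear_mult _ d] intro!: smooth_on_mult[OF U])
next
  case one
  have eq: "cnj (b $ ({}, {})) = ip z (scalar_ext 1) b" if "z \<in> U" for z
    by (simp add: ext_inner_one[OF cof[OF that]])
  have "smooth_on U (\<lambda>z. ip z (scalar_ext 1) b)"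
    by (rule smooth_on_cong[OF U eq smooth_on_const])
  moreover have "dd (\<lambda>z. ip z (scalar_ext 1) b) v z = ip z (scalar_ext 1) (metric_variation (\<lambda>l p. dd (h l p) v z) z b)" if "z \<in> U" for z v
    using dd_cong(2)[OF U that eq, where v = v] by (simp add: ext_inner_one[OF cof[OF that]] metric_variation_nth_empty)
  ultimately show ?case by blast
next
  case (dz k a)
  have eq: "(\<Sum>l\<in>UNIV. cnj (g l k z) * ip z a (cz l b)) = ip z (wedge (dz k) a) b" if "z \<in> U" for z
    by (simp add: ext_inner_dz[OF cof[OF that]] ezs_def g_def ext_inner_sum_right ext_inner_scale_right)
  have sm: "smooth_on U (\<lambda>z. \<Sum>l\<in>UNIV. cnj (g l k z) * ip z a (cz l b))"
    by (intro smooth_on_sum smooth_on_mult smooth_on_cnj smooth_g U conjunct1[OF dz])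
  have "smooth_on U (\<lambda>z. ip z (wedge (dz k) a) b)"
    by (rule smooth_on_cong[OF U eq sm])
  moreover have "dd (\<lambda>z. ip z (wedge (dz k) a) b) v z = ip z (wedge (dz k) a) (metric_variation (\<lambda>l p. dd (h l p) v z) z b)" if z: "z \<in> U" for z v
  proof -
    let ?H = "\<lambda>l p. dd (h l p) v z"
    have d: "(\<lambda>z. cnj (g l k z)) differentiable (at z)" "(\<lambda>z. ip z a (cz l b)) differentiable (at z)" for l
      using z dz smooth_on_differentiable smooth_on_differentiable[OF smooth_on_cnj[OF U smooth_g]] by blast+
    have dc: "dd (\<lambda>z. cnj (g l k z)) v z = cnj (dd (g l k) v z)" for l
      using dd_bounded_linear_comp(2)[OF bounded_linear_cnj diff_g[OF z]] by simp
    have "dd (\<lambda>z. ip z (wedge (dz k) a) b) v z = dd (\<lambda>z. \<Sum>l\<in>UNIV. cnj (g l k z) * ip z a (cz l b)) v z"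
      by (rule dd_cong(2)[OF U z eq smooth_on_differentiable[OF sm z]])
    also have "\<dots> = (\<Sum>l\<in>UNIV. cnj (g l k z) * ip z a (metric_variation ?H z (cz l b)) + cnj (dd (g l k) v z) * ip z a (cz l b))"
      using dz z by (subst dd_sum) (simp_all add: d dd_bilinear[OF bounded_bilinear_mult d] dc differentiable_mult)
    also have "\<dots> = ip z a (metric_variation ?H z (ezs (w z) k b) + (\<Sum>l\<in>UNIV. dd (g l k) v z *s cz l b))"
      by (simp add: ezs_def g_def[symmetric] metric_variation_sum metric_variation_scale ext_inner_add_right ext_inner_sum_right ext_inner_scale_right sum.distrib)
    also have "(\<Sum>l\<in>UNIV. dd (g l k) v z *s cz l b) = - (\<Sum>i\<in>UNIV. \<Sum>p\<in>UNIV. (?H i p * g i k z) *s ezs (w z) p b)"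
    proof -
      have "(\<Sum>l\<in>UNIV. dd (g l k) v z *s cz l b) = - (\<Sum>l\<in>UNIV. \<Sum>i\<in>UNIV. \<Sum>p\<in>UNIV. (?H i p * g i k z) *s (g l p z *s cz l b))"
        unfolding dd_g[OF z] by (simp add: vec.scale_sum_left sum_negf mult_ac)
      also have "(\<Sum>l\<in>UNIV. \<Sum>i\<in>UNIV. \<Sum>p\<in>UNIV. (?H i p * g i k z) *s (g l p z *s cz l b)) = 
        (\<Sum>i\<in>UNIV. \<Sum>p\<in>UNIV. \<Sum>l\<in>UNIV. (?H i p * g i k z) *s (g l p z *s cz l b))"
        by (subst sum.swap, rule sum.cong[OF refl], rule sum.swap)
      finally show ?thesis by (simp add: ezs_def g_def[symmetric] vec_scale_sum)
    qed
    finally show ?thesis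
      unfolding ext_inner_dz[OF cof[OF z]] ezs_metric_variation[OF z] by simp
  qed
  ultimately show ?case by blast
next
  case (dzbar k a)
  have eq: "(\<Sum>l\<in>UNIV. g l k z * ip z a (czb l b)) = ip z (wedge (dzbar k) a) b" if "z \<in> U" for z
    by (simp add: ext_inner_dzbar[OF cof[OF that]] ezbs_def g_def ext_inner_sum_right ext_inner_scale_right)
  have sm: "smooth_on U (\<lambda>z. \<Sum>l\<in>UNIV. g l k z * ip z a (czb l b))"
    by (intro smooth_on_sum smooth_on_mult smooth_g U conjunct1[OF dzbar])
  have "smooth_on U (\<lambda>z. ip z (wedge (dzbar k) a) b)"
    by (rule smooth_on_cong[OF U eq sm])
  moreover have "dd (\<lambda>z. ip z (wedge (dzbar k) a) b) v z = ip z (wedge (dzbar k) a) (metric_variation (\<lambda>l p. dd (h l p) v z) z b)" if z: "z \<in> U" for z v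
  proof -
    let ?H = "\<lambda>l p. dd (h l p) v z"
    have d: "g l k differentiable (at z)" "(\<lambda>z. ip z a (czb l b)) differentiable (at z)" for l
      using z dzbar smooth_on_differentiable diff_g by blast+
    have "dd (\<lambda>z. ip z (wedge (dzbar k) a) b) v z = dd (\<lambda>z. \<Sum>l\<in>UNIV. g l k z * ip z a (czb l b)) v z"
      by (rule dd_cong(2)[OF U z eq smooth_on_differentiable[OF sm z]])
    also have "\<dots> = (\<Sum>l\<in>UNIV. g l k z * ip z a (metric_variation ?H z (czb l b)) + dd (g l k) v z * ip z a (czb l b))"
      using dzbar z by (subst dd_sum) (simp_all add: d dd_bilinear[OF bounded_bilinear_mult d] differentiable_mult)
    also have "\<dots> = ip z a (metric_variation ?H z (ezbs (w z) k b) + (\<Sum>l\<in>UNIV. cnj (dd (g l k) v z) *s czb l b))"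
      by (simp add: ezbs_def g_def[symmetric] metric_variation_sum metric_variation_scale ext_inner_add_right ext_inner_sum_right ext_inner_scale_right sum.distrib)
    also have "(\<Sum>l\<in>UNIV. cnj (dd (g l k) v z) *s czb l b) = - (\<Sum>i\<in>UNIV. \<Sum>p\<in>UNIV. (?H i p * cnj (g p k z)) *s ezbs (w z) i b)"
    proof -
      have "(\<Sum>l\<in>UNIV. cnj (dd (g l k) v z) *s czb l b) = - (\<Sum>l\<in>UNIV. \<Sum>p\<in>UNIV. \<Sum>i\<in>UNIV. (?H i p * cnj (g p k z)) *s (cnj (g l i z) *s czb l b))"
        unfolding dd_g[OF z] by (simp add: vec.scale_sum_left sum_negf mult_ac dd_h_cnj[OF z])
      also have "(\<Sum>l\<in>UNIV. \<Sum>p\<in>UNIV. \<Sum>i\<in>UNIV. (?H i p * cnj (g p k z)) *s (cnj (g l i z) *s czb l b)) = 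
        (\<Sum>p\<in>UNIV. \<Sum>i\<in>UNIV. \<Sum>l\<in>UNIV. (?H i p * cnj (g p k z)) *s (cnj (g l i z) *s czb l b))"
        by (subst sum.swap, rule sum.cong[OF refl], rule sum.swap)
      also have "\<dots> = (\<Sum>p\<in>UNIV. \<Sum>i\<in>UNIV. (?H i p * cnj (g p k z)) *s ezbs (w z) i b)"
        by (simp add: ezbs_def g_def vec_scale_sum)
      also have "\<dots> = (\<Sum>i\<in>UNIV. \<Sum>p\<in>UNIV. (?H i p * cnj (g p k z)) *s ezbs (w z) i b)"
        by (rule sum.swap)
      finally show ?thesis .
    qed
    finally show ?thesis
      unfolding ext_inner_dzbar[OF cof[OF z]] ezbs_metric_variation[OF z] by simp
  qed
  ultimately show ?case by blast
qed

lemma inner_expand: "ip z a b = (\<Sum>P\<in>UNIV. \<Sum>Q\<in>UNIV. a $ P * cnj (b $ Q) * ip z (axis P 1) (axis Q 1))"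
proof -
  have "ip z a b = ip z (\<Sum>P\<in>UNIV. a $ P *s axis P 1) (\<Sum>Q\<in>UNIV. b $ Q *s axis Q 1)"
    using ext_eq_sum[of a] ext_eq_sum[of b] by (simp only:)
  then show ?thesis
    unfolding ext_inner_sum_left ext_inner_scale_left unfolding ext_inner_sum_right ext_inner_scale_right
    by (simp add: sum_distrib_left mult.assoc)
qed

lemma smooth_inner:
  assumes "smooth_on U a" "smooth_on U b" shows "smooth_on U (\<lambda>z. ip z (a z) (b z))"
  by (subst inner_expand)
    (intro smooth_on_sum smooth_on_mult smooth_on_cnj smooth_on_nth U assms conjunct1[OF dd_inner_const])

text \<open>The product rule after expansion over constant basis forms, to which
  \<open>dd_inner_const\<close> applies.\<close>

lemma dd_inner:
  assumes z: "z \<in> U" and a: "a differentiable (at z)" and b: "b differentiable (at z)"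
  shows "dd (\<lambda>z. ip z (a z) (b z)) v z = ip z (dd a v z) (b z) + ip z (a z) (dd b v z) + ip z (a z) (metric_variation (\<lambda>l p. dd (h l p) v z) z (b z))"
proof -
  let ?H = "\<lambda>l p. dd (h l p) v z"
  have da: "(\<lambda>z. a z $ P) differentiable (at z)" "dd (\<lambda>z. a z $ P) v z = dd a v z $ P" for P
    using dd_bounded_linear_comp[OF bounded_linear_vec_nth a] by auto
  have db0: "(\<lambda>z. b z $ P) differentiable (at z)" "dd (\<lambda>z. b z $ P) v z = dd b v z $ P" for P
    using dd_bounded_linear_comp[OF bounded_linear_vec_nth b] by auto
  have db: "(\<lambda>z. cnj (b z $ P)) differentiable (at z)" "dd (\<lambda>z. cnj (b z $ P)) v z = cnj (dd b v z $ P)" for P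
    using dd_bounded_linear_comp[OF bounded_linear_cnj db0(1)] db0(2) by auto
  have dG: "(\<lambda>z. ip z (axis P 1) (axis Q 1)) differentiable (at z)" for P Q
    using dd_inner_const smooth_on_differentiable z by blast
  have ddG: "dd (\<lambda>z. ip z (axis P 1) (axis Q 1)) v z = ip z (axis P 1) (metric_variation ?H z (axis Q 1))" for P Q
    using dd_inner_const z by blast
  have dab: "(\<lambda>z. a z $ P * cnj (b z $ Q)) differentiable (at z)" for P Q
    by (intro differentiable_mult da db)
  have dabG: "(\<lambda>z. a z $ P * cnj (b z $ Q) * ip z (axis P 1) (axis Q 1)) differentiable (at z)" for P Q
    by (intro differentiable_mult dG dab)
  have eq: "dd (\<lambda>z. a z $ P * cnj (b z $ Q) * ip z (axis P 1) (axis Q 1)) v z =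
      dd a v z $ P * cnj (b z $ Q) * ip z (axis P 1) (axis Q 1) + a z $ P * cnj (dd b v z $ Q) * ip z (axis P 1) (axis Q 1)
      + a z $ P * cnj (b z $ Q) * ip z (axis P 1) (metric_variation ?H z (axis Q 1))" for P Q
    by (simp only: dd_bilinear[OF bounded_bilinear_mult dab dG] dd_bilinear[OF bounded_bilinear_mult da(1) db(1)] da db ddG)
      (simp add: algebra_simps)
  have "dd (\<lambda>z. ip z (a z) (b z)) v z = dd (\<lambda>z. \<Sum>P\<in>UNIV. \<Sum>Q\<in>UNIV. a z $ P * cnj (b z $ Q) * ip z (axis P 1) (axis Q 1)) v z"
    by (subst inner_expand) rule
  also have "\<dots> = (\<Sum>P\<in>UNIV. \<Sum>Q\<in>UNIV. dd (\<lambda>z. a z $ P * cnj (b z $ Q) * ip z (axis P 1) (axis Q 1)) v z)"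
  proof -
    have 1: "(\<lambda>z. \<Sum>Q\<in>UNIV. a z $ P * cnj (b z $ Q) * ip z (axis P 1) (axis Q 1)) differentiable (at z)" for P
      by (rule differentiable_sum, simp, intro ballI dabG)
    show ?thesis by (simp add: dd_sum[OF 1] dd_sum[OF dabG])
  qed
  also have "\<dots> = ip z (dd a v z) (b z) + ip z (a z) (dd b v z) + (\<Sum>P\<in>UNIV. \<Sum>Q\<in>UNIV. a z $ P * cnj (b z $ Q) * ip z (axis P 1) (metric_variation ?H z (axis Q 1)))"
    unfolding eq by (simp add: sum.distrib flip: inner_expand)
  also have "(\<Sum>P\<in>UNIV. \<Sum>Q\<in>UNIV. a z $ P * cnj (b z $ Q) * ip z (axis P 1) (metric_variation ?H z (axis Q 1))) = ip z (a z) (metric_variation ?H z (b z))"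
  proof -
    have "ip z (a z) (metric_variation ?H z (b z)) = ip z (\<Sum>P\<in>UNIV. a z $ P *s axis P 1) (metric_variation ?H z (\<Sum>Q\<in>UNIV. b z $ Q *s axis Q 1))"
      using ext_eq_sum[of "a z"] ext_eq_sum[of "b z"] by (simp only:)
    then show ?thesis
      unfolding ext_inner_sum_left ext_inner_scale_left metric_variation_sum metric_variation_scale unfolding ext_inner_sum_right ext_inner_scale_right
      by (simp add: sum_distrib_left mult.assoc)
  qed
  finally show ?thesis .
qed

text \<open>The product is conjugate linear in its second argument, so an antiholomorphic derivative
  reaches b and the metric variation as a holomorphic one.\<close>

lemma wsb_inner:
  assumes z: "z \<in> U" and a: "a differentiable (at z)" and b: "b differentiable (at z)"
  shows "wsb j (\<lambda>z. ip z (a z) (b z)) z = ip z (wirtbar j a z) (b z) + ip z (a z) (wirt j b z) + ip z (a z) (metric_variation (\<lambda>l p. ws j (h l p) z) z (b z))"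
proof -
  have "metric_variation (\<lambda>l p. ws j (h l p) z) z (b z) = (1/2) *s metric_variation (\<lambda>l p. dd (h l p) (axis j 1) z) z (b z) + (-\<i>/2) *s metric_variation (\<lambda>l p. dd (h l p) (axis j \<i>) z) z (b z)"
    unfolding metric_variation_lin[symmetric] by (simp add: ws_def diff_divide_distrib)
  then show ?thesis
    unfolding wsb_def dd_inner[OF assms] wirt_def wirtbar_def
    by (simp only: ext_inner_add_left ext_inner_add_right ext_inner_diff_right ext_inner_scale_left ext_inner_scale_right)
      (simp add: add_divide_distrib algebra_simps)
qed

text \<open>The form \<alpha> is expanded over constant basis forms, whose adjoints are compositions
  of contractions with Gram coefficients.\<close>

lemma smooth_wadj:
  assumes "smooth_on U \<alpha>" "smooth_on U v" shows "smooth_on U (\<lambda>z. wadj (w z) (\<alpha> z) (v z))"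
proof -
  have const: "smooth_on U (\<lambda>z. wadj (w z) \<beta> (v z))" if "smooth_on U v" for \<beta> v
    using that
  proof (induction \<beta> arbitrary: v rule: ext_induct)
    case (add a b)
    show ?case
      by (rule smooth_on_cong[OF U _ smooth_on_add[OF U add(1)[OF add(3)] add(2)[OF add(3)]]]) (simp add: wadj_add_left cof)
  next
    case (scale c a)
    show ?case
      by (rule smooth_on_cong[OF U _ smooth_on_smult[OF U smooth_on_const[of U "cnj c"] scale(1)[OF scale(2)]]]) (simp add: wadj_scale_left cof)
  next
    case one
    show ?case by (rule smooth_on_cong[OF U _ one]) (simp add: wadj_scalar cof)
  next
    case (dz j a)
    have "smooth_on U (\<lambda>z. \<Sum>l\<in>UNIV. g l j z *s cz l (v z))"
      by (intro smooth_on_sum smooth_on_smult smooth_g smooth_on_bounded_linear[OF bounded_linear_cz] U dz(2))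
    then show ?case
      by (rule smooth_on_cong[OF U _ dz(1), rotated]) (simp add: wadj_wedge wadj_dz cof ezs_def g_def)
  next
    case (dzbar j a)
    have "smooth_on U (\<lambda>z. \<Sum>l\<in>UNIV. cnj (g l j z) *s czb l (v z))"
      by (intro smooth_on_sum smooth_on_smult smooth_on_cnj smooth_g smooth_on_bounded_linear[OF bounded_linear_czb] U dzbar(2))
    then show ?case
      by (rule smooth_on_cong[OF U _ dzbar(1), rotated]) (simp add: wadj_wedge wadj_dzbar cof ezbs_def g_def)
  qed
  have sm: "smooth_on U (\<lambda>z. \<Sum>P\<in>UNIV. cnj (\<alpha> z $ P) *s wadj (w z) (axis P 1) (v z))"
    by (intro smooth_on_sum smooth_on_smult smooth_on_cnj smooth_on_nth const assms U)
  moreover have "(\<Sum>P\<in>UNIV. cnj (\<alpha> z $ P) *s wadj (w z) (axis P 1) (v z)) = wadj (w z) (\<alpha> z) (v z)" if "z \<in> U" for z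
    by (subst (2) ext_eq_sum[of "\<alpha> z"]) (simp add: wadj_sum_left wadj_scale_left cof that)
  ultimately show ?thesis by (intro smooth_on_cong[OF U _ sm])
qed

lemma smooth_lam: "smooth_on U v \<Longrightarrow> smooth_on U (\<lambda>z. lam (w z) (v z))"
  by (rule smooth_on_cong[OF U _ smooth_wadj[OF w]]) (simp_all add: lam_def cof)

end

section \<open>The adjoint of the antiholomorphic differential in coordinates\<close>

definition ldel :: "('n::{finite,linorder} cvec \<Rightarrow> 'n ext) \<Rightarrow> 'n cvec \<Rightarrow> 'n ext" where
  "ldel v z = (\<Sum>j\<in>UNIV. wedge (dz j) (wirt j v z))"

definition ldelbar :: "('n::{finite,linorder} cvec \<Rightarrow> 'n ext) \<Rightarrow> 'n cvec \<Rightarrow> 'n ext" where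
  "ldelbar v z = (\<Sum>j\<in>UNIV. wedge (dzbar j) (wirtbar j v z))"

context smooth_metric
begin

definition "rho z = det (herm_matrix (w z))"

lemma smooth_rho: "smooth_on U rho"
  unfolding rho_def[abs_def] using smooth_h unfolding h_def[abs_def] by (intro smooth_on_det U)

lemma wsb_h: assumes "z \<in> U" shows "wsb j (h l p) z = cnj (ws j (h p l) z)"
proof -
  have "wsb j (h l p) z = wsb j (\<lambda>z. cnj (h p l z)) z"
    by (rule wsb_cong[OF U assms]) (simp_all add: h_cnj dd_bounded_linear_comp(1)[OF bounded_linear_cnj diff_h[OF assms]])
  then show ?thesis using cnj_ws[OF diff_h[OF assms]] by simp
qed

text \<open>Jacobi's formula, written with a conjugate so that the same derivatives
  \<open>ws j (h l p) z\<close> appear as in \<open>wsb_inner\<close>.\<close>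

lemma wsb_rho:
  assumes z: "z \<in> U"
  shows "wsb j rho z = rho z * cnj (\<Sum>l\<in>UNIV. \<Sum>p\<in>UNIV. g l p z * ws j (h l p) z)"
proof -
  have 1: "dd rho v z = rho z * (\<Sum>l\<in>UNIV. \<Sum>p\<in>UNIV. g l p z * dd (h l p) v z)" for v
  proof -
    have "dd rho v z = rho z * (\<Sum>i\<in>UNIV. \<Sum>j\<in>UNIV. matrix_inv (herm_matrix (w z)) $ j $ i * dd (\<lambda>x. herm_matrix (w x) $ i $ j) v z)"
      unfolding rho_def[abs_def] using diff_h[OF z, unfolded h_def[abs_def]] herm_matrix_invertible[OF cof[OF z]]
      by (rule dd_det)
    then show ?thesis by (simp add: g_def gram_def transpose_def h_def[abs_def])
  qed
  have "wsb j rho z = rho z * (\<Sum>l\<in>UNIV. \<Sum>p\<in>UNIV. g l p z * wsb j (h l p) z)"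
    unfolding wsb_def 1 by (simp add: sum_distrib_left sum.distrib ring_distribs add_divide_distrib sum_divide_distrib mult_ac)
  also have "(\<Sum>l\<in>UNIV. \<Sum>p\<in>UNIV. g l p z * wsb j (h l p) z) = (\<Sum>p\<in>UNIV. \<Sum>l\<in>UNIV. cnj (g p l z * ws j (h p l) z))"
    by (subst sum.swap) (simp add: wsb_h[OF z] g_cnj[OF z])
  finally show ?thesis by simp
qed

lemma wirtbar_w:
  assumes z: "z \<in> U"
  shows "wirtbar j w z = (\<Sum>l\<in>UNIV. \<Sum>p\<in>UNIV. (\<i> * cnj (ws j (h p l) z)) *s wedge (dz l) (dzbar p))"
proof -
  have d: "(\<lambda>z. \<i> * h l p z) differentiable (at z)" for l p by (intro differentiable_mult differentiable_const diff_h z)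
  have d2: "(\<lambda>z. (\<i> * h l p z) *s wedge (dz l) (dzbar p)) differentiable (at z)" for l p
    by (intro differentiable_bilinear[OF bounded_bilinear_smult] d differentiable_const)
  have d3: "(\<lambda>z. \<Sum>p\<in>UNIV. (\<i> * h l p z) *s wedge (dz l) (dzbar p)) differentiable (at z)" for l
    by (rule differentiable_sum, simp, intro ballI d2)
  have d4: "(\<lambda>z. \<Sum>l\<in>UNIV. \<Sum>p\<in>UNIV. (\<i> * h l p z) *s wedge (dz l) (dzbar p)) differentiable (at z)"
    by (rule differentiable_sum, simp, intro ballI d3)
  have "wirtbar j w z = wirtbar j (\<lambda>z. \<Sum>l\<in>UNIV. \<Sum>p\<in>UNIV. (\<i> * h l p z) *s wedge (dz l) (dzbar p)) z"
    by (rule wirtbar_cong[OF U z _ d4]) (simp add: h_def coframed_expand[OF cof, symmetric])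
  also have "\<dots> = (\<Sum>l\<in>UNIV. \<Sum>p\<in>UNIV. (\<i> * wsb j (h l p) z) *s wedge (dz l) (dzbar p))"
    by (simp add: wirtbar_sum[OF d3] wirtbar_sum[OF d2] wirtbar_smult[OF d differentiable_const] wsb_mult[OF differentiable_const diff_h[OF z]])
  finally show ?thesis by (simp add: wsb_h[OF z])
qed

text \<open>Obtained by differentiating the relation that defines \<Lambda> as an adjoint, with a
  constant first argument. The derivative of w contributes -\<i> times the sum on the right, and the
  commutator of \<Lambda> with the metric variation contributes 2\<i> times the same sum.\<close>

lemma wirt_lam:
  assumes z: "z \<in> U" and v: "smooth_on U v"
  shows "wirt j (\<lambda>z. lam (w z) (v z)) z = lam (w z) (wirt j v z) +
    \<i> *s (\<Sum>l\<in>UNIV. \<Sum>p\<in>UNIV. ws j (h l p) z *s ezbs (w z) l (ezs (w z) p (v z)))"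
proof -
  let ?H = "\<lambda>l p. ws j (h l p) z" and ?M = "metric_variation (\<lambda>l p. ws j (h l p) z) z"
  note c = cof[OF z]
  have vd: "v differentiable (at z)" and lvd: "(\<lambda>z. lam (w z) (v z)) differentiable (at z)" and wd: "w differentiable (at z)"
    using smooth_on_differentiable z v smooth_lam[OF v] w by blast+
  have "wirt j (\<lambda>z. lam (w z) (v z)) z = wadj (w z) (wirtbar j w z) (v z) + lam (w z) (wirt j v z) + lam (w z) (?M (v z)) - ?M (lam (w z) (v z))"
  proof (rule ext_inner_eqI[OF c])
    fix a
    have wa: "(\<lambda>z. wedge (w z) a) differentiable (at z)"
      by (rule differentiable_bilinear[OF bounded_bilinear_wedge wd]) simp
    have wwa: "wirtbar j (\<lambda>z. wedge (w z) a) z = wedge (wirtbar j w z) a"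
      using wirt_clinear(2)[of "\<lambda>x. wedge x a", OF wedge_add_left wedge_scale_left wd] .
    have eq: "ip y a (lam (w y) (v y)) = ip y (wedge (w y) a) (v y)" if "y \<in> U" for y
      using wadj_adj[OF cof[OF that]] by (simp add: lam_def cof that)
    have "wsb j (\<lambda>z. ip z a (lam (w z) (v z))) z = wsb j (\<lambda>z. ip z (wedge (w z) a) (v z)) z"
    proof (rule wsb_cong[OF U z])
      show "(\<lambda>z. ip z (wedge (w z) a) (v z)) differentiable at z"
        by (rule smooth_on_differentiable[OF smooth_inner[OF smooth_on_wedge[OF U w] v] z]) simp
    qed (simp add: eq)
    then have "ip z a (wirt j (\<lambda>z. lam (w z) (v z)) z) + ip z a (?M (lam (w z) (v z))) =
      ip z (wedge (wirtbar j w z) a) (v z) + ip z (wedge (w z) a) (wirt j v z) + ip z (wedge (w z) a) (?M (v z))"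
      unfolding wsb_inner[OF z differentiable_const lvd] wsb_inner[OF z wa vd] wwa by simp
    then show "ip z a (wirt j (\<lambda>z. lam (w z) (v z)) z) = ip z a (wadj (w z) (wirtbar j w z) (v z) + lam (w z) (wirt j v z) + lam (w z) (?M (v z)) - ?M (lam (w z) (v z)))"
      unfolding wadj_adj[OF c] by (simp add: lam_def c ext_inner_add_right ext_inner_diff_right algebra_simps)
  qed
  moreover have "wadj (w z) (wirtbar j w z) (v z) = - \<i> *s (\<Sum>l\<in>UNIV. \<Sum>p\<in>UNIV. ?H l p *s ezbs (w z) l (ezs (w z) p (v z)))"
    unfolding wirtbar_w[OF z]
    by (simp add: wadj_sum_left[OF c] wadj_scale_left[OF c] wadj_wedge[OF c] wadj_dz[OF c] wadj_dzbar[OF c] sum_negf vec_scale_sum, rule sum.swap)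
  moreover have "lam (w z) (?M (v z)) - ?M (lam (w z) (v z)) = (2 * \<i>) *s (\<Sum>l\<in>UNIV. \<Sum>p\<in>UNIV. ?H l p *s ezbs (w z) l (ezs (w z) p (v z)))"
  proof -
    have 1: "lam (w z) (wedge (dz l) (ezs (w z) p (v z)) + wedge (dzbar p) (ezbs (w z) l (v z)))
      = (wedge (dz l) (ezs (w z) p (lam (w z) (v z))) + wedge (dzbar p) (ezbs (w z) l (lam (w z) (v z)))) - (2 * \<i>) *s ezbs (w z) l (ezs (w z) p (v z))" for l p
      using ezbs_ezs_anticomm[of "w z" l p "v z"]
      by (simp add: lam_add[OF c] lam_dz[OF c] lam_dzbar[OF c] lam_ezs[OF c] lam_ezbs[OF c] vec_eq_iff algebra_simps)
    show ?thesis
      unfolding metric_variation_def lam_minus[OF c] lam_sum[OF c] lam_scale[OF c] 1 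
      by (simp add: vec.scale_right_diff_distrib sum_subtractf vec_scale_sum mult.commute)
  qed
  ultimately show ?thesis by (simp add: vec_eq_iff algebra_simps)
qed

text \<open>The operator -\<i>[\<Lambda>, \<partial>] - \<tau>^* in coordinates, with \<tau> =
  [\<Lambda>, \<bar>\<partial>\<omega> \<and> .].\<close>

definition "ldelbar_adj v z = - \<i> *s (lam (w z) (ldel v z) - ldel (\<lambda>z. lam (w z) (v z)) z)
   - (wadj (w z) (ldelbar w z) (wedge (w z) (v z)) - wedge (w z) (wadj (w z) (ldelbar w z) (v z)))"

text \<open>The right side is what integration by parts produces: derivative of v, variation of the
  product, derivative of the density. Here the derivatives of the metric cancel: on both sides they
  appear linearly as \<open>ws j (h l p) z\<close>, and the operators they multiply agree by
  \<open>torsion_identity\<close>.\<close>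

lemma ldelbar_adj_expand:
  assumes z: "z \<in> U" and v: "smooth_on U v"
  shows "- ldelbar_adj v z = (\<Sum>j\<in>UNIV. ezbs (w z) j (wirt j v z + metric_variation (\<lambda>l p. ws j (h l p) z) z (v z)
     + (\<Sum>l\<in>UNIV. \<Sum>p\<in>UNIV. g l p z * ws j (h l p) z) *s v z))"
proof -
  let ?e = "ezs (w z)" and ?f = "ezbs (w z)" and ?v = "v z"
  note c = cof[OF z]
  define H where "H = (\<lambda>j l p. ws j (h l p) z)"
  have lin: "lam (w z) (ldel v z) - ldel (\<lambda>z. lam (w z) (v z)) z =
    - \<i> *s ((\<Sum>j\<in>UNIV. ?f j (wirt j v z)) + (\<Sum>j\<in>UNIV. \<Sum>l\<in>UNIV. \<Sum>p\<in>UNIV. H j l p *s wedge (dz j) (?f l (?e p ?v))))"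
  proof -
    have "lam (w z) (wedge (dz j) (wirt j v z)) - wedge (dz j) (wirt j (\<lambda>z. lam (w z) (v z)) z)
      = - \<i> *s (?f j (wirt j v z) + (\<Sum>l\<in>UNIV. \<Sum>p\<in>UNIV. H j l p *s wedge (dz j) (?f l (?e p ?v))))" for j
      unfolding wirt_lam[OF z v] lam_dz[OF c] wedge_add_right wedge_scale_right wedge_sum_right H_def by (simp add: vec_eq_iff algebra_simps)
    then show ?thesis
      unfolding ldel_def lam_sum[OF c] sum_subtractf[symmetric] by (simp add: sum.distrib sum_subtractf vec_scale_sum sum_negf)
  qed
  have W: "wadj (w z) (ldelbar w z) x = - \<i> *s (\<Sum>j\<in>UNIV. \<Sum>l\<in>UNIV. \<Sum>p\<in>UNIV. H j l p *s ?f l (?e p (?f j x)))" for x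
  proof -
    have "wadj (w z) (ldelbar w z) x = (\<Sum>j\<in>UNIV. \<Sum>p\<in>UNIV. \<Sum>l\<in>UNIV. (- \<i> * H j l p) *s ?f l (?e p (?f j x)))"
      unfolding ldelbar_def wirtbar_w[OF z] H_def
      by (simp add: wadj_sum_left[OF c] wadj_scale_left[OF c] wadj_wedge[OF c] wadj_dz[OF c] wadj_dzbar[OF c])
    also have "\<dots> = (\<Sum>j\<in>UNIV. \<Sum>l\<in>UNIV. \<Sum>p\<in>UNIV. (- \<i> * H j l p) *s ?f l (?e p (?f j x)))"
      by (rule sum.cong[OF refl], rule sum.swap)
    finally show ?thesis by (simp add: vec_scale_sum)
  qed
  have tors: "wadj (w z) (ldelbar w z) (wedge (w z) ?v) - wedge (w z) (wadj (w z) (ldelbar w z) ?v)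
    = (\<Sum>j\<in>UNIV. \<Sum>l\<in>UNIV. \<Sum>p\<in>UNIV. H j l p *s (?f j (?e p (wedge (dz l) ?v)) - ?f j (wedge (dzbar p) (?f l ?v)) - wedge (dz j) (?f l (?e p ?v))))"
    unfolding W torsion_identity[OF c]
    by (simp add: wedge_sum_right wedge_minus_right wedge_scale_right vec_scale_sum sum_subtractf[symmetric] sum_negf[symmetric] vec.scale_right_diff_distrib mult.commute)
  \<comment> \<open>The trace from the density is the anticommutator of \<open>dz l\<close> with its
    adjoint, so it only reverses the order of the two in the first half of the metric
    variation.\<close>
  have M: "?f j (metric_variation (H j) z ?v + (\<Sum>l\<in>UNIV. \<Sum>p\<in>UNIV. g l p z * H j l p) *s ?v)
    = (\<Sum>l\<in>UNIV. \<Sum>p\<in>UNIV. H j l p *s (?f j (?e p (wedge (dz l) ?v)) - ?f j (wedge (dzbar p) (?f l ?v))))" for j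
  proof -
    have "metric_variation (H j) z ?v + (\<Sum>l\<in>UNIV. \<Sum>p\<in>UNIV. g l p z * H j l p) *s ?v =
      (\<Sum>l\<in>UNIV. \<Sum>p\<in>UNIV. H j l p *s (?e p (wedge (dz l) ?v) - wedge (dzbar p) (?f l ?v)))"
      unfolding metric_variation_def ezs_dz g_def[symmetric] vec.scale_sum_left sum_negf[symmetric] sum.distrib[symmetric]
      by (intro sum.cong refl) (simp add: vec_eq_iff algebra_simps)
    then show ?thesis by (simp add: ezbs_sum ezbs_scale ezbs_diff)
  qed
  have "(\<Sum>j\<in>UNIV. ?f j (wirt j v z + metric_variation (H j) z ?v + (\<Sum>l\<in>UNIV. \<Sum>p\<in>UNIV. g l p z * H j l p) *s ?v)) =
    (\<Sum>j\<in>UNIV. ?f j (wirt j v z)) + (\<Sum>j\<in>UNIV. \<Sum>l\<in>UNIV. \<Sum>p\<in>UNIV. H j l p *s (?f j (?e p (wedge (dz l) ?v)) - ?f j (wedge (dzbar p) (?f l ?v))))"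
    unfolding M[symmetric] by (simp add: add.assoc ezbs_add sum.distrib)
  moreover have "- ldelbar_adj v z = (\<Sum>j\<in>UNIV. ?f j (wirt j v z)) + (\<Sum>j\<in>UNIV. \<Sum>l\<in>UNIV. \<Sum>p\<in>UNIV. H j l p *s (?f j (?e p (wedge (dz l) ?v)) - ?f j (wedge (dzbar p) (?f l ?v))))"
  proof -
    have "(\<Sum>j\<in>UNIV. \<Sum>l\<in>UNIV. \<Sum>p\<in>UNIV. H j l p *s (?f j (?e p (wedge (dz l) ?v)) - ?f j (wedge (dzbar p) (?f l ?v)) - wedge (dz j) (?f l (?e p ?v))))
      = (\<Sum>j\<in>UNIV. \<Sum>l\<in>UNIV. \<Sum>p\<in>UNIV. H j l p *s (?f j (?e p (wedge (dz l) ?v)) - ?f j (wedge (dzbar p) (?f l ?v)))) - (\<Sum>j\<in>UNIV. \<Sum>l\<in>UNIV. \<Sum>p\<in>UNIV. H j l p *s wedge (dz j) (?f l (?e p ?v)))"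
      by (simp only: sum_subtractf[symmetric] vec.scale_right_diff_distrib)
    then show ?thesis unfolding ldelbar_adj_def lin tors by (simp add: vec_eq_iff algebra_simps)
  qed
  ultimately show ?thesis by (simp add: H_def)
qed

text \<open>The defect of adjointness, times the density, is a divergence; its integral vanishes as
  soon as a has compact support.\<close>

lemma local_divergence:
  assumes z: "z \<in> U" and a: "smooth_on U a" and v: "smooth_on U v"
  shows "(\<Sum>j\<in>UNIV. wsb j (\<lambda>z. ip z (wedge (dzbar j) (a z)) (v z) * rho z) z) =
    rho z * (ip z (ldelbar a z) (v z) - ip z (a z) (ldelbar_adj v z))"
proof -
  note c = cof[OF z]
  let ?H = "\<lambda>j l p. ws j (h l p) z" 
  let ?d = "\<lambda>j. \<Sum>l\<in>UNIV. \<Sum>p\<in>UNIV. g l p z * ws j (h l p) z"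
  have ad: "a differentiable (at z)" and vd: "v differentiable (at z)" and rd: "rho differentiable (at z)"
    using smooth_on_differentiable z a v smooth_rho by blast+
  have sfa: "smooth_on U (\<lambda>z. wedge (dzbar j) (a z))" for j by (intro smooth_on_wedge smooth_on_const U a)
  note fad = smooth_on_differentiable[OF sfa z]
  note ipd = smooth_on_differentiable[OF smooth_inner[OF sfa v] z]
  have "wsb j (\<lambda>z. ip z (wedge (dzbar j) (a z)) (v z) * rho z) z = rho z * (ip z (wedge (dzbar j) (wirtbar j a z)) (v z)
     + ip z (a z) (ezbs (w z) j (wirt j v z + metric_variation (?H j) z (v z) + ?d j *s v z)))" for j
  proof -
    have "wsb j (\<lambda>z. ip z (wedge (dzbar j) (a z)) (v z) * rho z) z =
      (ip z (wedge (dzbar j) (wirtbar j a z)) (v z) + ip z (wedge (dzbar j) (a z)) (wirt j v z) + ip z (wedge (dzbar j) (a z)) (metric_variation (?H j) z (v z))) * rho z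
      + ip z (wedge (dzbar j) (a z)) (v z) * (rho z * cnj (?d j))"
      unfolding wsb_mult[OF ipd rd] wsb_inner[OF z fad vd] wsb_rho[OF z] wirt_wedge_const(2)[OF ad] by simp
    also have "\<dots> = rho z * (ip z (wedge (dzbar j) (wirtbar j a z)) (v z) + ip z (wedge (dzbar j) (a z)) (wirt j v z + metric_variation (?H j) z (v z) + ?d j *s v z))"
      by (simp add: ext_inner_add_right ext_inner_scale_right algebra_simps)
    finally show ?thesis unfolding ext_inner_dzbar[OF c] by simp
  qed
  then have "(\<Sum>j\<in>UNIV. wsb j (\<lambda>z. ip z (wedge (dzbar j) (a z)) (v z) * rho z) z) =
    rho z * (ip z (ldelbar a z) (v z) + ip z (a z) (- ldelbar_adj v z))"
    unfolding ldelbar_adj_expand[OF z v] by (simp add: sum_distrib_left[symmetric] sum.distrib ldelbar_def ext_inner_sum_left ext_inner_sum_right)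
  then show ?thesis by (simp add: ext_inner_minus_right)
qed

end

section \<open>Forms on complex and Hermitian manifolds\<close>

lemma transition_jac_eq: "transition_jac d c z = jac (snd d \<circ> chart_inv c) z"
  by (simp add: transition_jac_def jac_def)

section \<open>Charts, transition maps and local expressions\<close>

locale complex_manifold =
  fixes A :: "('x::{t2_space,second_countable_topology}, 'n::{finite,linorder}) chart set"
  assumes atlas: "complex_atlas A"
begin

definition "tmap c d = snd d \<circ> chart_inv c"
definition "overlap c d = snd c ` (fst c \<inter> fst d)"

lemma chart_at: "chart_at A x \<in> A" "x \<in> fst (chart_at A x)"
proof -
  have "x \<in> (\<Union>c\<in>A. fst c)" using atlas by (simp add: complex_atlas_def)
  then have "\<exists>c. c \<in> A \<and> x \<in> fst c" by blast
  from someI_ex[OF this] show "chart_at A x \<in> A" "x \<in> fst (chart_at A x)" by (simp_all add: chart_at_def)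
qed

context
  fixes c assumes c: "c \<in> A"
begin

lemma open_dom: "open (fst c)" and open_image: "open (chart_image c)"
  and homeo: "homeomorphism (fst c) (chart_image c) (snd c) (chart_inv c)"
  using atlas c by (auto simp: complex_atlas_def)

lemma inv_left: "y \<in> fst c \<Longrightarrow> chart_inv c (snd c y) = y"
  using homeo by (simp add: homeomorphism_def)

lemma inv_right: "z \<in> chart_image c \<Longrightarrow> snd c (chart_inv c z) = z"
  using homeo by (simp add: homeomorphism_def)

lemma inv_mem: "z \<in> chart_image c \<Longrightarrow> chart_inv c z \<in> fst c"
  using homeo by (auto simp: homeomorphism_def)

lemma image_mem: "y \<in> fst c \<Longrightarrow> snd c y \<in> chart_image c"
  by (simp add: chart_image_def)

lemma cont_chart: "continuous_on (fst c) (snd c)" and cont_inv: "continuous_on (chart_image c) (chart_inv c)"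
  using homeo by (simp_all add: homeomorphism_def)

lemma overlap_eq: "overlap c d = chart_image c \<inter> chart_inv c -` fst d"
proof
  show "overlap c d \<subseteq> chart_image c \<inter> chart_inv c -` fst d"
    using inv_left by (auto simp: overlap_def chart_image_def)
  show "chart_image c \<inter> chart_inv c -` fst d \<subseteq> overlap c d"
    using inv_mem inv_right by (force simp: overlap_def)
qed

lemma open_preimage: "open W \<Longrightarrow> open (chart_image c \<inter> chart_inv c -` W)"
  using continuous_on_open_vimage[OF open_image, of "chart_inv c"] cont_inv by (metis Int_commute)

lemma open_preimage_chart: "open Z \<Longrightarrow> open (fst c \<inter> snd c -` Z)"
  using continuous_on_open_vimage[OF open_dom, of "snd c"] cont_chart by (metis Int_commute)

lemma overlap_self [simp]: "overlap c c = chart_image c"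
  by (simp add: overlap_def chart_image_def)

end

context
  fixes c d assumes c: "c \<in> A" and d: "d \<in> A"
begin

lemma open_overlap: "open (overlap c d)"
  unfolding overlap_eq[OF c] by (rule open_preimage[OF c open_dom[OF d]])

lemma overlap_subset: "overlap c d \<subseteq> chart_image c"
  by (auto simp: overlap_def chart_image_def)

lemma tmap_holomorphic: "holomorphic_map_on (overlap c d) (tmap c d)"
  using atlas c d unfolding complex_atlas_def overlap_def tmap_def by blast

lemma tmap_smooth: "smooth_on (overlap c d) (tmap c d)"
  using tmap_holomorphic by (simp add: holomorphic_map_on_def)

lemma tmap_diff: "z \<in> overlap c d \<Longrightarrow> tmap c d differentiable (at z)"
  by (rule smooth_on_differentiable[OF tmap_smooth])

lemma tmap_mem: "z \<in> overlap c d \<Longrightarrow> tmap c d z \<in> overlap d c"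
  using inv_left[OF c] by (auto simp: overlap_def tmap_def)

lemma tmap_inv: "z \<in> overlap c d \<Longrightarrow> chart_inv d (tmap c d z) = chart_inv c z"
  using inv_left[OF c] inv_left[OF d] by (auto simp: overlap_def tmap_def)

lemma frechet_jac: "z \<in> overlap c d \<Longrightarrow> frechet_derivative (tmap c d) (at z) v = jac (tmap c d) z *v v"
proof -
  assume z: "z \<in> overlap c d"
  let ?D = "frechet_derivative (tmap c d) (at z)"
  have lin: "linear ?D" by (rule linear_frechet[OF tmap_diff[OF z]])
  have sc: "?D (x *s v) = x *s ?D v" for x v
    using tmap_holomorphic z by (simp add: holomorphic_map_on_def)
  have "?D v = ?D (\<Sum>k\<in>UNIV. v $ k *s axis k 1)" using vec_expand[of v] by simp
  also have "\<dots> = (\<Sum>k\<in>UNIV. v $ k *s ?D (axis k 1))" using lin by (simp add: linear_sum sc)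
  also have "\<dots> = jac (tmap c d) z *v v"
    by (simp add: vec_eq_iff jac_def matrix_vector_mult_def mult.commute)
  finally show ?thesis .
qed

end

lemma jac_cocycle:
  assumes cde: "c \<in> A" "d \<in> A" "e \<in> A" and z: "z \<in> overlap c d" "z \<in> overlap c e"
  shows "jac (tmap c e) z = jac (tmap d e) (tmap c d z) ** jac (tmap c d) z"
proof -
  have tz: "tmap c d z \<in> overlap d e"
    using z inv_mem[OF cde(1)] inv_left[OF cde(2)] unfolding overlap_eq[OF cde(1)] overlap_eq[OF cde(2)]
    by (auto simp: tmap_def image_mem[OF cde(2)])
  have eq: "tmap d e (tmap c d y) = tmap c e y" if "y \<in> overlap c d" for y
    using tmap_inv[OF cde(1,2) that] by (simp add: tmap_def)
  have dm: "(\<lambda>y. tmap d e (tmap c d y)) differentiable (at z)"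
    by (rule dd_comp(1)[OF tmap_diff[OF cde(1,2) z(1)] tmap_diff[OF cde(2,3) tz]])
  have "frechet_derivative (tmap c e) (at z) v = jac (tmap d e) (tmap c d z) *v (jac (tmap c d) z *v v)" for v
  proof -
    have "frechet_derivative (tmap c e) (at z) v = frechet_derivative (\<lambda>y. tmap d e (tmap c d y)) (at z) v"
      by (rule dd_cong(2)[OF open_overlap[OF cde(1,2)] z(1) eq dm])
    also have "\<dots> = frechet_derivative (tmap d e) (at (tmap c d z)) (frechet_derivative (tmap c d) (at z) v)"
      by (rule dd_comp(2)[OF tmap_diff[OF cde(1,2) z(1)] tmap_diff[OF cde(2,3) tz]])
    finally show ?thesis by (simp add: frechet_jac[OF cde(1,2) z(1)] frechet_jac[OF cde(2,3) tz])
  qed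
  then have "jac (tmap c e) z *v v = (jac (tmap d e) (tmap c d z) ** jac (tmap c d) z) *v v" for v
    by (simp add: frechet_jac[OF cde(1,3) z(2), symmetric] matrix_vector_mul_assoc)
  then show ?thesis by (simp add: matrix_eq)
qed

lemma jac_self:
  assumes c: "c \<in> A" and z: "z \<in> chart_image c" shows "jac (tmap c c) z = mat 1"
proof -
  have "frechet_derivative (tmap c c) (at z) v = frechet_derivative (\<lambda>y. y) (at z) v" for v
    using inv_right[OF c] by (intro dd_cong(2)[OF open_image[OF c] z]) (auto simp: tmap_def)
  then have "jac (tmap c c) z *v v = mat 1 *v v" for v
    using frechet_jac[OF c c] z by (simp add: overlap_self[OF c] dd_eq[OF has_derivative_ident])
  then show ?thesis by (simp add: matrix_eq)
qed

lemma jac_invertible: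
  assumes cd: "c \<in> A" "d \<in> A" and z: "z \<in> overlap c d"
  shows "invertible (jac (tmap c d) z)"
proof -
  have zc: "z \<in> overlap c c" using z overlap_subset[OF cd] overlap_self[OF cd(1)] by auto
  have zz: "z \<in> chart_image c" using z overlap_subset[OF cd] by auto
  have "jac (tmap d c) (tmap c d z) ** jac (tmap c d) z = mat 1"
    using jac_cocycle[OF cd cd(1) z zc] jac_self[OF cd(1) zz] by simp
  then show ?thesis unfolding invertible_def using matrix_left_right_inverse by blast
qed

text \<open>The matrix by which \<open>local_expr\<close> converts from the chart chosen at the
  point to the fixed chart c.\<close>

definition chart_jac :: "('x, 'n) chart \<Rightarrow> 'n cvec \<Rightarrow> 'n mtx" where
  "chart_jac c z = jac (tmap c (chart_at A (chart_inv c z))) z"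

lemma local_expr_eq: "local_expr A c u z = subst_ext (chart_jac c z) (u (chart_inv c z))"
  by (simp add: local_expr_def Let_def transition_jac_eq chart_jac_def tmap_def)

lemma overlap_chart_at: "c \<in> A \<Longrightarrow> z \<in> chart_image c \<Longrightarrow> z \<in> overlap c (chart_at A (chart_inv c z))"
  using chart_at by (simp add: overlap_eq)

lemma chart_jac_invertible: "c \<in> A \<Longrightarrow> z \<in> chart_image c \<Longrightarrow> invertible (chart_jac c z)"
  unfolding chart_jac_def by (rule jac_invertible[OF _ chart_at(1) overlap_chart_at])

text \<open>By the cocycle rule the chosen chart drops out, so the expressions in two fixed charts
  are related by an honest holomorphic pullback although the chosen chart may jump.\<close>

lemma local_expr_change:
  assumes cd: "c \<in> A" "d \<in> A" and z: "z \<in> overlap c d"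
  shows "local_expr A c u z = subst_ext (jac (tmap c d) z) (local_expr A d u (tmap c d z))"
proof -
  have zz: "z \<in> chart_image c" using z overlap_subset[OF cd] by auto
  show ?thesis
    unfolding local_expr_eq chart_jac_def tmap_inv[OF cd z] subst_ext_comp
    using jac_cocycle[OF cd chart_at(1) z overlap_chart_at[OF cd(1) zz]] by simp
qed

lemma local_expr_add: "local_expr A c (\<lambda>x. u x + v x) z = local_expr A c u z + local_expr A c v z"
  by (simp add: local_expr_eq subst_ext_add)
lemma local_expr_diff: "local_expr A c (\<lambda>x. u x - v x) z = local_expr A c u z - local_expr A c v z"
  by (simp add: local_expr_eq subst_ext_diff)
lemma local_expr_scale: "local_expr A c (\<lambda>x. f x *s u x) z = f (chart_inv c z) *s local_expr A c u z"
  by (simp add: local_expr_eq subst_ext_scale)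
lemma local_expr_wedge: "local_expr A c (\<lambda>x. wedge (u x) (v x)) z = wedge (local_expr A c u z) (local_expr A c v z)"
  by (simp add: local_expr_eq subst_ext_wedge)
lemma local_expr_conj: "local_expr A c (\<lambda>x. conj_ext (u x)) z = conj_ext (local_expr A c u z)"
  by (simp add: local_expr_eq subst_ext_conj)
lemma local_expr_pw: "local_expr A c (\<lambda>x. pw (u x)) z = pw (local_expr A c u z)"
  by (simp add: local_expr_eq subst_ext_pw)
lemma local_expr_function_form: "local_expr A c (function_form f) z = scalar_ext (of_real (f (chart_inv c z)))"
  by (simp add: local_expr_eq function_form_def)

lemma smooth_formD: "smooth_form A u \<Longrightarrow> c \<in> A \<Longrightarrow> smooth_on (chart_image c) (local_expr A c u)"
  by (simp add: smooth_form_def)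

lemma smooth_form_add: "smooth_form A u \<Longrightarrow> smooth_form A v \<Longrightarrow> smooth_form A (\<lambda>x. u x + v x)"
  unfolding smooth_form_def local_expr_add by (auto intro!: smooth_on_add open_image)
lemma smooth_form_diff: "smooth_form A u \<Longrightarrow> smooth_form A v \<Longrightarrow> smooth_form A (\<lambda>x. u x - v x)"
  unfolding smooth_form_def local_expr_diff by (auto intro!: smooth_on_diff open_image)
lemma smooth_form_wedge: "smooth_form A u \<Longrightarrow> smooth_form A v \<Longrightarrow> smooth_form A (\<lambda>x. wedge (u x) (v x))"
  unfolding smooth_form_def local_expr_wedge by (auto intro!: smooth_on_wedge open_image)
lemma smooth_form_conj: "smooth_form A u \<Longrightarrow> smooth_form A (\<lambda>x. conj_ext (u x))"
  unfolding smooth_form_def local_expr_conj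
  by (auto intro!: smooth_on_bounded_linear[OF bounded_linear_conj_ext] open_image)
lemma smooth_form_pw: "smooth_form A u \<Longrightarrow> smooth_form A (\<lambda>x. pw (u x))"
  unfolding smooth_form_def local_expr_pw
  by (auto intro!: smooth_on_bounded_linear[OF bounded_linear_pw] open_image)
lemma smooth_form_const_scale: "smooth_form A u \<Longrightarrow> smooth_form A (\<lambda>x. k *s u x)"
  unfolding smooth_form_def local_expr_scale by (auto intro!: smooth_on_smult smooth_on_const open_image)

lemma smooth_form_scale:
  assumes "smooth_function A f" "smooth_form A u" shows "smooth_form A (\<lambda>x. complex_of_real (f x) *s u x)"
  unfolding smooth_form_def local_expr_scale
  using assms by (auto simp: smooth_function_def smooth_form_def o_def intro!: smooth_on_smult smooth_on_of_real open_image)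

lemma smooth_form_function_form: "smooth_function A f \<Longrightarrow> smooth_form A (function_form f)"
  unfolding smooth_form_def local_expr_function_form
  by (auto simp: smooth_function_def o_def intro!: smooth_on_bounded_linear[OF bounded_linear_scalar_ext] smooth_on_of_real open_image)

section \<open>The differentials on the manifold\<close>

lemma delbar_eq: "delbar A u x = ldelbar (local_expr A (chart_at A x) u) (snd (chart_at A x) x)"
  by (simp add: delbar_def Let_def ldelbar_def)

lemma del_eq: "del A u x = ldel (local_expr A (chart_at A x) u) (snd (chart_at A x) x)"
  by (simp add: del_def Let_def ldel_def)

text \<open>\<open>delbar\<close> is evaluated in the chart chosen at each point; naturality under
  the transition map carries the result to the fixed chart c. Only after this can the smoothness of
  \<open>delbar A u\<close> be discussed and the operator be iterated.\<close>

lemma local_expr_delbar: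
  assumes u: "smooth_form A u" and c: "c \<in> A" and z: "z \<in> chart_image c"
  shows "local_expr A c (delbar A u) z = ldelbar (local_expr A c u) z"
proof -
  define d where "d = chart_at A (chart_inv c z)"
  have d: "d \<in> A" by (simp add: d_def chart_at)
  have zo: "z \<in> overlap c d" unfolding d_def by (rule overlap_chart_at[OF c z])
  let ?\<phi> = "tmap c d"
  let ?a = "local_expr A d u"
  have sa: "smooth_on (chart_image d) ?a" by (rule smooth_formD[OF u d])
  have sub: "?\<phi> ` overlap c d \<subseteq> chart_image d" using tmap_mem[OF c d] overlap_subset[OF d c] by auto
  have pull: "(\<Sum>j\<in>UNIV. wedge (dzbar j) (wirtbar j (\<lambda>z. subst_ext (jac ?\<phi> z) (?a (?\<phi> z))) z)) =
     subst_ext (jac ?\<phi> z) (\<Sum>l\<in>UNIV. wedge (dzbar l) (wirtbar l ?a (?\<phi> z)))"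
    by (rule wirtbar_pullback[OF open_overlap[OF c d] tmap_holomorphic[OF c d] open_image[OF d] sub sa zo])
  have dl: "local_expr A c u differentiable (at z)" by (rule smooth_on_differentiable[OF smooth_formD[OF u c] z])
  have "wirtbar j (local_expr A c u) z = wirtbar j (\<lambda>z. subst_ext (jac ?\<phi> z) (?a (?\<phi> z))) z" for j
    by (rule wirtbar_cong[OF open_overlap[OF c d] zo _ dl, symmetric]) (rule local_expr_change[OF c d])
  then have "ldelbar (local_expr A c u) z = subst_ext (jac ?\<phi> z) (ldelbar ?a (?\<phi> z))"
    unfolding ldelbar_def using pull by simp
  moreover have "?\<phi> z = snd d (chart_inv c z)" by (simp add: tmap_def)
  ultimately show ?thesis
    by (simp add: local_expr_eq[of c "delbar A u"] delbar_eq chart_jac_def d_def)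
qed

lemma ldelbar_conj: "f differentiable (at z) \<Longrightarrow> ldelbar (\<lambda>z. conj_ext (f z)) z = conj_ext (ldel f z)"
  by (simp add: ldelbar_def ldel_def wirtbar_conj conj_ext_sum conj_ext_wedge)

lemma conj_delbar: "smooth_form A u \<Longrightarrow> conj_ext (delbar A (\<lambda>x. conj_ext (u x)) x) = del A u x"
  using smooth_on_differentiable[OF smooth_formD[OF _ chart_at(1)] image_mem[OF chart_at], of u x]
  unfolding delbar_eq del_eq local_expr_conj[abs_def] by (simp add: ldelbar_conj)

lemma local_expr_del:
  assumes u: "smooth_form A u" and c: "c \<in> A" and z: "z \<in> chart_image c"
  shows "local_expr A c (del A u) z = ldel (local_expr A c u) z"
proof -
  have "del A u = (\<lambda>x. conj_ext (delbar A (\<lambda>x. conj_ext (u x)) x))" using conj_delbar[OF u] by auto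
  then have "local_expr A c (del A u) z = conj_ext (ldelbar (\<lambda>z. conj_ext (local_expr A c u z)) z)"
    by (simp add: local_expr_conj local_expr_delbar[OF smooth_form_conj[OF u] c z] local_expr_conj[abs_def])
  then show ?thesis
    using smooth_on_differentiable[OF smooth_formD[OF u c] z] by (simp add: ldelbar_conj)
qed

lemma smooth_form_delbar:
  assumes u: "smooth_form A u" shows "smooth_form A (delbar A u)"
  unfolding smooth_form_def
proof
  fix c assume c: "c \<in> A"
  have "smooth_on (chart_image c) (ldelbar (local_expr A c u))"
    unfolding ldelbar_def[abs_def]
    by (intro smooth_on_sum smooth_on_wedge smooth_on_const smooth_on_wirtbar smooth_formD[OF u c] open_image[OF c])
  then show "smooth_on (chart_image c) (local_expr A c (delbar A u))"
    by (rule smooth_on_cong[OF open_image[OF c] local_expr_delbar[OF u c, symmetric], rotated])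
qed

lemma smooth_form_del:
  assumes u: "smooth_form A u" shows "smooth_form A (del A u)"
proof -
  have "del A u = (\<lambda>x. conj_ext (delbar A (\<lambda>x. conj_ext (u x)) x))" using conj_delbar[OF u] by auto
  then show ?thesis by (simp add: smooth_form_conj smooth_form_delbar u)
qed

lemma delbar_add:
  assumes "smooth_form A u" "smooth_form A v"
  shows "delbar A (\<lambda>x. u x + v x) x = delbar A u x + delbar A v x"
proof -
  note d = smooth_on_differentiable[OF smooth_formD[OF _ chart_at(1)] image_mem[OF chart_at], of _ x]
  show ?thesis unfolding delbar_eq local_expr_add[abs_def] ldelbar_def
    by (simp add: wirtbar_add[OF d[OF assms(1)] d[OF assms(2)]] wedge_add_right sum.distrib)
qed

lemma delbar_const_scale:
  assumes "smooth_form A u"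
  shows "delbar A (\<lambda>x. k *s u x) x = k *s delbar A u x"
proof -
  note d = smooth_on_differentiable[OF smooth_formD[OF assms chart_at(1)] image_mem[OF chart_at], of x]
  show ?thesis unfolding delbar_eq local_expr_scale[abs_def] ldelbar_def
    by (simp add: wirtbar_smult[OF differentiable_const d] wedge_scale_right vec_scale_sum)
qed

text \<open>A bump in coordinates, extended by zero. In another chart it is the bump after a
  transition map near points of the domain of c. A point outside that domain lies off K, which is
  closed as a compact set in a Hausdorff space, and there the function vanishes nearby.\<close>

lemma smooth_function_bump:
  assumes c: "c \<in> A" and x: "x \<in> fst c"
  obtains \<psi> :: "'x \<Rightarrow> real" and V K where "smooth_function A \<psi>" "open V" "x \<in> V" "\<And>y. y \<in> V \<Longrightarrow> \<psi> y = 1"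
    "compact K" "K \<subseteq> fst c" "\<And>y. y \<notin> K \<Longrightarrow> \<psi> y = 0" "\<And>y. 0 \<le> \<psi> y" "\<And>y. \<psi> y \<le> 1"
proof -
  let ?z = "snd c x"
  obtain e where e: "e > 0" "cball ?z e \<subseteq> chart_image c"
    using open_contains_cball open_image[OF c] image_mem[OF c x] by blast
  \<comment> \<open>The bump of radius r is supported in the ball of radius 2 r = e, which lies in
    the image of the chart.\<close>
  define r where "r = e / 2"
  have r: "r > 0" "cball ?z (2 * r) \<subseteq> chart_image c" using e by (auto simp: r_def)
  obtain f :: "'n cvec \<Rightarrow> real" where f: "smooth_on UNIV f" "\<And>z. dist ?z z \<le> r \<Longrightarrow> f z = 1"
    "\<And>z. dist ?z z \<ge> 2 * r \<Longrightarrow> f z = 0" "\<And>z. 0 \<le> f z" "\<And>z. f z \<le> 1"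
    using bump_exists[OF r(1), of ?z] by blast
  define \<psi> where "\<psi> = (\<lambda>y. if y \<in> fst c then f (snd c y) else 0)"
  define K where "K = chart_inv c ` cball ?z (2 * r)"
  define V where "V = fst c \<inter> snd c -` ball ?z r"
  have K: "compact K"
    unfolding K_def using cont_inv[OF c] r(2) by (intro compact_continuous_image compact_cball) (auto intro: continuous_on_subset)
  have out: "\<psi> y = 0" if "y \<notin> K" for y
  proof (cases "y \<in> fst c")
    case True
    then have "snd c y \<notin> cball ?z (2 * r)" using that inv_left[OF c True] unfolding K_def by force
    then show ?thesis by (simp add: \<psi>_def f(3))
  qed (simp add: \<psi>_def)
  have "smooth_on (chart_image d) (\<psi> \<circ> chart_inv d)" if d: "d \<in> A" for d
  proof (rule smooth_on_local)
    fix z assume z: "z \<in> chart_image d"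
    show "\<exists>T. open T \<and> z \<in> T \<and> smooth_on T (\<psi> \<circ> chart_inv d)"
    proof (cases "chart_inv d z \<in> fst c")
      case True
      have "smooth_on (overlap d c) (\<lambda>z. f (tmap d c z))"
        by (rule smooth_on_comp[OF open_overlap[OF d c] open_UNIV _ tmap_smooth[OF d c] f(1)]) simp
      then have "smooth_on (overlap d c) (\<psi> \<circ> chart_inv d)"
        by (rule smooth_on_cong[OF open_overlap[OF d c], rotated]) (simp add: overlap_eq[OF d] \<psi>_def tmap_def)
      moreover have "z \<in> overlap d c" using True z by (simp add: overlap_eq[OF d])
      ultimately show ?thesis using open_overlap[OF d c] by blast
    next
      case False
      let ?T = "chart_image d \<inter> chart_inv d -` (- K)"
      have o: "open ?T" using K by (intro open_preimage[OF d] open_Compl compact_imp_closed)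
      have "K \<subseteq> fst c" unfolding K_def using r(2) inv_mem[OF c] by auto
      then have "z \<in> ?T" using False z by auto
      moreover have "smooth_on ?T (\<psi> \<circ> chart_inv d)"
        by (rule smooth_on_cong[OF o _ smooth_on_const[of _ 0]]) (simp add: out)
      ultimately show ?thesis using o by blast
    qed
  qed
  then have "smooth_function A \<psi>" by (simp add: smooth_function_def)
  moreover have "open V" unfolding V_def by (rule open_preimage_chart[OF c open_ball])
  moreover have "x \<in> V" using x r by (simp add: V_def)
  moreover have "\<psi> y = 1" if "y \<in> V" for y using that by (auto simp: V_def \<psi>_def intro!: f(2))
  moreover have "K \<subseteq> fst c" unfolding K_def using r(2) inv_mem[OF c] by auto
  ultimately show ?thesis using that[of \<psi> V K] K out f(4,5) by (simp add: \<psi>_def)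
qed

end

section \<open>Pointwise adjoints on a Hermitian manifold\<close>

locale hermitian_manifold = complex_manifold A
  for A :: "('x::{t2_space,second_countable_topology}, 'n::{finite,linorder}) chart set" +
  fixes \<omega> :: "('x, 'n) form"
  assumes metric: "hermitian_metric A \<omega>"
begin

lemma smooth_metric_form: "smooth_form A \<omega>" using metric by (simp add: hermitian_metric_def)

lemma metric_coframed: "coframed (\<omega> x)"
  using metric by (auto simp: hermitian_metric_def intro: positive_11_coframed)

lemma local_metric_coframed: "c \<in> A \<Longrightarrow> z \<in> chart_image c \<Longrightarrow> coframed (local_expr A c \<omega> z)"
  using metric_coframed[of "chart_inv c z"] coframed_subst[OF _ chart_jac_invertible[of c z]]
  unfolding coframed_def local_expr_eq by blast

lemma smooth_metric_local: "c \<in> A \<Longrightarrow> smooth_metric (chart_image c) (local_expr A c \<omega>)"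
  by unfold_locales (simp_all add: open_image smooth_formD[OF smooth_metric_form] local_metric_coframed)

lemma local_expr_wadj:
  assumes "c \<in> A" "z \<in> chart_image c"
  shows "local_expr A c (\<lambda>x. wadj (\<omega> x) (\<alpha> x) (v x)) z = wadj (local_expr A c \<omega> z) (local_expr A c \<alpha> z) (local_expr A c v z)"
  unfolding local_expr_eq using wadj_subst[OF metric_coframed chart_jac_invertible[OF assms]] by simp

lemma local_expr_lam:
  assumes "c \<in> A" "z \<in> chart_image c"
  shows "local_expr A c (\<lambda>x. lam (\<omega> x) (v x)) z = lam (local_expr A c \<omega> z) (local_expr A c v z)"
  using local_expr_wadj[OF assms, of \<omega> v] by (simp add: lam_def metric_coframed local_metric_coframed[OF assms])

lemma local_expr_inner:
  assumes "c \<in> A" "z \<in> chart_image c"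
  shows "ext_inner (local_expr A c \<omega> z) (local_expr A c u z) (local_expr A c v z) = ext_inner (\<omega> (chart_inv c z)) (u (chart_inv c z)) (v (chart_inv c z))"
  unfolding local_expr_eq by (rule ext_inner_subst[OF metric_coframed chart_jac_invertible[OF assms]])

lemma smooth_form_wadj:
  assumes "smooth_form A \<alpha>" "smooth_form A v"
  shows "smooth_form A (\<lambda>x. wadj (\<omega> x) (\<alpha> x) (v x))"
  unfolding smooth_form_def
proof
  fix c assume c: "c \<in> A"
  interpret smooth_metric "chart_image c" "local_expr A c \<omega>" by (rule smooth_metric_local[OF c])
  show "smooth_on (chart_image c) (local_expr A c (\<lambda>x. wadj (\<omega> x) (\<alpha> x) (v x)))"
    by (rule smooth_on_cong[OF open_image[OF c] local_expr_wadj[OF c, symmetric] smooth_wadj[OF smooth_formD[OF assms(1) c] smooth_formD[OF assms(2) c]]])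
qed

lemma smooth_form_lam: "smooth_form A v \<Longrightarrow> smooth_form A (\<lambda>x. lam (\<omega> x) (v x))"
  using smooth_form_wadj[OF smooth_metric_form] by (simp add: lam_def metric_coframed)

lemma smooth_inner_function:
  assumes "smooth_form A u" "smooth_form A v" "c \<in> A"
  shows "smooth_on (chart_image c) (\<lambda>z. ext_inner (\<omega> (chart_inv c z)) (u (chart_inv c z)) (v (chart_inv c z)))"
proof -
  interpret smooth_metric "chart_image c" "local_expr A c \<omega>" by (rule smooth_metric_local[OF assms(3)])
  show ?thesis
    by (rule smooth_on_cong[OF open_image[OF assms(3)] local_expr_inner[OF assms(3)] smooth_inner[OF smooth_formD[OF assms(1,3)] smooth_formD[OF assms(2,3)]]])
qed

lemma pointwise_adj_eqI:
  assumes "\<And>u x. ext_inner (\<omega> x) (T u x) (v x) = ext_inner (\<omega> x) (u x) (b x)"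
  shows "pointwise_adj \<omega> T v = b"
proof
  fix x
  show "pointwise_adj \<omega> T v x = b x"
    unfolding pointwise_adj_def
  proof (rule the_equality)
    fix c assume "\<forall>u. ext_inner (\<omega> x) (T u x) (v x) = ext_inner (\<omega> x) (u x) c"
    \<comment> \<open>Forms that are constant as functions of the point take every value at x, so
      the condition over all u determines the value of the adjoint.\<close>
    then have "ext_inner (\<omega> x) a c = ext_inner (\<omega> x) a (b x)" for a
      using assms[where u = "\<lambda>_. a" and x = x] by simp
    then show "c = b x" by (rule ext_inner_eqI[OF metric_coframed])
  qed (simp add: assms)
qed

lemma Lam_eq: "Lam \<omega> v = (\<lambda>x. lam (\<omega> x) (v x))"
  unfolding Lam_def
  by (rule pointwise_adj_eqI) (simp add: ext_mult_def wadj_adj metric_coframed lam_def)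

text \<open>The pointwise adjoint of [\<Lambda>, \<alpha> \<and> .]: taking adjoints reverses the
  products and turns \<Lambda> into \<omega> \<and> . again. The graded commutator is an ordinary
  one since -2 is even.\<close>

definition torsion_adj :: "('x, 'n) form \<Rightarrow> ('x, 'n) form \<Rightarrow> ('x, 'n) form" where
  "torsion_adj \<alpha> v = (\<lambda>x. wadj (\<omega> x) (\<alpha> x) (wedge (\<omega> x) (v x)) - wedge (\<omega> x) (wadj (\<omega> x) (\<alpha> x) (v x)))"

lemma ext_inner_lam: "ext_inner (\<omega> x) (lam (\<omega> x) a) b = ext_inner (\<omega> x) a (wedge (\<omega> x) b)"
  by (metis metric_coframed ext_inner_cnj lam_def wadj_adj)

lemma torsion_adj_adj:
  "ext_inner (\<omega> x) (gcomm (-2) (Lam \<omega>) 3 (ext_mult \<alpha>) u x) (v x) = ext_inner (\<omega> x) (u x) (torsion_adj \<alpha> v x)"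
  by (simp add: gcomm_def Lam_eq ext_mult_def torsion_adj_def ext_inner_diff_left ext_inner_diff_right
     ext_inner_lam wadj_adj metric_coframed)

lemma pointwise_adj_torsion: "pointwise_adj \<omega> (gcomm (-2) (Lam \<omega>) 3 (ext_mult \<alpha>)) v = torsion_adj \<alpha> v"
  by (rule pointwise_adj_eqI) (rule torsion_adj_adj)

lemma pointwise_adj_conj_torsion:
  "pointwise_adj \<omega> (conj_op (gcomm (-2) (Lam \<omega>) 3 (ext_mult \<alpha>))) v = conj_op (torsion_adj \<alpha>) v"
proof (rule pointwise_adj_eqI)
  fix u x
  let ?T = "gcomm (-2) (Lam \<omega>) 3 (ext_mult \<alpha>)"
  have "ext_inner (\<omega> x) (conj_op ?T u x) (v x) = cnj (ext_inner (\<omega> x) (?T (\<lambda>y. conj_ext (u y)) x) (conj_ext (v x)))"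
    by (simp flip: ext_inner_conj[OF metric_coframed] add: conj_op_def)
  also have "\<dots> = ext_inner (\<omega> x) (u x) (conj_op (torsion_adj \<alpha>) v x)"
    using torsion_adj_adj[of x \<alpha> "\<lambda>y. conj_ext (u y)" "\<lambda>y. conj_ext (v y)"]
    by (simp flip: ext_inner_conj[OF metric_coframed] add: conj_op_def)
  finally show "ext_inner (\<omega> x) (conj_op ?T u x) (v x) = ext_inner (\<omega> x) (u x) (conj_op (torsion_adj \<alpha>) v x)" .
qed

lemma smooth_form_torsion_adj: "smooth_form A \<alpha> \<Longrightarrow> smooth_form A v \<Longrightarrow> smooth_form A (torsion_adj \<alpha> v)"
  unfolding torsion_adj_def
  by (intro smooth_form_diff smooth_form_wadj smooth_form_wedge smooth_metric_form)

text \<open>The Hermitian commutation relation \<open>\<bar>\<partial>\<^sup>* = - \<i>[\<Lambda>, \<partial>] - \<tau>\<^sup>*\<close> with \<open>\<tau> = [\<Lambda>, \<bar>\<partial>\<omega> \<and> \<cdot>]\<close>.\<close>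

definition delbar_adj :: "('x, 'n) form \<Rightarrow> ('x, 'n) form" where
  "delbar_adj v = (\<lambda>x. - \<i> *s (lam (\<omega> x) (del A v x) - del A (\<lambda>x. lam (\<omega> x) (v x)) x) - torsion_adj (delbar A \<omega>) v x)"

lemma local_expr_delbar_adj:
  assumes v: "smooth_form A v" and c: "c \<in> A" and z: "z \<in> chart_image c"
  shows "local_expr A c (delbar_adj v) z = smooth_metric.ldelbar_adj (local_expr A c \<omega>) (local_expr A c v) z"
proof -
  interpret smooth_metric "chart_image c" "local_expr A c \<omega>" by (rule smooth_metric_local[OF c])
  have dl: "ldel (local_expr A c (\<lambda>x. lam (\<omega> x) (v x))) z = ldel (\<lambda>z. lam (local_expr A c \<omega> z) (local_expr A c v z)) z"
    unfolding ldel_def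
    by (intro sum.cong refl arg_cong[of _ _ "wedge _"] wirt_cong[OF open_image[OF c] z])
      (simp_all add: local_expr_lam[OF c] smooth_on_differentiable[OF smooth_lam[OF smooth_formD[OF v c]] z])
  show ?thesis
    unfolding delbar_adj_def torsion_adj_def ldelbar_adj_def
    by (simp add: local_expr_diff local_expr_scale local_expr_lam[OF c z] local_expr_del[OF v c z]
       local_expr_del[OF smooth_form_lam[OF v] c z] dl local_expr_wedge local_expr_wadj[OF c z] local_expr_delbar[OF smooth_metric_form c z])
qed

lemma smooth_form_delbar_adj: "smooth_form A v \<Longrightarrow> smooth_form A (delbar_adj v)"
  unfolding delbar_adj_def
  by (intro smooth_form_diff smooth_form_const_scale smooth_form_lam smooth_form_del
     smooth_form_torsion_adj smooth_form_delbar smooth_metric_form)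

end

section \<open>The twist by \<eta>\<close>

locale twisted_manifold = hermitian_manifold A \<omega>
  for A :: "('x::{t2_space,second_countable_topology}, 'n::{finite,linorder}) chart set" and \<omega> +
  fixes \<eta> :: "'x \<Rightarrow> real"
  assumes eta: "smooth_function A \<eta>" and eta_nz: "\<And>x. \<eta> x \<noteq> 0"
begin

definition "inv_eta = (\<lambda>x. inverse (\<eta> x))"

lemma smooth_inv_eta: "smooth_function A inv_eta"
  using eta eta_nz by (auto simp: smooth_function_def inv_eta_def o_def intro!: smooth_on_inverse open_image)

text \<open>This is \<bar>\<partial> of log |\<eta>|.\<close>

definition dbar_log :: "('x, 'n) form" where
  "dbar_log x = complex_of_real (inv_eta x) *s delbar A (function_form \<eta>) x"

lemma smooth_dbar_log: "smooth_form A dbar_log"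
  unfolding dbar_log_def[abs_def]
  by (intro smooth_form_scale smooth_inv_eta smooth_form_delbar smooth_form_function_form eta)

lemma conj_dbar_log: "conj_ext (dbar_log x) = complex_of_real (inv_eta x) *s del A (function_form \<eta>) x"
proof -
  have "(\<lambda>x. conj_ext (function_form \<eta> x)) = (function_form \<eta> :: ('x, 'n) form)" by (simp add: function_form_def fun_eq_iff)
  then show ?thesis
    using conj_delbar[OF smooth_form_function_form[OF eta], of x] by (simp add: dbar_log_def conj_ext_scale)
qed

lemma dbar_log_expand: "\<exists>b. dbar_log x = (\<Sum>j\<in>UNIV. b j *s dzbar j)"
proof -
  let ?c = "chart_at A x" and ?f = "\<lambda>z. complex_of_real (\<eta> (chart_inv (chart_at A x) z))"
  have "smooth_on (chart_image ?c) ?f"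
    using eta chart_at by (intro smooth_on_of_real open_image) (auto simp: smooth_function_def o_def)
  then have d: "?f differentiable (at (snd ?c x))"
    by (rule smooth_on_differentiable[OF _ image_mem[OF chart_at]])
  have "delbar A (function_form \<eta>) x = (\<Sum>j\<in>UNIV. wsb j ?f (snd ?c x) *s dzbar j)"
    unfolding delbar_eq ldelbar_def local_expr_function_form[abs_def] wirt_scalar_ext(2)[OF d] by simp
  then have "dbar_log x = (\<Sum>j\<in>UNIV. (complex_of_real (inv_eta x) * wsb j ?f (snd ?c x)) *s dzbar j)"
    by (simp add: dbar_log_def vec_scale_sum)
  then show ?thesis by (rule exI[of _ "\<lambda>j. complex_of_real (inv_eta x) * wsb j ?f (snd ?c x)"])
qed

abbreviation "D \<equiv> D01 A \<eta>"
abbreviation "Db \<equiv> D01bar A \<eta>"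

lemma D_eq: "D u x = delbar A u x - wedge (dbar_log x) (pw (u x))"
  by (simp add: D01_def dbar_log_def ext_mult_def p_weight_def pw_def wedge_scale_left inv_eta_def inverse_eq_divide)

lemma Db_eq: assumes "smooth_form A u" shows "Db u x = del A u x - wedge (conj_ext (dbar_log x)) (qw (u x))"
proof -
  have "delbar A (\<lambda>y. conj_ext (u y)) x = conj_ext (del A u x)"
    using arg_cong[OF conj_delbar[OF assms, of x], of conj_ext] by simp
  then show ?thesis
    by (simp add: D01bar_def conj_op_def D_eq conj_ext_diff conj_ext_wedge qw_conj[symmetric])
qed

lemma Db_conj: "Db u x = conj_ext (D (\<lambda>y. conj_ext (u y)) x)"
  by (simp add: D01bar_def conj_op_def)

lemma smooth_D: "smooth_form A u \<Longrightarrow> smooth_form A (D u)"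
  unfolding D_eq[abs_def]
  by (intro smooth_form_diff smooth_form_delbar smooth_form_wedge smooth_dbar_log smooth_form_pw)

lemma smooth_Db: "smooth_form A u \<Longrightarrow> smooth_form A (Db u)"
  unfolding Db_conj[abs_def] by (intro smooth_form_conj smooth_D)

lemma D_add: "smooth_form A u \<Longrightarrow> smooth_form A v \<Longrightarrow> D (\<lambda>x. u x + v x) x = D u x + D v x"
  by (simp add: D_eq delbar_add pw_add wedge_add_right)

lemma D_scale: "smooth_form A u \<Longrightarrow> D (\<lambda>x. k *s u x) x = k *s D u x"
  by (simp add: D_eq delbar_const_scale pw_scale wedge_scale_right vec.scale_right_diff_distrib)

lemma Db_add: "smooth_form A u \<Longrightarrow> smooth_form A v \<Longrightarrow> Db (\<lambda>x. u x + v x) x = Db u x + Db v x"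
  by (simp add: Db_conj conj_ext_add D_add smooth_form_conj)

lemma Db_scale: "smooth_form A u \<Longrightarrow> Db (\<lambda>x. k *s u x) x = k *s Db u x"
  by (simp add: Db_conj conj_ext_scale D_scale smooth_form_conj)

text \<open>The candidate for the formal adjoint in the shape that the final identity wants.
  Integration by parts yields another shape; \<open>D_adj_eq\<close> compares the two.\<close>

definition D_adj :: "('x, 'n) form \<Rightarrow> ('x, 'n) form" where
  "D_adj v = (\<lambda>x. - \<i> *s (lam (\<omega> x) (Db v x) - Db (\<lambda>x. lam (\<omega> x) (v x)) x) - torsion_adj (D \<omega>) v x
     + of_nat CARD('n) *s eta_comm \<omega> \<eta> (del A (function_form \<eta>)) v x)"

lemma eta_comm_del: "eta_comm \<omega> \<eta> (del A (function_form \<eta>)) v x = \<i> *s (wedge (conj_ext (dbar_log x)) (lam (\<omega> x) (v x)) - lam (\<omega> x) (wedge (conj_ext (dbar_log x)) (v x)))"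
  by (simp add: eta_comm_def gcomm_def ext_mult_def Lam_eq conj_dbar_log wedge_scale_left lam_scale metric_coframed inv_eta_def
     divide_inverse vec.scale_right_diff_distrib)

lemma eta_comm_delbar: "eta_comm \<omega> \<eta> (delbar A (function_form \<eta>)) v x = \<i> *s (wedge (dbar_log x) (lam (\<omega> x) (v x)) - lam (\<omega> x) (wedge (dbar_log x) (v x)))"
  by (simp add: eta_comm_def gcomm_def ext_mult_def Lam_eq dbar_log_def wedge_scale_left lam_scale metric_coframed inv_eta_def
     divide_inverse vec.scale_right_diff_distrib)

lemma smooth_eta_comm_del: "smooth_form A v \<Longrightarrow> smooth_form A (eta_comm \<omega> \<eta> (del A (function_form \<eta>)) v)"
  unfolding eta_comm_del[abs_def]
  by (intro smooth_form_const_scale smooth_form_diff smooth_form_wedge smooth_form_lam smooth_form_conj smooth_dbar_log)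

lemma smooth_eta_comm_delbar: "smooth_form A v \<Longrightarrow> smooth_form A (eta_comm \<omega> \<eta> (delbar A (function_form \<eta>)) v)"
  unfolding eta_comm_delbar[abs_def]
  by (intro smooth_form_const_scale smooth_form_diff smooth_form_wedge smooth_form_lam smooth_dbar_log)

lemma smooth_D_adj: "smooth_form A v \<Longrightarrow> smooth_form A (D_adj v)"
  unfolding D_adj_def
  by (intro smooth_form_diff smooth_form_add smooth_form_const_scale smooth_form_lam smooth_Db smooth_D
     smooth_form_torsion_adj smooth_eta_comm_del smooth_metric_form)

text \<open>Expanding the twists of \<open>Db\<close> and of the torsion, and adding the term with
  n, leaves \<open>delbar_adj\<close> and the combination of \<open>twist_identity\<close>, extended
  from the \<open>dz j\<close> to the conjugate of \<open>dbar_log\<close> by linearity.\<close>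

lemma D_adj_eq:
  assumes v: "smooth_form A v"
  shows "D_adj v x = delbar_adj v x - pw (wadj (\<omega> x) (dbar_log x) (v x))"
proof -
  let ?w = "\<omega> x" and ?n = "of_nat CARD('n) :: complex"
  note c = metric_coframed[of x]
  obtain b where b: "dbar_log x = (\<Sum>j\<in>UNIV. b j *s dzbar j)" using dbar_log_expand by blast
  have cb: "conj_ext (dbar_log x) = (\<Sum>j\<in>UNIV. cnj (b j) *s dz j)" by (simp add: b conj_ext_sum conj_ext_scale)
  have ab: "wadj ?w (dbar_log x) y = (\<Sum>j\<in>UNIV. cnj (b j) *s ezbs ?w j y)" for y
    by (simp add: b wadj_sum_left[OF c] wadj_scale_left[OF c] wadj_dzbar[OF c])
  \<comment> \<open>The metric has p = 1, so its twist is \<open>dbar_log\<close> with coefficient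
    1.\<close>
  have Dw: "D \<omega> x = delbar A \<omega> x - wedge (dbar_log x) ?w" by (simp add: D_eq pw_metric[OF c])
  have t: "torsion_adj (D \<omega>) v x = torsion_adj (delbar A \<omega>) v x
     - (lam ?w (wadj ?w (dbar_log x) (wedge ?w (v x))) - wedge ?w (lam ?w (wadj ?w (dbar_log x) (v x))))"
    unfolding torsion_adj_def Dw
    by (simp add: wadj_diff_left[OF c] wadj_wedge[OF c] lam_def[OF c] wedge_diff_right)
  have "\<i> *s (lam ?w (wedge (conj_ext (dbar_log x)) (qw (v x))) - wedge (conj_ext (dbar_log x)) (qw (lam ?w (v x))))
     + (lam ?w (wadj ?w (dbar_log x) (wedge ?w (v x))) - wedge ?w (lam ?w (wadj ?w (dbar_log x) (v x))))
     + (\<i> * ?n) *s (wedge (conj_ext (dbar_log x)) (lam ?w (v x)) - lam ?w (wedge (conj_ext (dbar_log x)) (v x)))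
     = (\<Sum>j\<in>UNIV. cnj (b j) *s (\<i> *s (lam ?w (wedge (dz j) (qw (v x))) - wedge (dz j) (qw (lam ?w (v x))))
         + (lam ?w (ezbs ?w j (wedge ?w (v x))) - wedge ?w (lam ?w (ezbs ?w j (v x))))
         + (\<i> * ?n) *s (wedge (dz j) (lam ?w (v x)) - lam ?w (wedge (dz j) (v x)))))"
    unfolding cb ab
    by (simp add: wedge_sum_left wedge_sum_right wedge_scale_left wedge_scale_right lam_sum[OF c] lam_scale[OF c] sum_subtractf[symmetric] sum.distrib[symmetric]
       vec_scale_sum vec.scale_right_diff_distrib vec.scale_right_distrib mult.commute mult.left_commute)
  also have "\<dots> = - pw (wadj ?w (dbar_log x) (v x))"
    unfolding twist_identity[OF c] ab pw_sum pw_scale by (simp add: sum_negf)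
  finally have tw: "\<i> *s (lam ?w (wedge (conj_ext (dbar_log x)) (qw (v x))) - wedge (conj_ext (dbar_log x)) (qw (lam ?w (v x))))
     + (lam ?w (wadj ?w (dbar_log x) (wedge ?w (v x))) - wedge ?w (lam ?w (wadj ?w (dbar_log x) (v x))))
     + (\<i> * ?n) *s (wedge (conj_ext (dbar_log x)) (lam ?w (v x)) - lam ?w (wedge (conj_ext (dbar_log x)) (v x)))
     = - pw (wadj ?w (dbar_log x) (v x))" .
  have "D_adj v x = delbar_adj v x + (\<i> *s (lam ?w (wedge (conj_ext (dbar_log x)) (qw (v x))) - wedge (conj_ext (dbar_log x)) (qw (lam ?w (v x))))
     + (lam ?w (wadj ?w (dbar_log x) (wedge ?w (v x))) - wedge ?w (lam ?w (wadj ?w (dbar_log x) (v x))))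
     + (\<i> * ?n) *s (wedge (conj_ext (dbar_log x)) (lam ?w (v x)) - lam ?w (wedge (conj_ext (dbar_log x)) (v x))))"
    unfolding D_adj_def delbar_adj_def t eta_comm_del Db_eq[OF v] Db_eq[OF smooth_form_lam[OF v]] lam_diff[OF c]
    by (simp add: vec_eq_iff algebra_simps)
  then show ?thesis unfolding tw by simp
qed

text \<open>The zero-order terms of the twist are adjoint to each other at every point. The defect
  of adjointness is therefore that of the untwisted operator, which is already known to be a
  divergence in a chart.\<close>

lemma D_inner:
  assumes v: "smooth_form A v"
  shows "ext_inner (\<omega> x) (D u x) (v x) - ext_inner (\<omega> x) (u x) (D_adj v x)
    = ext_inner (\<omega> x) (delbar A u x) (v x) - ext_inner (\<omega> x) (u x) (delbar_adj v x)"
  unfolding D_eq D_adj_eq[OF v]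
  by (simp add: ext_inner_diff_left ext_inner_diff_right wadj_adj[OF metric_coframed] ext_inner_pw[OF metric_coframed])

end

section \<open>The volume measure\<close>

text \<open>An index type for the real coordinates \<open>Re z\<^sub>j\<close>, \<open>Im z\<^sub>j\<close>, well-ordered as the change of variables
  formula of the library demands.\<close>

datatype 'n dbl = Dbl (dbl_index: 'n) (dbl_part: bool)

instantiation dbl :: (linorder) linorder
begin

definition "d \<le> e \<longleftrightarrow> dbl_index d < dbl_index e \<or> (dbl_index d = dbl_index e \<and> (dbl_part d \<longrightarrow> dbl_part e))"
definition "(d :: 'a dbl) < e \<longleftrightarrow> d \<le> e \<and> \<not> e \<le> d"

instance
  by standard (auto simp: less_eq_dbl_def less_dbl_def intro: dbl.expand)

end

instance dbl :: (finite) finite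
proof
  have "UNIV = (\<lambda>(i, b). Dbl i b) ` (UNIV :: ('a \<times> bool) set)"
    by (auto simp: image_iff) (metis dbl.exhaust)
  then show "finite (UNIV :: 'a dbl set)" by (metis finite finite_imageI)
qed

instance dbl :: ("{finite,linorder}") wellorder
proof
  fix P :: "'a dbl \<Rightarrow> bool" and d
  assume step: "\<And>x. (\<And>y. y < x \<Longrightarrow> P y) \<Longrightarrow> P x"
  show "P d"
  proof (induction "card {y. y < d}" arbitrary: d rule: less_induct)
    case less
    show ?case
    proof (rule step)
      fix y assume "y < d"
      then have "{x. x < y} \<subset> {x. x < d}" by (auto intro: less_trans)
      then show "P y" by (intro less psubset_card_mono) auto
    qed
  qed
qed

lemma det_upper_triangular:
  fixes M :: "'a::comm_ring_1 ^ 'd::{finite,linorder} ^ 'd::{finite,linorder}"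
  assumes "\<And>i j. j < i \<Longrightarrow> M $ i $ j = 0"
  shows "det M = (\<Prod>i\<in>UNIV. M $ i $ i)"
proof -
  have *: "of_int (sign p) * (\<Prod>i\<in>UNIV. M $ i $ p i) = (if p = id then \<Prod>i\<in>UNIV. M $ i $ i else 0)"
    if p: "p permutes UNIV" for p
  proof (cases "p = id")
    case False
    have "\<exists>i. p i < i"
    proof (rule ccontr)
      assume "\<not> (\<exists>i. p i < i)"
      then have ge: "i \<le> p i" for i by (auto simp: not_less)
      \<comment> \<open>The largest moved index would go to a larger one, which is then fixed; this
        contradicts injectivity.\<close>
      let ?N = "{i. p i \<noteq> i}"
      have "?N \<noteq> {}" using False by (auto simp: fun_eq_iff)
      then have "Max ?N \<in> ?N" by (intro Max_in) auto
      define m where "m = Max ?N"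
      have m: "p m \<noteq> m" "m < p m" using \<open>Max ?N \<in> ?N\<close> ge[of m] by (auto simp: m_def)
      have "p (p m) = p m"
        using m(2) Max_ge[of ?N "p m"] by (auto simp: m_def not_le[symmetric])
      then show False using m(1) p by (metis permutes_inj injD)
    qed
    then have "(\<Prod>i\<in>UNIV. M $ i $ p i) = 0" using assms by (metis finite iso_tuple_UNIV_I prod_zero)
    then show ?thesis using False by simp
  qed (simp add: sign_id)
  have "det M = (\<Sum>p\<in>{p. p permutes (UNIV :: 'd set)}. if p = id then \<Prod>i\<in>UNIV. M $ i $ i else 0)"
    unfolding det_def by (intro sum.cong refl) (simp add: *)
  then show ?thesis by (simp add: permutes_id finite_permutations)
qed

definition realify :: "complex ^ 'n \<Rightarrow> real ^ 'n dbl" where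
  "realify z = (\<chi> d. if dbl_part d then Im (z $ dbl_index d) else Re (z $ dbl_index d))"

definition complexify :: "real ^ 'n dbl \<Rightarrow> complex ^ 'n" where
  "complexify x = (\<chi> j. Complex (x $ Dbl j False) (x $ Dbl j True))"

lemma realify_inverse [simp]: "complexify (realify z) = z" "realify (complexify x) = x"
  by (simp_all add: realify_def complexify_def vec_eq_iff complex_eq_iff) (metis dbl.collapse)

lemma linear_realify: "linear realify" and linear_complexify: "linear complexify"
  by (rule linearI; simp add: realify_def complexify_def vec_eq_iff complex_eq_iff)+

definition dbl_basis :: "'n dbl \<Rightarrow> complex ^ 'n::finite" where
  "dbl_basis d = axis (dbl_index d) (if dbl_part d then \<i> else 1)"

lemma inner_dbl_basis: "z \<bullet> dbl_basis d = realify z $ d"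
  by (simp add: dbl_basis_def realify_def inner_axis inner_complex_def)

lemma bij_dbl_basis: "bij_betw dbl_basis UNIV (Basis :: (complex ^ 'n::finite) set)"
proof (rule bij_betwI')
  fix d e :: "'n dbl"
  show "dbl_basis d = dbl_basis e \<longleftrightarrow> d = e"
  proof
    assume "dbl_basis d = dbl_basis e"
    then have "dbl_index d = dbl_index e \<and> (if dbl_part d then \<i> else 1) = (if dbl_part e then \<i> else (1 :: complex))"
      unfolding dbl_basis_def axis_eq_axis by (auto split: if_splits)
    then show "d = e" by (auto intro!: dbl.expand split: if_splits simp: complex_eq_iff)
  qed simp
  show "dbl_basis d \<in> Basis" by (auto simp: dbl_basis_def Basis_vec_def Basis_complex_def)
next
  fix b :: "complex ^ 'n" assume "b \<in> Basis"
  then obtain j u where "b = axis j u" "u = 1 \<or> u = \<i>" by (auto simp: Basis_vec_def Basis_complex_def)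
  then have "b = dbl_basis (Dbl j (u = \<i>))" by (elim disjE) (simp_all add: dbl_basis_def)
  then show "\<exists>d\<in>UNIV. b = dbl_basis d" by blast
qed

lemma bij_axis: "bij_betw (\<lambda>d. axis d (1::real)) UNIV (Basis :: (real ^ 'd::finite) set)"
  by (auto simp: bij_betw_def inj_on_def axis_eq_axis Basis_vec_def)

lemma inner_realify: "realify x \<bullet> realify y = x \<bullet> y"
proof -
  have "x \<bullet> y = (\<Sum>b\<in>Basis. (x \<bullet> b) * (y \<bullet> b))" by (rule euclidean_inner)
  also have "\<dots> = (\<Sum>d\<in>UNIV. realify x $ d * realify y $ d)"
    by (subst sum.reindex_bij_betw[OF bij_dbl_basis, symmetric]) (simp add: inner_dbl_basis)
  finally show ?thesis by (simp add: inner_vec_def)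
qed

lemma measurable_realify [measurable]: "realify \<in> borel_measurable borel"
  and measurable_complexify [measurable]: "complexify \<in> borel_measurable borel"
  using linear_realify linear_complexify
  by (auto intro!: borel_measurable_continuous_onI linear_continuous_on simp: linear_conv_bounded_linear)

text \<open>Lebesgue measure is determined by its values on boxes, and \<open>realify\<close>
  carries boxes to boxes with the same side lengths because it matches the two standard
  bases.\<close>

lemma lborel_realify: "lborel = distr lborel borel (realify :: complex ^ 'n::finite \<Rightarrow> _)"
proof (rule lborel_eqI)
  fix l u :: "real ^ 'n dbl"
  assume "\<And>b. b \<in> Basis \<Longrightarrow> l \<bullet> b \<le> u \<bullet> b"
  then have le: "l $ d \<le> u $ d" for d
    by (metis inner_axis' axis_in_Basis_iff Basis_real_def insertI1 inner_commute inner_real_def mult.left_neutral)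
  have B: "(Basis :: (complex ^ 'n) set) = range dbl_basis"
    by (rule bij_betw_imp_surj_on[OF bij_dbl_basis, symmetric])
  have mem: "x \<in> box (complexify l) (complexify u) \<longleftrightarrow> (\<forall>d. l $ d < realify x $ d \<and> realify x $ d < u $ d)" for x
    unfolding box_def B by (simp add: inner_dbl_basis)
  have "realify -` box l u = box (complexify l) (complexify u)"
  proof -
    have B': "(Basis :: (real ^ 'n dbl) set) = range (\<lambda>d. axis d 1)"
      by (rule bij_betw_imp_surj_on[OF bij_axis, symmetric])
    have "y \<in> box l u \<longleftrightarrow> (\<forall>d. l $ d < y $ d \<and> y $ d < u $ d)" for y
      unfolding box_def B' by (simp add: inner_axis)
    then show ?thesis using mem by blast
  qed
  moreover have "emeasure lborel (box (complexify l) (complexify u)) = (\<Prod>b\<in>Basis. (complexify u - complexify l) \<bullet> b)"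
  proof (rule emeasure_lborel_box)
    fix b :: "complex ^ 'n" assume "b \<in> Basis"
    then show "complexify l \<bullet> b \<le> complexify u \<bullet> b" using le unfolding B by (auto simp: inner_dbl_basis)
  qed
  moreover have "(\<Prod>b\<in>Basis. (complexify u - complexify l) \<bullet> b) = (\<Prod>b\<in>Basis. (u - l) \<bullet> b)"
    unfolding prod.reindex_bij_betw[OF bij_dbl_basis, symmetric] prod.reindex_bij_betw[OF bij_axis, symmetric]
    by (simp add: inner_dbl_basis linear_diff[OF linear_realify] inner_diff_left inner_axis)
  ultimately show "emeasure (distr lborel borel realify) (box l u) = (\<Prod>b\<in>Basis. (u - l) \<bullet> b)"
    by (simp add: emeasure_distr)
qed simp

definition real_matrix :: "complex ^ 'n ^ 'n \<Rightarrow> real ^ 'n dbl ^ 'n::finite dbl" where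
  "real_matrix J = matrix (\<lambda>x. realify (J *v complexify x))"

lemma linear_real_matrix: "linear (\<lambda>x. realify (J *v complexify x))"
proof -
  have "linear (\<lambda>z. J *v z)"
    by (rule linearI) (simp_all add: vec.add matrix_vector_right_distrib scaleR_vec_complex vector_scalar_commute)
  from linear_compose[OF linear_compose[OF linear_complexify this] linear_realify] show ?thesis by (simp add: o_def)
qed

lemma real_matrix_mult: "real_matrix (J ** K) = real_matrix J ** real_matrix K"
proof -
  have "(\<lambda>x. realify (J *v complexify x)) \<circ> (\<lambda>x. realify (K *v complexify x)) = (\<lambda>x. realify ((J ** K) *v complexify x))"
    by (auto simp: matrix_vector_mul_assoc)
  then show ?thesis
    unfolding real_matrix_def using matrix_compose[OF linear_real_matrix linear_real_matrix] by metis
qed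

lemma real_matrix_nth: "real_matrix W $ d $ e = realify (\<chi> i. W $ i $ dbl_index e * (if dbl_part e then \<i> else 1)) $ d"
proof -
  have c: "complexify (axis e 1) = dbl_basis e"
    by (cases e) (auto simp: complexify_def dbl_basis_def axis_def vec_eq_iff complex_eq_iff)
  have "W *v dbl_basis e = (\<chi> i. W $ i $ dbl_index e * (if dbl_part e then \<i> else 1))"
  proof -
    have "(W *v dbl_basis e) $ i = (\<Sum>k\<in>UNIV. if k = dbl_index e then W $ i $ k * (if dbl_part e then \<i> else 1) else 0)" for i
      unfolding matrix_vector_mult_def vec_lambda_beta dbl_basis_def by (intro sum.cong) (auto simp: axis_def)
    then show ?thesis by (simp add: vec_eq_iff)
  qed
  then show ?thesis by (simp add: real_matrix_def matrix_def c)
qed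

lemma sum_cmod_sq: "(\<Sum>i\<in>UNIV. x $ i * cnj (x $ i)) = complex_of_real (x \<bullet> x)" for x :: "complex ^ 'n"
  unfolding inner_vec_def of_real_sum
  by (intro sum.cong refl) (simp add: complex_eq_iff inner_complex_def)

text \<open>A unitary map preserves the Hermitian norm, so its real matrix is orthogonal; on the
  complex side the determinant times its conjugate is 1.\<close>

lemma det_real_matrix_unitary:
  fixes Q :: "complex ^ 'n ^ 'n::finite"
  assumes Q: "\<And>s t. (\<Sum>i\<in>UNIV. Q $ i $ s * cnj (Q $ i $ t)) = (if s = t then 1 else 0)"
  shows "\<bar>det (real_matrix Q)\<bar> = 1" "cmod (det Q) = 1"
proof -
  have "transpose Q ** cmat Q = mat 1"
    by (simp add: vec_eq_iff matrix_matrix_mult_def transpose_def cmat_def mat_def Q)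
  then have 1: "det Q * det (cmat Q) = 1" by (metis det_I det_mul det_transpose)
  have "det (cmat Q) = cnj (det Q)" by (simp add: det_def cmat_def)
  then have "(cmod (det Q))\<^sup>2 = 1" using 1 by (metis complex_norm_square of_real_eq_1_iff)
  then show "cmod (det Q) = 1" by (simp add: power2_eq_1_iff) (smt (verit) norm_ge_zero)
  have Qin: "(Q *v z) \<bullet> (Q *v z) = z \<bullet> z" for z
  proof -
    have "complex_of_real ((Q *v z) \<bullet> (Q *v z)) = (\<Sum>i\<in>UNIV. (\<Sum>s\<in>UNIV. Q $ i $ s * z $ s) * cnj (\<Sum>t\<in>UNIV. Q $ i $ t * z $ t))"
      by (simp add: sum_cmod_sq[symmetric] matrix_vector_mult_def)
    also have "\<dots> = (\<Sum>i\<in>UNIV. \<Sum>s\<in>UNIV. \<Sum>t\<in>UNIV. z $ s * cnj (z $ t) * (Q $ i $ s * cnj (Q $ i $ t)))"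
      by (simp add: sum_product mult_ac)
    also have "\<dots> = (\<Sum>s\<in>UNIV. \<Sum>t\<in>UNIV. \<Sum>i\<in>UNIV. z $ s * cnj (z $ t) * (Q $ i $ s * cnj (Q $ i $ t)))"
      by (subst sum.swap, rule sum.cong[OF refl], rule sum.swap)
    also have "\<dots> = (\<Sum>s\<in>UNIV. \<Sum>t\<in>UNIV. if t = s then z $ s * cnj (z $ t) else 0)"
      by (intro sum.cong refl) (auto simp: sum_distrib_left[symmetric] Q)
    also have "\<dots> = complex_of_real (z \<bullet> z)" by (simp add: sum_cmod_sq[symmetric])
    finally show ?thesis by (simp only: of_real_eq_iff)
  qed
  have "orthogonal_transformation (\<lambda>x. realify (Q *v complexify x))"
    unfolding orthogonal_transformation
    using linear_real_matrix by (auto simp: norm_eq_sqrt_inner inner_realify Qin) (metis inner_realify realify_inverse(2))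
  then show "\<bar>det (real_matrix Q)\<bar> = 1" unfolding real_matrix_def by (rule orthogonal_transformation_det)
qed

text \<open>Gram-Schmidt for the product pulled back by J gives a triangular W with positive
  diagonal such that J W is unitary. Unitary maps have real determinant of modulus 1. As the two
  real coordinates of one index are adjacent in the order of \<open>dbl\<close>, W is triangular as
  a real matrix too, with each diagonal entry occurring twice.\<close>

lemma det_real_matrix:
  fixes J :: "'n::{finite,linorder} mtx"
  assumes "invertible J"
  shows "\<bar>det (real_matrix J)\<bar> = (cmod (det J))\<^sup>2"
proof -
  define H where "H = transpose J ** cmat J"
  have Hjk: "H $ j $ k = (\<Sum>i\<in>UNIV. J $ i $ j * cnj (J $ i $ k))" for j k
    by (simp add: H_def matrix_matrix_mult_def transpose_def cmat_def)
  have HH: "sesq H x y = (\<Sum>i\<in>UNIV. (J *v x) $ i * cnj ((J *v y) $ i))" for x y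
  proof -
    have "(\<Sum>i\<in>UNIV. (J *v x) $ i * cnj ((J *v y) $ i)) = (\<Sum>i\<in>UNIV. \<Sum>j\<in>UNIV. \<Sum>k\<in>UNIV. (J $ i $ j * cnj (J $ i $ k)) * x $ j * cnj (y $ k))"
      by (simp add: matrix_vector_mult_def sum_product mult_ac)
    also have "\<dots> = (\<Sum>j\<in>UNIV. \<Sum>k\<in>UNIV. \<Sum>i\<in>UNIV. (J $ i $ j * cnj (J $ i $ k)) * x $ j * cnj (y $ k))"
      by (subst sum.swap, rule sum.cong[OF refl], rule sum.swap)
    finally show ?thesis by (simp add: sesq_def Hjk sum_distrib_right)
  qed
  have herm: "H $ j $ k = cnj (H $ k $ j)" for j k by (simp add: Hjk mult.commute)
  have pos: "0 < Re (sesq H v v)" if "v \<noteq> 0" for v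
  proof -
    have "J *v v \<noteq> 0" using assms that by (metis invertible_def matrix_vector_mul_assoc matrix_vector_mul_lid matrix_vector_mult_0_right)
    then show ?thesis by (simp add: HH sum_cmod_sq)
  qed
  obtain V :: "'n mtx" where V: "\<And>s t. sesq H (V $ s) (V $ t) = (if s = t then 1 else 0)"
    "\<And>s j. s < j \<Longrightarrow> V $ s $ j = 0" "\<And>s. \<exists>r>0. V $ s $ s = of_real r"
  proof (rule gram_schmidt[OF herm pos])
    fix V :: "'n mtx"
    assume *: "\<And>s t. sesq H (V $ s) (V $ t) = (if s = t then 1 else 0)"
      "\<And>s j. s < j \<Longrightarrow> V $ s $ j = 0" "\<And>s. \<exists>r>0. V $ s $ s = of_real r"
    show thesis by (rule that) (rule *, assumption?)+
  qed
  obtain r where r: "\<And>s. 0 < r s" "\<And>s. V $ s $ s = complex_of_real (r s)" using V(3) by metis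
  define W where "W = transpose V"
  have JW: "(J ** W) $ i $ s = (J *v (V $ s)) $ i" for i s
    by (simp add: W_def matrix_matrix_mult_def transpose_def matrix_vector_mult_def)
  have Q: "(\<Sum>i\<in>UNIV. (J ** W) $ i $ s * cnj ((J ** W) $ i $ t)) = (if s = t then 1 else 0)" for s t
    unfolding JW HH[symmetric] by (rule V(1))
  have detW: "det W = (\<Prod>s\<in>UNIV. complex_of_real (r s))"
    using V(2) r(2) by (subst det_upper_triangular) (auto simp: W_def transpose_def)
  have detRW: "det (real_matrix W) = (\<Prod>s\<in>UNIV. r s)\<^sup>2"
  proof -
    have "real_matrix W $ d $ e = 0" if "e < d" for d e
    proof (cases "dbl_index e = dbl_index d")
      case True
      \<comment> \<open>Inside a diagonal block the entry below the diagonal is the imaginary part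
        of a positive number.\<close>
      then have "dbl_part d" "\<not> dbl_part e" using that by (auto simp: less_dbl_def less_eq_dbl_def)
      then show ?thesis using True r(2) by (simp add: real_matrix_nth realify_def W_def transpose_def)
    next
      case False
      then have "dbl_index e < dbl_index d" using that by (auto simp: less_dbl_def less_eq_dbl_def)
      then show ?thesis using V(2) by (simp add: real_matrix_nth realify_def W_def transpose_def)
    qed
    then have "det (real_matrix W) = (\<Prod>d\<in>UNIV. real_matrix W $ d $ d)" by (rule det_upper_triangular)
    also have "\<dots> = (\<Prod>d\<in>UNIV. r (dbl_index d))"
      by (intro prod.cong refl) (simp add: real_matrix_nth realify_def W_def transpose_def r(2))
    also have "\<dots> = (\<Prod>(s, b)\<in>UNIV \<times> (UNIV :: bool set). r s)"
      by (rule prod.reindex_bij_witness[of _ "\<lambda>(s, b). Dbl s b" "\<lambda>d. (dbl_index d, dbl_part d)"]) auto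
    also have "\<dots> = (\<Prod>s\<in>UNIV. \<Prod>b\<in>(UNIV :: bool set). r s)"
      by (subst prod.cartesian_product) rule
    also have "\<dots> = (\<Prod>s\<in>UNIV. r s)\<^sup>2"
      by (simp add: UNIV_bool prod.distrib power2_eq_square)
    finally show ?thesis .
  qed
  define R where "R = (\<Prod>s\<in>UNIV. r s)"
  have R: "R > 0" using r(1) by (simp add: R_def prod_pos)
  have "\<bar>det (real_matrix J)\<bar> * R\<^sup>2 = 1"
    using det_real_matrix_unitary(1)[OF Q] detRW by (simp add: real_matrix_mult det_mul abs_mult R_def)
  moreover have "cmod (det J) * R = 1"
    using det_real_matrix_unitary(2)[OF Q] R by (simp add: det_mul norm_mult detW R_def flip: of_real_prod)
  ultimately have "\<bar>det (real_matrix J)\<bar> * R\<^sup>2 = (cmod (det J))\<^sup>2 * R\<^sup>2"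
    by (metis one_power2 power_mult_distrib)
  then show ?thesis using R by simp
qed

section \<open>Change of variables for holomorphic maps\<close>

lemma emeasure_realify_image:
  assumes "realify ` T \<in> sets borel" "T \<in> sets borel"
  shows "emeasure lborel (realify ` T) = emeasure lborel (T :: (complex ^ 'n::finite) set)"
proof -
  have "realify -` realify ` T = T" by (auto simp: image_iff) (metis realify_inverse(1))
  then show ?thesis using assms by (subst lborel_realify) (simp add: emeasure_distr)
qed

lemma realify_image: "realify ` T = complexify -` T"
  by (auto simp: image_iff) (metis realify_inverse(2))

lemma sets_realify_image: "T \<in> sets borel \<Longrightarrow> realify ` T \<in> sets borel"
  unfolding realify_image using measurable_sets[OF measurable_complexify, of T] by simp

text \<open>The formula is carried over from real coordinates. Boundedness of the image makes its
  measure finite, as the real formula for \<open>measure\<close> requires.\<close>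

lemma emeasure_holomorphic_image_bounded:
  fixes \<phi> :: "'n::{finite,linorder} cvec \<Rightarrow> 'n cvec"
  assumes \<Omega>: "open \<Omega>" and hol: "holomorphic_map_on \<Omega> \<phi>" and inv: "\<And>z. z \<in> \<Omega> \<Longrightarrow> invertible (jac \<phi> z)"
    and lin: "\<And>z v. z \<in> \<Omega> \<Longrightarrow> frechet_derivative \<phi> (at z) v = jac \<phi> z *v v"
    and inj: "inj_on \<phi> \<Omega>" and S: "S \<in> sets borel" "S \<subseteq> \<Omega>" and im: "\<phi> ` S \<in> sets borel" "bounded (\<phi> ` S)"
  shows "emeasure lborel (\<phi> ` S) = (\<integral>\<^sup>+ z\<in>S. ennreal ((cmod (det (jac \<phi> z)))\<^sup>2) \<partial>lborel)"
proof -
  define f where "f = (\<lambda>x. realify (\<phi> (complexify x)))"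
  define S' where "S' = realify ` S"
  have S': "S' \<in> sets borel" unfolding S'_def by (rule sets_realify_image[OF S(1)])
  have fS: "f ` S' = realify ` (\<phi> ` S)" by (auto simp: f_def S'_def image_image)
  have bl: "bounded_linear realify" "bounded_linear complexify"
    using linear_realify linear_complexify by (simp_all add: linear_conv_bounded_linear)
  have der: "(f has_derivative (\<lambda>v. realify (jac \<phi> (complexify x) *v complexify v))) (at x within S')" if "x \<in> S'" for x
  proof -
    have z: "complexify x \<in> \<Omega>" using that S(2) by (auto simp: S'_def)
    have d: "(\<phi> has_derivative frechet_derivative \<phi> (at (complexify x))) (at (complexify x))"
      using hol z by (intro differentiable_has_derivative smooth_on_differentiable[of \<Omega>]) (auto simp: holomorphic_map_on_def)
    have "(\<phi> has_derivative (\<lambda>v. jac \<phi> (complexify x) *v v)) (at (complexify x))"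
    proof -
      have "frechet_derivative \<phi> (at (complexify x)) = (\<lambda>v. jac \<phi> (complexify x) *v v)" using lin[OF z] by auto
      with d show ?thesis by simp
    qed
    from diff_chain_at[OF bounded_linear_imp_has_derivative[OF bl(2)] this]
    have "((\<lambda>x. \<phi> (complexify x)) has_derivative (\<lambda>v. jac \<phi> (complexify x) *v complexify v)) (at x)" by (simp add: o_def)
    from bounded_linear.has_derivative[OF bl(1) this] show ?thesis unfolding f_def by (rule has_derivative_at_withinI)
  qed
  have injf: "inj_on f S'"
    using inj S(2) unfolding inj_on_def f_def S'_def by (auto dest!: arg_cong[of _ _ complexify]) (metis subsetD)
  have fSb: "f ` S' \<in> sets borel" unfolding fS by (rule sets_realify_image[OF im(1)])
  have "bounded (f ` S')" unfolding fS using im(2) bl(1) by (rule bounded_linear_image)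
  then have lm: "f ` S' \<in> lmeasurable" using fSb by (intro bounded_set_imp_lmeasurable) auto
  have "((\<lambda>x. \<bar>det (matrix (\<lambda>v. realify (jac \<phi> (complexify x) *v complexify v)))\<bar>) has_integral measure lebesgue (f ` S')) S'"
    using has_measure_differentiable_image[OF _ der injf, of "measure lebesgue (f ` S')"] lm S' by auto
  then have hi: "((\<lambda>x. (cmod (det (jac \<phi> (complexify x))))\<^sup>2) has_integral measure lebesgue (f ` S')) S'"
  proof (rule has_integral_eq[rotated])
    fix x assume "x \<in> S'"
    then have "complexify x \<in> \<Omega>" using S(2) by (auto simp: S'_def)
    from det_real_matrix[OF inv[OF this]]
    show "\<bar>det (matrix (\<lambda>v. realify (jac \<phi> (complexify x) *v complexify v)))\<bar> = (cmod (det (jac \<phi> (complexify x))))\<^sup>2"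
      by (simp add: real_matrix_def)
  qed
  have "emeasure lborel (\<phi> ` S) = emeasure lborel (f ` S')"
    unfolding fS by (rule emeasure_realify_image[OF sets_realify_image[OF im(1)] im(1), symmetric])
  also have "\<dots> = ennreal (measure lebesgue (f ` S'))"
    using emeasure_eq_measure2[OF lm] fSb by simp
  also have "\<dots> = (\<integral>\<^sup>+ x. ennreal ((cmod (det (jac \<phi> (complexify x))))\<^sup>2) * indicator S' x \<partial>lborel)"
    by (rule nn_integral_has_integral_lebesgue'[OF _ hi, symmetric]) simp
  also have "\<dots> = (\<integral>\<^sup>+ z. ennreal ((cmod (det (jac \<phi> z)))\<^sup>2) * indicator S z \<partial>lborel)"
  proof -
    have d: "(\<lambda>z. det (jac \<phi> z)) \<in> borel_measurable (restrict_space borel \<Omega>)"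
      using smooth_on_continuous[OF smooth_on_det[OF \<Omega> smooth_on_jac[OF \<Omega> hol]]]
      by (rule borel_measurable_continuous_on_restrict)
    have m: "(\<lambda>z. ennreal ((cmod (det (jac \<phi> z)))\<^sup>2) * indicator S z) \<in> borel_measurable borel"
    proof -
      have "(\<lambda>z. indicator \<Omega> z *\<^sub>R det (jac \<phi> z)) \<in> borel_measurable borel"
        using d \<Omega> by (subst (asm) borel_measurable_restrict_space_iff) auto
      then have "(\<lambda>z. ennreal ((cmod (indicator \<Omega> z *\<^sub>R det (jac \<phi> z)))\<^sup>2) * indicator S z) \<in> borel_measurable borel"
        using S(1) by measurable
      moreover have "(\<lambda>z. ennreal ((cmod (indicator \<Omega> z *\<^sub>R det (jac \<phi> z)))\<^sup>2) * indicator S z) = (\<lambda>z. ennreal ((cmod (det (jac \<phi> z)))\<^sup>2) * indicator S z)"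
        using S(2) by (auto simp: fun_eq_iff indicator_def)
      ultimately show ?thesis by simp
    qed
    have ind: "indicator S' x = (indicator S (complexify x) :: ennreal)" for x
      by (auto simp: S'_def realify_image indicator_def)
    have "(\<integral>\<^sup>+ x. ennreal ((cmod (det (jac \<phi> (complexify x))))\<^sup>2) * indicator S' x \<partial>lborel)
      = (\<integral>\<^sup>+ x. ennreal ((cmod (det (jac \<phi> (complexify x))))\<^sup>2) * indicator S (complexify x) \<partial>(distr lborel borel realify))"
      unfolding ind lborel_realify[symmetric] ..
    also have "\<dots> = (\<integral>\<^sup>+ z. ennreal ((cmod (det (jac \<phi> z)))\<^sup>2) * indicator S z \<partial>lborel)"
      using measurable_compose[OF measurable_complexify m] by (subst nn_integral_distr) simp_all
    finally show ?thesis .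
  qed
  finally show ?thesis .
qed

lemma emeasure_holomorphic_image:
  fixes \<phi> :: "'n::{finite,linorder} cvec \<Rightarrow> 'n cvec"
  assumes \<Omega>: "open \<Omega>" and hol: "holomorphic_map_on \<Omega> \<phi>" and inv: "\<And>z. z \<in> \<Omega> \<Longrightarrow> invertible (jac \<phi> z)"
    and lin: "\<And>z v. z \<in> \<Omega> \<Longrightarrow> frechet_derivative \<phi> (at z) v = jac \<phi> z *v v"
    and inj: "inj_on \<phi> \<Omega>" and S: "S \<in> sets borel" "S \<subseteq> \<Omega>"
    and im: "\<And>T. T \<in> sets borel \<Longrightarrow> T \<subseteq> \<Omega> \<Longrightarrow> \<phi> ` T \<in> sets borel"
  shows "emeasure lborel (\<phi> ` S) = (\<integral>\<^sup>+ z\<in>S. ennreal ((cmod (det (jac \<phi> z)))\<^sup>2) \<partial>lborel)"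
proof -
  have cont: "continuous_on \<Omega> \<phi>" using hol by (auto simp: holomorphic_map_on_def intro: smooth_on_continuous)
  \<comment> \<open>S is exhausted by the preimages of balls, whose images are bounded; monotone
    convergence does the rest.\<close>
  define T where "T n = S \<inter> {z \<in> \<Omega>. \<phi> z \<in> ball 0 (real n)}" for n
  have Tb: "T n \<in> sets borel" for n
  proof -
    have "open (\<Omega> \<inter> \<phi> -` ball 0 (real n))" using \<Omega> cont continuous_on_open_vimage[OF \<Omega>] by (metis Int_commute open_ball)
    then show ?thesis using S(1) by (auto simp: T_def Collect_conj_eq vimage_def)
  qed
  have TO: "T n \<subseteq> \<Omega>" for n by (auto simp: T_def)
  have mono: "incseq T" by (auto simp: incseq_def T_def)
  have UT: "(\<Union>n. T n) = S"
  proof -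
    have "\<exists>n. \<phi> z \<in> ball 0 (real n)" for z using reals_Archimedean2[of "norm (\<phi> z)"] by auto
    then show ?thesis using S(2) by (auto simp: T_def)
  qed
  have "emeasure lborel (\<phi> ` S) = (SUP n. emeasure lborel (\<phi> ` T n))"
  proof -
    have "\<phi> ` S = (\<Union>n. \<phi> ` T n)" using UT by blast
    moreover have "incseq (\<lambda>n. \<phi> ` T n)" using mono by (auto simp: incseq_def)
    ultimately show ?thesis using im[OF Tb TO] by (subst SUP_emeasure_incseq) auto
  qed
  also have "\<dots> = (SUP n. (\<integral>\<^sup>+ z\<in>T n. ennreal ((cmod (det (jac \<phi> z)))\<^sup>2) \<partial>lborel))"
  proof (rule SUP_cong[OF refl])
    fix n
    have "bounded (\<phi> ` T n)" by (rule bounded_subset[OF bounded_ball[of 0 "real n"]]) (auto simp: T_def)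
    then show "emeasure lborel (\<phi> ` T n) = (\<integral>\<^sup>+ z\<in>T n. ennreal ((cmod (det (jac \<phi> z)))\<^sup>2) \<partial>lborel)"
      by (intro emeasure_holomorphic_image_bounded[OF \<Omega> hol inv lin inj Tb TO im[OF Tb TO]])
  qed
  also have "\<dots> = (\<integral>\<^sup>+ z\<in>S. ennreal ((cmod (det (jac \<phi> z)))\<^sup>2) \<partial>lborel)"
  proof -
    \<comment> \<open>The Jacobian is controlled on \<Omega> only; the indicator makes the density
      Borel on the whole space.\<close>
    define j where "j = (\<lambda>z. ennreal ((cmod (indicator \<Omega> z *\<^sub>R det (jac \<phi> z)))\<^sup>2))"
    have "(\<lambda>z. det (jac \<phi> z)) \<in> borel_measurable (restrict_space borel \<Omega>)"
      using smooth_on_continuous[OF smooth_on_det[OF \<Omega> smooth_on_jac[OF \<Omega> hol]]]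
      by (rule borel_measurable_continuous_on_restrict)
    then have "(\<lambda>z. indicator \<Omega> z *\<^sub>R det (jac \<phi> z)) \<in> borel_measurable borel"
      using \<Omega> by (subst (asm) borel_measurable_restrict_space_iff) auto
    then have j: "j \<in> borel_measurable lborel" unfolding j_def by measurable
    have eq: "(\<integral>\<^sup>+ z\<in>B. ennreal ((cmod (det (jac \<phi> z)))\<^sup>2) \<partial>lborel) = emeasure (density lborel j) B" if "B \<subseteq> \<Omega>" "B \<in> sets borel" for B
      using that j by (subst emeasure_density) (auto intro!: nn_integral_cong simp: j_def indicator_def)
    show ?thesis
      unfolding eq[OF TO Tb] eq[OF S(2,1)] using Tb mono UT by (subst SUP_emeasure_incseq) auto
  qed
  finally show ?thesis .
qed

text \<open>The formula for sets says that two measures coincide: the Jacobian density on S pushed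
  forward by \<phi>, and Lebesgue measure restricted to the image. Integrating f against both gives
  the formula for functions.\<close>

lemma nn_integral_holomorphic_image:
  fixes \<phi> :: "'n::{finite,linorder} cvec \<Rightarrow> 'n cvec"
  assumes \<Omega>: "open \<Omega>" and hol: "holomorphic_map_on \<Omega> \<phi>" and inv: "\<And>z. z \<in> \<Omega> \<Longrightarrow> invertible (jac \<phi> z)"
    and lin: "\<And>z v. z \<in> \<Omega> \<Longrightarrow> frechet_derivative \<phi> (at z) v = jac \<phi> z *v v"
    and inj: "inj_on \<phi> \<Omega>" and S: "S \<in> sets borel" "S \<subseteq> \<Omega>"
    and im: "\<And>T. T \<in> sets borel \<Longrightarrow> T \<subseteq> \<Omega> \<Longrightarrow> \<phi> ` T \<in> sets borel"
    and f: "f \<in> borel_measurable borel"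
  shows "(\<integral>\<^sup>+ y\<in>\<phi> ` S. f y \<partial>lborel) = (\<integral>\<^sup>+ z\<in>S. ennreal ((cmod (det (jac \<phi> z)))\<^sup>2) * f (\<phi> z) \<partial>lborel)"
proof -
  define j where "j = (\<lambda>z. ennreal ((cmod (indicator \<Omega> z *\<^sub>R det (jac \<phi> z)))\<^sup>2) * indicator S z)"
  define p where "p = (\<lambda>z. indicator \<Omega> z *\<^sub>R \<phi> z)"
  have "(\<lambda>z. det (jac \<phi> z)) \<in> borel_measurable (restrict_space borel \<Omega>)"
    using smooth_on_continuous[OF smooth_on_det[OF \<Omega> smooth_on_jac[OF \<Omega> hol]]]
    by (rule borel_measurable_continuous_on_restrict)
  then have "(\<lambda>z. indicator \<Omega> z *\<^sub>R det (jac \<phi> z)) \<in> borel_measurable borel"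
    using \<Omega> by (subst (asm) borel_measurable_restrict_space_iff) auto
  then have j: "j \<in> borel_measurable lborel" unfolding j_def using S(1) by measurable
  have "\<phi> \<in> borel_measurable (restrict_space borel \<Omega>)"
    using hol by (intro borel_measurable_continuous_on_restrict smooth_on_continuous) (simp add: holomorphic_map_on_def)
  then have p: "p \<in> borel_measurable borel"
    using \<Omega> unfolding p_def by (subst (asm) borel_measurable_restrict_space_iff) auto
  have "distr (density lborel j) borel p = density lborel (indicator (\<phi> ` S))"
  proof (rule measure_eqI)
    fix B assume "B \<in> sets (distr (density lborel j) borel p)"
    then have B: "B \<in> sets borel" by simp
    define T where "T = S \<inter> p -` B"
    have T: "T \<in> sets borel" "T \<subseteq> \<Omega>" unfolding T_def using S measurable_sets[OF p B] by auto
    have "emeasure (distr (density lborel j) borel p) B = emeasure (density lborel j) (p -` B)"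
      using p B by (subst emeasure_distr) auto
    also have "\<dots> = (\<integral>\<^sup>+ z. j z * indicator (p -` B) z \<partial>lborel)"
      using j measurable_sets[OF p B] by (intro emeasure_density) auto
    also have "\<dots> = (\<integral>\<^sup>+ z\<in>T. ennreal ((cmod (det (jac \<phi> z)))\<^sup>2) \<partial>lborel)"
      using S(2) by (intro nn_integral_cong) (auto simp: j_def T_def indicator_def)
    also have "\<dots> = emeasure lborel (\<phi> ` T)"
      by (rule emeasure_holomorphic_image[OF \<Omega> hol inv lin inj T im, symmetric])
    also have "\<phi> ` T = \<phi> ` S \<inter> B" using S(2) by (auto simp: T_def p_def indicator_def)
    also have "emeasure lborel (\<phi> ` S \<inter> B) = emeasure (density lborel (indicator (\<phi> ` S))) B"
      using B im[OF S] by (subst emeasure_density) (auto simp flip: nn_integral_indicator intro!: nn_integral_cong simp: indicator_def)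
    finally show "emeasure (distr (density lborel j) borel p) B = emeasure (density lborel (indicator (\<phi> ` S))) B" .
  qed simp
  then have "(\<integral>\<^sup>+ y. f y \<partial>density lborel (indicator (\<phi> ` S))) = (\<integral>\<^sup>+ y. f y \<partial>distr (density lborel j) borel p)" by simp
  also have "\<dots> = (\<integral>\<^sup>+ z. j z * f (p z) \<partial>lborel)"
    using p f j by (subst nn_integral_distr) (auto intro!: nn_integral_density)
  also have "\<dots> = (\<integral>\<^sup>+ z\<in>S. ennreal ((cmod (det (jac \<phi> z)))\<^sup>2) * f (\<phi> z) \<partial>lborel)"
    using S(2) by (intro nn_integral_cong) (auto simp: j_def p_def indicator_def)
  also have "(\<integral>\<^sup>+ y. f y \<partial>density lborel (indicator (\<phi> ` S))) = (\<integral>\<^sup>+ y\<in>\<phi> ` S. f y \<partial>lborel)"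
    using f im[OF S] by (subst nn_integral_density) (auto simp: mult.commute)
  finally show ?thesis .
qed

section \<open>Gluing the volume measure from charts\<close>

lemma det_herm_matrix_coframe:
  assumes "orthonormal_coframe w C"
  shows "det (herm_matrix w) = complex_of_real ((cmod (det C))\<^sup>2)" "cmod (det C) > 0"
proof -
  have "det (cmat C) = cnj (det C)" by (simp add: det_def cmat_def)
  then show "det (herm_matrix w) = complex_of_real ((cmod (det C))\<^sup>2)"
    unfolding herm_matrix_coframe[OF assms] det_mul det_transpose by (simp only: complex_norm_square)
  show "cmod (det C) > 0" using assms invertible_det_nz by (auto simp: orthonormal_coframe_def)
qed

context hermitian_manifold
begin

definition dens :: "('x, 'n) chart \<Rightarrow> 'n cvec \<Rightarrow> real" where
  "dens c z = 2 ^ CARD('n) * Re (det (herm_matrix (local_expr A c \<omega> z)))"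

lemma assumes "c \<in> A" "z \<in> chart_image c" shows dens_pos: "dens c z > 0"
  and dens_complex: "complex_of_real (dens c z) = 2 ^ CARD('n) * det (herm_matrix (local_expr A c \<omega> z))"
proof -
  obtain C where "orthonormal_coframe (local_expr A c \<omega> z) C"
    using local_metric_coframed[OF assms] by (auto simp: coframed_def)
  from det_herm_matrix_coframe[OF this]
  show "dens c z > 0" "complex_of_real (dens c z) = 2 ^ CARD('n) * det (herm_matrix (local_expr A c \<omega> z))"
    by (simp_all add: dens_def)
qed

lemma smooth_dens: assumes "c \<in> A" shows "smooth_on (chart_image c) (dens c)"
proof -
  interpret smooth_metric "chart_image c" "local_expr A c \<omega>" by (rule smooth_metric_local[OF assms])
  have "smooth_on (chart_image c) (\<lambda>z. 2 ^ CARD('n) * Re (rho z))"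
    by (intro smooth_on_mult smooth_on_const smooth_on_bounded_linear[OF bounded_linear_Re] smooth_rho U)
  then show ?thesis by (simp add: dens_def[abs_def] rho_def)
qed

text \<open>The density is the constant times |det C|^2 for any coframe matrix C, and the transition
  map multiplies C by its Jacobian.\<close>

lemma dens_change:
  assumes cd: "c \<in> A" "d \<in> A" and z: "z \<in> overlap c d"
  shows "dens c z = (cmod (det (jac (tmap c d) z)))\<^sup>2 * dens d (tmap c d z)"
proof -
  let ?J = "jac (tmap c d) z" and ?w = "local_expr A d \<omega> (tmap c d z)"
  have "tmap c d z \<in> chart_image d" using tmap_mem[OF cd z] overlap_subset[OF cd(2,1)] by auto
  then obtain C where C: "orthonormal_coframe ?w C"
    using local_metric_coframed[OF cd(2)] by (auto simp: coframed_def)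
  have C': "orthonormal_coframe (local_expr A c \<omega> z) (C ** ?J)"
    unfolding local_expr_change[OF cd z] by (rule coframed_subst[OF C jac_invertible[OF cd z]])
  show ?thesis
    unfolding dens_def det_herm_matrix_coframe(1)[OF C] det_herm_matrix_coframe(1)[OF C']
    by (simp add: det_mul norm_mult power_mult_distrib)
qed

lemma image_vimage: assumes "c \<in> A" "S \<subseteq> fst c" shows "snd c ` S = chart_image c \<inter> chart_inv c -` S"
proof
  show "snd c ` S \<subseteq> chart_image c \<inter> chart_inv c -` S"
    using inv_left[OF assms(1)] assms(2) by (auto simp: chart_image_def)
  show "chart_image c \<inter> chart_inv c -` S \<subseteq> snd c ` S"
    using inv_right[OF assms(1)] by (force simp: image_iff)
qed

lemma sets_vimage_inv: assumes "c \<in> A" "S \<in> sets borel" shows "chart_image c \<inter> chart_inv c -` S \<in> sets borel"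
proof -
  have "chart_inv c \<in> borel_measurable (restrict_space borel (chart_image c))"
    by (rule borel_measurable_continuous_on_restrict[OF cont_inv[OF assms(1)]])
  from measurable_sets[OF this assms(2)] have "chart_inv c -` S \<inter> chart_image c \<in> sets (restrict_space borel (chart_image c))"
    by (simp add: space_restrict_space)
  then show ?thesis
    using open_image[OF assms(1)] by (subst (asm) sets_restrict_space_iff) (auto simp: Int_commute)
qed

lemma sets_image: "c \<in> A \<Longrightarrow> S \<in> sets borel \<Longrightarrow> S \<subseteq> fst c \<Longrightarrow> snd c ` S \<in> sets borel"
  using sets_vimage_inv by (simp add: image_vimage)

lemma sets_vimage_chart: assumes "c \<in> A" "B \<in> sets borel" shows "fst c \<inter> snd c -` B \<in> sets borel"
proof -
  have "snd c \<in> borel_measurable (restrict_space borel (fst c))"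
    by (rule borel_measurable_continuous_on_restrict[OF cont_chart[OF assms(1)]])
  from measurable_sets[OF this assms(2)] have "snd c -` B \<inter> fst c \<in> sets (restrict_space borel (fst c))"
    by (simp add: space_restrict_space)
  then show ?thesis
    using open_dom[OF assms(1)] by (subst (asm) sets_restrict_space_iff) (auto simp: Int_commute)
qed

lemma dens_measurable: assumes "c \<in> A" shows "(\<lambda>z. indicator (chart_image c) z * dens c z) \<in> borel_measurable borel"
proof -
  have "dens c \<in> borel_measurable (restrict_space borel (chart_image c))"
    by (rule borel_measurable_continuous_on_restrict[OF smooth_on_continuous[OF smooth_dens[OF assms]]])
  then show ?thesis
    using open_image[OF assms] by (subst (asm) borel_measurable_restrict_space_iff) auto
qed

text \<open>The value of \<open>inv_ext\<close> outside the image of the chart is irrelevant.\<close>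

definition inv_ext :: "('x, 'n) chart \<Rightarrow> 'n cvec \<Rightarrow> 'x" where
  "inv_ext c z = (if z \<in> chart_image c then chart_inv c z else undefined)"

text \<open>The volume of one chart as a Borel measure on the whole manifold, without mass outside
  the domain of the chart.\<close>

definition chart_vol :: "('x, 'n) chart \<Rightarrow> 'x measure" where
  "chart_vol c = distr (density lborel (\<lambda>z. ennreal (indicator (chart_image c) z * dens c z))) borel (inv_ext c)"

lemma inv_ext_measurable: assumes "c \<in> A" shows "inv_ext c \<in> borel_measurable borel"
proof (rule borel_measurableI)
  fix S :: "'x set" assume "open S"
  then have S: "S \<in> sets borel" by simp
  have "inv_ext c -` S \<inter> space borel = (chart_image c \<inter> chart_inv c -` S) \<union> (if undefined \<in> S then - chart_image c else {})"
    by (auto simp: inv_ext_def split: if_splits)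
  then show "inv_ext c -` S \<inter> space borel \<in> sets borel"
    using sets_vimage_inv[OF assms S] open_image[OF assms] by auto
qed

lemma emeasure_chart_vol:
  assumes c: "c \<in> A" and S: "S \<in> sets borel"
  shows "emeasure (chart_vol c) S = (\<integral>\<^sup>+ z\<in>snd c ` (S \<inter> fst c). ennreal (dens c z) \<partial>lborel)"
proof -
  have im: "snd c ` (S \<inter> fst c) = chart_image c \<inter> chart_inv c -` S"
    using image_vimage[OF c, of "S \<inter> fst c"] inv_mem[OF c] by auto
  have v: "inv_ext c -` S \<in> sets borel" using measurable_sets[OF inv_ext_measurable[OF c] S] by simp
  have "emeasure (chart_vol c) S = emeasure (density lborel (\<lambda>z. ennreal (indicator (chart_image c) z * dens c z))) (inv_ext c -` S)"
    unfolding chart_vol_def using inv_ext_measurable[OF c] S by (subst emeasure_distr) auto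
  also have "\<dots> = (\<integral>\<^sup>+ z. ennreal (indicator (chart_image c) z * dens c z) * indicator (inv_ext c -` S) z \<partial>lborel)"
    using dens_measurable[OF c] v by (intro emeasure_density) auto
  also have "\<dots> = (\<integral>\<^sup>+ z\<in>snd c ` (S \<inter> fst c). ennreal (dens c z) \<partial>lborel)"
    unfolding im by (intro nn_integral_cong) (auto simp: indicator_def inv_ext_def)
  finally show ?thesis .
qed

lemma sets_chart_vol [simp]: "sets (chart_vol c) = sets borel" "space (chart_vol c) = UNIV"
  by (simp_all add: chart_vol_def)

text \<open>The factor |det|^2 in \<open>dens_change\<close> is the one in the change of variables
  formula.\<close>

lemma chart_vol_agree:
  assumes cd: "c \<in> A" "d \<in> A" and S: "S \<in> sets borel" "S \<subseteq> fst c" "S \<subseteq> fst d"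
  shows "emeasure (chart_vol c) S = emeasure (chart_vol d) S"
proof -
  let ?\<phi> = "tmap c d" and ?T = "snd c ` S"
  have T: "?T \<in> sets borel" "?T \<subseteq> overlap c d"
    using sets_image[OF cd(1) S(1,2)] S by (auto simp: overlap_def)
  have im: "?\<phi> ` snd c ` B = snd d ` B" if "B \<subseteq> fst c" for B
    using inv_left[OF cd(1)] that by (auto simp: tmap_def image_iff) (metis subsetD)+
  \<comment> \<open>A Borel set of coordinates in the overlap comes from a Borel set of the
    manifold. Its image under the transition map is then a chart image again, hence Borel.\<close>
  have sub: "\<exists>B. B \<in> sets borel \<and> B \<subseteq> fst c \<and> B \<subseteq> fst d \<and> R = snd c ` B" if R: "R \<in> sets borel" "R \<subseteq> overlap c d" for R
  proof (intro exI conjI)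
    show "fst c \<inter> snd c -` R \<in> sets borel" by (rule sets_vimage_chart[OF cd(1) R(1)])
    show "fst c \<inter> snd c -` R \<subseteq> fst d"
      using R(2) inv_left[OF cd(1)] by (auto simp: overlap_eq[OF cd(1)])
    show "R = snd c ` (fst c \<inter> snd c -` R)" using R(2) unfolding overlap_def by blast
  qed auto
  have inj: "inj_on ?\<phi> (overlap c d)"
  proof (rule inj_on_inverseI)
    show "tmap d c (?\<phi> z) = z" if "z \<in> overlap c d" for z
      using that inv_left[OF cd(1)] inv_left[OF cd(2)] by (auto simp: overlap_def tmap_def)
  qed
  have imb: "?\<phi> ` R \<in> sets borel" if R: "R \<in> sets borel" "R \<subseteq> overlap c d" for R
  proof -
    obtain B where B: "B \<in> sets borel" "B \<subseteq> fst c" "B \<subseteq> fst d" "R = snd c ` B" using sub[OF R] by blast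
    show ?thesis unfolding B(4) im[OF B(2)] by (rule sets_image[OF cd(2) B(1,3)])
  qed
  have m: "(\<lambda>y. ennreal (indicator (chart_image d) y * dens d y)) \<in> borel_measurable borel"
    by (rule measurable_compose[OF dens_measurable[OF cd(2)] measurable_ennreal])
  have "emeasure (chart_vol d) S = (\<integral>\<^sup>+ y\<in>?\<phi> ` ?T. ennreal (indicator (chart_image d) y * dens d y) \<partial>lborel)"
    unfolding emeasure_chart_vol[OF cd(2) S(1)] im[OF S(2)] using S(3)
    by (intro nn_integral_cong) (auto simp: indicator_def Int_absorb2 chart_image_def)
  also have "\<dots> = (\<integral>\<^sup>+ z\<in>?T. ennreal ((cmod (det (jac ?\<phi> z)))\<^sup>2) * ennreal (indicator (chart_image d) (?\<phi> z) * dens d (?\<phi> z)) \<partial>lborel)"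
    by (rule nn_integral_holomorphic_image[OF open_overlap[OF cd] tmap_holomorphic[OF cd] jac_invertible[OF cd] frechet_jac[OF cd] inj T imb m])
  also have "\<dots> = (\<integral>\<^sup>+ z\<in>?T. ennreal (dens c z) \<partial>lborel)"
  proof (intro nn_integral_cong)
    fix z
    have "ennreal ((cmod (det (jac ?\<phi> z)))\<^sup>2) * ennreal (indicator (chart_image d) (?\<phi> z) * dens d (?\<phi> z)) = ennreal (dens c z)" if "z \<in> ?T"
    proof -
      have z: "z \<in> overlap c d" using that T by blast
      then have "?\<phi> z \<in> chart_image d" using tmap_mem[OF cd] overlap_subset[OF cd(2,1)] by auto
      then show ?thesis using ennreal_mult[OF zero_le_power2 less_imp_le[OF dens_pos[OF cd(2)]]] by (simp add: dens_change[OF cd z])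
    qed
    then show "ennreal ((cmod (det (jac ?\<phi> z)))\<^sup>2) * ennreal (indicator (chart_image d) (?\<phi> z) * dens d (?\<phi> z)) * indicator ?T z = ennreal (dens c z) * indicator ?T z"
      by (auto simp: indicator_def)
  qed
  also have "\<dots> = emeasure (chart_vol c) S"
    unfolding emeasure_chart_vol[OF cd(1) S(1)] using S(2) by (simp add: Int_absorb2)
  finally show ?thesis by simp
qed

text \<open>Second countability enters here: a Lindelof subcover by chart domains, made disjoint,
  cuts the manifold into countably many Borel pieces, each inside one chart.\<close>

lemma countable_cover:
  obtains c :: "nat \<Rightarrow> ('x, 'n) chart" and E :: "nat \<Rightarrow> 'x set" where "\<And>i. c i \<in> A" "\<And>i. E i \<in> sets borel" "\<And>i. E i \<subseteq> fst (c i)"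
    "disjoint_family E" "(\<Union>i. E i) = UNIV"
proof -
  obtain F where F: "F \<subseteq> fst ` A" "countable F" "\<Union>F = \<Union>(fst ` A)"
    using Lindelof[of "fst ` A"] open_dom by (metis (no_types, lifting) image_iff)
  have U: "\<Union>F = UNIV" using F(3) atlas by (simp add: complex_atlas_def)
  then have "F \<noteq> {}" by blast
  define D where "D = from_nat_into F"
  have D: "range D = F" unfolding D_def by (rule range_from_nat_into[OF \<open>F \<noteq> {}\<close> F(2)])
  have "\<forall>i. \<exists>c. c \<in> A \<and> D i = fst c" using D F(1) by blast
  then obtain c where c: "\<And>i. c i \<in> A" "\<And>i. D i = fst (c i)" by metis
  show ?thesis
  proof (rule that[of c "disjointed D"])
    have "range D \<subseteq> sets borel" using borel_open[OF open_dom[OF c(1)]] by (auto simp: c(2))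
    then show "disjointed D i \<in> sets borel" for i using sets.range_disjointed_sets[of D borel] by blast
    show "disjointed D i \<subseteq> fst (c i)" for i using disjointed_subset[of D i] c(2) by simp
    show "(\<Union>i. disjointed D i) = UNIV" using U D by (simp add: UN_disjointed_eq)
  qed (auto intro: c(1) disjoint_family_disjointed)
qed

text \<open>The volume of S is the sum of the chart volumes of its pieces, and
  \<open>chart_vol_agree\<close> identifies it with the volume in any other chart that contains
  S.\<close>

lemma volume_exists:
  "\<exists>\<mu>. sets \<mu> = sets borel \<and> (\<forall>c\<in>A. \<forall>S\<in>sets borel. S \<subseteq> fst c \<longrightarrow> emeasure \<mu> S = emeasure (chart_vol c) S)"
proof -
  obtain c :: "nat \<Rightarrow> ('x, 'n) chart" and E :: "nat \<Rightarrow> 'x set" where c: "\<And>i. c i \<in> A" and E: "\<And>i. E i \<in> sets borel" "\<And>i. E i \<subseteq> fst (c i)"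
    "disjoint_family E" "(\<Union>i. E i) = UNIV" by (rule countable_cover) blast
  define f where "f S = (\<Sum>i. emeasure (chart_vol (c i)) (S \<inter> E i))" for S
  define \<mu> where "\<mu> = measure_of (UNIV :: 'x set) (sets borel) f"
  have sets: "sets \<mu> = sets borel" unfolding \<mu>_def using sets.sigma_sets_eq[of "borel :: 'x measure"] by simp
  have "countably_additive (sets \<mu>) f"
    unfolding countably_additive_def
  proof (intro allI impI)
    fix B :: "nat \<Rightarrow> 'x set"
    assume B: "range B \<subseteq> sets \<mu>" "disjoint_family B" "(\<Union>k. B k) \<in> sets \<mu>"
    \<comment> \<open>Countable additivity exchanges two sums of nonnegative terms; one of them is
      read as an integral over the counting measure.\<close>
    have "(\<Sum>k. f (B k)) = (\<Sum>k. \<integral>\<^sup>+ i. emeasure (chart_vol (c i)) (B k \<inter> E i) \<partial>count_space UNIV)"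
      by (simp add: f_def nn_integral_count_space_nat)
    also have "\<dots> = (\<integral>\<^sup>+ i. (\<Sum>k. emeasure (chart_vol (c i)) (B k \<inter> E i)) \<partial>count_space UNIV)"
      by (rule nn_integral_suminf[symmetric]) simp
    also have "\<dots> = (\<integral>\<^sup>+ i. emeasure (chart_vol (c i)) ((\<Union>k. B k) \<inter> E i) \<partial>count_space UNIV)"
    proof (intro nn_integral_cong)
      fix i
      have "(\<Sum>k. emeasure (chart_vol (c i)) (B k \<inter> E i)) = emeasure (chart_vol (c i)) (\<Union>k. B k \<inter> E i)"
        using B E(1) by (intro suminf_emeasure) (auto simp: sets disjoint_family_on_def)
      then show "(\<Sum>k. emeasure (chart_vol (c i)) (B k \<inter> E i)) = emeasure (chart_vol (c i)) ((\<Union>k. B k) \<inter> E i)" by (simp add: Int_UN_distrib2)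
    qed
    finally show "(\<Sum>k. f (B k)) = f (\<Union>k. B k)" by (simp add: f_def nn_integral_count_space_nat)
  qed
  then have em: "emeasure \<mu> S = f S" if "S \<in> sets borel" for S
    using that by (intro emeasure_measure_of[OF \<mu>_def]) (auto simp: sets positive_def f_def)
  have "emeasure \<mu> S = emeasure (chart_vol d) S" if d: "d \<in> A" and S: "S \<in> sets borel" "S \<subseteq> fst d" for d S
  proof -
    have "emeasure \<mu> S = (\<Sum>i. emeasure (chart_vol d) (S \<inter> E i))"
      unfolding em[OF S(1)] f_def using S E
      by (intro suminf_cong chart_vol_agree[OF c d]) auto
    also have "\<dots> = emeasure (chart_vol d) (\<Union>i. S \<inter> E i)"
    proof (rule suminf_emeasure)
      show "disjoint_family (\<lambda>i. S \<inter> E i)" using E(3) unfolding disjoint_family_on_def by blast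
    qed (use S E(1) in auto)
    also have "(\<Union>i. S \<inter> E i) = S" using E(4) by blast
    finally show ?thesis .
  qed
  with sets show ?thesis by blast
qed

lemma volume_unique:
  assumes "sets \<mu> = sets borel" "\<And>c S. c \<in> A \<Longrightarrow> S \<in> sets borel \<Longrightarrow> S \<subseteq> fst c \<Longrightarrow> emeasure \<mu> S = emeasure (chart_vol c) S"
    and "sets \<nu> = sets borel" "\<And>c S. c \<in> A \<Longrightarrow> S \<in> sets borel \<Longrightarrow> S \<subseteq> fst c \<Longrightarrow> emeasure \<nu> S = emeasure (chart_vol c) S"
  shows "\<mu> = \<nu>"
proof (rule measure_eqI)
  obtain c :: "nat \<Rightarrow> ('x, 'n) chart" and E :: "nat \<Rightarrow> 'x set" where c: "\<And>i. c i \<in> A" and E: "\<And>i. E i \<in> sets borel" "\<And>i. E i \<subseteq> fst (c i)"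
    "disjoint_family E" "(\<Union>i. E i) = UNIV" by (rule countable_cover) blast
  fix S assume "S \<in> sets \<mu>"
  then have S: "S \<in> sets borel" by (simp add: assms)
  have SU: "(\<Union>i. S \<inter> E i) = S" using E(4) by blast
  have dis: "disjoint_family (\<lambda>i. S \<inter> E i)" using E(3) unfolding disjoint_family_on_def by blast
  have SE: "range (\<lambda>i. S \<inter> E i) \<subseteq> sets borel" using S E(1) by auto
  have "emeasure \<mu> (\<Union>i. S \<inter> E i) = (\<Sum>i. emeasure \<mu> (S \<inter> E i))"
    using SE assms(1) by (intro suminf_emeasure[symmetric] dis) simp
  also have "\<dots> = (\<Sum>i. emeasure \<nu> (S \<inter> E i))"
  proof (intro suminf_cong)
    fix i
    have "S \<inter> E i \<in> sets borel" "S \<inter> E i \<subseteq> fst (c i)" using S E(1,2) by auto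
    then show "emeasure \<mu> (S \<inter> E i) = emeasure \<nu> (S \<inter> E i)"
      using assms(2)[OF c] assms(4)[OF c] by simp
  qed
  also have "\<dots> = emeasure \<nu> (\<Union>i. S \<inter> E i)"
    using SE assms(3) by (intro suminf_emeasure dis) simp
  finally show "emeasure \<mu> S = emeasure \<nu> S" unfolding SU .
qed (simp add: assms)

abbreviation "vol \<equiv> volume A \<omega>"

lemma volume_props:
  shows sets_volume [simp]: "sets vol = sets borel"
    and emeasure_volume: "c \<in> A \<Longrightarrow> S \<in> sets borel \<Longrightarrow> S \<subseteq> fst c \<Longrightarrow> emeasure vol S = emeasure (chart_vol c) S"
proof -
  have eq: "emeasure (chart_vol c) S = (\<integral>\<^sup>+ z\<in>snd c ` S. ennreal (2 ^ CARD('n) * Re (det (herm_matrix (local_expr A c \<omega> z)))) \<partial>lborel)"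
    if "c \<in> A" "S \<in> sets borel" "S \<subseteq> fst c" for c S
    using that by (simp add: emeasure_chart_vol Int_absorb2 dens_def)
  let ?P = "\<lambda>\<mu>. sets \<mu> = sets borel \<and> (\<forall>c\<in>A. \<forall>S\<in>sets borel. S \<subseteq> fst c \<longrightarrow>
        emeasure \<mu> S = (\<integral>\<^sup>+ z\<in>snd c ` S. ennreal (2 ^ CARD('n) * Re (det (herm_matrix (local_expr A c \<omega> z)))) \<partial>lborel))"
  have "\<exists>!\<mu>. ?P \<mu>"
  proof (rule ex_ex1I)
    show "\<exists>\<mu>. ?P \<mu>" using volume_exists eq by auto
    show "\<mu> = \<nu>" if "?P \<mu>" "?P \<nu>" for \<mu> \<nu>
      using that by (intro volume_unique) (auto simp: eq)
  qed
  from theI'[OF this] have P: "?P vol" by (simp add: volume_def)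
  then show "sets vol = sets borel" by blast
  show "emeasure vol S = emeasure (chart_vol c) S" if "c \<in> A" "S \<in> sets borel" "S \<subseteq> fst c"
    using P eq[OF that] that by auto
qed

lemma density_volume_chart:
  assumes c: "c \<in> A" shows "density vol (indicator (fst c)) = chart_vol c"
proof (rule measure_eqI)
  fix S assume "S \<in> sets (density vol (indicator (fst c)))"
  then have S: "S \<in> sets borel" by simp
  have o: "fst c \<in> sets borel" using open_dom[OF c] by simp
  have "emeasure (density vol (indicator (fst c))) S = (\<integral>\<^sup>+ x. indicator (S \<inter> fst c) x \<partial>vol)"
  proof -
    have "emeasure (density vol (indicator (fst c))) S = (\<integral>\<^sup>+ x. indicator (fst c) x * indicator S x \<partial>vol)"
      using S o by (intro emeasure_density borel_measurable_indicator) simp_all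
    also have "\<dots> = (\<integral>\<^sup>+ x. indicator (S \<inter> fst c) x \<partial>vol)"
      by (intro nn_integral_cong) (auto split: split_indicator)
    finally show ?thesis .
  qed
  also have "\<dots> = emeasure vol (S \<inter> fst c)" using S o by simp
  also have "\<dots> = emeasure (chart_vol c) (S \<inter> fst c)" using S o by (intro emeasure_volume c) auto
  also have "\<dots> = emeasure (chart_vol c) S" using S o by (simp add: emeasure_chart_vol[OF c])
  finally show "emeasure (density vol (indicator (fst c))) S = emeasure (chart_vol c) S" .
qed simp

lemma volume_chart:
  fixes F :: "'x \<Rightarrow> complex"
  assumes c: "c \<in> A" and F: "F \<in> borel_measurable borel" "\<And>y. y \<notin> fst c \<Longrightarrow> F y = 0"
  shows integral_volume_chart: "(\<integral>y. F y \<partial>vol) = (\<integral>z. indicator (chart_image c) z *\<^sub>R (dens c z *\<^sub>R F (chart_inv c z)) \<partial>lborel)"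
    and integrable_volume_chart: "integrable vol F \<longleftrightarrow> integrable lborel (\<lambda>z. indicator (chart_image c) z *\<^sub>R (dens c z *\<^sub>R F (chart_inv c z)))"
proof -
  let ?d = "\<lambda>z. indicator (chart_image c) z * dens c z"
  have Fv: "F \<in> borel_measurable vol" using F(1) by (simp add: measurable_def sets_eq_imp_space_eq[OF sets_volume])
  have ind: "(\<lambda>y. indicat_real (fst c) y *\<^sub>R F y) = F" using F(2) by (auto simp: fun_eq_iff indicator_def)
  have i1: "(indicator (fst c) :: 'x \<Rightarrow> ennreal) = (\<lambda>y. ennreal (indicator (fst c) y))" by (auto simp: fun_eq_iff indicator_def)
  have o: "indicat_real (fst c) \<in> borel_measurable vol"
    using open_dom[OF c] by (intro borel_measurable_indicator) simp
  have nn: "AE z in lborel. 0 \<le> ?d z" using dens_pos[OF c] by (auto simp: indicator_def less_imp_le)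
  have dm: "?d \<in> borel_measurable lborel" using dens_measurable[OF c] by simp
  have Fi: "(\<lambda>z. F (inv_ext c z)) \<in> borel_measurable lborel" using measurable_compose[OF inv_ext_measurable[OF c] F(1)] by simp
  have eq: "(\<lambda>z. ?d z *\<^sub>R F (inv_ext c z)) = (\<lambda>z. indicator (chart_image c) z *\<^sub>R (dens c z *\<^sub>R F (chart_inv c z)))"
    by (auto simp: fun_eq_iff indicator_def inv_ext_def)
  have "(\<integral>y. F y \<partial>vol) = (\<integral>y. F y \<partial>density vol (\<lambda>y. ennreal (indicator (fst c) y)))"
    using integral_density[OF Fv o] ind by simp
  also have "\<dots> = (\<integral>y. F y \<partial>chart_vol c)" using density_volume_chart[OF c] by (simp add: i1)
  also have "\<dots> = (\<integral>z. F (inv_ext c z) \<partial>density lborel (\<lambda>z. ennreal (?d z)))"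
    unfolding chart_vol_def using inv_ext_measurable[OF c] F(1) by (intro integral_distr) auto
  also have "\<dots> = (\<integral>z. ?d z *\<^sub>R F (inv_ext c z) \<partial>lborel)"
    by (rule integral_density[OF Fi dm nn])
  finally show "(\<integral>y. F y \<partial>vol) = (\<integral>z. indicator (chart_image c) z *\<^sub>R (dens c z *\<^sub>R F (chart_inv c z)) \<partial>lborel)" unfolding eq .
  have "integrable vol F \<longleftrightarrow> integrable (density vol (\<lambda>y. ennreal (indicator (fst c) y))) F"
    using integrable_density[OF Fv o] ind by simp
  also have "\<dots> \<longleftrightarrow> integrable (chart_vol c) F" using density_volume_chart[OF c] by (simp add: i1)
  also have "\<dots> \<longleftrightarrow> integrable (density lborel (\<lambda>z. ennreal (?d z))) (\<lambda>z. F (inv_ext c z))"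
    unfolding chart_vol_def using inv_ext_measurable[OF c] F(1) by (intro integrable_distr_eq) auto
  also have "\<dots> \<longleftrightarrow> integrable lborel (\<lambda>z. ?d z *\<^sub>R F (inv_ext c z))"
    by (rule integrable_density[OF Fi dm nn])
  finally show "integrable vol F \<longleftrightarrow> integrable lborel (\<lambda>z. indicator (chart_image c) z *\<^sub>R (dens c z *\<^sub>R F (chart_inv c z)))" unfolding eq .
qed

end

section \<open>Integration by parts\<close>

lemma continuous_compact_support_bounded:
  fixes f :: "'a::euclidean_space \<Rightarrow> real"
  assumes "continuous_on UNIV f" "compact K" "\<And>x. x \<notin> K \<Longrightarrow> f x = 0"
  obtains B where "0 \<le> B" "\<And>x. \<bar>f x\<bar> \<le> B"
proof -
  have "compact (f ` K)" using assms by (intro compact_continuous_image) (auto intro: continuous_on_subset)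
  then obtain B where B: "\<And>x. x \<in> K \<Longrightarrow> \<bar>f x\<bar> \<le> B" using compact_imp_bounded by (force simp: bounded_iff)
  show ?thesis
    by (rule that[of "max B 0"]) (use B assms(3) in \<open>auto, metis abs_zero linear max.coboundedI1 max.coboundedI2\<close>)
qed

lemma integrable_compact_support:
  fixes f :: "'a::euclidean_space \<Rightarrow> 'b::{banach, second_countable_topology}"
  assumes "compact K" "continuous_on K f" "\<And>x. x \<notin> K \<Longrightarrow> f x = 0"
  shows "integrable lborel f"
proof -
  have "(\<lambda>x. indicator K x *\<^sub>R f x) = f" using assms(3) by (auto simp: fun_eq_iff indicator_def)
  then show ?thesis using borel_integrable_compact[OF assms(1,2)] by simp
qed

lemma dd_zero_outside:
  assumes "closed K" "\<And>x. x \<notin> K \<Longrightarrow> f x = 0" "x \<notin> K"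
  shows "dd f v x = 0"
proof -
  have "dd f v x = dd (\<lambda>x. 0) v x"
    by (rule dd_cong(2)[of "- K" x]) (use assms in auto)
  then show ?thesis by simp
qed

text \<open>Each difference quotient \<open>q n\<close> integrates to zero by translation
  invariance, and dominated convergence passes to the derivative. The mean value theorem turns the
  quotients into values of the derivative, which gives both the limit and the bound.\<close>

lemma integral_dd_zero_real:
  fixes f :: "'a::euclidean_space \<Rightarrow> real"
  assumes sm: "smooth_on UNIV f" and K: "compact K" and out: "\<And>x. x \<notin> K \<Longrightarrow> f x = 0"
  shows "integrable lborel (dd f v)" "(\<integral>x. dd f v x \<partial>lborel) = 0"
proof -
  have cf: "continuous_on UNIV f" and cd: "continuous_on UNIV (dd f v)"
    using sm smooth_on_dd smooth_on_continuous by blast+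
  have dout: "dd f v x = 0" if "x \<notin> K" for x
    by (rule dd_zero_outside[OF compact_imp_closed[OF K] out that])
  show int: "integrable lborel (dd f v)"
    by (rule integrable_compact_support[OF K continuous_on_subset[OF cd] dout]) auto
  have fint: "integrable lborel f"
    by (rule integrable_compact_support[OF K continuous_on_subset[OF cf] out]) auto
  obtain B where B: "0 \<le> B" "\<And>x. \<bar>dd f v x\<bar> \<le> B"
    using continuous_compact_support_bounded[OF cd K dout] by blast
  \<comment> \<open>All points from which some translate by s v with s between 0 and 1 reaches K. It
    is compact, and every quotient \<open>q n\<close> vanishes outside it.\<close>
  define L where "L = (\<lambda>(y, s). y - s *\<^sub>R v) ` (K \<times> {0..1})"
  have L: "compact L" unfolding L_def
    by (intro compact_continuous_image compact_Times K) (auto intro!: continuous_intros simp: case_prod_beta)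
  define q where "q n x = real (Suc n) * (f (x + (1 / real (Suc n)) *\<^sub>R v) - f x)" for n x
  have q: "\<exists>\<xi>. 0 < \<xi> \<and> \<xi> < 1 / real (Suc n) \<and> q n x = dd f v (x + \<xi> *\<^sub>R v)" for n x
  proof -
    obtain \<xi> where "0 < \<xi>" "\<xi> < 1 / real (Suc n)" "f (x + (1 / real (Suc n)) *\<^sub>R v) - f x = 1 / real (Suc n) * dd f v (x + \<xi> *\<^sub>R v)"
      by (rule dd_mvt[of "1 / real (Suc n)" f x v]) (use smooth_on_differentiable[OF sm] in auto)
    then show ?thesis by (intro exI[of _ \<xi>]) (simp add: q_def)
  qed
  have lim: "(\<lambda>n. q n x) \<longlonglongrightarrow> dd f v x" for x
  proof -
    obtain \<xi> where xi: "\<And>n. 0 < \<xi> n" "\<And>n. \<xi> n < 1 / real (Suc n)" "\<And>n. q n x = dd f v (x + \<xi> n *\<^sub>R v)" using q[of _ x] by metis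
    have "\<xi> \<longlonglongrightarrow> 0"
      by (rule tendsto_sandwich[OF _ _ tendsto_const LIMSEQ_inverse_real_of_nat])
        (use xi(1,2) in \<open>auto intro!: always_eventually less_imp_le simp: inverse_eq_divide\<close>)
    then have "(\<lambda>n. x + \<xi> n *\<^sub>R v) \<longlonglongrightarrow> x + 0 *\<^sub>R v" by (intro tendsto_intros)
    then have "(\<lambda>n. dd f v (x + \<xi> n *\<^sub>R v)) \<longlonglongrightarrow> dd f v (x + 0 *\<^sub>R v)"
      using cd by (auto simp: continuous_on_eq_continuous_at intro!: isCont_tendsto_compose[of _ "dd f v"])
    then show ?thesis by (simp add: xi(3))
  qed
  have qm: "q n \<in> borel_measurable lborel" for n
  proof -
    have "continuous_on UNIV (q n)" unfolding q_def by (intro continuous_intros continuous_on_compose2[OF cf]) auto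
    then show ?thesis using borel_measurable_continuous_onI by (simp add: measurable_lborel1)
  qed
  have bound: "norm (q n x) \<le> indicator L x *\<^sub>R B" for n x
  proof (cases "x \<in> L")
    case True
    then show ?thesis using q[of n x] B(2) by auto
  next
    case False
    obtain \<xi> where xi: "0 < \<xi>" "\<xi> < 1 / real (Suc n)" "q n x = dd f v (x + \<xi> *\<^sub>R v)" using q[of n x] by blast
    have "1 / real (Suc n) \<le> 1" by simp
    then have "\<xi> \<in> {0..1}" unfolding atLeastAtMost_iff using xi(1,2) by linarith
    then have "x + \<xi> *\<^sub>R v \<notin> K" using False unfolding L_def by (force simp: image_iff)
    then show ?thesis using xi(3) dout B(1) by simp
  qed
  have "(\<lambda>n. \<integral>x. q n x \<partial>lborel) \<longlonglongrightarrow> (\<integral>x. dd f v x \<partial>lborel)"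
  proof (rule integral_dominated_convergence[where w = "\<lambda>x. indicator L x *\<^sub>R B"])
    show "integrable lborel (\<lambda>x. indicator L x *\<^sub>R B)" by (rule borel_integrable_compact[OF L]) simp
  qed (use qm lim bound int in auto)
  moreover have "(\<integral>x. q n x \<partial>lborel) = 0" for n
  proof -
    let ?a = "(1 / real (Suc n)) *\<^sub>R v"
    have fm: "f \<in> borel_measurable borel" using cf by (rule borel_measurable_continuous_onI)
    have "integrable lborel (\<lambda>x. f (?a + x))" 
      using fint fm integrable_distr_eq[of "(+) ?a" lborel borel f] by (simp add: lborel_distr_plus)
    moreover have "(\<integral>x. f (?a + x) \<partial>lborel) = (\<integral>x. f x \<partial>lborel)"
      using fm integral_distr[of "(+) ?a" lborel borel f] by (simp add: lborel_distr_plus)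
    ultimately show ?thesis unfolding q_def using fint by (simp add: add.commute)
  qed
  ultimately have "(\<lambda>n. 0) \<longlonglongrightarrow> (\<integral>x. dd f v x \<partial>lborel)" by simp
  then show "(\<integral>x. dd f v x \<partial>lborel) = 0" using LIMSEQ_unique tendsto_const by blast
qed

lemma integral_wsb_zero:
  fixes f :: "complex ^ 'n::finite \<Rightarrow> complex"
  assumes sm: "smooth_on UNIV f" and K: "compact K" and out: "\<And>x. x \<notin> K \<Longrightarrow> f x = 0"
  shows "integrable lborel (wsb j f)" "(\<integral>x. wsb j f x \<partial>lborel) = 0"
proof -
  have fd: "f differentiable (at x)" for x using smooth_on_differentiable[OF sm] by simp
  have re: "integrable lborel (dd (\<lambda>x. Re (f x)) v)" "(\<integral>x. dd (\<lambda>x. Re (f x)) v x \<partial>lborel) = 0"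
    and im: "integrable lborel (dd (\<lambda>x. Im (f x)) v)" "(\<integral>x. dd (\<lambda>x. Im (f x)) v x \<partial>lborel) = 0" for v
    using out by (intro integral_dd_zero_real[OF smooth_on_bounded_linear[OF bounded_linear_Re open_UNIV sm] K]
       integral_dd_zero_real[OF smooth_on_bounded_linear[OF bounded_linear_Im open_UNIV sm] K]; simp)+
  have split: "dd f v = (\<lambda>x. complex_of_real (dd (\<lambda>x. Re (f x)) v x) + \<i> * complex_of_real (dd (\<lambda>x. Im (f x)) v x))" for v
    by (auto simp: fun_eq_iff complex_eq_iff dd_bounded_linear_comp(2)[OF bounded_linear_Re fd] dd_bounded_linear_comp(2)[OF bounded_linear_Im fd])
  have d: "integrable lborel (dd f v)" "(\<integral>x. dd f v x \<partial>lborel) = 0" for v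
    unfolding split using re[of v] im[of v] by (simp_all add: integrable_of_real)
  show "integrable lborel (wsb j f)" "(\<integral>x. wsb j f x \<partial>lborel) = 0"
    unfolding wsb_def[abs_def] using d by simp_all
qed

section \<open>Integration by parts inside one chart\<close>

context hermitian_manifold
begin

lemma continuous_inner:
  assumes "smooth_form A u" "smooth_form A v"
  shows "continuous_on UNIV (\<lambda>y. ext_inner (\<omega> y) (u y) (v y))"
proof -
  have "continuous (at x) (\<lambda>y. ext_inner (\<omega> y) (u y) (v y))" for x
  proof -
    let ?c = "chart_at A x"
    note c = chart_at(1)[of x]
    have "continuous_on (fst ?c) (\<lambda>y. (\<lambda>z. ext_inner (\<omega> (chart_inv ?c z)) (u (chart_inv ?c z)) (v (chart_inv ?c z))) (snd ?c y))"
      by (rule continuous_on_compose2[OF smooth_on_continuous[OF smooth_inner_function[OF assms c]] cont_chart[OF c]]) (auto simp: chart_image_def)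
    then have "continuous_on (fst ?c) (\<lambda>y. ext_inner (\<omega> y) (u y) (v y))"
      by (rule continuous_on_cong[THEN iffD1, rotated 2]) (simp_all add: inv_left[OF c])
    then show ?thesis using continuous_on_eq_continuous_at open_dom[OF c] chart_at(2) by blast
  qed
  then show ?thesis by (simp add: continuous_on_eq_continuous_at)
qed

lemma inner_measurable: "smooth_form A u \<Longrightarrow> smooth_form A v \<Longrightarrow> (\<lambda>y. ext_inner (\<omega> y) (u y) (v y)) \<in> borel_measurable borel"
  by (rule borel_measurable_continuous_onI[OF continuous_inner])

lemma compact_chart_image: "c \<in> A \<Longrightarrow> compact K \<Longrightarrow> K \<subseteq> fst c \<Longrightarrow> compact (snd c ` K)"
  by (rule compact_continuous_image[OF continuous_on_subset[OF cont_chart]])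

lemma integrable_inner:
  assumes u: "smooth_form A u" and v: "smooth_form A v" and c: "c \<in> A" and K: "compact K" "K \<subseteq> fst c"
    and out: "\<And>y. y \<notin> K \<Longrightarrow> u y = 0"
  shows "integrable vol (\<lambda>y. ext_inner (\<omega> y) (u y) (v y))"
proof -
  let ?F = "\<lambda>y. ext_inner (\<omega> y) (u y) (v y)"
  let ?G = "\<lambda>z. indicat_real (chart_image c) z *\<^sub>R (dens c z *\<^sub>R ?F (chart_inv c z))"
  have K': "snd c ` K \<subseteq> chart_image c" using K(2) by (auto simp: chart_image_def)
  have "continuous_on (chart_image c) (\<lambda>z. dens c z *\<^sub>R ?F (chart_inv c z))"
    by (intro continuous_on_scaleR smooth_on_continuous smooth_dens smooth_inner_function u v c)
  then have "continuous_on (snd c ` K) (\<lambda>z. dens c z *\<^sub>R ?F (chart_inv c z))" using K' continuous_on_subset by blast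
  then have "continuous_on (snd c ` K) ?G"
    by (rule continuous_on_cong[THEN iffD1, rotated 2]) (use K' in auto)
  moreover have "?G z = 0" if "z \<notin> snd c ` K" for z
  proof (cases "z \<in> chart_image c")
    case True
    then have "chart_inv c z \<notin> K" using that inv_right[OF c True] by (metis imageI)
    then show ?thesis using out by simp
  qed simp
  ultimately have "integrable lborel ?G" by (rule integrable_compact_support[OF compact_chart_image[OF c K]])
  moreover have "?F y = 0" if "y \<notin> fst c" for y
  proof -
    have "y \<notin> K" using that K(2) by blast
    then show ?thesis by (simp add: out)
  qed
  ultimately show ?thesis
    using integrable_volume_chart[OF c inner_measurable[OF u v]] by simp
qed

lemma delbar_zero_outside:
  assumes u: "smooth_form A u" and "closed K" "\<And>y. y \<notin> K \<Longrightarrow> u y = 0" "x \<notin> K"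
  shows "delbar A u x = 0"
proof -
  let ?c = "chart_at A x"
  note c = chart_at(1)[of x]
  let ?T = "chart_image ?c \<inter> chart_inv ?c -` (- K)"
  have o: "open ?T" using assms(2) by (intro open_preimage[OF c]) auto
  have x: "snd ?c x \<in> ?T" using assms(4) chart_at(2) image_mem[OF c] inv_left[OF c] by auto
  have "wirtbar j (local_expr A ?c u) (snd ?c x) = wirtbar j (\<lambda>z. 0) (snd ?c x)" for j
    by (rule wirtbar_cong[OF o x]) (use assms(3) in \<open>auto simp: local_expr_eq\<close>)
  then show ?thesis by (simp add: delbar_eq ldelbar_def)
qed

text \<open>In coordinates the integrand times the density is a constant multiple of the divergence
  of \<open>local_divergence\<close>, and each summand integrates to zero.\<close>

lemma chart_by_parts:
  assumes u: "smooth_form A u" and v: "smooth_form A v" and c: "c \<in> A" and K: "compact K" "K \<subseteq> fst c"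
    and out: "\<And>y. y \<notin> K \<Longrightarrow> u y = 0"
  shows "(\<integral>y. ext_inner (\<omega> y) (delbar A u y) (v y) - ext_inner (\<omega> y) (u y) (delbar_adj v y) \<partial>vol) = 0"
proof -
  interpret smooth_metric "chart_image c" "local_expr A c \<omega>" by (rule smooth_metric_local[OF c])
  let ?F = "\<lambda>y. ext_inner (\<omega> y) (delbar A u y) (v y) - ext_inner (\<omega> y) (u y) (delbar_adj v y)"
  let ?a = "local_expr A c u" and ?v = "local_expr A c v" and ?K = "snd c ` K"
  have su: "smooth_on (chart_image c) ?a" and sv: "smooth_on (chart_image c) ?v"
    by (intro smooth_formD u v c)+
  have K': "?K \<subseteq> chart_image c" using K(2) by (auto simp: chart_image_def)
  have cK: "compact ?K" by (rule compact_chart_image[OF c K])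
  have azero: "?a z = 0" if "z \<in> chart_image c" "z \<notin> ?K" for z
  proof -
    have "chart_inv c z \<notin> K" using that inv_right[OF c that(1)] by (metis imageI)
    then show ?thesis using out by (simp add: local_expr_eq)
  qed
  define f where "f j z = ip z (wedge (dzbar j) (?a z)) (?v z) * rho z" for j z
  \<comment> \<open>Extension by zero. It is smooth on the whole space because f j vanishes on the
    image of the chart outside a compact subset.\<close>
  define G where "G j z = (if z \<in> chart_image c then f j z else 0)" for j z
  have Gout: "G j z = 0" if "z \<notin> ?K" for j z
    using azero that by (simp add: G_def f_def)
  have sf: "smooth_on (chart_image c) (f j)" for j
    unfolding f_def by (intro smooth_on_mult smooth_inner smooth_on_wedge smooth_on_const su sv smooth_rho open_image[OF c])
  have sG: "smooth_on UNIV (G j)" for j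
  proof (rule smooth_on_local)
    fix z
    show "\<exists>T. open T \<and> z \<in> T \<and> smooth_on T (G j)"
    proof (cases "z \<in> ?K")
      case True
      have "smooth_on (chart_image c) (G j)"
        by (rule smooth_on_cong[OF open_image[OF c] _ sf]) (simp add: G_def)
      then show ?thesis using True K' open_image[OF c] by blast
    next
      case False
      have o: "open (- ?K)" using cK compact_imp_closed by blast
      have "smooth_on (- ?K) (G j)"
        by (rule smooth_on_cong[OF o _ smooth_on_const[of _ 0]]) (simp add: Gout)
      then show ?thesis using False o by blast
    qed
  qed
  have eq: "indicat_real (chart_image c) z *\<^sub>R (dens c z *\<^sub>R ?F (chart_inv c z)) = 2 ^ CARD('n) * (\<Sum>j\<in>UNIV. wsb j (G j) z)" for z
  proof (cases "z \<in> chart_image c")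
    case True
    have "?F (chart_inv c z) = ip z (ldelbar ?a z) (?v z) - ip z (?a z) (ldelbar_adj ?v z)"
      by (simp only: local_expr_inner[OF c True, symmetric] local_expr_delbar[OF u c True] local_expr_delbar_adj[OF v c True])
    then have "dens c z *\<^sub>R ?F (chart_inv c z) = 2 ^ CARD('n) * (rho z * (ip z (ldelbar ?a z) (?v z) - ip z (?a z) (ldelbar_adj ?v z)))"
      by (simp add: scaleR_conv_of_real dens_complex[OF c True] rho_def)
    also have "\<dots> = 2 ^ CARD('n) * (\<Sum>j\<in>UNIV. wsb j (f j) z)"
      unfolding local_divergence[OF True su sv, symmetric] f_def[abs_def] ..
    also have "(\<Sum>j\<in>UNIV. wsb j (f j) z) = (\<Sum>j\<in>UNIV. wsb j (G j) z)"
      by (intro sum.cong refl wsb_cong[OF open_image[OF c] True, symmetric] smooth_on_differentiable[OF sf True]) (simp add: G_def)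
    finally show ?thesis using True by simp
  next
    case False
    then have "z \<notin> ?K" using K' by auto
    then have "wsb j (G j) z = 0" for j
      by (simp add: wsb_def dd_zero_outside[OF compact_imp_closed[OF cK] Gout])
    then show ?thesis using False by simp
  qed
  have "?F y = 0" if "y \<notin> fst c" for y
  proof -
    have "y \<notin> K" using that K(2) by blast
    then show ?thesis using out delbar_zero_outside[OF u compact_imp_closed[OF K(1)] out] by simp
  qed
  moreover have "?F \<in> borel_measurable borel"
    by (intro borel_measurable_diff inner_measurable u v smooth_form_delbar smooth_form_delbar_adj)
  ultimately have "(\<integral>y. ?F y \<partial>vol) = (\<integral>z. 2 ^ CARD('n) * (\<Sum>j\<in>UNIV. wsb j (G j) z) \<partial>lborel)"
    unfolding eq[symmetric] by (intro integral_volume_chart[OF c])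
  also have "\<dots> = 0"
    using integral_wsb_zero[OF sG cK Gout] by simp
  finally show ?thesis .
qed

end

section \<open>Decomposition of test forms\<close>

context complex_manifold
begin

definition chart_bump :: "('x \<Rightarrow> real) \<Rightarrow> bool" where
  "chart_bump \<psi> \<longleftrightarrow> smooth_function A \<psi> \<and> (\<exists>c\<in>A. \<exists>K. compact K \<and> K \<subseteq> fst c \<and> (\<forall>y. y \<notin> K \<longrightarrow> \<psi> y = 0))"

lemma chart_bump_exists:
  obtains \<psi> V where "chart_bump \<psi>" "open V" "x \<in> V" "\<And>y. y \<in> V \<Longrightarrow> \<psi> y = 1"
proof -
  obtain \<psi> :: "'x \<Rightarrow> real" and V K where *: "smooth_function A \<psi>" "open V" "x \<in> V" "\<And>y. y \<in> V \<Longrightarrow> \<psi> y = 1"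
    "compact K" "K \<subseteq> fst (chart_at A x)" "\<And>y. y \<notin> K \<Longrightarrow> \<psi> y = 0"
    using smooth_function_bump[OF chart_at] by metis
  then have "chart_bump \<psi>" unfolding chart_bump_def using chart_at(1) by blast
  then show ?thesis using * that by blast
qed

text \<open>Takes the place of a partition of unity. Finitely many bumps suffice for one of them to
  be 1 at every point where u does not vanish. Splitting off \<psi> u for one bump leaves (1 -
  \<psi>) u, which vanishes where \<psi> = 1, so the remaining bumps serve it in the same
  way.\<close>

lemma chart_bump_induct [consumes 2, case_names zero add bump]:
  assumes u: "smooth_form A u" and cpt: "compact (closure {x. u x \<noteq> 0})"
    and zero: "P (\<lambda>x. 0)"
    and add: "\<And>u v. smooth_form A u \<Longrightarrow> smooth_form A v \<Longrightarrow> P u \<Longrightarrow> P v \<Longrightarrow> P (\<lambda>x. u x + v x)"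
    and bump: "\<And>u c K. smooth_form A u \<Longrightarrow> c \<in> A \<Longrightarrow> compact K \<Longrightarrow> K \<subseteq> fst c \<Longrightarrow> (\<And>y. y \<notin> K \<Longrightarrow> u y = 0) \<Longrightarrow> P u"
  shows "P u"
proof -
  have *: "P u" if "finite F" "\<forall>\<psi>\<in>F. chart_bump \<psi>" "smooth_form A u" "\<forall>y. u y \<noteq> 0 \<longrightarrow> (\<exists>\<psi>\<in>F. \<psi> y = 1)" for F u
    using that
  proof (induction F arbitrary: u rule: finite_induct)
    case empty
    then have "u = (\<lambda>x. 0)" by auto
    then show ?case using zero by simp
  next
    case (insert \<psi> F)
    define v where "v = (\<lambda>x. complex_of_real (\<psi> x) *s u x)"
    obtain c K where c: "smooth_function A \<psi>" "c \<in> A" "compact K" "K \<subseteq> fst c" "\<And>y. y \<notin> K \<Longrightarrow> \<psi> y = 0"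
      using insert.prems(1) unfolding chart_bump_def by auto
    have v: "smooth_form A v" unfolding v_def by (rule smooth_form_scale[OF c(1) insert.prems(2)])
    have Pv: "P v" by (rule bump[OF v c(2-4)]) (simp add: v_def c(5))
    have w: "smooth_form A (\<lambda>x. u x - v x)" by (rule smooth_form_diff[OF insert.prems(2) v])
    have Pw: "P (\<lambda>x. u x - v x)"
    proof (rule insert.IH[OF _ w])
      show "\<forall>y. u y - v y \<noteq> 0 \<longrightarrow> (\<exists>\<psi>\<in>F. \<psi> y = 1)"
      proof (intro allI impI)
        fix y assume ne: "u y - v y \<noteq> 0"
        then have "u y \<noteq> 0" "\<psi> y \<noteq> 1" by (auto simp: v_def)
        then show "\<exists>\<psi>\<in>F. \<psi> y = 1" using insert.prems(3) by auto
      qed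
    qed (use insert.prems in auto)
    show ?case using add[OF v w Pv Pw] by simp
  qed
  have "\<exists>\<psi> V. chart_bump \<psi> \<and> open V \<and> x \<in> V \<and> (\<forall>y\<in>V. \<psi> y = 1)" for x
    by (rule chart_bump_exists[of x]) blast
  then have "\<forall>x. \<exists>\<psi> V. chart_bump \<psi> \<and> open V \<and> x \<in> V \<and> (\<forall>y\<in>V. \<psi> y = 1)" by (rule allI)
  from choice[OF this] obtain \<psi> where "\<forall>x. \<exists>V. chart_bump (\<psi> x) \<and> open V \<and> x \<in> V \<and> (\<forall>y\<in>V. \<psi> x y = 1)" ..
  from choice[OF this] obtain V where V: "\<And>x. chart_bump (\<psi> x)" "\<And>x. open (V x)" "\<And>x. x \<in> V x" "\<And>x y. y \<in> V x \<Longrightarrow> \<psi> x y = 1"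
    by blast
  have "closure {x. u x \<noteq> 0} \<subseteq> (\<Union>x\<in>UNIV. V x)" using V(3) by blast
  from compactE_image[OF cpt V(2) this]
  obtain X where X: "finite X" "closure {x. u x \<noteq> 0} \<subseteq> (\<Union>x\<in>X. V x)" .
  have cover: "\<exists>f\<in>\<psi> ` X. f y = 1" if "u y \<noteq> 0" for y
  proof -
    have "y \<in> closure {x. u x \<noteq> 0}" by (rule subsetD[OF closure_subset]) (simp add: that)
    then obtain x where "x \<in> X" "y \<in> V x" using X(2) by blast
    then show ?thesis using V(4) by blast
  qed
  show ?thesis
  proof (rule *[of "\<psi> ` X"])
    show "\<forall>y. u y \<noteq> 0 \<longrightarrow> (\<exists>f\<in>\<psi> ` X. f y = 1)" using cover by blast
  qed (use X(1) V(1) u in auto)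
qed

end

section \<open>Separation of smooth forms by test forms\<close>

context hermitian_manifold
begin

lemma L2_inner_eq: "L2_inner A \<omega> u v = (\<integral>x. ext_inner (\<omega> x) (u x) (v x) \<partial>vol)"
  by (simp add: L2_inner_def)

text \<open>Uniqueness of the formal adjoint. The difference w is tested against \<psi> w for a bump
  \<psi>: the nonnegative function \<psi> |w|^2 has integral zero, hence vanishes almost everywhere.
  If w x were nonzero, that function would be positive on a nonempty open set.\<close>

lemma L2_inner_separates:
  assumes w1: "smooth_form A w1" and w2: "smooth_form A w2"
    and eq: "\<And>u. smooth_form A u \<Longrightarrow> compact (closure {x. u x \<noteq> 0}) \<Longrightarrow> L2_inner A \<omega> u w1 = L2_inner A \<omega> u w2"
  shows "w1 = w2"
proof
  fix x
  define w where "w = (\<lambda>x. w1 x - w2 x)"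
  have w: "smooth_form A w" unfolding w_def by (rule smooth_form_diff[OF w1 w2])
  let ?c = "chart_at A x"
  note c = chart_at(1)[of x]
  obtain \<psi> :: "'x \<Rightarrow> real" and V K where psi: "smooth_function A \<psi>" "open V" "x \<in> V" "\<And>y. y \<in> V \<Longrightarrow> \<psi> y = 1"
    "compact K" "K \<subseteq> fst ?c" "\<And>y. y \<notin> K \<Longrightarrow> \<psi> y = 0" "\<And>y. 0 \<le> \<psi> y"
    using smooth_function_bump[OF chart_at] by metis
  define u where "u = (\<lambda>x. complex_of_real (\<psi> x) *s w x)"
  have u: "smooth_form A u" unfolding u_def by (rule smooth_form_scale[OF psi(1) w])
  have uK: "u y = 0" if "y \<notin> K" for y using psi(7)[OF that] by (simp add: u_def)
  have "{x. u x \<noteq> 0} \<subseteq> K" using uK by blast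
  then have "compact (closure {x. u x \<noteq> 0})"
    using psi(5) compact_imp_closed closure_minimal compact_Int_closed by (metis closed_closure inf.absorb_iff2)
  then have "L2_inner A \<omega> u w1 = L2_inner A \<omega> u w2" by (rule eq[OF u])
  moreover have "L2_inner A \<omega> u w = L2_inner A \<omega> u w1 - L2_inner A \<omega> u w2"
    unfolding L2_inner_eq w_def ext_inner_diff_right
    by (intro Bochner_Integration.integral_diff integrable_inner[OF u _ c psi(5,6) uK] w1 w2)
  ultimately have "(\<integral>y. ext_inner (\<omega> y) (u y) (w y) \<partial>vol) = 0" by (simp add: L2_inner_eq)
  define r where "r y = Re (ext_inner (\<omega> y) (w y) (w y))" for y
  have r: "ext_inner (\<omega> y) (w y) (w y) = complex_of_real (r y)" "0 \<le> r y" "r y = 0 \<longleftrightarrow> w y = 0" for y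
    using ext_inner_pos[OF metric_coframed[of y], of "w y"] by (auto simp: r_def)
  define G where "G z = indicat_real (chart_image ?c) z * (dens ?c z * (\<psi> (chart_inv ?c z) * r (chart_inv ?c z)))" for z
  have inner: "ext_inner (\<omega> y) (u y) (w y) = complex_of_real (\<psi> y * r y)" for y
    by (simp add: u_def ext_inner_scale_left r)
  have out: "ext_inner (\<omega> y) (u y) (w y) = 0" if "y \<notin> fst ?c" for y
  proof -
    have "y \<notin> K" using that psi(6) by blast
    then show ?thesis by (simp add: uK)
  qed
  have G: "indicat_real (chart_image ?c) z *\<^sub>R (dens ?c z *\<^sub>R ext_inner (\<omega> (chart_inv ?c z)) (u (chart_inv ?c z)) (w (chart_inv ?c z))) = complex_of_real (G z)" for z
    by (simp add: inner G_def scaleR_conv_of_real)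
  have iuw: "integrable vol (\<lambda>y. ext_inner (\<omega> y) (u y) (w y))" by (rule integrable_inner[OF u w c psi(5,6) uK])
  have int: "integrable lborel (\<lambda>z. complex_of_real (G z))"
    using iuw by (subst (asm) integrable_volume_chart[OF c inner_measurable[OF u w] out]) (assumption | simp only: G)+
  have "(\<integral>z. complex_of_real (G z) \<partial>lborel) = 0"
    using \<open>(\<integral>y. ext_inner (\<omega> y) (u y) (w y) \<partial>vol) = 0\<close> by (subst (asm) integral_volume_chart[OF c inner_measurable[OF u w] out]) (assumption | simp only: G)+
  then have G0: "(\<integral>z. G z \<partial>lborel) = 0" by simp
  have Gint: "integrable lborel G" using integrable_Re[OF int] by simp
  have "AE z in lborel. G z = 0"
    using integral_nonneg_eq_0_iff_AE[OF Gint] G0 psi(8) r(2) dens_pos[OF c]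
    by (auto simp: G_def indicator_def less_imp_le intro!: always_eventually)
  then have neg: "negligible {z. G z \<noteq> 0}"
    using completion.AE_iff_null_sets[where M = lborel and P = "\<lambda>z. G z = 0"] by (simp add: negligible_iff_null_sets AE_completion_iff)
  show "w1 x = w2 x"
  proof (rule ccontr)
    assume "w1 x \<noteq> w2 x"
    then have rx: "r x \<noteq> 0" by (simp add: r(3) w_def)
    let ?S = "{y. ext_inner (\<omega> y) (w y) (w y) \<noteq> 0} \<inter> V"
    have o: "open ?S"
      using continuous_inner[OF w w] psi(2) by (intro open_Int open_Collect_neq) (auto intro: continuous_intros)
    let ?T = "chart_image ?c \<inter> chart_inv ?c -` ?S"
    have oT: "open ?T" by (rule open_preimage[OF c o])
    have xT: "snd ?c x \<in> ?T" using image_mem[OF chart_at] inv_left[OF chart_at] psi(3) rx r(1) by simp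
    have "?T \<subseteq> {z. G z \<noteq> 0}" 
    proof
      fix z assume z: "z \<in> ?T"
      then have "\<psi> (chart_inv ?c z) = 1" "r (chart_inv ?c z) \<noteq> 0" using psi(4) r(1) by auto
      then show "z \<in> {z. G z \<noteq> 0}" using z dens_pos[OF c, of z] by (simp add: G_def)
    qed
    then have "negligible ?T" using neg negligible_subset by blast
    then show False using open_not_negligible[OF oT] xT by blast
  qed
qed

end

section \<open>The formal adjoints of the twisted operators\<close>

context twisted_manifold
begin

lemma D_parts:
  assumes v: "smooth_form A v" and u: "smooth_form A u" and cpt: "compact (closure {x. u x \<noteq> 0})"
  shows "L2_inner A \<omega> (D u) v = L2_inner A \<omega> u (D_adj v)"
proof -
  \<comment> \<open>Integrability belongs to the induction statement, since the integral is additive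
    only for integrable functions.\<close>
  have "integrable vol (\<lambda>y. ext_inner (\<omega> y) (D u y) (v y)) \<and> integrable vol (\<lambda>y. ext_inner (\<omega> y) (u y) (D_adj v y))
     \<and> L2_inner A \<omega> (D u) v = L2_inner A \<omega> u (D_adj v)" (is "?P u")
    using u cpt
  proof (induction u rule: chart_bump_induct)
    case zero
    have "smooth_form A (\<lambda>x. 0)" using smooth_form_diff[OF u u] by simp
    then have "D (\<lambda>x. 0) = (\<lambda>x. 0)" using D_scale[of "\<lambda>x. 0" 0] by (auto simp: fun_eq_iff)
    then show ?case by (simp add: L2_inner_eq)
  next
    case (add u1 u2)
    have "D (\<lambda>x. u1 x + u2 x) = (\<lambda>x. D u1 x + D u2 x)" using D_add[OF add(1,2)] by (auto simp: fun_eq_iff)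
    then show ?case using add(3,4) by (simp add: L2_inner_eq ext_inner_add_left)
  next
    case (bump u c K)
    have "D u y = 0" if "y \<notin> K" for y
      using delbar_zero_outside[OF bump(1) compact_imp_closed[OF bump(3)] bump(5) that] bump(5)[OF that] by (simp add: D_eq pw_def zero_vec_def[symmetric])
    then have i1: "integrable vol (\<lambda>y. ext_inner (\<omega> y) (D u y) (v y))"
      by (intro integrable_inner[OF smooth_D[OF bump(1)] v bump(2-4)])
    have i2: "integrable vol (\<lambda>y. ext_inner (\<omega> y) (u y) (D_adj v y))"
      by (rule integrable_inner[OF bump(1) smooth_D_adj[OF v] bump(2-5)])
    have "L2_inner A \<omega> (D u) v - L2_inner A \<omega> u (D_adj v)
      = (\<integral>y. ext_inner (\<omega> y) (D u y) (v y) - ext_inner (\<omega> y) (u y) (D_adj v y) \<partial>vol)"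
      unfolding L2_inner_eq by (rule Bochner_Integration.integral_diff[OF i1 i2, symmetric])
    also have "\<dots> = 0" unfolding D_inner[OF v] by (rule chart_by_parts[OF bump(1) v bump(2-5)])
    finally show ?case using i1 i2 by simp
  qed
  then show ?thesis by simp
qed

lemma formal_adj_eqI:
  assumes "smooth_form A w"
    and "\<And>u. smooth_form A u \<Longrightarrow> compact (closure {x. u x \<noteq> 0}) \<Longrightarrow> L2_inner A \<omega> (P u) v = L2_inner A \<omega> u w"
  shows "formal_adj A \<omega> P v = w"
  unfolding formal_adj_def
proof (rule the_equality)
  fix w' assume "smooth_form A w' \<and> (\<forall>u. smooth_form A u \<and> compact (closure {x. u x \<noteq> 0}) \<longrightarrow> L2_inner A \<omega> (P u) v = L2_inner A \<omega> u w')"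
  then show "w' = w" using assms by (intro L2_inner_separates) auto
qed (use assms in auto)

lemma formal_adj_D: "smooth_form A v \<Longrightarrow> formal_adj A \<omega> D v = D_adj v"
  by (intro formal_adj_eqI smooth_D_adj D_parts)

lemma smooth_conj_D_adj: "smooth_form A v \<Longrightarrow> smooth_form A (conj_op D_adj v)"
  unfolding conj_op_def by (intro smooth_form_conj smooth_D_adj)

text \<open>Conjugating both arguments conjugates the product, so the conjugate operator has the
  conjugate adjoint.\<close>

lemma formal_adj_Db:
  assumes v: "smooth_form A v" shows "formal_adj A \<omega> Db v = conj_op D_adj v"
proof (rule formal_adj_eqI[OF smooth_conj_D_adj[OF v]])
  fix u assume u: "smooth_form A u" and cpt: "compact (closure {x. u x \<noteq> 0})"
  have eq: "conj_ext a = 0 \<longleftrightarrow> a = 0" for a :: "'n ext" by (metis conj_ext_conj conj_ext_zero)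
  have "L2_inner A \<omega> (Db u) v = cnj (L2_inner A \<omega> (D (\<lambda>y. conj_ext (u y))) (\<lambda>y. conj_ext (v y)))"
    unfolding L2_inner_eq Bochner_Integration.integral_cnj[symmetric]
    by (intro Bochner_Integration.integral_cong refl) (simp flip: ext_inner_conj[OF metric_coframed] add: Db_conj)
  also have "\<dots> = cnj (L2_inner A \<omega> (\<lambda>y. conj_ext (u y)) (D_adj (\<lambda>y. conj_ext (v y))))"
    using D_parts[OF smooth_form_conj[OF v] smooth_form_conj[OF u]] cpt by (simp add: eq)
  also have "\<dots> = L2_inner A \<omega> u (conj_op D_adj v)"
    unfolding L2_inner_eq Bochner_Integration.integral_cnj[symmetric]
    by (intro Bochner_Integration.integral_cong refl) (simp flip: ext_inner_conj[OF metric_coframed] add: conj_op_def)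
  finally show "L2_inner A \<omega> (Db u) v = L2_inner A \<omega> u (conj_op D_adj v)" .
qed

section \<open>The rough identity\<close>

lemma D_diff: "smooth_form A u \<Longrightarrow> smooth_form A v \<Longrightarrow> D (\<lambda>x. u x - v x) x = D u x - D v x"
  using D_add[of "\<lambda>x. u x - v x" v x] smooth_form_diff[of u v] by simp

lemma Db_diff: "smooth_form A u \<Longrightarrow> smooth_form A v \<Longrightarrow> Db (\<lambda>x. u x - v x) x = Db u x - Db v x"
  using Db_add[of "\<lambda>x. u x - v x" v x] smooth_form_diff[of u v] by simp

lemma smooth_conj_torsion_adj: "smooth_form A \<alpha> \<Longrightarrow> smooth_form A v \<Longrightarrow> smooth_form A (conj_op (torsion_adj \<alpha>) v)"
  unfolding conj_op_def by (intro smooth_form_conj smooth_form_torsion_adj)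

text \<open>\<Lambda> is real, so conjugation exchanges the two operators and changes only the signs
  that come from \<i>: the one of the commutator and the one of the term with n.\<close>

lemma conj_D_adj:
  "conj_op D_adj v x = \<i> *s (lam (\<omega> x) (D v x) - D (\<lambda>x. lam (\<omega> x) (v x)) x) - conj_op (torsion_adj (D \<omega>)) v x
     - of_nat CARD('n) *s eta_comm \<omega> \<eta> (delbar A (function_form \<eta>)) v x"
proof -
  note c = metric_coframed[of x]
  have e: "conj_ext (eta_comm \<omega> \<eta> (del A (function_form \<eta>)) (\<lambda>y. conj_ext (v y)) x) = - eta_comm \<omega> \<eta> (delbar A (function_form \<eta>)) v x"
    by (simp add: eta_comm_del eta_comm_delbar conj_ext_scale conj_ext_diff conj_ext_wedge lam_conj[OF c, symmetric] vec.scale_minus_left)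
  have l: "conj_ext (lam (\<omega> y) a) = lam (\<omega> y) (conj_ext a)" for y a by (simp add: lam_conj[OF metric_coframed])
  show ?thesis
    by (simp add: conj_op_def D_adj_def conj_ext_add conj_ext_diff conj_ext_scale e l Db_conj)
qed

text \<open>Both Laplacians are expanded by the commutation relations. The mixed terms
  \<open>Db (lam (D u))\<close> and \<open>D (lam (Db u))\<close>, abbreviated by suppressing the
  point, have the same coefficients in both and cancel in the difference; the other four
  second-order terms form [[D, Db], \<Lambda>]. This is the graded Jacobi identity written out. The
  torsion and n terms keep their signs for D and change them for \<open>Db\<close>.\<close>

lemma rough_identity:
  assumes u: "smooth_form A u"
  shows "Laplace'' A \<omega> \<eta> u x =
      Laplace' A \<omega> \<eta> u x
    + \<i> *s gcomm 2 (gcomm 1 D 1 Db) (-2) (Lam \<omega>) u x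
    + gcomm 1 Db (-1) (pointwise_adj \<omega> (conj_op (tau01 A \<omega> \<eta>))) u x
    - gcomm 1 D (-1) (pointwise_adj \<omega> (tau01 A \<omega> \<eta>)) u x
    + of_nat CARD('n) *s gcomm 1 D (-1) (eta_comm \<omega> \<eta> (del A (function_form \<eta>))) u x
    + of_nat CARD('n) *s gcomm 1 Db (-1) (eta_comm \<omega> \<eta> (delbar A (function_form \<eta>))) u x"
proof -
  let ?N = "of_nat CARD('n) :: complex"
  let ?l = "\<lambda>v x. lam (\<omega> x) (v x)"
  let ?e = "eta_comm \<omega> \<eta> (del A (function_form \<eta>))" and ?f = "eta_comm \<omega> \<eta> (delbar A (function_form \<eta>))"
  let ?t = "torsion_adj (D \<omega>)" and ?tc = "conj_op (torsion_adj (D \<omega>))"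
  note sD = smooth_D[OF smooth_metric_form]
  note s = smooth_form_diff smooth_form_add smooth_form_const_scale smooth_form_lam smooth_D smooth_Db
    smooth_form_torsion_adj[OF sD] smooth_conj_torsion_adj[OF sD] smooth_eta_comm_del smooth_eta_comm_delbar u
  have l: "lam (\<omega> x) (a + b) = lam (\<omega> x) a + lam (\<omega> x) b" for a b by (rule lam_add[OF metric_coframed])
  have 1: "D (D_adj u) x = - \<i> *s (D (?l (Db u)) x - D (Db (?l u)) x) - D (?t u) x + ?N *s D (?e u) x"
    unfolding D_adj_def by (simp add: D_diff D_add D_scale s)
  have 2: "Db (conj_op D_adj u) x = \<i> *s (Db (?l (D u)) x - Db (D (?l u)) x) - Db (?tc u) x - ?N *s Db (?f u) x"
    unfolding conj_D_adj[abs_def] by (simp add: Db_diff Db_scale s)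
  have 3: "D_adj (D u) x = - \<i> *s (?l (Db (D u)) x - Db (?l (D u)) x) - ?t (D u) x + ?N *s ?e (D u) x"
    by (simp add: D_adj_def)
  have 4: "conj_op D_adj (Db u) x = \<i> *s (?l (D (Db u)) x - D (?l (Db u)) x) - ?tc (Db u) x - ?N *s ?f (Db u) x"
    by (simp add: conj_D_adj)
  have 5: "pointwise_adj \<omega> (tau01 A \<omega> \<eta>) v = ?t v" "pointwise_adj \<omega> (conj_op (tau01 A \<omega> \<eta>)) v = ?tc v" for v
    unfolding tau01_def by (rule pointwise_adj_torsion pointwise_adj_conj_torsion)+
  show ?thesis
    unfolding Laplace''_def Laplace'_def gcomm_def
    by (simp add: formal_adj_D formal_adj_Db u smooth_D smooth_Db 1 2 3 4 Lam_eq l 5)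
qed

end

theorem proposition4p4:
  fixes A :: "('x::{t2_space,second_countable_topology}, 'n::{finite,linorder}) chart set"
    and \<omega> :: "('x, 'n) form"
    and \<eta> :: "'x \<Rightarrow> real"
    and u :: "('x, 'n) form"
    and k :: nat
  assumes "complex_atlas A"
    and "hermitian_metric A \<omega>"
    and "CARD('n) \<ge> 2"
    and "smooth_function A \<eta>"
    and "(\<forall>x. \<eta> x > 0) \<or> (\<forall>x. \<eta> x < 0)"
    and "k \<le> 2 * CARD('n)"
    and "smooth_form A u"
    and "has_degree k u"
  shows "Laplace'' A \<omega> \<eta> u = (\<lambda>x.
      Laplace' A \<omega> \<eta> u x
    + \<i> *s gcomm 2 (gcomm 1 (D01 A \<eta>) 1 (D01bar A \<eta>)) (-2) (Lam \<omega>) u x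
    + gcomm 1 (D01bar A \<eta>) (-1) (pointwise_adj \<omega> (conj_op (tau01 A \<omega> \<eta>))) u x
    - gcomm 1 (D01 A \<eta>) (-1) (pointwise_adj \<omega> (tau01 A \<omega> \<eta>)) u x
    + of_nat (CARD('n)) *s gcomm 1 (D01 A \<eta>) (-1) (eta_comm \<omega> \<eta> (del A (function_form \<eta>))) u x
    + of_nat (CARD('n)) *s gcomm 1 (D01bar A \<eta>) (-1) (eta_comm \<omega> \<eta> (delbar A (function_form \<eta>))) u x)"
proof -
  have "\<eta> x \<noteq> 0" for x using assms(5) by (metis less_irrefl)
  then interpret twisted_manifold A \<omega> \<eta> using assms by unfold_locales auto
  show ?thesis by (rule ext) (rule rough_identity[OF assms(7)])
qed

end
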